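(* Let $\mathcal X:y^n=f(x)$ be a superelliptic curve over $\mathbb F_q$ as in the context, and let $s\ge 1$ satisfy $c\,\nu(s)<N$. Then $$\dim\operatorname{Hull}(\mathcal C_s)=\Phi(\nu(s))+\varepsilon(G_s,A_s),$$ where $\varepsilon(G_s,A_s)$ is the excess of the pair $(G_s,A_s)$. Moreover the following hold. (1) $\Phi$ is a quasi-polynomial in $\nu$ of degree one, with leading coefficient $c$ and quasi-period dividing $n/c$. (2) $\Phi(\nu(s))=c\,\nu(s)+1-g_{\mathcal X}$ if and only if $s\in W(\mathcal X)$. (3) $\varepsilon(G_s,A_s)=0$ for $s\in W(\mathcal X)$, and in general $$0\le\varepsilon(G_s,A_s)\le\ell(K-G_s\wedge A_s),\qquad\deg(K-G_s\wedge A_s)=t(s).$$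
   Context: Setting. $q$ is a power of a prime $p$; $n\ge2$, $d\ge3$ are integers with $n\mid q-1$ (so $p\nmid n$); $c=\gcd(n,d)$; $f\in\mathbb F_q[x]$ is separable of degree $d$ with no root in $\mathbb F_q$. $\mathcal X$ is the smooth projective model of $y^n=f(x)$ over $\mathbb F_q$, of genus $g_{\mathcal X}=\frac{(n-1)(d-1)+1-c}{2}$, and $\pi:\mathcal X\to\mathbb P^1$, $(x,y)\mapsto x$. $\mathrm{Ram}$ is the reduced divisor of the $d$ geometric points over the roots of $f$, $D_\infty$ the reduced divisor of the $c$ geometric points over $x=\infty$. $D$ is the sum of all $\mathbb F_q$-rational points of $\mathcal X$ over $\mathbb A^1(\mathbb F_q)$, $N=\deg D$, and $E=\sum_{a\in\mathbb F_q}\pi^*(a)-D$ (effective). $\Delta=\{a\in\mathbb F_q:f(a)\notin(\mathbb F_q^* )^n\}$, $\delta=|\Delta|$; one has $N=n(q-\delta)$, $\deg E=n\delta$. Riemann-Roch spaces and codes. $L(G)=\{h\in\mathbb F_q(\mathcal X)^*:\operatorname{div}(h)+G\ge0\}\cup\{0\}$, $\ell(G)=\dim_{\mathbb F_q} L(G)$; for $G$ with support disjoint from $\operatorname{Supp} D$, $C_L(D,G)\subseteq\mathbb F_q^N$ is the image of evaluation of $L(G)$ at the points of $D$. For $s\ge1$: $G_s=sD_\infty$ and $\mathcal C_s=C_L(D,G_s)$, the weighted superelliptic code (equivalently the span of the vectors $(x(P)^iy(P)^j)_{P}$, $i\ge0$, $0\le j\le n-1$, $\frac nc i+\frac dc j\le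 s$). $\operatorname{Hull}(C)=C\cap C^\perp$ for the standard bilinear form. Put $M=\frac{(q-1)n}{c}-1$, $\mu(s)=\min\{s,M-s\}$, $K=\operatorname{div}(\eta)$ with $\eta=-dx/(x^q-x)$, and $A_s=D-G_s+K=(n-1)\mathrm{Ram}-E+(M-s)D_\infty$; then $\mathcal C_s^\perp=C_L(D,A_s)$. Notation. $\wedge,\vee$ denote the coefficientwise minimum and maximum of divisors. The excess of a pair $(G,A)$ is $$\varepsilon(G,A)=\dim_{\mathbb F_q}\frac{(L(G)+L(A))\cap L(G\vee A-D)}{L(G-D)+L(A-D)}.$$ $\nu(s)=\mu(s)-\frac{n\delta}{c}\in\mathbb Z$; $t(s)=2g_{\mathcal X}-2-c\,\mu(s)+n\delta$; the window is $W(\mathcal X)=\{s\ge1:t(s)<0\}$; and for $\nu\in\mathbb Z$ $$\Phi(\nu)=\sum_{j=0}^{n-1}\max\Bigl\{0,\Bigl\lfloor\frac{c\nu-dj}{n}\Bigr\rfloor+1\Bigr\}.$$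
   Formalization: In (1), Φ is claimed to be a quasi-polynomial only for ν with cν > 2g−2, the exact range where no truncation occurs, since on all integers it is false: Φ(ν)=0 for every ν<0. *)

theory Defs
  imports
    "HOL-Computational_Algebra.Computational_Algebra"
    "HOL-Library.Function_Algebras"
    "HOL-Library.Cardinality"
begin

section \<open>Function fields in one variable\<close>

text \<open>
  The smooth projective curve is treated through its function field: a field (a type \<open>'k\<close>)
  containing the field of constants \<open>'a\<close> by way of an embedding \<open>\<iota>\<close>. The closed points of the
  curve are the places of this field. A place is represented by its normalised discrete
  valuation, which is trivial on the constants. The value at \<open>0\<close>, mathematically infinite, is
  set to \<open>0\<close>, so that a place is represented by exactly one function.
\<close>

type_synonym 'k place = "'k \<Rightarrow> int"
type_synonym 'k divisor = "'k place \<Rightarrow> int"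

definition field_embedding :: "('a::field \<Rightarrow> 'k::field) \<Rightarrow> bool" where
  "field_embedding \<iota> \<longleftrightarrow>
     \<iota> 0 = 0 \<and> \<iota> 1 = 1 \<and> (\<forall>a b. \<iota> (a + b) = \<iota> a + \<iota> b) \<and> (\<forall>a b. \<iota> (a * b) = \<iota> a * \<iota> b)"

definition places :: "('a::field \<Rightarrow> 'k::field) \<Rightarrow> 'k place set" where
  "places \<iota> = {v.
     v 0 = 0 \<and>
     (\<forall>z w. z \<noteq> 0 \<longrightarrow> w \<noteq> 0 \<longrightarrow> v (z * w) = v z + v w) \<and>
     (\<forall>z w. z \<noteq> 0 \<longrightarrow> w \<noteq> 0 \<longrightarrow> z + w \<noteq> 0 \<longrightarrow> min (v z) (v w) \<le> v (z + w)) \<and>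
     (\<forall>a. a \<noteq> 0 \<longrightarrow> v (\<iota> a) = 0) \<and>
     (\<exists>t. v t = 1)}"

definition valuation_ring :: "'k::field place \<Rightarrow> 'k set" where
  "valuation_ring v = {z. z = 0 \<or> 0 \<le> v z}"

definition maximal_ideal :: "'k::field place \<Rightarrow> 'k set" where
  "maximal_ideal v = {z. z = 0 \<or> 0 < v z}"

definition const_scale :: "('a::field \<Rightarrow> 'k::field) \<Rightarrow> 'a \<Rightarrow> 'k \<Rightarrow> 'k" where
  "const_scale \<iota> a z = \<iota> a * z"

text \<open>
  For subspaces \<open>W \<subseteq> V\<close>, the next predicate says that \<open>B\<close> is a finite set of representatives of a
  basis of \<open>V/W\<close>: every element of \<open>V\<close> is congruent modulo \<open>W\<close> to exactly one linear
  combination of \<open>B\<close>. The dimension of \<open>V/W\<close> is only meaningful when it is finite.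
\<close>

definition quotient_basis ::
    "('a::field \<Rightarrow> 'b::ab_group_add \<Rightarrow> 'b) \<Rightarrow> 'b set \<Rightarrow> 'b set \<Rightarrow> 'b set \<Rightarrow> bool" where
  "quotient_basis scale V W B \<longleftrightarrow>
     finite B \<and> B \<subseteq> V \<and>
     (\<forall>v\<in>V. \<exists>!u. (\<forall>b. b \<notin> B \<longrightarrow> u b = 0) \<and> v - (\<Sum>b\<in>B. scale (u b) b) \<in> W)"

definition quotient_dim ::
    "('a::field \<Rightarrow> 'b::ab_group_add \<Rightarrow> 'b) \<Rightarrow> 'b set \<Rightarrow> 'b set \<Rightarrow> nat" where
  "quotient_dim scale V W = (THE m. \<exists>B. quotient_basis scale V W B \<and> card B = m)"

text \<open>The degree of a place is the degree of its residue field over the constants.\<close>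

definition place_degree :: "('a::field \<Rightarrow> 'k::field) \<Rightarrow> 'k place \<Rightarrow> nat" where
  "place_degree \<iota> v = quotient_dim (const_scale \<iota>) (valuation_ring v) (maximal_ideal v)"

text \<open>
  Divisors are functions on valuations vanishing outside the places. Sums, differences, order,
  coefficientwise minimum \<open>inf\<close> and maximum \<open>sup\<close> are the pointwise operations on functions.
\<close>

definition is_divisor :: "('a::field \<Rightarrow> 'k::field) \<Rightarrow> 'k divisor \<Rightarrow> bool" where
  "is_divisor \<iota> G \<longleftrightarrow> finite {v. G v \<noteq> 0} \<and> {v. G v \<noteq> 0} \<subseteq> places \<iota>"

definition divisor_degree :: "('a::field \<Rightarrow> 'k::field) \<Rightarrow> 'k divisor \<Rightarrow> int" where
  "divisor_degree \<iota> G = (\<Sum>v | G v \<noteq> 0. G v * int (place_degree \<iota> v))"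

definition principal_divisor :: "('a::field \<Rightarrow> 'k::field) \<Rightarrow> 'k \<Rightarrow> 'k divisor" where
  "principal_divisor \<iota> h = (\<lambda>v. if v \<in> places \<iota> then v h else 0)"

definition RR_space :: "('a::field \<Rightarrow> 'k::field) \<Rightarrow> 'k divisor \<Rightarrow> 'k set" where
  "RR_space \<iota> G = {h. h \<noteq> 0 \<and> 0 \<le> principal_divisor \<iota> h + G} \<union> {0}"

definition RR_dim :: "('a::field \<Rightarrow> 'k::field) \<Rightarrow> 'k divisor \<Rightarrow> nat" where
  "RR_dim \<iota> G = vector_space.dim (const_scale \<iota>) (RR_space \<iota> G)"

definition genus :: "('a::field \<Rightarrow> 'k::field) \<Rightarrow> int" where
  "genus \<iota> = (GREATEST g. \<exists>G. is_divisor \<iota> G \<and> g = divisor_degree \<iota> G - int (RR_dim \<iota> G) + 1)"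

text \<open>
  A differential of \<open>'k\<close> over the constants is represented by its values on the derivations of
  \<open>'k\<close> over the constants, on which \<open>dz\<close> takes the values \<open>\<delta> z\<close>. Since the differentials of
  a function field over a perfect field form a one-dimensional space, nothing is lost by this.
  The order of \<open>\<omega>\<close> at \<open>v\<close> is \<open>v(g)\<close>, where \<open>\<omega> = g dt\<close> for a local parameter \<open>t\<close>.
\<close>

type_synonym 'k differential = "('k \<Rightarrow> 'k) \<Rightarrow> 'k"

definition derivations :: "('a::field \<Rightarrow> 'k::field) \<Rightarrow> ('k \<Rightarrow> 'k) set" where
  "derivations \<iota> = {\<delta>.
     (\<forall>z w. \<delta> (z + w) = \<delta> z + \<delta> w) \<and>
     (\<forall>z w. \<delta> (z * w) = z * \<delta> w + w * \<delta> z) \<and>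
     (\<forall>a. \<delta> (\<iota> a) = 0)}"

definition exact_diff :: "'k::field \<Rightarrow> 'k differential" where
  "exact_diff z = (\<lambda>\<delta>. \<delta> z)"

definition mult_diff :: "'k::field \<Rightarrow> 'k differential \<Rightarrow> 'k differential" where
  "mult_diff g \<omega> = (\<lambda>\<delta>. g * \<omega> \<delta>)"

definition diff_order ::
    "('a::field \<Rightarrow> 'k::field) \<Rightarrow> 'k place \<Rightarrow> 'k differential \<Rightarrow> int" where
  "diff_order \<iota> v \<omega> =
     (THE m. \<exists>t g. v t = 1 \<and> (\<forall>\<delta>\<in>derivations \<iota>. \<omega> \<delta> = mult_diff g (exact_diff t) \<delta>) \<and> v g = m)"

definition diff_divisor :: "('a::field \<Rightarrow> 'k::field) \<Rightarrow> 'k differential \<Rightarrow> 'k divisor" where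
  "diff_divisor \<iota> \<omega> = (\<lambda>v. if v \<in> places \<iota> then diff_order \<iota> v \<omega> else 0)"


section \<open>Evaluation codes, hulls and the excess\<close>

text \<open>
  Here \<open>D\<close> is a sum of distinct places of degree one. Words are functions on the
  places that vanish outside the support of \<open>D\<close>; they stand for vectors with coordinates indexed
  by the points of \<open>D\<close>.
\<close>

definition place_value :: "('a::field \<Rightarrow> 'k::field) \<Rightarrow> 'k place \<Rightarrow> 'k \<Rightarrow> 'a" where
  "place_value \<iota> v h = (THE a. h - \<iota> a \<in> maximal_ideal v)"

definition words :: "'k divisor \<Rightarrow> ('k place \<Rightarrow> 'a::field) set" where
  "words D = {w. \<forall>v. D v = 0 \<longrightarrow> w v = 0}"

definition AG_code ::
    "('a::field \<Rightarrow> 'k::field) \<Rightarrow> 'k divisor \<Rightarrow> 'k divisor \<Rightarrow> ('k place \<Rightarrow> 'a) set" where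
  "AG_code \<iota> D G =
     (\<lambda>h. \<lambda>v. if D v \<noteq> 0 then place_value \<iota> v h else 0) ` RR_space \<iota> G"

definition dual_code ::
    "'k divisor \<Rightarrow> ('k place \<Rightarrow> 'a::field) set \<Rightarrow> ('k place \<Rightarrow> 'a) set" where
  "dual_code D C = {w \<in> words D. \<forall>u\<in>C. (\<Sum>v | D v \<noteq> 0. w v * u v) = 0}"

definition code_hull :: "'k divisor \<Rightarrow> ('k place \<Rightarrow> 'a::field) set \<Rightarrow> ('k place \<Rightarrow> 'a) set" where
  "code_hull D C = C \<inter> dual_code D C"

definition code_dim :: "('k place \<Rightarrow> 'a::field) set \<Rightarrow> nat" where
  "code_dim C = vector_space.dim (\<lambda>a w v. a * w v) C"

definition sum_space :: "'b::ab_group_add set \<Rightarrow> 'b set \<Rightarrow> 'b set" where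
  "sum_space U V = {u + v | u v. u \<in> U \<and> v \<in> V}"

definition excess ::
    "('a::field \<Rightarrow> 'k::field) \<Rightarrow> 'k divisor \<Rightarrow> 'k divisor \<Rightarrow> 'k divisor \<Rightarrow> nat" where
  "excess \<iota> D G A = quotient_dim (const_scale \<iota>)
     (sum_space (RR_space \<iota> G) (RR_space \<iota> A) \<inter> RR_space \<iota> (sup G A - D))
     (sum_space (RR_space \<iota> (G - D)) (RR_space \<iota> (A - D)))"


section \<open>Superelliptic curves\<close>

text \<open>
  \<open>'k\<close> is the function field of the curve \<open>y\<^sup>n = f(x)\<close>: it is generated over the
  constants by \<open>x\<close> and \<open>y\<close>, where \<open>x\<close> is transcendental. (For \<open>f\<close> separable and nonconstant
  the polynomial \<open>Y\<^sup>n - f(x)\<close> is absolutely irreducible, so this determines the field.)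
\<close>

definition eval1 :: "('a::field \<Rightarrow> 'k::field) \<Rightarrow> 'a poly \<Rightarrow> 'k \<Rightarrow> 'k" where
  "eval1 \<iota> p x = poly (map_poly \<iota> p) x"

definition eval2 :: "('a::field \<Rightarrow> 'k::field) \<Rightarrow> 'a poly poly \<Rightarrow> 'k \<Rightarrow> 'k \<Rightarrow> 'k" where
  "eval2 \<iota> P x y = poly (map_poly (\<lambda>p. eval1 \<iota> p x) P) y"

definition superelliptic_function_field ::
    "('a::field \<Rightarrow> 'k::field) \<Rightarrow> 'k \<Rightarrow> 'k \<Rightarrow> nat \<Rightarrow> 'a poly \<Rightarrow> bool" where
  "superelliptic_function_field \<iota> x y n f \<longleftrightarrow>
     field_embedding \<iota> \<and>
     (\<forall>p. p \<noteq> 0 \<longrightarrow> eval1 \<iota> p x \<noteq> 0) \<and>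
     y ^ n = eval1 \<iota> f x \<and>
     (\<forall>z. \<exists>P Q. eval2 \<iota> Q x y \<noteq> 0 \<and> z = eval2 \<iota> P x y / eval2 \<iota> Q x y)"

definition superelliptic_curve ::
    "('a::{field,finite} \<Rightarrow> 'k::field) \<Rightarrow> 'k \<Rightarrow> 'k \<Rightarrow> nat \<Rightarrow> nat \<Rightarrow> 'a poly \<Rightarrow> bool" where
  "superelliptic_curve \<iota> x y n d f \<longleftrightarrow>
     2 \<le> n \<and> 3 \<le> d \<and> n dvd CARD('a) - 1 \<and>
     degree f = d \<and> coprime f (pderiv f) \<and> (\<forall>a. poly f a \<noteq> 0) \<and>
     superelliptic_function_field \<iota> x y n f"

text \<open>The reduced divisor of the points at which \<open>x\<close> has a pole.\<close>

definition D_inf :: "('a::field \<Rightarrow> 'k::field) \<Rightarrow> 'k \<Rightarrow> 'k divisor" where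
  "D_inf \<iota> x = (\<lambda>v. of_bool (v \<in> places \<iota> \<and> v x < 0))"

text \<open>The sum of the rational points lying over rational points of the affine line.\<close>

definition D_aff :: "('a::field \<Rightarrow> 'k::field) \<Rightarrow> 'k \<Rightarrow> 'k divisor" where
  "D_aff \<iota> x = (\<lambda>v. of_bool (v \<in> places \<iota> \<and> place_degree \<iota> v = 1 \<and> (\<exists>a. 0 < v (x - \<iota> a))))"

definition G_div :: "('a::field \<Rightarrow> 'k::field) \<Rightarrow> 'k \<Rightarrow> int \<Rightarrow> 'k divisor" where
  "G_div \<iota> x s = (\<lambda>v. s * D_inf \<iota> x v)"

definition eta :: "('a::{field,finite} \<Rightarrow> 'k::field) \<Rightarrow> 'k \<Rightarrow> 'k differential" where
  "eta \<iota> x = mult_diff (- 1 / (x ^ CARD('a) - x)) (exact_diff x)"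

definition K_div :: "('a::{field,finite} \<Rightarrow> 'k::field) \<Rightarrow> 'k \<Rightarrow> 'k divisor" where
  "K_div \<iota> x = diff_divisor \<iota> (eta \<iota> x)"

definition A_div :: "('a::{field,finite} \<Rightarrow> 'k::field) \<Rightarrow> 'k \<Rightarrow> int \<Rightarrow> 'k divisor" where
  "A_div \<iota> x s = D_aff \<iota> x - G_div \<iota> x s + K_div \<iota> x"

definition superelliptic_code ::
    "('a::field \<Rightarrow> 'k::field) \<Rightarrow> 'k \<Rightarrow> int \<Rightarrow> ('k place \<Rightarrow> 'a) set" where
  "superelliptic_code \<iota> x s = AG_code \<iota> (D_aff \<iota> x) (G_div \<iota> x s)"

text \<open>
  The divisions by \<open>gcd n (degree f)\<close> below are exact, because that number divides \<open>n\<close>.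
\<close>

definition num_nonpowers :: "nat \<Rightarrow> 'a::{field,finite} poly \<Rightarrow> nat" where
  "num_nonpowers n f = card {a. \<not> (\<exists>b. b \<noteq> 0 \<and> poly f a = b ^ n)}"

definition M_const :: "nat \<Rightarrow> 'a::{field,finite} poly \<Rightarrow> int" where
  "M_const n f = (int CARD('a) - 1) * int n div int (gcd n (degree f)) - 1"

definition mu :: "nat \<Rightarrow> 'a::{field,finite} poly \<Rightarrow> int \<Rightarrow> int" where
  "mu n f s = min s (M_const n f - s)"

definition nu :: "nat \<Rightarrow> 'a::{field,finite} poly \<Rightarrow> int \<Rightarrow> int" where
  "nu n f s = mu n f s - int (n * num_nonpowers n f) div int (gcd n (degree f))"

definition t_fun ::
    "('a::{field,finite} \<Rightarrow> 'k::field) \<Rightarrow> nat \<Rightarrow> 'a poly \<Rightarrow> int \<Rightarrow> int" where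
  "t_fun \<iota> n f s =
     2 * genus \<iota> - 2 - int (gcd n (degree f)) * mu n f s + int (n * num_nonpowers n f)"

definition window :: "('a::{field,finite} \<Rightarrow> 'k::field) \<Rightarrow> nat \<Rightarrow> 'a poly \<Rightarrow> int set" where
  "window \<iota> n f = {s. 1 \<le> s \<and> t_fun \<iota> n f s < 0}"

definition Phi :: "nat \<Rightarrow> nat \<Rightarrow> int \<Rightarrow> int" where
  "Phi n d \<nu> =
     (\<Sum>j<n. max 0 (\<lfloor>of_int (int (gcd n d) * \<nu> - int d * int j) / (of_nat n :: rat)\<rfloor> + 1))"

text \<open>
  \<open>quasi_polynomial_on\<close> says that on the set \<open>S\<close> the function \<open>F\<close> agrees with a quasi-polynomial
  of degree \<open>k\<close>, constant leading coefficient \<open>l\<close> and quasi-period \<open>m\<close>; \<open>p \<nu>\<close> is its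
  constituent on the residue class of \<open>\<nu>\<close> modulo \<open>m\<close>.
\<close>

definition quasi_polynomial_on ::
    "int set \<Rightarrow> (int \<Rightarrow> int) \<Rightarrow> nat \<Rightarrow> rat \<Rightarrow> nat \<Rightarrow> bool" where
  "quasi_polynomial_on S F k l m \<longleftrightarrow>
     0 < m \<and>
     (\<exists>p :: int \<Rightarrow> rat poly.
        (\<forall>\<nu>. p (\<nu> + int m) = p \<nu>) \<and>
        (\<forall>\<nu>. degree (p \<nu>) = k \<and> lead_coeff (p \<nu>) = l) \<and>
        (\<forall>\<nu>\<in>S. of_int (F \<nu>) = poly (p \<nu>) (of_int \<nu>)))"

end

theory Submission
  imports Defs "HOL-Library.Product_Plus"
begin

text \<open>
  All spaces involved are finite, because the field of constants has q elements, and a space of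
  dimension l has q^l elements. The theorem is therefore proved by counting, and it can be proved
  in this elementary way because the Riemann-Roch spaces that occur have bases of monomials, up to
  multiplication by a function.

  The function field has the basis 1, y, ..., y^(n-1) over the rational functions in x, and the
  automorphisms \<open>y \<mapsto> \<zeta> y\<close> with \<open>\<zeta>\<^sup>n = 1\<close>, all defined over the constants since n divides q - 1.
  The component of an element at y^j is an average of its conjugates (\<open>component_eq\<close>), so it has
  no more poles than the conjugates have. Hence the functions with poles of order at most m at
  infinity are the combinations of the monomials x^i y^j that have this property (\<open>Lsp_mD\<close>), and
  \<open>Phi n d m\<close> counts them. The same averaging shows that places with the same restriction to the
  rational functions are conjugate and gives the ramification (\<open>inf_values\<close>, \<open>fin_values\<close>). The
  existence of places over a given one (\<open>place_extension\<close>) follows from Zorn's lemma.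

  The involution \<open>j \<mapsto> n - 1 - j\<close> on the monomials gives the Riemann-Roch formula with duality for
  the multiples of \<open>D\<^sub>\<infinity>\<close> (\<open>Phi_duality\<close>), with an explicit number in the place of the genus.
  Degrees are compared with dimensions by approximation: when the pole orders allowed by a divisor
  are increased, the number of functions grows as much as the degree predicts if every principal
  part occurs (\<open>Lsp_chain_eq\<close>). This yields the degree of \<open>D\<^sub>\<infinity>\<close>, the degree 0 of the divisor of a
  polynomial in x, and the genus (\<open>genus_eq\<close>). The differential dx is handled by derivations: over
  the p-th powers the field is generated by any local parameter t, so there is a derivation d/dt,
  which maps the valuation ring to itself (\<open>ex_local_derivation\<close>), and the order of dx is the
  value of dx/dt.

  Write \<open>\<Delta>\<close> for the set of all a such that f(a) is not an n-th power. Over every other a lie n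
  points of degree one, told apart by the value of y (\<open>residues_y\<close>). So D is the divisor of zeros
  of a polynomial in x, and every divisor in the theorem is a multiple of \<open>D\<^sub>\<infinity>\<close> plus the divisor
  of a function. The dimensions of their Riemann-Roch spaces are thus values of \<open>Phi n d\<close>. In
  particular \<open>G \<and> A\<close> is equivalent to \<open>\<nu>(s) D\<^sub>\<infinity>\<close> (\<open>inf_eq\<close>), and \<open>K - G \<and> A = G \<or> A - D\<close>
  (\<open>sup_minus_D\<close>).

  The evaluations of L(A) are orthogonal to those of L(G), because the power sums over the roots
  of \<open>b\<^sup>n = f(a)\<close> and over the whole field vanish (\<open>residue_sum_zero\<close>). The dimensions add up to N
  by \<open>Phi_duality\<close>, so the one code is the dual of the other (\<open>dual_code_eq\<close>).

  For the hull, the pairs (u, v) in L(G) \<open>\<times>\<close> L(A) with the same evaluation, that is, with u - v in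
  \<open>L(G \<or> A - D)\<close>, are counted in two ways. Sorted by the common evaluation, their number is that
  of the hull times those of L(G - D) and L(A - D). Sorted by the difference u - v, it is that of
  \<open>(L(G) + L(A)) \<inter> L(G \<or> A - D)\<close> times that of \<open>L(G) \<inter> L(A) = L(G \<and> A)\<close>. If \<open>c \<nu>(s) < N\<close>, then
  \<open>L(G \<and> A - D)\<close> is zero, so the sum L(G - D) + L(A - D) is direct, and the quotient of the two
  counts gives \<open>dim Hull = \<Phi>(\<nu>(s)) + \<epsilon>\<close> (\<open>card_hull\<close>). The excess is the dimension of a
  subquotient of \<open>L(G \<or> A - D) = L(K - G \<and> A)\<close>, which is zero in the window (\<open>excess_le\<close>). The
  statements on \<open>\<Phi>\<close> follow from \<open>Phi_duality\<close>, since \<open>\<Phi>\<close> vanishes at negative arguments only.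
\<close>

section \<open>Counting cosets\<close>

definition subgrp :: "'b::ab_group_add set \<Rightarrow> bool" where
  "subgrp V \<longleftrightarrow> 0 \<in> V \<and> (\<forall>u\<in>V. \<forall>v\<in>V. u - v \<in> V)"

definition cosets :: "'b::ab_group_add set \<Rightarrow> 'b set \<Rightarrow> 'b set set" where
  "cosets V W = (\<lambda>v. {w. w - v \<in> W}) ` V"

text \<open>The index of \<open>W\<close> in \<open>V\<close>, or \<open>0\<close> if there are infinitely many cosets.\<close>

definition idx :: "'b::ab_group_add set \<Rightarrow> 'b set \<Rightarrow> nat" where
  "idx V W = card (cosets V W)"

lemma subgrp_zero: "subgrp V \<Longrightarrow> 0 \<in> V"
  and subgrp_diff: "subgrp V \<Longrightarrow> u \<in> V \<Longrightarrow> v \<in> V \<Longrightarrow> u - v \<in> V"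
  by (auto simp: subgrp_def)

lemma subgrp_uminus: "subgrp V \<Longrightarrow> u \<in> V \<Longrightarrow> - u \<in> V"
  using subgrp_diff[of V 0 u] by (simp add: subgrp_zero)

lemma subgrp_add: "subgrp V \<Longrightarrow> u \<in> V \<Longrightarrow> v \<in> V \<Longrightarrow> u + v \<in> V"
  using subgrp_diff[of V u "- v"] by (simp add: subgrp_uminus)

lemma subgrp_inter: "subgrp V \<Longrightarrow> subgrp W \<Longrightarrow> subgrp (V \<inter> W)"
  by (auto simp: subgrp_def)

lemma subgrp_sum_space: "subgrp V \<Longrightarrow> subgrp W \<Longrightarrow> subgrp (sum_space V W)"
  unfolding sum_space_def
proof -
  assume V: "subgrp V" and W: "subgrp W"
  have "\<exists>u v. 0 = u + v \<and> u \<in> V \<and> v \<in> W"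
    using V W by (intro exI[of _ 0]) (auto simp: subgrp_def)
  moreover have "\<exists>u v. a + b - (c + e) = u + v \<and> u \<in> V \<and> v \<in> W"
    if "a \<in> V" "b \<in> W" "c \<in> V" "e \<in> W" for a b c e
    using that V W by (intro exI[of _ "a - c"] exI[of _ "b - e"]) (auto simp: subgrp_diff)
  ultimately show "subgrp {u + v |u v. u \<in> V \<and> v \<in> W}"
    unfolding subgrp_def by blast
qed

lemma coset_eq_iff:
  assumes "subgrp W"
  shows "{w. w - u \<in> W} = {w. w - v \<in> W} \<longleftrightarrow> u - v \<in> W"
proof
  assume "{w. w - u \<in> W} = {w. w - v \<in> W}"
  moreover have "u \<in> {w. w - u \<in> W}" using assms by (simp add: subgrp_zero)
  ultimately show "u - v \<in> W" by blast
next
  assume uv: "u - v \<in> W"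
  have "w - v \<in> W" if "w - u \<in> W" for w
    using subgrp_add[OF assms that uv] by simp
  moreover have "w - u \<in> W" if "w - v \<in> W" for w
    using subgrp_diff[OF assms that uv] by simp
  ultimately show "{w. w - u \<in> W} = {w. w - v \<in> W}" by blast
qed

lemma same_fibers_bij:
  assumes "\<And>u v. u \<in> V \<Longrightarrow> v \<in> V \<Longrightarrow> a u = a v \<longleftrightarrow> b u = b v"
  shows "bij_betw (\<lambda>A. b (inv_into V a A)) (a ` V) (b ` V)"
proof (rule bij_betwI')
  fix A B assume A: "A \<in> a ` V" and B: "B \<in> a ` V"
  then show "(b (inv_into V a A) = b (inv_into V a B)) = (A = B)"
    using assms[OF inv_into_into[OF A] inv_into_into[OF B]] f_inv_into_f[OF A] f_inv_into_f[OF B]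
    by metis
next
  fix A assume A: "A \<in> a ` V"
  then show "b (inv_into V a A) \<in> b ` V" by (simp add: inv_into_into)
next
  fix y assume "y \<in> b ` V"
  then obtain v where v: "v \<in> V" "y = b v" by auto
  have "a (inv_into V a (a v)) = a v" using v by (simp add: f_inv_into_f)
  then have "b (inv_into V a (a v)) = b v" using assms v by (simp add: inv_into_into)
  then show "\<exists>A\<in>a ` V. y = b (inv_into V a A)" using v by (intro bexI[of _ "a v"]) auto
qed

text \<open>Indices are computed by means of a function on \<open>V\<close> whose fibres are the cosets of \<open>W\<close>. It
  need not be a homomorphism, and its values may be of any type.\<close>

lemma idx_fibers:
  assumes "subgrp W" "\<And>u v. u \<in> V \<Longrightarrow> v \<in> V \<Longrightarrow> g u = g v \<longleftrightarrow> u - v \<in> W"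
  shows "idx V W = card (g ` V)" "finite (cosets V W) \<longleftrightarrow> finite (g ` V)"
proof -
  have "bij_betw (\<lambda>A. g (inv_into V (\<lambda>v. {w. w - v \<in> W}) A)) (cosets V W) (g ` V)"
    unfolding cosets_def by (rule same_fibers_bij) (simp add: coset_eq_iff assms)
  then show "idx V W = card (g ` V)" "finite (cosets V W) \<longleftrightarrow> finite (g ` V)"
    by (auto simp: idx_def bij_betw_same_card bij_betw_finite)
qed

definition transversal :: "'b::ab_group_add set \<Rightarrow> 'b set \<Rightarrow> 'b set \<Rightarrow> bool" where
  "transversal V W T \<longleftrightarrow> T \<subseteq> V \<and> (\<forall>v\<in>V. \<exists>t\<in>T. v - t \<in> W) \<and>
     (\<forall>t\<in>T. \<forall>t'\<in>T. t - t' \<in> W \<longrightarrow> t = t')"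

lemma idx_transversal:
  assumes "subgrp W" "transversal V W T"
  shows "idx V W = card T" "finite (cosets V W) \<longleftrightarrow> finite T"
proof -
  let ?c = "\<lambda>v. {w. w - v \<in> W}"
  have inj: "inj_on ?c T"
    using assms by (auto simp: inj_on_def coset_eq_iff transversal_def)
  have "?c ` V = ?c ` T"
  proof (intro equalityI subsetI)
    fix A assume "A \<in> ?c ` V"
    then obtain v where v: "v \<in> V" "A = ?c v" by auto
    then obtain t where "t \<in> T" "v - t \<in> W" using assms by (auto simp: transversal_def)
    then show "A \<in> ?c ` T" using v coset_eq_iff[OF assms(1)] by auto
  next
    fix A assume "A \<in> ?c ` T"
    then show "A \<in> ?c ` V" using assms by (auto simp: transversal_def)
  qed
  then show "idx V W = card T" "finite (cosets V W) \<longleftrightarrow> finite T"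
    using inj by (auto simp: idx_def cosets_def card_image finite_image_iff)
qed

lemma ex_transversal:
  assumes "subgrp W"
  shows "\<exists>T. transversal V W T"
proof -
  let ?c = "\<lambda>v. {w. w - v \<in> W}"
  let ?T = "inv_into V ?c ` (?c ` V)"
  have i: "inv_into V ?c (?c v) \<in> V" "v - inv_into V ?c (?c v) \<in> W" if "v \<in> V" for v
  proof -
    show "inv_into V ?c (?c v) \<in> V" using that by (intro inv_into_into) auto
    have "?c (inv_into V ?c (?c v)) = ?c v" using that by (intro f_inv_into_f) auto
    then show "v - inv_into V ?c (?c v) \<in> W" using coset_eq_iff[OF assms] by metis
  qed
  have "t = t'" if "t \<in> ?T" "t' \<in> ?T" "t - t' \<in> W" for t t'
  proof -
    obtain A B where AB: "A \<in> ?c ` V" "t = inv_into V ?c A" "B \<in> ?c ` V" "t' = inv_into V ?c B"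
      using \<open>t \<in> ?T\<close> \<open>t' \<in> ?T\<close> by (elim imageE) auto
    then have "?c t = A" "?c t' = B"
      using f_inv_into_f[of A ?c V] f_inv_into_f[of B ?c V] by auto
    then show ?thesis using AB coset_eq_iff[OF assms] that by metis
  qed
  then have "transversal V W ?T" unfolding transversal_def using i by blast
  then show ?thesis by blast
qed

text \<open>Sums of representatives of \<open>V/W\<close> and of \<open>W/U\<close> represent \<open>V/U\<close>.\<close>

lemma idx_mult:
  assumes "subgrp U" "subgrp W" "U \<subseteq> W" "W \<subseteq> V" "subgrp V"
    and "finite (cosets V W)" "finite (cosets W U)"
  shows "idx V U = idx V W * idx W U" "finite (cosets V U)"
proof -
  obtain S T where ST: "transversal V W S" "transversal W U T"
    using ex_transversal assms by metis
  have S: "s \<in> V" "s' \<in> S \<Longrightarrow> s - s' \<in> W \<Longrightarrow> s = s'" if "s \<in> S" for s s'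
    using ST(1) that unfolding transversal_def by blast+
  have T: "t \<in> W" "t' \<in> T \<Longrightarrow> t - t' \<in> U \<Longrightarrow> t = t'" if "t \<in> T" for t t'
    using ST(2) that unfolding transversal_def by blast+
  let ?g = "\<lambda>(s, t). s + t"
  have inj: "(s, t) = (s', t')"
    if st: "s \<in> S" "t \<in> T" "s' \<in> S" "t' \<in> T" "(s + t) - (s' + t') \<in> U" for s t s' t'
  proof -
    have "s - s' = ((s + t) - (s' + t')) + (t' - t)" by simp
    also have "\<dots> \<in> W"
      using st(5) assms(3) subgrp_diff[OF assms(2) T(1)[OF st(4)] T(1)[OF st(2)]]
      by (intro subgrp_add[OF assms(2)]) auto
    finally have s: "s = s'" by (rule S(2)[OF st(1,3)])
    have "t - t' \<in> U" using st(5) unfolding s by (metis add_diff_cancel_left)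
    then have "t = t'" by (rule T(2)[OF st(2,4)])
    then show ?thesis using s by blast
  qed
  have cov: "\<exists>t\<in>?g ` (S \<times> T). v - t \<in> U" if v: "v \<in> V" for v
  proof -
    obtain s where s: "s \<in> S" "v - s \<in> W" using v ST(1) unfolding transversal_def by blast
    then obtain t where t: "t \<in> T" "v - s - t \<in> U" using ST(2) unfolding transversal_def by blast
    then show ?thesis using s by (intro bexI[of _ "s + t"]) (auto simp: algebra_simps)
  qed
  have "transversal V U (?g ` (S \<times> T))"
    unfolding transversal_def
  proof (intro conjI ballI impI)
    show "?g ` (S \<times> T) \<subseteq> V"
    proof (rule subsetI, elim imageE SigmaE)
      fix v p a b assume "v = ?g p" "a \<in> S" "b \<in> T" "p = (a, b)"
      then show "v \<in> V" using S(1)[of a] T(1)[of b] assms(4) subgrp_add[OF assms(5), of a b] by auto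
    qed
  next
    fix v assume "v \<in> V" then show "\<exists>t\<in>?g ` (S \<times> T). v - t \<in> U" by (rule cov)
  next
    fix t t' assume "t \<in> ?g ` (S \<times> T)" "t' \<in> ?g ` (S \<times> T)" "t - t' \<in> U"
    then obtain a b a' b' where "a \<in> S" "b \<in> T" "a' \<in> S" "b' \<in> T" "t = a + b" "t' = a' + b'"
      by (elim imageE SigmaE) auto
    then show "t = t'" using inj[of a b a' b'] \<open>t - t' \<in> U\<close> by simp
  qed
  note tr = idx_transversal[OF assms(1) this]
  have "inj_on ?g (S \<times> T)"
  proof (rule inj_onI, elim SigmaE)
    fix p p' a b a' b'
    assume "?g p = ?g p'" "a \<in> S" "b \<in> T" "p = (a, b)" "a' \<in> S" "b' \<in> T" "p' = (a', b')"
    then show "p = p'" using inj[of a b a' b'] subgrp_zero[OF assms(1)] by simp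
  qed
  then show "idx V U = idx V W * idx W U"
    using tr idx_transversal[OF assms(2) ST(1)] idx_transversal[OF assms(1) ST(2)]
    by (simp add: card_image card_cartesian_product)
  show "finite (cosets V U)"
    using tr idx_transversal[OF assms(2) ST(1)] idx_transversal[OF assms(1) ST(2)] assms(6,7)
    by simp
qed

lemma finite_cosets: "finite V \<Longrightarrow> finite (cosets V W)"
  by (simp add: cosets_def)

lemma idx_zero: "idx V {0} = card V"
  by (rule idx_transversal) (auto simp: subgrp_def transversal_def)

lemma card_eq_idx_mult:
  assumes "subgrp V" "subgrp W" "W \<subseteq> V" "finite V"
  shows "card V = idx V W * card W"
  using idx_mult(1)[of "{0}" W V] assms
  by (simp add: idx_zero finite_cosets finite_subset subgrp_zero subgrp_def)

section \<open>Dimensions over a finite field by counting\<close>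

lemma card_field_ge_2: "2 \<le> CARD('a::{field,finite})"
proof -
  have "card {0, 1::'a} \<le> CARD('a)" by (rule card_mono) auto
  then show ?thesis by simp
qed

lemma card_supported_functions:
  assumes "finite B"
  shows "card {u::'c \<Rightarrow> 'a::{zero,finite}. \<forall>b. b \<notin> B \<longrightarrow> u b = 0} = CARD('a) ^ card B"
    and "finite {u::'c \<Rightarrow> 'a::{zero,finite}. \<forall>b. b \<notin> B \<longrightarrow> u b = 0}"
proof -
  let ?F = "{u::'c \<Rightarrow> 'a. \<forall>b. b \<notin> B \<longrightarrow> u b = 0}"
  have b: "bij_betw (\<lambda>u. restrict u B) ?F (B \<rightarrow>\<^sub>E UNIV)"
    by (rule bij_betwI[where g = "\<lambda>u b. if b \<in> B then u b else 0"])
       (auto simp: fun_eq_iff PiE_def extensional_def)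
  have "finite (B \<rightarrow>\<^sub>E (UNIV :: 'a set))" using assms by (intro finite_PiE) auto
  then show "finite ?F" using bij_betw_finite[OF b] by simp
  show "card ?F = CARD('a) ^ card B"
    using bij_betw_same_card[OF b] assms by (simp add: card_PiE)
qed

lemma subspace_subgrp:
  assumes "vector_space scale" "module.subspace scale V"
  shows "subgrp V"
proof -
  interpret vector_space scale by fact
  show ?thesis using assms(2) by (simp add: subgrp_def subspace_0 subspace_diff)
qed

text \<open>The linear combinations of \<open>B\<close> form a transversal of \<open>W\<close> in \<open>V\<close>, with one element for every
  coefficient function.\<close>

lemma quotient_basis_idx:
  fixes scale :: "'a::{field,finite} \<Rightarrow> 'b::ab_group_add \<Rightarrow> 'b"
  assumes vs: "vector_space scale" and V: "module.subspace scale V" and W: "module.subspace scale W"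
    and B: "quotient_basis scale V W B"
  shows "idx V W = CARD('a) ^ card B"
proof -
  interpret vector_space scale by fact
  let ?F = "{u::'b \<Rightarrow> 'a. \<forall>b. b \<notin> B \<longrightarrow> u b = 0}"
  let ?s = "\<lambda>u. \<Sum>b\<in>B. scale (u b) b"
  have fin: "finite B" and BV: "B \<subseteq> V" using B by (auto simp: quotient_basis_def)
  have sV: "?s u \<in> V" for u
    using BV by (intro subspace_sum[OF V] subspace_scale[OF V]) auto
  have uniq: "u = u'" if "u \<in> ?F" "u' \<in> ?F" "?s u - ?s u' \<in> W" for u u'
  proof -
    have "?s u - ?s u \<in> W" using subspace_0[OF W] by simp
    moreover have "\<exists>!w. (\<forall>b. b \<notin> B \<longrightarrow> w b = 0) \<and> ?s u - ?s w \<in> W"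
      using B sV[of u] unfolding quotient_basis_def by blast
    ultimately show ?thesis using that by blast
  qed
  have cov: "\<exists>t\<in>?s ` ?F. v - t \<in> W" if "v \<in> V" for v
    using B that unfolding quotient_basis_def by blast
  have "transversal V W (?s ` ?F)"
    unfolding transversal_def
  proof (intro conjI ballI impI)
    show "?s ` ?F \<subseteq> V" using sV by blast
    fix t t' assume "t \<in> ?s ` ?F" "t' \<in> ?s ` ?F" "t - t' \<in> W"
    then obtain u u' where "u \<in> ?F" "u' \<in> ?F" "t = ?s u" "t' = ?s u'" by blast
    then show "t = t'" using uniq[of u u'] \<open>t - t' \<in> W\<close> by auto
  qed (use cov in blast)
  then have "idx V W = card (?s ` ?F)"
    by (rule idx_transversal[OF subspace_subgrp[OF vs W]])
  also have "\<dots> = card ?F"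
  proof (rule card_image, rule inj_onI)
    fix u u' assume u: "u \<in> ?F" "u' \<in> ?F" and "?s u = ?s u'"
    then have "?s u - ?s u' \<in> W" using subspace_0[OF W] by (simp del: sum_subtractf)
    then show "u = u'" by (rule uniq[OF u])
  qed
  finally show ?thesis using card_supported_functions(1)[OF fin] by simp
qed

text \<open>A maximal family that is independent modulo \<open>W\<close> is a basis of the quotient; its size is
  bounded because its combinations lie in different cosets.\<close>

lemma ex_quotient_basis:
  fixes scale :: "'a::{field,finite} \<Rightarrow> 'b::ab_group_add \<Rightarrow> 'b"
  assumes vs: "vector_space scale" and V: "module.subspace scale V" and W: "module.subspace scale W"
    and fin: "finite (cosets V W)"
  shows "\<exists>B. quotient_basis scale V W B"
proof -
  interpret vector_space scale by fact
  let ?F = "\<lambda>B. {u::'b \<Rightarrow> 'a. \<forall>b. b \<notin> B \<longrightarrow> u b = 0}"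
  let ?s = "\<lambda>B u. \<Sum>b\<in>B. scale (u b) b"
  define ind where "ind B \<longleftrightarrow> finite B \<and> B \<subseteq> V \<and> (\<forall>u\<in>?F B. ?s B u \<in> W \<longrightarrow> u = (\<lambda>_. 0))" for B
  have indD: "u = (\<lambda>_. 0)" if "ind B" "u \<in> ?F B" "?s B u \<in> W" for B u
    using bspec[of "?F B" _ u, OF that(1)[unfolded ind_def, THEN conjunct2, THEN conjunct2] that(2)] that(3)
    by blast
  have uniq: "u = u'" if B: "ind B" "u \<in> ?F B" "u' \<in> ?F B" "?s B u - ?s B u' \<in> W" for B u u'
  proof -
    have "?s B (\<lambda>b. u b - u' b) = ?s B u - ?s B u'"
      by (simp add: scale_left_diff_distrib sum_subtractf)
    then have "?s B (\<lambda>b. u b - u' b) \<in> W" using that by simp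
    moreover have "(\<lambda>b. u b - u' b) \<in> ?F B" using that by simp
    ultimately have "(\<lambda>b. u b - u' b) = (\<lambda>_. 0)" by (intro indD[OF B(1)])
    then show ?thesis by (auto simp: fun_eq_iff)
  qed
  have sV: "?s B u \<in> V" if "ind B" for B u
    using that by (intro subspace_sum[OF V] subspace_scale[OF V]) (auto simp: ind_def)
  have bound: "card B \<le> idx V W" if B: "ind B" for B
  proof -
    have "card B < 2 ^ card B" by (rule less_exp)
    also have "\<dots> \<le> CARD('a) ^ card B"
      using card_field_ge_2[where 'a = 'a] by (simp add: power_mono)
    also have "\<dots> = card (?F B)" 
      using B card_supported_functions(1)[of B, where 'a = 'a] by (simp add: ind_def)
    also have "\<dots> = card ((\<lambda>u. {w. w - ?s B u \<in> W}) ` ?F B)"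
    proof (rule card_image[symmetric], rule inj_onI)
      fix u u' assume u: "u \<in> ?F B" "u' \<in> ?F B"
        and "{w. w - ?s B u \<in> W} = {w. w - ?s B u' \<in> W}"
      then have "?s B u - ?s B u' \<in> W"
        using coset_eq_iff[OF subspace_subgrp[OF vs W]] by blast
      then show "u = u'" by (rule uniq[OF B u])
    qed
    also have "\<dots> \<le> idx V W"
      unfolding idx_def
    proof (rule card_mono[OF fin], rule subsetI)
      fix A assume "A \<in> (\<lambda>u. {w. w - ?s B u \<in> W}) ` ?F B"
      then obtain u where "A = {w. w - ?s B u \<in> W}" by blast
      then show "A \<in> cosets V W" unfolding cosets_def using sV[OF B, of u] by blast
    qed
    finally show ?thesis by simp
  qed
  have "ind {}" by (auto simp: ind_def)
  moreover have "\<forall>B. ind B \<longrightarrow> card B < Suc (idx V W)" using bound by (simp add: less_Suc_eq_le)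
  ultimately have "\<exists>B. ind B \<and> (\<forall>B'. ind B' \<longrightarrow> card B' \<le> card B)"
    by (rule ex_has_greatest_nat)
  then obtain B where B: "ind B" and max: "\<And>B'. ind B' \<Longrightarrow> card B' \<le> card B" by blast
  have finB: "finite B" and BV: "B \<subseteq> V" using B by (simp_all add: ind_def)
  have span: "\<exists>u\<in>?F B. v - ?s B u \<in> W" if v: "v \<in> V" for v
  proof (rule ccontr)
    assume nn: "\<not> ?thesis"
    have neg: False if u: "u \<in> ?F B" "v - ?s B u \<in> W" for u
    proof -
      have "\<exists>u\<in>?F B. v - ?s B u \<in> W" by (rule bexI[where x = u]) (fact u)+
      with nn show False by contradiction
    qed
    have vB: "v \<notin> B"
    proof
      assume vB: "v \<in> B"
      have "?s B (\<lambda>b. if b = v then 1 else 0) = (\<Sum>b\<in>B. if b = v then b else 0)"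
        by (intro sum.cong) auto
      also have "\<dots> = v" using vB finB by simp
      finally have "v - ?s B (\<lambda>b. if b = v then 1 else 0) \<in> W" using subspace_0[OF W] by simp
      moreover have "(\<lambda>b. if b = v then 1 else 0) \<in> ?F B" using vB by auto
      ultimately show False by (intro neg)
    qed
    have "ind (insert v B)"
      unfolding ind_def
    proof (intro conjI ballI impI)
      fix u :: "'b \<Rightarrow> 'a" assume u: "u \<in> ?F (insert v B)" and uW: "?s (insert v B) u \<in> W"
      have split: "?s (insert v B) u = scale (u v) v + ?s B u" using finB vB by simp
      have eq: "?s B (\<lambda>b. if b \<in> B then g b else 0) = ?s B g" for g :: "'b \<Rightarrow> 'a"
        by (intro sum.cong) auto
      have "u v = 0"
      proof (rule ccontr)
        assume uv: "u v \<noteq> 0"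
        have "scale (1 / u v) (?s (insert v B) u) \<in> W" by (rule subspace_scale[OF W uW])
        also have "scale (1 / u v) (?s (insert v B) u) = v + ?s B (\<lambda>b. u b / u v)"
          unfolding split using uv by (simp add: scale_right_distrib scale_sum_right)
        also have "\<dots> = v - ?s B (\<lambda>b. - (u b / u v))" by (simp add: sum_negf)
        also have "\<dots> = v - ?s B (\<lambda>b. if b \<in> B then - (u b / u v) else 0)" by (simp only: eq)
        finally have "v - ?s B (\<lambda>b. if b \<in> B then - (u b / u v) else 0) \<in> W" .
        moreover have "(\<lambda>b. if b \<in> B then - (u b / u v) else 0) \<in> ?F B" by simp
        ultimately show False by (intro neg)
      qed
      then have "u \<in> ?F B" "?s B u \<in> W" using u uW split by auto
      then show "u = (\<lambda>_. 0)" by (intro indD[OF B])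
    qed (use finB BV v in auto)
    then have "card (insert v B) \<le> card B" by (rule max)
    then show False using vB finB by simp
  qed
  have "quotient_basis scale V W B"
    unfolding quotient_basis_def
  proof (intro conjI ballI)
    fix v assume v: "v \<in> V"
    obtain u where u: "u \<in> ?F B" "v - ?s B u \<in> W" using bexE[OF span[OF v]] .
    show "\<exists>!u. (\<forall>b. b \<notin> B \<longrightarrow> u b = 0) \<and> v - ?s B u \<in> W"
    proof (intro ex1I[of _ u] conjI)
      fix w assume w: "(\<forall>b. b \<notin> B \<longrightarrow> w b = 0) \<and> v - ?s B w \<in> W"
      have w2: "v - ?s B w \<in> W" using w by (rule conjunct2)
      have "(v - ?s B u) - (v - ?s B w) \<in> W" by (rule subspace_diff[OF W u(2) w2])
      then have "?s B w - ?s B u \<in> W" by (simp add: algebra_simps)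
      then show "w = u" using w by (intro uniq[OF B _ u(1)]) auto
    next
      show "v - ?s B u \<in> W" by (rule u(2))
    qed (use u(1) in auto)
  qed (use finB BV in auto)
  then show ?thesis ..
qed

text \<open>By this and the next lemma, dimensions are determined by counting.\<close>

lemma card_power_quotient_dim:
  fixes scale :: "'a::{field,finite} \<Rightarrow> 'b::ab_group_add \<Rightarrow> 'b"
  assumes vs: "vector_space scale" and V: "module.subspace scale V" and W: "module.subspace scale W"
    and fin: "finite (cosets V W)"
  shows "CARD('a) ^ quotient_dim scale V W = idx V W"
proof -
  obtain B where B: "quotient_basis scale V W B" using ex_quotient_basis[OF assms] ..
  have inj: "m = m'" if "CARD('a) ^ m = CARD('a) ^ m'" for m m'
    using that card_field_ge_2[where 'a = 'a] by (simp add: power_inject_exp)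
  have "quotient_dim scale V W = card B"
    unfolding quotient_dim_def
  proof (rule the_equality)
    fix m assume "\<exists>B. quotient_basis scale V W B \<and> card B = m"
    then show "m = card B"
      using quotient_basis_idx[OF vs V W] B by (metis inj)
  qed (use B in blast)
  then show ?thesis using quotient_basis_idx[OF vs V W B] by simp
qed

lemma card_power_dim:
  fixes scale :: "'a::{field,finite} \<Rightarrow> 'b::ab_group_add \<Rightarrow> 'b"
  assumes vs: "vector_space scale" and V: "module.subspace scale V" and fin: "finite V"
  shows "CARD('a) ^ vector_space.dim scale V = card V"
proof -
  interpret vector_space scale by fact
  obtain B where B: "B \<subseteq> V" "independent B" "V \<subseteq> span B" "card B = dim V"
    by (rule basis_exists)
  have finB: "finite B" using B fin finite_subset by blast
  have W: "subspace {0}" by (simp add: subspace_def)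
  have "quotient_basis scale V {0} B"
    unfolding quotient_basis_def
  proof (intro conjI ballI)
    fix v assume "v \<in> V"
    then have "v \<in> span B" using B by blast
    then obtain u where u: "v = (\<Sum>b\<in>B. scale (u b) b)" using span_finite[OF finB] by auto
    let ?u = "\<lambda>b. if b \<in> B then u b else 0"
    have eq: "(\<Sum>b\<in>B. scale (?u b) b) = v" unfolding u by (intro sum.cong) auto
    show "\<exists>!u. (\<forall>b. b \<notin> B \<longrightarrow> u b = 0) \<and> v - (\<Sum>b\<in>B. scale (u b) b) \<in> {0}"
    proof (intro ex1I[of _ ?u] conjI)
      fix w assume w: "(\<forall>b. b \<notin> B \<longrightarrow> w b = 0) \<and> v - (\<Sum>b\<in>B. scale (w b) b) \<in> {0}"
      then have "(\<Sum>b\<in>B. scale (w b - ?u b) b) = 0"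
        using eq by (simp add: scale_left_diff_distrib sum_subtractf)
      then have "w b - ?u b = 0" if "b \<in> B" for b
        using independentD[OF B(2) finB subset_refl, of "\<lambda>b. w b - ?u b" b] that by simp
      then show "w = ?u" using w by (auto simp: fun_eq_iff)
    qed (use eq in auto)
  qed (use finB B in auto)
  then show ?thesis using quotient_basis_idx[OF vs V W] B by (simp add: idx_zero)
qed

section \<open>Powers and power sums in a finite field\<close>

text \<open>Multiplication by \<open>a\<close> permutes the nonzero elements, so it does not change their product.\<close>

lemma finite_field_power_card:
  fixes a :: "'a::{field,finite}"
  assumes "a \<noteq> 0"
  shows "a ^ (CARD('a) - 1) = 1"
proof -
  have "(\<Prod>y\<in>UNIV - {0}. a * y) = (\<Prod>y\<in>UNIV - {0}. y)"
    by (rule prod.reindex_bij_witness[of _ "\<lambda>y. y / a" "\<lambda>y. a * y"]) (use assms in auto)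
  then have "a ^ (CARD('a) - 1) * \<Prod>(UNIV - {0::'a}) = \<Prod>(UNIV - {0::'a})"
    by (simp add: prod.distrib)
  then show ?thesis by simp
qed

lemma card_power_eq_1_le:
  fixes m :: nat assumes "0 < m"
  shows "card {c::'a::{field,finite}. c ^ m = 1} \<le> m"
proof -
  let ?p = "monom 1 m - 1 :: 'a poly"
  have d: "degree ?p = m" using assms
    using degree_add_eq_left[of "- 1" "monom 1 m :: 'a poly"] by (simp add: degree_monom_eq)
  then have "?p \<noteq> 0" using assms by auto
  then have "card {c. poly ?p c = 0} \<le> degree ?p" by (rule card_poly_roots_bound)
  then show ?thesis unfolding d by (simp add: poly_monom)
qed

text \<open>Translation by \<open>1\<close> does not change the sum of all elements.\<close>

lemma of_nat_card_eq_0: "of_nat CARD('a) = (0::'a::{field,finite})"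
proof -
  have "(\<Sum>a\<in>UNIV. a + 1) = (\<Sum>a\<in>UNIV. a::'a)"
    by (rule sum.reindex_bij_witness[of _ "\<lambda>a. a - 1" "\<lambda>a. a + 1"]) auto
  then show ?thesis by (simp add: sum.distrib)
qed

lemma of_nat_dvd_card_minus_1_ne_0:
  assumes "n dvd CARD('a) - 1"
  shows "of_nat n \<noteq> (0::'a::{field,finite})"
proof
  assume 0: "of_nat n = (0::'a)"
  obtain m where "CARD('a) - 1 = n * m" using assms by blast
  then have "CARD('a) = n * m + 1" using card_field_ge_2[where 'a = 'a] by simp
  then have "of_nat CARD('a) = (1::'a)" using 0 by simp
  then show False by (simp add: of_nat_card_eq_0)
qed

text \<open>Let \<open>m = (q - 1)/n\<close>. The map \<open>b \<mapsto> b\<^sup>n\<close> sends the \<open>n m\<close> nonzero elements to at most \<open>m\<close>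
  elements, the roots of \<open>c\<^sup>m = 1\<close>. Its fibres are no larger than the group of the \<open>n\<close>-th roots of
  unity.\<close>

lemma card_roots_of_unity:
  assumes dvd: "n dvd CARD('a::{field,finite}) - 1"
  shows "card {z::'a. z ^ n = 1} = n"
proof -
  let ?U = "{z::'a. z ^ n = 1}"
  obtain m where m: "CARD('a) - 1 = n * m" using dvd by blast
  have pos: "0 < n * m" using card_field_ge_2[where 'a = 'a] m by linarith
  have fib: "card {b::'a. b \<noteq> 0 \<and> b ^ n = c} \<le> card ?U" for c
  proof (cases "\<exists>b. b \<noteq> 0 \<and> b ^ n = c")
    case True
    then obtain b where b: "b \<noteq> 0" "b ^ n = c" by blast
    have "{b::'a. b \<noteq> 0 \<and> b ^ n = c} \<subseteq> (\<lambda>z. b * z) ` ?U"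
    proof
      fix w assume w: "w \<in> {b::'a. b \<noteq> 0 \<and> b ^ n = c}"
      then have "w = b * (w / b)" "(w / b) ^ n = 1" using b by (auto simp: power_divide)
      then show "w \<in> (\<lambda>z. b * z) ` ?U" by blast
    qed
    then show ?thesis by (meson card_image_le card_mono finite finite_imageI le_trans)
  next
    case False then have "{b::'a. b \<noteq> 0 \<and> b ^ n = c} = {}" by blast
    then show ?thesis by (metis card.empty le0)
  qed
  have "n * m = card (UNIV - {0::'a})" using m by (simp add: card_Diff_singleton)
  also have "UNIV - {0::'a} \<subseteq> (\<Union>c\<in>{c. c ^ m = 1}. {b. b \<noteq> 0 \<and> b ^ n = c})"
  proof
    fix b :: 'a assume "b \<in> UNIV - {0}"
    then have "(b ^ n) ^ m = 1" "b \<noteq> 0"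
      using finite_field_power_card[of b] m by (auto simp: power_mult)
    then show "b \<in> (\<Union>c\<in>{c. c ^ m = 1}. {b. b \<noteq> 0 \<and> b ^ n = c})" by blast
  qed
  then have "card (UNIV - {0::'a}) \<le> card (\<Union>c\<in>{c::'a. c ^ m = 1}. {b. b \<noteq> 0 \<and> b ^ n = c})"
    by (intro card_mono) auto
  also have "\<dots> \<le> (\<Sum>c\<in>{c::'a. c ^ m = 1}. card {b. b \<noteq> 0 \<and> b ^ n = c})"
    by (rule card_UN_le) auto
  also have "\<dots> \<le> card {c::'a. c ^ m = 1} * card ?U"
    using sum_bounded_above[of "{c::'a. c ^ m = 1}" "\<lambda>c. card {b. b \<noteq> 0 \<and> b ^ n = c}" "card ?U"] fib
    by simp
  also have "\<dots> \<le> m * card ?U" using card_power_eq_1_le[of m] pos by (intro mult_right_mono) auto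
  finally have "n \<le> card ?U" using pos by (simp add: mult.commute)
  moreover have "card ?U \<le> n" using card_power_eq_1_le[of n] pos by auto
  ultimately show ?thesis by simp
qed

text \<open>The substitution of \<open>g a\<close> for \<open>a\<close> multiplies the sum by \<open>g\<^sup>i\<close>, which is not \<open>1\<close> for some
  \<open>g\<close>.\<close>

lemma sum_powers_eq_0:
  assumes "i < CARD('a::{field,finite}) - 1"
  shows "(\<Sum>a\<in>UNIV. (a::'a) ^ i) = 0"
proof (cases "i = 0")
  case True then show ?thesis by (simp add: of_nat_card_eq_0)
next
  case False
  have "\<exists>g::'a. g \<noteq> 0 \<and> g ^ i \<noteq> 1"
  proof (rule ccontr)
    assume "\<not> ?thesis"
    then have "UNIV - {0::'a} \<subseteq> {c. c ^ i = 1}" by auto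
    then have "card (UNIV - {0::'a}) \<le> card {c::'a. c ^ i = 1}" by (intro card_mono) auto
    also have "\<dots> \<le> i" using False card_power_eq_1_le by blast
    finally show False using assms by (simp add: card_Diff_singleton)
  qed
  then obtain g :: 'a where g: "g \<noteq> 0" "g ^ i \<noteq> 1" by blast
  have "(\<Sum>a\<in>UNIV. (g * a) ^ i) = (\<Sum>a\<in>UNIV. (a::'a) ^ i)"
    by (rule sum.reindex_bij_witness[of _ "\<lambda>y. y / g" "\<lambda>y. g * y"]) (use g in auto)
  then have "g ^ i * (\<Sum>a\<in>UNIV. (a::'a) ^ i) = (\<Sum>a\<in>UNIV. a ^ i)"
    by (simp add: power_mult_distrib sum_distrib_left)
  then have "(g ^ i - 1) * (\<Sum>a\<in>UNIV. (a::'a) ^ i) = 0" by (simp add: left_diff_distrib)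
  then show ?thesis using g by simp
qed

text \<open>The substitution is now by a root of unity \<open>g\<close>.\<close>

lemma sum_roots_of_unity_powers:
  assumes dvd: "n dvd CARD('a::{field,finite}) - 1" and j: "\<not> n dvd j"
  shows "(\<Sum>z\<in>{z::'a. z ^ n = 1}. z ^ j) = 0"
proof -
  have n: "0 < n" using dvd card_field_ge_2[where 'a = 'a] by (cases n) auto
  have r: "0 < j mod n" "j mod n < n" using j n by (auto simp: dvd_eq_mod_eq_0)
  have red: "z ^ j = z ^ (j mod n)" if "z ^ n = 1" for z :: 'a
  proof -
    have "z ^ j = z ^ (n * (j div n) + j mod n)" by simp
    then show ?thesis using that by (simp only: power_add power_mult) simp
  qed
  have "\<exists>z::'a. z ^ n = 1 \<and> z ^ j \<noteq> 1"
  proof (rule ccontr)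
    assume "\<not> ?thesis"
    then have "{z::'a. z ^ n = 1} \<subseteq> {c. c ^ (j mod n) = 1}" using red by auto
    then have "card {z::'a. z ^ n = 1} \<le> card {c::'a. c ^ (j mod n) = 1}" by (intro card_mono) auto
    also have "\<dots> \<le> j mod n" using r card_power_eq_1_le by blast
    finally show False using r card_roots_of_unity[OF dvd] by simp
  qed
  then obtain g :: 'a where g: "g ^ n = 1" "g ^ j \<noteq> 1" by blast
  have g0: "g \<noteq> 0" using g n by (auto simp: zero_power)
  have "(\<Sum>z\<in>{z::'a. z ^ n = 1}. (g * z) ^ j) = (\<Sum>z\<in>{z::'a. z ^ n = 1}. z ^ j)"
    by (rule sum.reindex_bij_witness[of _ "\<lambda>y. y / g" "\<lambda>y. g * y"])
       (use g g0 in \<open>auto simp: power_divide power_mult_distrib\<close>)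
  then have "g ^ j * (\<Sum>z\<in>{z::'a. z ^ n = 1}. z ^ j) = (\<Sum>z\<in>{z::'a. z ^ n = 1}. z ^ j)"
    by (simp add: power_mult_distrib sum_distrib_left)
  then have "(g ^ j - 1) * (\<Sum>z\<in>{z::'a. z ^ n = 1}. z ^ j) = 0" by (simp add: left_diff_distrib)
  then show ?thesis using g by simp
qed

section \<open>Dual codes\<close>

text \<open>A nonzero linear form takes each of the \<open>q\<close> values equally often.\<close>

lemma words_subspace_functional:
  fixes C :: "('i \<Rightarrow> 'a::{field,finite}) set" and \<phi> :: "('i \<Rightarrow> 'a) \<Rightarrow> 'a"
  assumes C: "subgrp C" "finite C" and sc: "\<And>a w. w \<in> C \<Longrightarrow> (\<lambda>v. a * w v) \<in> C"
    and add: "\<And>u w. \<phi> (u - w) = \<phi> u - \<phi> w" and hom: "\<And>a w. \<phi> (\<lambda>v. a * w v) = a * \<phi> w"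
    and ne: "\<exists>w\<in>C. \<phi> w \<noteq> 0"
  shows "CARD('a) * card {w\<in>C. \<phi> w = 0} = card C"
proof -
  let ?K = "{w\<in>C. \<phi> w = 0}"
  have K: "subgrp ?K" using C add by (auto simp: subgrp_def) (metis cancel_comm_monoid_add_class.diff_cancel)
  obtain w where w: "w \<in> C" "\<phi> w \<noteq> 0" using ne by blast
  have "a \<in> \<phi> ` C" for a
  proof -
    have "\<phi> (\<lambda>v. (a / \<phi> w) * w v) = a" using w by (simp only: hom) simp
    then show ?thesis using sc[OF w(1)] by (metis imageI)
  qed
  then have "\<phi> ` C = UNIV" by auto
  moreover have "idx C ?K = card (\<phi> ` C)"
    using C K by (intro idx_fibers) (auto simp: add subgrp_diff)
  ultimately show ?thesis using card_eq_idx_mult[OF C(1) K] C by simp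
qed

text \<open>The pairs of orthogonal words in \<open>C\<close> and in the whole space are counted in two ways, using
  that a nonzero linear form vanishes on one word out of \<open>q\<close>.\<close>

lemma card_dual_code:
  fixes C :: "('k place \<Rightarrow> 'a::{field,finite}) set"
  assumes fin: "finite {v. D v \<noteq> 0}" and CW: "C \<subseteq> words D" and C: "subgrp C"
    and sc: "\<And>a w. w \<in> C \<Longrightarrow> (\<lambda>v. a * w v) \<in> C"
  shows "card C * card (dual_code D C) = CARD('a) ^ card {v. D v \<noteq> 0}"
proof -
  let ?W = "words D :: ('k place \<Rightarrow> 'a) set" and ?S = "{v. D v \<noteq> 0}"
  define B where "B w u = (\<Sum>v\<in>?S. w v * u v)" for w u :: "'k place \<Rightarrow> 'a"
  let ?Q = "CARD('a) ^ card ?S" and ?q = "CARD('a)"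
  have W: "card ?W = ?Q" "finite ?W"
    using card_supported_functions[OF fin, where 'a = 'a] by (simp_all add: words_def)
  have sW: "subgrp ?W" by (auto simp: subgrp_def words_def)
  have scW: "(\<lambda>v. a * w v) \<in> ?W" if "w \<in> ?W" for a w using that by (auto simp: words_def)
  have finC: "finite C" using W CW finite_subset by blast
  have dual: "dual_code D C = {w\<in>?W. \<forall>u\<in>C. B w u = 0}" by (simp add: dual_code_def B_def)
  have lin: "B (w - w') u = B w u - B w' u" "B (\<lambda>v. a * w v) u = a * B w u"
    "B w (u - u') = B w u - B w u'" "B w (\<lambda>v. a * u v) = a * B w u" for a w w' u u'
    by (simp_all add: B_def sum_subtractf algebra_simps sum_distrib_left)
  have cu: "?q * card {w\<in>?W. B w u = 0} = (if u = 0 then ?q * ?Q else ?Q)" if u: "u \<in> C" for u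
  proof (cases "u = 0")
    case True then show ?thesis using W by (simp add: B_def)
  next
    case False
    then obtain v where v: "u v \<noteq> 0" by (auto simp: fun_eq_iff)
    then have vS: "v \<in> ?S" using u CW by (auto simp: words_def)
    let ?w = "\<lambda>v'. if v' = v then 1 else 0"
    have "B ?w u = (\<Sum>v'\<in>?S. if v' = v then u v' else 0)" unfolding B_def by (intro sum.cong) auto
    also have "\<dots> = u v" using vS fin by simp
    finally have "\<exists>w\<in>?W. B w u \<noteq> 0" using v vS by (intro bexI[of _ ?w]) (auto simp: words_def)
    then show ?thesis
      using words_subspace_functional[OF sW W(2) scW, of "\<lambda>w. B w u"] lin False W by simp
  qed
  have cw: "?q * card {u\<in>C. B w u = 0} = (if w \<in> dual_code D C then ?q * card C else card C)"
    if w: "w \<in> ?W" for w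
  proof (cases "w \<in> dual_code D C")
    case True then have "{u\<in>C. B w u = 0} = C" by (auto simp: dual)
    then show ?thesis using True by simp
  next
    case False
    then have "\<exists>u\<in>C. B w u \<noteq> 0" using w by (auto simp: dual)
    then show ?thesis
      using words_subspace_functional[OF C finC sc, of "B w"] lin False by simp
  qed
  have e1: "(\<Sum>u\<in>C. ?q * card {w\<in>?W. B w u = 0}) = (\<Sum>w\<in>?W. ?q * card {u\<in>C. B w u = 0})"
    using sum.swap_restrict[OF finC W(2), of "\<lambda>_ _. ?q" "\<lambda>u w. B w u = 0"] by (simp add: mult.commute)
  have e2: "(\<Sum>u\<in>C. ?q * card {w\<in>?W. B w u = 0}) = ?q * ?Q + (card C - 1) * ?Q"
  proof -
    have "(\<Sum>u\<in>C. ?q * card {w\<in>?W. B w u = 0}) = (\<Sum>u\<in>C. if u = 0 then ?q * ?Q else ?Q)"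
      by (intro sum.cong) (auto simp: cu)
    also have "\<dots> = ?q * ?Q + (\<Sum>u\<in>C - {0}. ?Q)"
      using finC subgrp_zero[OF C] by (subst sum.remove[of _ 0]) auto
    finally show ?thesis using finC subgrp_zero[OF C] by simp
  qed
  have e3: "(\<Sum>w\<in>?W. ?q * card {u\<in>C. B w u = 0})
      = card (dual_code D C) * (?q * card C) + (?Q - card (dual_code D C)) * card C"
  proof -
    have sub: "dual_code D C \<subseteq> ?W" by (auto simp: dual)
    then have fd: "finite (dual_code D C)" using W finite_subset by blast
    have "(\<Sum>w\<in>?W. ?q * card {u\<in>C. B w u = 0})
        = (\<Sum>w\<in>?W. if w \<in> dual_code D C then ?q * card C else card C)"
      by (intro sum.cong) (auto simp: cw)
    also have "\<dots> = (\<Sum>w\<in>dual_code D C. ?q * card C) + (\<Sum>w\<in>?W - dual_code D C. card C)"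
      using sub W by (subst sum.subset_diff[of "dual_code D C"]) (auto simp: add.commute)
    finally show ?thesis using W sub fd by (simp add: card_Diff_subset)
  qed
  have le: "card (dual_code D C) \<le> ?Q"
    using W by (metis (no_types, lifting) card_mono dual mem_Collect_eq subsetI)
  have ge: "1 \<le> card C" using finC subgrp_zero[OF C] by (metis One_nat_def Suc_leI card_gt_0_iff empty_iff)
  have "int (?q * ?Q + (card C - 1) * ?Q) =
     int (card (dual_code D C) * (?q * card C) + (?Q - card (dual_code D C)) * card C)"
    using e1 e2 e3 by (simp only:)
  then have "int ?q * int ?Q + (int (card C) - 1) * int ?Q =
     int (card (dual_code D C)) * (int ?q * int (card C)) + (int ?Q - int (card (dual_code D C))) * int (card C)"
    using le ge by (simp only: of_nat_add of_nat_mult of_nat_diff of_nat_1)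
  moreover have "int ?q \<noteq> 1" using card_field_ge_2[where 'a = 'a] by linarith
  moreover have "c * e = Q"
    if "q * Q + (c - 1) * Q = e * (q * c) + (Q - e) * c" "q \<noteq> 1" for q Q c e :: int
  proof -
    have "(q - 1) * (c * e - Q) = 0" using that(1) by (simp add: algebra_simps)
    then show ?thesis using that(2) by simp
  qed
  ultimately have "int (card C) * int (card (dual_code D C)) = int ?Q" by blast
  then show ?thesis by (simp only: of_nat_mult[symmetric] of_nat_eq_iff)
qed

section \<open>Places and weak approximation\<close>

text \<open>The fractional ideals of a place. As \<open>v 0\<close> is \<open>0\<close> by convention, the element \<open>0\<close> has to be
  added.\<close>

definition pw :: "'k::field place \<Rightarrow> int \<Rightarrow> 'k set" where
  "pw v m = {z. z = 0 \<or> m \<le> v z}"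

lemma valuation_ring_eq: "valuation_ring v = pw v 0"
  and maximal_ideal_eq: "maximal_ideal v = pw v 1"
  by (auto simp: valuation_ring_def maximal_ideal_def pw_def)

context
  fixes \<iota> :: "'a::field \<Rightarrow> 'k::field" and v :: "'k place"
  assumes v: "v \<in> places \<iota>"
begin

lemma place_zero: "v 0 = 0"
  using v by (simp add: places_def)

lemma place_mult: "z \<noteq> 0 \<Longrightarrow> w \<noteq> 0 \<Longrightarrow> v (z * w) = v z + v w"
  using v by (simp add: places_def)

lemma place_add: "z \<noteq> 0 \<Longrightarrow> w \<noteq> 0 \<Longrightarrow> z + w \<noteq> 0 \<Longrightarrow> min (v z) (v w) \<le> v (z + w)"
  using v by (simp add: places_def)

lemma place_const: "a \<noteq> 0 \<Longrightarrow> v (\<iota> a) = 0"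
  using v by (simp add: places_def)

lemma place_one: "v 1 = 0"
  using place_mult[of 1 1] by simp

lemma place_uminus: "v (- z) = v z"
proof (cases "z = 0")
  case False
  have "v (- 1) = 0" using place_mult[of "- 1" "- 1"] by (simp add: place_one)
  then show ?thesis using place_mult[of "- 1" z] False by simp
qed simp

lemma place_power: "v (z ^ k) = int k * v z"
proof (cases "z = 0")
  case True then show ?thesis by (cases k) (auto simp: place_zero place_one)
next
  case False
  then show ?thesis by (induction k) (auto simp: place_one place_mult algebra_simps)
qed

lemma place_inverse: "v (inverse z) = - v z"
proof (cases "z = 0")
  case False then show ?thesis using place_mult[of z "inverse z"] by (simp add: place_one)
qed (simp add: place_zero)

lemma place_divide: "z \<noteq> 0 \<Longrightarrow> w \<noteq> 0 \<Longrightarrow> v (z / w) = v z - v w"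
  by (simp add: divide_inverse place_mult place_inverse)

lemma place_power_int: "v (z powi m) = m * v z"
  by (simp add: power_int_def place_power place_inverse)

lemma place_prod: "finite A \<Longrightarrow> (\<And>i. i \<in> A \<Longrightarrow> g i \<noteq> 0) \<Longrightarrow> v (prod g A) = (\<Sum>i\<in>A. v (g i))"
  by (induction A rule: finite_induct) (auto simp: place_one place_mult)

lemma uniformizer: obtains t where "v t = 1" "t \<noteq> 0"
proof -
  obtain t where "v t = 1" using v by (auto simp: places_def)
  moreover then have "t \<noteq> 0" by (auto simp: place_zero)
  ultimately show thesis by (rule that)
qed

lemma pw_zero: "0 \<in> pw v m"
  by (simp add: pw_def)

lemma pw_iff: "z \<noteq> 0 \<Longrightarrow> z \<in> pw v m \<longleftrightarrow> m \<le> v z"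
  by (simp add: pw_def)

lemma pw_mono: "z \<in> pw v m \<Longrightarrow> k \<le> m \<Longrightarrow> z \<in> pw v k"
  by (auto simp: pw_def)

lemma pw_add: "z \<in> pw v m \<Longrightarrow> w \<in> pw v m \<Longrightarrow> z + w \<in> pw v m"
  using place_add[of z w] by (cases "z = 0 \<or> w = 0 \<or> z + w = 0") (auto simp: pw_def)

lemma pw_uminus: "z \<in> pw v m \<Longrightarrow> - z \<in> pw v m"
  by (auto simp: pw_def place_uminus)

lemma pw_diff: "z \<in> pw v m \<Longrightarrow> w \<in> pw v m \<Longrightarrow> z - w \<in> pw v m"
  using pw_add[of z m "- w"] pw_uminus by simp

lemma pw_mult: "z \<in> pw v m \<Longrightarrow> w \<in> pw v k \<Longrightarrow> z * w \<in> pw v (m + k)"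
  by (cases "z = 0 \<or> w = 0") (auto simp: pw_def place_mult)

lemma pw_sum: "(\<And>i. i \<in> A \<Longrightarrow> g i \<in> pw v m) \<Longrightarrow> sum g A \<in> pw v m"
  by (induction A rule: infinite_finite_induct) (auto simp: pw_zero pw_add)

lemma pw_const: "field_embedding \<iota> \<Longrightarrow> \<iota> a \<in> pw v 0"
  using place_const[of a] by (cases "a = 0") (simp_all add: pw_def field_embedding_def)

lemma subgrp_pw: "subgrp (pw v m)"
  by (simp add: subgrp_def pw_zero pw_diff)

text \<open>If the value of \<open>z + w\<close> were larger than that of \<open>z\<close>, then so would be that of
  \<open>z = (z + w) - w\<close>.\<close>

lemma place_add_dominant:
  assumes "z \<noteq> 0" "w \<in> pw v (v z + 1)"
  shows "z + w \<noteq> 0" "v (z + w) = v z"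
proof -
  show ne: "z + w \<noteq> 0"
  proof
    assume "z + w = 0"
    then have "w = - z" by (simp add: eq_neg_iff_add_eq_0 add.commute)
    then show False using assms by (simp add: pw_def place_uminus)
  qed
  have "z \<in> pw v (v z)" by (simp add: pw_def)
  then have "z + w \<in> pw v (v z)" using assms(2) by (intro pw_add) (auto intro: pw_mono)
  moreover have "\<not> v z + 1 \<le> v (z + w)"
  proof
    assume "v z + 1 \<le> v (z + w)"
    then have "(z + w) - w \<in> pw v (v z + 1)" using assms(2) by (intro pw_diff) (auto simp: pw_def)
    then show False using assms(1) by (simp add: pw_def)
  qed
  ultimately show "v (z + w) = v z" using ne by (auto simp: pw_def)
qed

lemma place_sum_distinct:
  assumes "finite A" "\<And>i j. i \<in> A \<Longrightarrow> j \<in> A \<Longrightarrow> i \<noteq> j \<Longrightarrow> g i \<noteq> 0 \<Longrightarrow> g j \<noteq> 0 \<Longrightarrow> v (g i) \<noteq> v (g j)"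
    and "\<exists>i\<in>A. g i \<noteq> 0"
  shows "\<exists>m\<in>A. g m \<noteq> 0 \<and> sum g A \<noteq> 0 \<and> v (sum g A) = v (g m) \<and> (\<forall>j\<in>A. g j \<in> pw v (v (g m)))"
proof -
  let ?B = "{i\<in>A. g i \<noteq> 0}"
  have B: "finite ?B" "?B \<noteq> {}" using assms by auto
  obtain m where m: "m \<in> ?B" "v (g m) = Min ((\<lambda>i. v (g i)) ` ?B)"
  proof -
    have "Min ((\<lambda>i. v (g i)) ` ?B) \<in> (\<lambda>i. v (g i)) ` ?B" using B by (intro Min_in) auto
    then show thesis using that by force
  qed
  have le: "v (g m) \<le> v (g j)" if "j \<in> A" "g j \<noteq> 0" for j
    unfolding m(2) using B that by (intro Min_le) auto
  have "sum g A = g m + sum g (A - {m})" using assms(1) m(1) by (intro sum.remove) auto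
  moreover have "sum g (A - {m}) \<in> pw v (v (g m) + 1)"
  proof (rule pw_sum)
    fix j assume "j \<in> A - {m}"
    then have j: "j \<in> A" "m \<noteq> j" by auto
    show "g j \<in> pw v (v (g m) + 1)"
    proof (cases "g j = 0")
      case False
      then have "v (g m) \<noteq> v (g j)" using assms(2)[of m j] m(1) j by simp
      then show ?thesis using le[OF j(1) False] False by (simp add: pw_def)
    qed (simp add: pw_zero)
  qed
  ultimately have "sum g A \<noteq> 0" "v (sum g A) = v (g m)"
    using place_add_dominant[of "g m" "sum g (A - {m})"] m(1) by auto
  moreover have "\<forall>j\<in>A. g j \<in> pw v (v (g m))" using le by (auto simp: pw_def)
  ultimately show ?thesis using m(1) by blast
qed

end

text \<open>Otherwise \<open>w\<close> would be nonnegative on the valuation ring of \<open>v\<close>, hence zero on its units and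
  a multiple of \<open>v\<close>. Both valuations being normalised, they would be equal.\<close>

lemma place_not_le:
  assumes v: "v \<in> places \<iota>" and w: "w \<in> places \<iota>" and ne: "v \<noteq> w"
  shows "\<exists>z. z \<noteq> 0 \<and> 0 \<le> v z \<and> w z < 0"
proof (rule ccontr)
  assume "\<not> ?thesis"
  then have le: "0 \<le> w z" if "z \<noteq> 0" "0 \<le> v z" for z using that by (meson not_le)
  obtain t where t: "v t = 1" "t \<noteq> 0" by (rule uniformizer[OF v])
  obtain s where s: "w s = 1" "s \<noteq> 0" by (rule uniformizer[OF w])
  have eq: "w z = v z * w t" if z: "z \<noteq> 0" for z
  proof -
    define u where "u = z * t powi (- v z)"
    have u: "u \<noteq> 0" "v u = 0"
      using z t by (simp_all add: u_def place_mult[OF v] place_power_int[OF v])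
    have "0 \<le> w u" "0 \<le> w (inverse u)"
      using u by (intro le; simp add: place_inverse[OF v])+
    then have "w u = 0" by (simp add: place_inverse[OF w])
    then show ?thesis using z t by (simp add: u_def place_mult[OF w] place_power_int[OF w])
  qed
  have "v s * w t = 1" using eq[OF s(2)] s(1) by simp
  moreover have "0 \<le> w t" using le[OF t(2)] t(1) by simp
  ultimately have "w t = 1" by (auto simp: zmult_eq_1_iff)
  then have "v z = w z" for z using eq[of z] by (cases "z = 0") (auto simp: place_zero[OF v] place_zero[OF w])
  then show False using ne by (simp add: fun_eq_iff)
qed

lemma place_separate_two:
  assumes v: "v \<in> places \<iota>" and w: "w \<in> places \<iota>" and ne: "v \<noteq> w"
  shows "\<exists>z. z \<noteq> 0 \<and> 0 < v z \<and> w z < 0"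
proof -
  obtain a where a: "a \<noteq> 0" "0 \<le> v a" "w a < 0" using place_not_le[OF assms] by blast
  obtain b where b: "b \<noteq> 0" "0 \<le> w b" "v b < 0" using place_not_le[OF w v] ne by blast
  show ?thesis
    using a b by (intro exI[of _ "a / b"]) (simp add: place_divide[OF v] place_divide[OF w])
qed

text \<open>An element \<open>u\<close> that suits the places of \<open>S\<close> is made to suit a further place \<open>w\<close> by adding a
  high power of an element \<open>u'\<close> that suits \<open>w\<close>.\<close>

lemma place_separate:
  assumes v: "v \<in> places \<iota>" and "finite S" "S \<subseteq> places \<iota>" "v \<notin> S"
  shows "\<exists>z. z \<noteq> 0 \<and> 0 < v z \<and> (\<forall>w\<in>S. w z < 0)"
  using assms(2-)
proof (induction S rule: finite_induct)
  case empty
  obtain t where "v t = 1" "t \<noteq> 0" by (rule uniformizer[OF v])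
  then show ?case by (intro exI[of _ t]) simp
next
  case (insert w S)
  then have w: "w \<in> places \<iota>" and S: "S \<subseteq> places \<iota>" by auto
  obtain u where u: "u \<noteq> 0" "0 < v u" "\<forall>w\<in>S. w u < 0" using insert by auto
  obtain u' where u': "u' \<noteq> 0" "0 < v u'" "w u' < 0"
    using place_separate_two[OF v w] insert by auto
  show ?case
  proof (cases "w u < 0")
    case True then show ?thesis using u by blast
  next
    case False
    \<comment> \<open>The exponent is so large that \<open>u\<close> and \<open>u'\<^sup>r\<close> have different values at every place of \<open>S\<close>.\<close>
    define r where "r = Suc (nat (\<Sum>x\<in>S. \<bar>x u\<bar>))"
    have r: "\<bar>x u\<bar> < int r" if "x \<in> S" for x
      using member_le_sum[of x S "\<lambda>x. \<bar>x u\<bar>"] that insert.hyps(1) by (simp add: r_def)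
    let ?z = "u' ^ r + u"
    have pos: "0 < int r" unfolding r_def by (simp only: of_nat_0_less_iff zero_less_Suc)
    have "w (u' ^ r) < 0" using u'(3) pos by (simp add: place_power[OF w] mult_pos_neg)
    then have "u \<in> pw w (w (u' ^ r) + 1)" using False by (simp add: pw_def)
    then have z: "?z \<noteq> 0" "w ?z < 0"
      using place_add_dominant[OF w, of "u' ^ r" u] u'(1) \<open>w (u' ^ r) < 0\<close> by auto
    have "1 \<le> int r * v u'" using mult_mono[of 1 "int r" 1 "v u'"] pos u'(2) by simp
    then have "u' ^ r \<in> pw v 1" by (simp add: pw_def place_power[OF v])
    moreover have "u \<in> pw v 1" using u by (simp add: pw_def)
    ultimately have vz: "0 < v ?z" using pw_add[OF v] z(1) pw_iff[OF v] by fastforce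
    have "x ?z < 0" if x: "x \<in> S" for x
    proof -
      have xp: "x \<in> places \<iota>" using x S by blast
      have xu: "x u < 0" using u(3) x by blast
      have p: "x (u' ^ r) = int r * x u'" by (rule place_power[OF xp])
      have ne: "x (u' ^ r) \<noteq> x u"
      proof (cases "x u' = 0")
        case False
        have "int r * 1 \<le> int r * \<bar>x u'\<bar>" using False by (intro mult_left_mono) auto
        then show ?thesis using r[OF x] p by (auto simp: abs_mult)
      qed (use xu p in auto)
      show ?thesis
      proof (cases "x (u' ^ r) < x u")
        case True
        then have "x ?z = x (u' ^ r)" using u'(1) u(1)
          by (intro place_add_dominant(2)[OF xp]) (auto simp: pw_def)
        then show ?thesis using True xu by simp
      next
        case False
        then have "x (u + u' ^ r) = x u" using u'(1) u(1) ne
          by (intro place_add_dominant(2)[OF xp]) (auto simp: pw_def)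
        then show ?thesis using xu by (simp add: add.commute)
      qed
    qed
    then show ?thesis using z vz by (intro exI[of _ ?z]) auto
  qed
qed

text \<open>If \<open>u\<close> has a zero at \<open>v\<close> and poles at the other places, then \<open>1/(1 + u\<^sup>r)\<close> is close to \<open>1\<close>
  at \<open>v\<close> and close to \<open>0\<close> at the others.\<close>

lemma place_idempotent:
  assumes S: "finite S" "S \<subseteq> places \<iota>" "v \<in> S" and N: "0 \<le> N"
  shows "\<exists>z. z - 1 \<in> pw v N \<and> (\<forall>w\<in>S - {v}. z \<in> pw w N)"
proof -
  have v: "v \<in> places \<iota>" using S by blast
  obtain u where u: "u \<noteq> 0" "0 < v u" "\<forall>w\<in>S - {v}. w u < 0"
    using place_separate[OF v, of "S - {v}"] S by blast
  define r where "r = Suc (nat N)"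
  have r: "N < int r" "0 < int r" using N by (auto simp: r_def)
  let ?z = "1 / (1 + u ^ r)"
  have "int r * 1 \<le> int r * v u" using u(2) r by (intro mult_left_mono) auto
  then have "N < int r * v u" using r by linarith
  then have vu: "N < v (u ^ r)" by (simp only: place_power[OF v])
  then have d: "1 + u ^ r \<noteq> 0" "v (1 + u ^ r) = 0"
    using place_add_dominant[OF v, of 1 "u ^ r"] N by (auto simp: pw_def place_one[OF v])
  have "?z - 1 = - (u ^ r / (1 + u ^ r))" using d(1) by (simp add: field_simps)
  then have "?z - 1 \<in> pw v N"
    using d u(1) vu by (simp add: pw_def place_uminus[OF v] place_divide[OF v])
  moreover have "?z \<in> pw w N" if "w \<in> S - {v}" for w
  proof -
    have w: "w \<in> places \<iota>" and wu: "w u < 0" using that S u by auto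
    have "int r * w u \<le> int r * (- 1)" using wu by (intro mult_left_mono) auto
    then have "int r * w u < - N" using r by linarith
    then have lt: "w (u ^ r) < - N" by (simp only: place_power[OF w])
    then have "w (u ^ r + 1) = w (u ^ r)"
      using u(1) N by (intro place_add_dominant(2)[OF w]) (auto simp: pw_def place_one[OF w])
    then have "w (1 + u ^ r) < - N" using lt by (simp add: add.commute)
    then show ?thesis using d(1) by (simp add: pw_def place_divide[OF w] place_one[OF w])
  qed
  ultimately show ?thesis by blast
qed

text \<open>The targets are combined linearly with approximate idempotents. The precision \<open>B + M\<close> makes
  up for the poles of the targets, of order at most \<open>B\<close>.\<close>

lemma weak_approximation:
  fixes c :: "'k::field place \<Rightarrow> 'k" and N :: "'k place \<Rightarrow> int"
  assumes S: "finite S" "S \<subseteq> places \<iota>"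
  shows "\<exists>z. \<forall>v\<in>S. z - c v \<in> pw v (N v)"
proof -
  define B where "B = (\<Sum>v\<in>S. \<Sum>w\<in>S. \<bar>w (c v)\<bar>)"
  define M where "M = (\<Sum>v\<in>S. \<bar>N v\<bar>)"
  have B: "- B \<le> w (c v)" if "v \<in> S" "w \<in> S" for v w
  proof -
    have "\<bar>w (c v)\<bar> \<le> (\<Sum>w\<in>S. \<bar>w (c v)\<bar>)"
      using member_le_sum[of w S "\<lambda>w. \<bar>w (c v)\<bar>"] that S by simp
    also have "\<dots> \<le> B"
      unfolding B_def using member_le_sum[of v S "\<lambda>v. \<Sum>w\<in>S. \<bar>w (c v)\<bar>"] that S
      by (simp add: sum_nonneg)
    finally show ?thesis by linarith
  qed
  have M: "N v \<le> M" if "v \<in> S" for v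
    using member_le_sum[of v S "\<lambda>v. \<bar>N v\<bar>"] that S unfolding M_def by fastforce
  have "0 \<le> B + M" unfolding B_def M_def by (intro add_nonneg_nonneg sum_nonneg) auto
  then have "\<forall>v\<in>S. \<exists>z. z - 1 \<in> pw v (B + M) \<and> (\<forall>w\<in>S - {v}. z \<in> pw w (B + M))"
    using place_idempotent[OF S] by blast
  then obtain e where e: "\<forall>v\<in>S. e v - 1 \<in> pw v (B + M) \<and> (\<forall>w\<in>S - {v}. e v \<in> pw w (B + M))"
    by (rule bchoice[THEN exE])
  have "(\<Sum>v\<in>S. c v * e v) - c w \<in> pw w (N w)" if w: "w \<in> S" for w
  proof -
    have wp: "w \<in> places \<iota>" using w S by blast
    have m: "c v * z \<in> pw w M" if "v \<in> S" "z \<in> pw w (B + M)" for v z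
    proof -
      have "c v \<in> pw w (- B)" using B[OF that(1) w] by (simp add: pw_def)
      then show ?thesis using pw_mult[OF wp _ that(2), of "c v" "- B"] by simp
    qed
    have "(\<Sum>v\<in>S. c v * e v) = c w * e w + (\<Sum>v\<in>S - {w}. c v * e v)"
      using S w by (intro sum.remove) auto
    then have "(\<Sum>v\<in>S. c v * e v) - c w = c w * (e w - 1) + (\<Sum>v\<in>S - {w}. c v * e v)"
      by (simp add: algebra_simps)
    also have "\<dots> \<in> pw w M"
      using w e by (intro pw_add[OF wp] pw_sum[OF wp] m) auto
    finally show ?thesis using M[OF w] pw_mono[OF wp] by blast
  qed
  then show ?thesis by blast
qed

lemma vector_space_const_scale: "field_embedding \<iota> \<Longrightarrow> vector_space (const_scale \<iota>)"
  by unfold_locales (auto simp: field_embedding_def const_scale_def algebra_simps)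

section \<open>Extension of places\<close>

definition ring_set :: "'k::field set \<Rightarrow> bool" where
  "ring_set A \<longleftrightarrow> 1 \<in> A \<and> subgrp A \<and> (\<forall>a\<in>A. \<forall>b\<in>A. a * b \<in> A)"

definition adjoin :: "'k::field set \<Rightarrow> 'k \<Rightarrow> 'k set" where
  "adjoin A z = {poly p z | p. \<forall>i. coeff p i \<in> A}"

context
  fixes A :: "'k::field set"
  assumes A: "ring_set A"
begin

lemma ring_one: "1 \<in> A" and ring_zero: "0 \<in> A"
  and ring_mult: "a \<in> A \<Longrightarrow> b \<in> A \<Longrightarrow> a * b \<in> A"
  and ring_add: "a \<in> A \<Longrightarrow> b \<in> A \<Longrightarrow> a + b \<in> A"
  and ring_diff: "a \<in> A \<Longrightarrow> b \<in> A \<Longrightarrow> a - b \<in> A"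
  and ring_uminus: "a \<in> A \<Longrightarrow> - a \<in> A"
  using A by (simp_all add: ring_set_def subgrp_zero subgrp_add subgrp_diff subgrp_uminus)

lemma ring_power: "a \<in> A \<Longrightarrow> a ^ k \<in> A"
  by (induction k) (auto simp: ring_one ring_mult)

lemma ring_sum: "(\<And>i. i \<in> I \<Longrightarrow> g i \<in> A) \<Longrightarrow> sum g I \<in> A"
  by (induction I rule: infinite_finite_induct) (auto simp: ring_zero ring_add)

lemma ring_set_adjoin: "ring_set (adjoin A z)"
  unfolding ring_set_def subgrp_def
proof (intro conjI ballI)
  show "1 \<in> adjoin A z" unfolding adjoin_def
    by (rule CollectI, rule exI[of _ 1]) (auto simp: coeff_1 ring_one ring_zero)
  show "0 \<in> adjoin A z" unfolding adjoin_def
    by (rule CollectI, rule exI[of _ 0]) (auto simp: ring_zero)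
  fix a b assume "a \<in> adjoin A z" "b \<in> adjoin A z"
  then obtain p q where pq: "a = poly p z" "b = poly q z" "\<And>i. coeff p i \<in> A" "\<And>i. coeff q i \<in> A"
    by (auto simp: adjoin_def)
  show "a - b \<in> adjoin A z" unfolding adjoin_def
    by (rule CollectI, rule exI[of _ "p - q"]) (use pq in \<open>auto intro: ring_diff\<close>)
  show "a * b \<in> adjoin A z" unfolding adjoin_def
    by (rule CollectI, rule exI[of _ "p * q"])
       (use pq in \<open>auto simp: coeff_mult intro!: ring_sum ring_mult\<close>)
qed

lemma subset_adjoin: "A \<subseteq> adjoin A z"
proof
  fix a assume "a \<in> A"
  then show "a \<in> adjoin A z" unfolding adjoin_def
    by (intro CollectI exI[of _ "[:a:]"]) (auto simp: coeff_pCons ring_zero split: nat.split)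
qed

lemma generator_in_adjoin: "z \<in> adjoin A z"
  unfolding adjoin_def
  by (intro CollectI exI[of _ "[:0, 1:]"]) (auto simp: coeff_pCons ring_zero ring_one split: nat.split)

end

text \<open>A subring that is maximal among those not containing the inverse of \<open>\<pi>\<close> is a valuation
  ring.\<close>

locale maximal_ring =
  fixes V :: "'k::field set" and \<pi> :: 'k
  assumes ring: "ring_set V" and pi: "\<pi> \<in> V" "\<pi> \<noteq> 0" "inverse \<pi> \<notin> V"
    and maximal: "\<And>B. ring_set B \<Longrightarrow> V \<subseteq> B \<Longrightarrow> inverse \<pi> \<notin> B \<Longrightarrow> B = V"
begin

lemma pi_not_unit: "a \<in> V \<Longrightarrow> \<pi> * a \<noteq> 1"
  using pi by (metis inverse_unique)

text \<open>A relation of length \<open>k\<close> shows that \<open>\<pi>\<close> is invertible in \<open>V[z]\<close>. By maximality, every \<open>z\<close>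
  outside \<open>V\<close> has one.\<close>

definition relation :: "'k \<Rightarrow> nat \<Rightarrow> bool" where
  "relation z k \<longleftrightarrow> (\<exists>c. (\<forall>i. c i \<in> V) \<and> 1 = \<pi> * (\<Sum>i<k. c i * z ^ i))"

lemma ex_relation:
  assumes "z \<notin> V"
  shows "\<exists>k. relation z k"
proof -
  have "adjoin V z \<noteq> V" using generator_in_adjoin[OF ring] assms by blast
  then have "inverse \<pi> \<in> adjoin V z"
    using maximal[OF ring_set_adjoin[OF ring] subset_adjoin[OF ring]] by blast
  then obtain p where p: "inverse \<pi> = poly p z" "\<forall>i. coeff p i \<in> V" by (auto simp: adjoin_def)
  have "1 = \<pi> * poly p z" using pi(2) by (simp flip: p(1))
  then have "1 = \<pi> * (\<Sum>i<Suc (degree p). coeff p i * z ^ i)"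
    by (simp only: poly_altdef lessThan_Suc_atMost)
  then show ?thesis using p(2) unfolding relation_def by blast
qed

text \<open>Otherwise the inverse of \<open>u = 1 + \<pi> a\<close> would have a relation. Multiplied by \<open>u\<^sup>k\<close>, it would
  show that \<open>u\<^sup>k\<close>, which is congruent to \<open>1\<close> modulo \<open>\<pi> V\<close>, lies in \<open>\<pi> V\<close>.\<close>

lemma inverse_one_plus:
  assumes a: "a \<in> V"
  shows "1 + \<pi> * a \<noteq> 0" "inverse (1 + \<pi> * a) \<in> V"
proof -
  let ?u = "1 + \<pi> * a"
  show ne: "?u \<noteq> 0"
  proof
    assume "?u = 0"
    then have "\<pi> * (- a) = 1" by algebra
    then show False using pi_not_unit[of "- a"] a by (simp add: ring_uminus[OF ring])
  qed
  have uV: "?u \<in> V" using a pi(1) by (intro ring_add[OF ring] ring_mult[OF ring] ring_one[OF ring])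
  have pow: "\<exists>a'\<in>V. ?u ^ k = 1 + \<pi> * a'" for k
  proof (induction k)
    case 0 show ?case by (intro bexI[of _ 0]) (auto simp: ring_zero[OF ring])
  next
    case (Suc k)
    then obtain a' where a': "a' \<in> V" "?u ^ k = 1 + \<pi> * a'" by blast
    have "?u ^ Suc k = 1 + \<pi> * (a' + a + \<pi> * a' * a)"
      by (simp add: a'(2) algebra_simps)
    then show ?case using a a'(1) pi(1)
      by (intro bexI[of _ "a' + a + \<pi> * a' * a"] ring_add[OF ring] ring_mult[OF ring])
  qed
  show "inverse ?u \<in> V"
  proof (rule ccontr)
    assume "inverse ?u \<notin> V"
    then obtain k c where c: "\<forall>i. c i \<in> V" "1 = \<pi> * (\<Sum>i<k. c i * inverse ?u ^ i)"
      using ex_relation unfolding relation_def by blast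
    have "?u ^ k = \<pi> * (\<Sum>i<k. c i * inverse ?u ^ i) * ?u ^ k" by (simp only: c(2)[symmetric] mult_1)
    also have "\<dots> = \<pi> * (\<Sum>i<k. c i * inverse ?u ^ i * ?u ^ k)"
      by (simp only: mult.assoc sum_distrib_right)
    also have "(\<Sum>i<k. c i * inverse ?u ^ i * ?u ^ k) = (\<Sum>i<k. c i * ?u ^ (k - i))"
    proof (rule sum.cong[OF refl])
      fix i assume "i \<in> {..<k}"
      then have A: "?u ^ k = ?u ^ i * ?u ^ (k - i)" by (simp flip: power_add)
      have B: "inverse ?u ^ i * ?u ^ i = 1" using ne by (simp flip: power_mult_distrib)
      have "c i * inverse ?u ^ i * ?u ^ k = c i * (inverse ?u ^ i * ?u ^ i) * ?u ^ (k - i)"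
        by (simp only: A mult.assoc)
      then show "c i * inverse ?u ^ i * ?u ^ k = c i * ?u ^ (k - i)"
        by (simp only: B mult_1_right)
    qed
    finally have eq: "?u ^ k = \<pi> * (\<Sum>i<k. c i * ?u ^ (k - i))" .
    obtain a' where a': "a' \<in> V" "?u ^ k = 1 + \<pi> * a'" using pow by blast
    have "\<pi> * ((\<Sum>i<k. c i * ?u ^ (k - i)) - a') = 1"
      by (simp only: right_diff_distrib eq[symmetric]) (simp add: a'(2))
    moreover have "(\<Sum>i<k. c i * ?u ^ (k - i)) - a' \<in> V"
      using c(1) uV a'(1) by (intro ring_diff[OF ring] ring_sum[OF ring] ring_mult[OF ring] ring_power[OF ring]) auto
    ultimately show False using pi_not_unit by blast
  qed
qed

text \<open>The leading term of a relation for \<open>z\<close> is removed with a relation for \<open>1/z\<close> that is not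
  longer.\<close>

lemma shorten_relation:
  assumes z: "z \<noteq> 0" and r: "relation z (Suc r)" and s: "relation (inverse z) (Suc s)" and le: "s \<le> r"
  shows "relation z r"
proof -
  obtain c where c: "\<forall>i. c i \<in> V" "1 = \<pi> * (\<Sum>i<Suc r. c i * z ^ i)"
    using r unfolding relation_def by blast
  obtain d where d: "\<forall>i. d i \<in> V" "1 = \<pi> * (\<Sum>i<Suc s. d i * inverse z ^ i)"
    using s unfolding relation_def by blast
  define e where "e = inverse (1 + \<pi> * (- d 0))"
  have e: "e \<in> V" "e * (1 - \<pi> * d 0) = 1"
    using inverse_one_plus[of "- d 0"] d(1) by (auto simp: e_def ring_uminus[OF ring])
  have "1 = \<pi> * (d 0 + (\<Sum>j<s. d (Suc j) * inverse z ^ Suc j))"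
    by (subst d(2)) (simp only: sum.lessThan_Suc_shift power_0 mult_1_right)
  then have "1 - \<pi> * d 0 = \<pi> * (\<Sum>j<s. d (Suc j) * inverse z ^ Suc j)"
    by algebra
  then have "1 = e * \<pi> * (\<Sum>j<s. d (Suc j) * inverse z ^ Suc j)"
    using e(2) by (simp add: mult.assoc)
  then have "z ^ r = e * \<pi> * (\<Sum>j<s. d (Suc j) * inverse z ^ Suc j) * z ^ r" by simp
  also have "\<dots> = (\<Sum>j<s. e * \<pi> * d (Suc j) * (inverse z ^ Suc j * z ^ r))"
    by (simp only: sum_distrib_left sum_distrib_right mult.assoc)
  also have "\<dots> = (\<Sum>j<s. e * \<pi> * d (Suc j) * z ^ (r - Suc j))"
  proof (rule sum.cong[OF refl])
    fix j assume "j \<in> {..<s}"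
    then have "Suc j + (r - Suc j) = r" using le by simp
    then have A: "z ^ r = z ^ Suc j * z ^ (r - Suc j)" by (metis power_add)
    have B: "inverse z ^ Suc j * z ^ Suc j = 1"
      using z by (simp only: power_mult_distrib[symmetric]) simp
    have "inverse z ^ Suc j * z ^ r = (inverse z ^ Suc j * z ^ Suc j) * z ^ (r - Suc j)"
      by (simp only: A mult.assoc)
    then show "e * \<pi> * d (Suc j) * (inverse z ^ Suc j * z ^ r) = e * \<pi> * d (Suc j) * z ^ (r - Suc j)"
      by (simp only: B mult_1)
  qed
  also have "\<dots> = (\<Sum>i\<in>{i\<in>{..<r}. r \<le> i + s}. e * \<pi> * d (r - i) * z ^ i)"
    by (rule sum.reindex_bij_witness[of _ "\<lambda>i. r - Suc i" "\<lambda>j. r - Suc j"]) (use le in \<open>auto simp: Suc_diff_Suc\<close>)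
  also have "\<dots> = (\<Sum>i<r. if r \<le> i + s then e * \<pi> * d (r - i) * z ^ i else 0)"
    by (subst sum.inter_filter) auto
  finally have zr: "z ^ r = (\<Sum>i<r. if r \<le> i + s then e * \<pi> * d (r - i) * z ^ i else 0)" .
  define c' where "c' i = c i + (if r \<le> i + s then c r * (e * \<pi> * d (r - i)) else 0)" for i
  have "(\<Sum>i<Suc r. c i * z ^ i) = (\<Sum>i<r. c i * z ^ i) + c r * z ^ r" by simp
  also have "\<dots> = (\<Sum>i<r. c i * z ^ i) + (\<Sum>i<r. c r * (if r \<le> i + s then e * \<pi> * d (r - i) * z ^ i else 0))"
    by (simp only: zr sum_distrib_left)
  also have "\<dots> = (\<Sum>i<r. c' i * z ^ i)"
    unfolding sum.distrib[symmetric] by (intro sum.cong) (auto simp: c'_def algebra_simps)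
  finally have "1 = \<pi> * (\<Sum>i<r. c' i * z ^ i)" using c(2) by simp
  moreover have "\<forall>i. c' i \<in> V"
    using c(1) d(1) e(1) pi(1) by (auto simp: c'_def intro!: ring_add[OF ring] ring_mult[OF ring])
  ultimately show ?thesis unfolding relation_def by blast
qed

text \<open>If both \<open>z\<close> and \<open>1/z\<close> were outside \<open>V\<close>, the longer of their shortest relations could be
  shortened.\<close>

lemma valuation_ring_dichotomy:
  assumes z: "z \<noteq> 0"
  shows "z \<in> V \<or> inverse z \<in> V"
proof (rule ccontr)
  assume "\<not> ?thesis"
  then have ex: "\<exists>k. relation z k" "\<exists>k. relation (inverse z) k" using ex_relation by blast+
  define r where "r = (LEAST k. relation z k)"
  define s where "s = (LEAST k. relation (inverse z) k)"
  have rs: "relation z r" "relation (inverse z) s" using ex by (auto simp: r_def s_def intro: LeastI_ex)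
  have "\<not> relation w 0" for w by (simp add: relation_def)
  then obtain r' s' where Suc: "r = Suc r'" "s = Suc s'" using rs by (metis not0_implies_Suc)
  show False
  proof (cases "s' \<le> r'")
    case True
    then have "relation z r'" using shorten_relation[OF z] rs Suc by blast
    then have "r \<le> r'" unfolding r_def by (rule Least_le)
    then show False using Suc by simp
  next
    case False
    then have "relation (inverse z) s'"
      using shorten_relation[of "inverse z" s' r'] z rs Suc by simp
    then have "s \<le> s'" unfolding s_def by (rule Least_le)
    then show False using Suc by simp
  qed
qed

text \<open>The units of \<open>V\<close>. Two elements whose quotient is a unit have the same value with respect to
  \<open>V\<close>.\<close>

definition vunit :: "'k \<Rightarrow> bool" where
  "vunit z \<longleftrightarrow> z \<noteq> 0 \<and> z \<in> V \<and> inverse z \<in> V"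

lemma vunit_one: "vunit 1"
  by (simp add: vunit_def ring_one[OF ring])

lemma vunit_mult: "vunit z \<Longrightarrow> vunit w \<Longrightarrow> vunit (z * w)"
  by (simp add: vunit_def ring_mult[OF ring])

lemma vunit_inverse: "vunit z \<Longrightarrow> vunit (inverse z)"
  by (simp add: vunit_def)

lemma vunit_divide: "vunit z \<Longrightarrow> vunit w \<Longrightarrow> vunit (z / w)"
  by (simp add: divide_inverse vunit_mult vunit_inverse)

lemma vunit_power: "vunit z \<Longrightarrow> vunit (z ^ k)"
  by (induction k) (auto simp: vunit_one vunit_mult)

lemma vunit_plus_nonunit:
  assumes u: "vunit u" and a: "a \<in> V" "\<not> vunit a"
  shows "vunit (u + a)"
proof (cases "a = 0")
  case True then show ?thesis using u by simp
next
  case False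
  have ia: "inverse a \<notin> V" using a False by (simp add: vunit_def)
  have uV: "u \<in> V" "inverse u \<in> V" "u \<noteq> 0" using u by (auto simp: vunit_def)
  have bV: "u + a \<in> V" using uV a by (intro ring_add[OF ring])
  have b0: "u + a \<noteq> 0"
  proof
    assume "u + a = 0"
    then have "a = - u" by (simp add: eq_neg_iff_add_eq_0 add.commute)
    then have "inverse a = - inverse u" by simp
    then show False using ia uV ring_uminus[OF ring] by metis
  qed
  consider "a / (u + a) \<in> V" | "(u + a) / a \<in> V"
    using valuation_ring_dichotomy[of "a / (u + a)"] False b0 by auto
  then have "inverse (u + a) \<in> V"
  proof cases
    case 1
    have "inverse (u + a) = (1 - a / (u + a)) * inverse u" using uV b0 by (simp add: field_simps)
    then show ?thesis using 1 uV by (metis ring ring_diff ring_mult ring_one)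
  next
    case 2
    have "inverse a = ((u + a) / a - 1) * inverse u" using uV False by (simp add: field_simps)
    then have "inverse a \<in> V" using 2 uV by (metis ring ring_diff ring_mult ring_one)
    then show ?thesis using ia by blast
  qed
  then show ?thesis using b0 bV by (simp add: vunit_def)
qed

text \<open>Terms with pairwise different values do not cancel: one of them has the value of the sum.\<close>

lemma sum_without_ties:
  assumes "finite I" "I \<noteq> {}" "\<And>i. i \<in> I \<Longrightarrow> g i \<noteq> 0"
    and "\<And>i j. i \<in> I \<Longrightarrow> j \<in> I \<Longrightarrow> i \<noteq> j \<Longrightarrow> \<not> vunit (g i / g j)"
  shows "\<exists>i\<in>I. vunit (sum g I / g i)"
  using assms
proof (induction I rule: finite_ne_induct)
  case (singleton i)
  then show ?case by (simp add: vunit_one)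
next
  case (insert k I)
  then obtain i where i: "i \<in> I" "vunit (sum g I / g i)" by blast
  have ki: "k \<noteq> i" using i insert.hyps by blast
  have ne: "g k \<noteq> 0" "g i \<noteq> 0" using insert.prems(1) i by auto
  let ?q = "g k / g i" and ?u = "sum g I / g i"
  have nu: "\<not> vunit ?q" using insert.prems(2)[of k i] i ki by simp
  have sum: "sum g (insert k I) = g k + sum g I" using insert.hyps by simp
  show ?case
  proof (cases "?q \<in> V")
    case True
    have "vunit (?u + ?q)" by (rule vunit_plus_nonunit[OF i(2) True nu])
    moreover have "sum g (insert k I) / g i = ?u + ?q" unfolding sum by (simp add: add_divide_distrib)
    ultimately have "vunit (sum g (insert k I) / g i)" by (simp only:)
    then show ?thesis using i(1) by blast
  next
    case False
    then have qV: "inverse ?q \<in> V" using valuation_ring_dichotomy[of ?q] ne by auto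
    have uV: "?u \<in> V" "inverse ?u \<in> V" "?u \<noteq> 0" using i(2) unfolding vunit_def by blast+
    have "\<not> vunit (?u * inverse ?q)"
    proof
      assume "vunit (?u * inverse ?q)"
      then have "vunit (inverse ?q)" using vunit_mult[OF vunit_inverse[OF i(2)], of "?u * inverse ?q"] uV(3) by simp
      then show False using nu vunit_inverse by fastforce
    qed
    then have "vunit (1 + ?u * inverse ?q)"
      using vunit_plus_nonunit[OF vunit_one] ring_mult[OF ring uV(1) qV] by blast
    moreover have "sum g (insert k I) / g k = 1 + ?u * inverse ?q"
      unfolding sum using ne by (simp add: add_divide_distrib)
    ultimately show ?thesis by auto
  qed
qed

lemma zero_sum_tie:
  assumes "finite I" "sum g I = 0" "i \<in> I" "g i \<noteq> 0"
  shows "\<exists>i\<in>I. \<exists>j\<in>I. i \<noteq> j \<and> g i \<noteq> 0 \<and> g j \<noteq> 0 \<and> vunit (g i / g j)"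
proof (rule ccontr)
  assume neg: "\<not> ?thesis"
  let ?J = "{i\<in>I. g i \<noteq> 0}"
  have "\<exists>i\<in>?J. vunit (sum g ?J / g i)"
  proof (rule sum_without_ties)
    show "?J \<noteq> {}" using assms by blast
    show "\<not> vunit (g i / g j)" if "i \<in> ?J" "j \<in> ?J" "i \<noteq> j" for i j using neg that by blast
  qed (use assms(1) in auto)
  moreover have "sum g ?J = 0" using assms(1,2) by (subst sum.mono_neutral_left[of I]) auto
  ultimately show False by (auto simp: vunit_def)
qed

lemma vunit_pi_power: "vunit (\<pi> powi k) \<Longrightarrow> k = 0"
proof (rule ccontr)
  assume u: "vunit (\<pi> powi k)" and k: "k \<noteq> 0"
  have False if "vunit (\<pi> ^ Suc m)" for m
  proof -
    have "inverse (\<pi> ^ Suc m) * \<pi> ^ m \<in> V"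
      using that pi(1) by (intro ring_mult[OF ring] ring_power[OF ring]) (auto simp: vunit_def)
    moreover have "inverse (\<pi> ^ Suc m) * \<pi> ^ m = inverse \<pi>" using pi(2) by (simp add: field_simps)
    ultimately show False using pi(3) by metis
  qed
  moreover have "vunit (\<pi> ^ nat \<bar>k\<bar>)"
  proof (cases "0 \<le> k")
    case True then show ?thesis using u by (simp add: power_int_def)
  next
    case False
    then have "vunit (inverse (\<pi> powi k))" using u vunit_inverse by blast
    then show ?thesis using False by (simp add: power_int_def power_inverse)
  qed
  moreover obtain m where "nat \<bar>k\<bar> = Suc m" using k by (metis abs_eq_0 int_nat_eq not0_implies_Suc of_nat_0 abs_ge_zero)
  ultimately show False by metis
qed

text \<open>The normalised exponent of \<open>\<pi>\<close> in the \<open>N\<close>-th power of an element is the wanted valuation.\<close>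

lemma ex_place:
  fixes \<iota> :: "'a::field \<Rightarrow> 'k"
  assumes emb: "field_embedding \<iota>" and const: "\<And>a. \<iota> a \<in> V"
    and N: "0 < N" "\<And>z. z \<noteq> 0 \<Longrightarrow> \<exists>m. vunit (z ^ N * \<pi> powi m)"
  shows "\<exists>v\<in>places \<iota>. 0 < v \<pi> \<and> (\<forall>a\<in>V. 0 \<le> v a)"
proof -
  have "\<forall>z. \<exists>m. z \<noteq> 0 \<longrightarrow> vunit (z ^ N * \<pi> powi (- m))"
  proof
    fix z show "\<exists>m. z \<noteq> 0 \<longrightarrow> vunit (z ^ N * \<pi> powi (- m))"
    proof (cases "z = 0")
      case False
      then obtain m where "vunit (z ^ N * \<pi> powi m)" using N(2) by blast
      then show ?thesis by (intro exI[of _ "- m"]) simp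
    qed simp
  qed
  then obtain W where W: "\<And>z. z \<noteq> 0 \<Longrightarrow> vunit (z ^ N * \<pi> powi (- W z))" by metis
  have uniq: "m = W z" if "z \<noteq> 0" "vunit (z ^ N * \<pi> powi (- m))" for z m
  proof -
    have "vunit ((z ^ N * \<pi> powi (- m)) / (z ^ N * \<pi> powi (- W z)))"
      using that W by (intro vunit_divide) auto
    also have "(z ^ N * \<pi> powi (- m)) / (z ^ N * \<pi> powi (- W z)) = \<pi> powi (W z - m)"
      using that(1) pi(2) by (simp add: power_int_diff power_int_minus field_simps)
    finally show ?thesis using vunit_pi_power by fastforce
  qed
  have Wmult: "W (z * w) = W z + W w" if "z \<noteq> 0" "w \<noteq> 0" for z w
  proof -
    have "vunit ((z ^ N * \<pi> powi (- W z)) * (w ^ N * \<pi> powi (- W w)))"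
      by (rule vunit_mult[OF W[OF that(1)] W[OF that(2)]])
    also have "(z ^ N * \<pi> powi (- W z)) * (w ^ N * \<pi> powi (- W w)) = (z * w) ^ N * \<pi> powi (- (W z + W w))"
      using pi(2) by (simp add: power_int_diff power_int_minus power_mult_distrib field_simps)
    finally show ?thesis using uniq[of "z * w" "W z + W w"] that by simp
  qed
  have W1: "W 1 = 0" using Wmult[of 1 1] by simp
  have Winv: "W (inverse z) = - W z" if "z \<noteq> 0" for z
    using Wmult[of z "inverse z"] that W1 by simp
  have Wpow: "W (z ^ k) = int k * W z" if "z \<noteq> 0" for z k
    using that by (induction k) (auto simp: W1 Wmult algebra_simps)
  have Wpowi: "W (z powi k) = k * W z" if "z \<noteq> 0" for z k
    using that by (simp add: power_int_def Wpow Winv)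
  have Wpi: "W \<pi> = int N"
  proof -
    have "vunit (\<pi> ^ N * \<pi> powi (- int N))"
      using pi(2) by (simp add: power_int_minus vunit_one)
    then show ?thesis using uniq[of \<pi> "int N"] pi(2) by simp
  qed
  have Wpos: "0 \<le> W z" if z: "z \<in> V" "z \<noteq> 0" for z
  proof (rule ccontr)
    assume neg: "\<not> ?thesis"
    define k where "k = nat (- W z - 1)"
    have k: "- W z = int (Suc k)" using neg by (simp add: k_def)
    have u: "vunit (z ^ N * \<pi> ^ Suc k)" using W[OF z(2)] unfolding k by (simp only: power_int_of_nat)
    have "inverse (z ^ N * \<pi> ^ Suc k) * (z ^ N * \<pi> ^ k) \<in> V"
      using u z pi(1) by (intro ring_mult[OF ring] ring_power[OF ring]) (auto simp: vunit_def)
    moreover have "inverse (z ^ N * \<pi> ^ Suc k) * (z ^ N * \<pi> ^ k) = inverse \<pi>"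
      using pi(2) z(2) by (simp add: field_simps)
    ultimately show False using pi(3) by metis
  qed
  have Wneg: "z \<in> V" if z: "z \<noteq> 0" "0 \<le> W z" for z
  proof (rule ccontr)
    assume zV: "z \<notin> V"
    then have iV: "inverse z \<in> V" using valuation_ring_dichotomy[OF z(1)] by blast
    then have "W z = 0" using Wpos[OF iV] z Winv[OF z(1)] by simp
    then have "vunit (z ^ N)" using W[OF z(1)] by simp
    then have "z ^ N * inverse z ^ (N - 1) \<in> V"
      by (intro ring_mult[OF ring _ ring_power[OF ring iV]]) (simp add: vunit_def)
    moreover have "z ^ N * inverse z ^ (N - 1) = z"
    proof -
      have "z ^ N = z * z ^ (N - 1)" using N(1) by (metis Suc_diff_1 power_Suc)
      then show ?thesis using z(1) by (simp add: power_inverse)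
    qed
    ultimately show False using zV by simp
  qed
  have Wadd: "min (W z) (W w) \<le> W (z + w)" if zw: "z \<noteq> 0" "w \<noteq> 0" "z + w \<noteq> 0" for z w
  proof -
    have main: "W z \<le> W (z + w)" if zw: "z \<noteq> 0" "w \<noteq> 0" "z + w \<noteq> 0" "W z \<le> W w" for z w
    proof -
      have "0 \<le> W (w / z)" using zw by (simp add: divide_inverse Wmult Winv)
      then have "w / z \<in> V" using zw by (intro Wneg) auto
      then have "1 + w / z \<in> V" by (intro ring_add[OF ring] ring_one[OF ring])
      moreover have eq: "z + w = z * (1 + w / z)" using zw by (simp add: field_simps)
      moreover have ne: "1 + w / z \<noteq> 0" using eq zw by auto
      ultimately have "0 \<le> W (1 + w / z)" by (intro Wpos)
      then show ?thesis using eq ne zw by (simp add: Wmult)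
    qed
    show ?thesis
      using main[of z w] main[of w z] zw by (cases "W z \<le> W w") (auto simp: add.commute)
  qed
  \<comment> \<open>The positive generator of the value group.\<close>
  define d where "d = (LEAST k. 0 < k \<and> (\<exists>t. t \<noteq> 0 \<and> W t = int k))"
  have "\<exists>k. 0 < k \<and> (\<exists>t. t \<noteq> 0 \<and> W t = int k)" using N(1) Wpi pi(2) by blast
  then have "0 < d \<and> (\<exists>t. t \<noteq> 0 \<and> W t = int d)" unfolding d_def by (rule LeastI_ex)
  then have d: "0 < d" "\<exists>t. t \<noteq> 0 \<and> W t = int d" by simp_all
  then obtain t where t: "t \<noteq> 0" "W t = int d" by blast
  have dvd: "int d dvd W z" if z: "z \<noteq> 0" for z
  proof (rule ccontr)
    assume "\<not> ?thesis"
    then have "W z mod int d \<noteq> 0" by (simp add: dvd_eq_mod_eq_0)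
    moreover have "0 \<le> W z mod int d" "W z mod int d < int d" using d(1) by simp_all
    ultimately have m: "0 < W z mod int d" "W z mod int d < int d" by linarith+
    let ?s = "z * t powi (- (W z div int d))"
    have "W ?s = W z mod int d"
      using z t by (simp add: Wmult Wpowi minus_div_mult_eq_mod[symmetric] algebra_simps)
    moreover have "?s \<noteq> 0" using z t by simp
    ultimately have "0 < nat (W z mod int d) \<and> (\<exists>t. t \<noteq> 0 \<and> W t = int (nat (W z mod int d)))"
      using m by (intro conjI exI[of _ ?s]) simp_all
    then have "d \<le> nat (W z mod int d)" unfolding d_def by (rule Least_le)
    then show False using m by linarith
  qed
  define v where "v z = (if z = 0 then 0 else W z div int d)" for z
  have eq: "W z = v z * int d" if "z \<noteq> 0" for z using dvd[OF that] that by (simp add: v_def)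
  have le_iff: "v z \<le> v w \<longleftrightarrow> W z \<le> W w" if "z \<noteq> 0" "w \<noteq> 0" for z w
    using eq that d(1) by simp
  have "v \<in> places \<iota>"
    unfolding places_def
  proof (intro CollectI conjI allI impI)
    show "v 0 = 0" by (simp add: v_def)
  next
    fix z w :: 'k assume zw: "z \<noteq> 0" "w \<noteq> 0"
    then have "v (z * w) * int d = (v z + v w) * int d"
      using eq[of "z * w"] eq[of z] eq[of w] Wmult[of z w] by (simp add: algebra_simps)
    then show "v (z * w) = v z + v w" using d(1) by simp
  next
    fix z w :: 'k assume zw: "z \<noteq> 0" "w \<noteq> 0" "z + w \<noteq> 0"
    then show "min (v z) (v w) \<le> v (z + w)"
      using Wadd[OF zw] le_iff[of z "z + w"] le_iff[of w "z + w"] by (auto simp: min_le_iff_disj)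
  next
    fix a :: 'a assume a: "a \<noteq> 0"
    have "\<iota> a * \<iota> (inverse a) = 1" using emb a unfolding field_embedding_def by (metis right_inverse)
    then have ne: "\<iota> a \<noteq> 0" and inv: "inverse (\<iota> a) = \<iota> (inverse a)"
      by (auto intro: inverse_unique)
    have "0 \<le> W (\<iota> a)" by (rule Wpos[OF const ne])
    moreover have "0 \<le> W (inverse (\<iota> a))" unfolding inv using const ne inv by (intro Wpos) auto
    ultimately have "W (\<iota> a) = 0" using Winv[OF ne] by simp
    then show "v (\<iota> a) = 0" by (simp add: v_def)
  next
    show "\<exists>t. v t = 1" using t d(1) by (intro exI[of _ t]) (simp add: v_def)
  qed
  moreover have "0 < v \<pi>" using eq[OF pi(2)] Wpi N(1) d(1) by (metis mult_pos_pos mult_nonpos_nonneg not_le of_nat_0_less_iff less_imp_le)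
  moreover have "0 \<le> v a" if "a \<in> V" for a
    using Wpos[OF that] d(1) by (cases "a = 0") (auto simp: v_def pos_imp_zdiv_nonneg_iff)
  ultimately show ?thesis by blast
qed

end

text \<open>Zorn's lemma gives a maximal ring \<open>V\<close> above \<open>A\<close> in which \<open>\<pi>\<close> is not invertible. Two terms of
  an algebraic equation for \<open>z\<close> have the same value with respect to \<open>V\<close>. Since the nonzero
  coefficients are powers of \<open>\<pi>\<close> up to units, so is \<open>z ^ (i - j)\<close> for some exponents with
  \<open>0 < i - j \<le> n\<close>, and so is \<open>z ^ fact n\<close>. The value group is therefore cyclic.\<close>

lemma place_extension:
  fixes \<iota> :: "'a::field \<Rightarrow> 'k::field"
  assumes emb: "field_embedding \<iota>" and A: "ring_set A" "range \<iota> \<subseteq> A"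
    and pi: "\<pi> \<in> A" "\<pi> \<noteq> 0" "inverse \<pi> \<notin> A"
    and alg: "\<And>z. z \<noteq> 0 \<Longrightarrow> \<exists>c. (\<forall>i\<le>n. c i \<in> R) \<and> (\<exists>i\<le>n. c i \<noteq> 0) \<and> (\<Sum>i\<le>n. c i * z ^ i) = 0"
    and R: "\<And>c. c \<in> R \<Longrightarrow> c \<noteq> 0 \<Longrightarrow> \<exists>m. c * \<pi> powi m \<in> A \<and> inverse (c * \<pi> powi m) \<in> A"
  shows "\<exists>v\<in>places \<iota>. 0 < v \<pi> \<and> (\<forall>a\<in>A. 0 \<le> v a)"
proof -
  let ?S = "{B. ring_set B \<and> A \<subseteq> B \<and> inverse \<pi> \<notin> B}"
  have "\<exists>M\<in>?S. \<forall>X\<in>?S. M \<subseteq> X \<longrightarrow> X = M"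
  proof (rule subset_Zorn_nonempty)
    show "?S \<noteq> {}" using A(1) pi(3) by blast
    fix C assume C: "C \<noteq> {}" "subset.chain ?S C"
    then have CS: "B \<in> ?S" if "B \<in> C" for B using that by (auto simp: subset.chain_def)
    have tot: "\<exists>B\<in>C. a \<in> B \<and> b \<in> B" if "a \<in> \<Union>C" "b \<in> \<Union>C" for a b
    proof -
      obtain X Y where XY: "X \<in> C" "a \<in> X" "Y \<in> C" "b \<in> Y" using \<open>a \<in> \<Union>C\<close> \<open>b \<in> \<Union>C\<close> by blast
      then have "X \<subseteq> Y \<or> Y \<subseteq> X" using C(2) by (auto simp: subset.chain_def)
      then show ?thesis using XY by blast
    qed
    obtain B0 where B0: "B0 \<in> C" using C(1) by blast
    have "ring_set (\<Union>C)"
      unfolding ring_set_def subgrp_def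
    proof (intro conjI ballI)
      show "1 \<in> \<Union>C" using B0 CS[OF B0] ring_one by blast
      show "0 \<in> \<Union>C" using B0 CS[OF B0] ring_zero by blast
      fix a b assume "a \<in> \<Union>C" "b \<in> \<Union>C"
      then obtain B where B: "B \<in> C" "a \<in> B" "b \<in> B" using tot by blast
      then have "ring_set B" using CS by blast
      then show "a - b \<in> \<Union>C" "a * b \<in> \<Union>C" using B ring_diff ring_mult by blast+
    qed
    moreover have "A \<subseteq> \<Union>C" using B0 CS[OF B0] by blast
    moreover have "inverse \<pi> \<notin> \<Union>C" using CS by blast
    ultimately show "\<Union>C \<in> ?S" by blast
  qed
  then obtain V where VS: "V \<in> ?S" and mx: "\<forall>X\<in>?S. V \<subseteq> X \<longrightarrow> X = V" by (elim bexE) (rule that)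
  have V: "ring_set V" "A \<subseteq> V" "inverse \<pi> \<notin> V" using VS by simp_all
  have max: "X = V" if "ring_set X" "V \<subseteq> X" "inverse \<pi> \<notin> X" for X
    using mx[rule_format, of X] that V(2) by simp
  interpret maximal_ring V \<pi>
    by unfold_locales (use V pi max in auto)
  have vunitR: "\<exists>m. vunit (c * \<pi> powi m)" if "c \<in> R" "c \<noteq> 0" for c
  proof -
    obtain m where "c * \<pi> powi m \<in> A" "inverse (c * \<pi> powi m) \<in> A" using R \<open>c \<in> R\<close> \<open>c \<noteq> 0\<close> by blast
    then have "vunit (c * \<pi> powi m)" unfolding vunit_def using V(2) \<open>c \<noteq> 0\<close> pi(2) by auto
    then show ?thesis ..
  qed
  have "\<exists>m. vunit (z ^ fact n * \<pi> powi m)" if z: "z \<noteq> 0" for z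
  proof -
    obtain c where c: "\<forall>i\<le>n. c i \<in> R" "\<exists>i\<le>n. c i \<noteq> 0" "(\<Sum>i\<le>n. c i * z ^ i) = 0"
      using alg[OF z] by blast
    obtain i0 where i0: "i0 \<in> {..n}" "c i0 * z ^ i0 \<noteq> 0" using c(2) z by auto
    obtain i j where ij: "i \<le> n" "j \<le> n" "i \<noteq> j" "c i \<noteq> 0" "c j \<noteq> 0" "vunit (c i * z ^ i / (c j * z ^ j))"
      using zero_sum_tie[OF finite_atMost c(3) i0] by auto
    \<comment> \<open>The exponent \<open>i - j\<close> divides \<open>fact n\<close>, which does not depend on \<open>z\<close>.\<close>
    have main: "\<exists>m. vunit (z ^ fact n * \<pi> powi m)"
      if ij: "j < i" "i \<le> n" "c i \<noteq> 0" "c j \<noteq> 0" "vunit (c i * z ^ i / (c j * z ^ j))" for i j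
    proof -
      obtain a b where ab: "vunit (c i * \<pi> powi a)" "vunit (c j * \<pi> powi b)"
        using vunitR[of "c i"] vunitR[of "c j"] c(1) ij by auto
      have "vunit (c i * z ^ i / (c j * z ^ j) * (c j * \<pi> powi b) / (c i * \<pi> powi a))"
        by (rule vunit_divide[OF vunit_mult[OF ij(5) ab(2)] ab(1)])
      also have "c i * z ^ i / (c j * z ^ j) * (c j * \<pi> powi b) / (c i * \<pi> powi a) = z ^ (i - j) * \<pi> powi (b - a)"
        using ij z pi(2) by (simp add: power_diff power_int_diff field_simps)
      finally have u: "vunit (z ^ (i - j) * \<pi> powi (b - a))" .
      have "i - j dvd fact n" using ij by (intro dvd_fact) auto
      then obtain k where k: "fact n = (i - j) * k" by blast
      have "vunit ((z ^ (i - j) * \<pi> powi (b - a)) ^ k)" by (rule vunit_power[OF u])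
      also have "(z ^ (i - j) * \<pi> powi (b - a)) ^ k = z ^ fact n * \<pi> powi ((b - a) * int k)"
        by (simp add: power_mult_distrib k power_mult power_int_mult)
      finally show ?thesis by blast
    qed
    show ?thesis
    proof (cases "j < i")
      case True then show ?thesis using main ij by blast
    next
      case False
      have "vunit (c j * z ^ j / (c i * z ^ i))" using vunit_inverse[OF ij(6)] by simp
      then show ?thesis using main[of i j] ij False by simp
    qed
  qed
  moreover have "\<iota> a \<in> V" for a using V(2) A(2) by (meson rangeI subsetD)
  ultimately have "\<exists>v\<in>places \<iota>. 0 < v \<pi> \<and> (\<forall>a\<in>V. 0 \<le> v a)"
    by (intro ex_place[OF emb, where N = "fact n"]) auto
  then show ?thesis using V(2) by blast
qed

section \<open>Polynomials over a field\<close>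

lemma ex_prime_divisor_poly:
  fixes h :: "'a::field poly"
  assumes "0 < degree h"
  shows "\<exists>p. prime_elem p \<and> p dvd h"
  using assms
proof (induction "degree h" arbitrary: h rule: less_induct)
  case less
  show ?case
  proof (cases "irreducible h")
    case True
    then have "prime_elem h" by (rule field_poly_irreducible_imp_prime)
    then show ?thesis by (intro exI[of _ h]) simp
  next
    case False
    have "h \<noteq> 0" using less.prems by auto
    then have "\<not> is_unit h" using less.prems is_unit_iff_degree[of h] by simp
    then obtain a b where ab: "h = a * b" "\<not> is_unit a" "\<not> is_unit b"
      using False \<open>h \<noteq> 0\<close> unfolding irreducible_def by blast
    then have ne: "a \<noteq> 0" "b \<noteq> 0" using \<open>h \<noteq> 0\<close> by auto
    then have deg: "0 < degree a" "0 < degree b"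
      using ab(2,3) is_unit_iff_degree[of a] is_unit_iff_degree[of b] by simp_all
    then have "degree a < degree h" using ab(1) ne by (simp add: degree_mult_eq)
    then obtain p where "prime_elem p" "p dvd a" using less.hyps deg by blast
    then show ?thesis using ab(1) by auto
  qed
qed

lemma prime_elem_degree: "prime_elem (p :: 'a::field poly) \<Longrightarrow> 0 < degree p"
  unfolding prime_elem_def using is_unit_iff_degree[of p] by simp

lemma prime_power_decomposition:
  fixes h :: "'a::field poly"
  assumes p: "prime_elem p" and "h \<noteq> 0"
  shows "\<exists>k h'. h = p ^ k * h' \<and> \<not> p dvd h'"
  using assms(2)
proof (induction "degree h" arbitrary: h rule: less_induct)
  case less
  show ?case
  proof (cases "p dvd h")
    case True
    then obtain g where g: "h = p * g" by blast
    have ne: "p \<noteq> 0" "g \<noteq> 0" using less.prems g by auto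
    then have "degree g < degree h" using prime_elem_degree[OF p] g by (simp add: degree_mult_eq)
    then obtain k h' where "g = p ^ k * h'" "\<not> p dvd h'" using less.hyps ne by blast
    then show ?thesis using g by (intro exI[of _ "Suc k"] exI[of _ h']) (simp add: mult.assoc)
  next
    case False
    then show ?thesis by (intro exI[of _ 0] exI[of _ h]) simp
  qed
qed

lemma finite_polys_degree_less: "finite {p :: 'a::{field,finite} poly. \<forall>i\<ge>k. coeff p i = 0}"
  and card_polys_degree_less: "card {p :: 'a::{field,finite} poly. \<forall>i\<ge>k. coeff p i = 0} = CARD('a) ^ k"
proof -
  let ?F = "{u::nat \<Rightarrow> 'a. \<forall>b. b \<notin> {..<k} \<longrightarrow> u b = 0}"
  have b: "bij_betw coeff {p :: 'a poly. \<forall>i\<ge>k. coeff p i = 0} ?F"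
  proof (rule bij_betwI')
    show "(coeff p = coeff q) = (p = q)" for p q :: "'a poly" by (simp add: coeff_inject)
    show "coeff p \<in> ?F" if "p \<in> {p. \<forall>i\<ge>k. coeff p i = 0}" for p using that by auto
    fix u assume u: "u \<in> ?F"
    then have "coeff (Abs_poly u) = u" by (intro coeff_Abs_poly[of k]) simp
    then show "\<exists>p\<in>{p. \<forall>i\<ge>k. coeff p i = 0}. u = coeff p"
      using u by (intro bexI[of _ "Abs_poly u"]) simp_all
  qed
  have F: "finite ?F" "card ?F = CARD('a) ^ k"
    using card_supported_functions[of "{..<k}", where 'a = 'a] by simp_all
  show "finite {p :: 'a poly. \<forall>i\<ge>k. coeff p i = 0}" using F(1) by (simp only: bij_betw_finite[OF b])
  show "card {p :: 'a poly. \<forall>i\<ge>k. coeff p i = 0} = CARD('a) ^ k"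
    using F(2) by (simp only: bij_betw_same_card[OF b])
qed

lemma monic_eq_prod_roots:
  fixes h :: "'f::field poly"
  assumes S: "finite S" and deg: "degree h = card S" and lc: "lead_coeff h = 1"
    and root: "\<And>a. a \<in> S \<Longrightarrow> poly h a = 0"
  shows "h = (\<Prod>a\<in>S. [:- a, 1:])"
proof (rule ccontr)
  let ?p = "\<Prod>a\<in>S. [:- a, 1:]"
  assume "h \<noteq> ?p"
  then have ne: "?p - h \<noteq> 0" by simp
  have dp: "degree ?p = card S" by (subst degree_prod_sum_eq) simp_all
  have lp: "lead_coeff ?p = 1" by (simp add: lead_coeff_prod)
  have "degree (?p - h) \<le> card S" using degree_diff_le[of ?p "card S" h] deg dp by simp
  moreover have "coeff (?p - h) (card S) = 0" using lp lc deg dp by simp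
  ultimately have lt: "degree (?p - h) < card S" using ne by (metis leading_coeff_0_iff le_neq_implies_less)
  have "poly (?p - h) a = 0" if a: "a \<in> S" for a
  proof -
    have "poly ?p a = 0" unfolding poly_prod using S a by (intro prod_zero) (auto intro: bexI[of _ a])
    then show ?thesis using root[OF a] by simp
  qed
  then have "S \<subseteq> {a. poly (?p - h) a = 0}" by blast
  then have "card S \<le> card {a. poly (?p - h) a = 0}" by (rule card_mono[OF poly_roots_finite[OF ne]])
  then show False using card_poly_roots_bound[OF ne] lt by simp
qed

section \<open>The function field of a superelliptic curve\<close>

locale superelliptic =
  fixes \<iota> :: "'a::{field,finite} \<Rightarrow> 'k::field" and x y :: 'k and n d :: nat and f :: "'a poly"
  assumes curve: "superelliptic_curve \<iota> x y n d f"
begin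

lemma n_ge_2: "2 \<le> n" and d_ge_3: "3 \<le> d" and n_dvd: "n dvd CARD('a) - 1"
  and degree_f: "degree f = d" and coprime_f: "coprime f (pderiv f)" and f_no_root: "poly f a \<noteq> 0"
  and emb: "field_embedding \<iota>" and transcendental: "p \<noteq> 0 \<Longrightarrow> eval1 \<iota> p x \<noteq> 0"
  and y_power_n: "y ^ n = eval1 \<iota> f x"
  and generated: "\<exists>P Q. eval2 \<iota> Q x y \<noteq> 0 \<and> z = eval2 \<iota> P x y / eval2 \<iota> Q x y"
  using curve by (auto simp: superelliptic_curve_def superelliptic_function_field_def)

lemma iota_hom: "\<iota> 0 = 0" "\<iota> 1 = 1" "\<iota> (a + b) = \<iota> a + \<iota> b" "\<iota> (a * b) = \<iota> a * \<iota> b"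
  using emb by (auto simp: field_embedding_def)

lemma iota_uminus: "\<iota> (- a) = - \<iota> a"
  using iota_hom(3)[of a "- a"] iota_hom(1) by (simp add: eq_neg_iff_add_eq_0 add.commute)

lemma iota_diff: "\<iota> (a - b) = \<iota> a - \<iota> b"
  using iota_hom(3)[of a "- b"] by (simp add: iota_uminus)

lemma iota_eq_0: "\<iota> a = 0 \<longleftrightarrow> a = 0"
proof
  assume "\<iota> a = 0"
  then show "a = 0" using iota_hom(4)[of a "inverse a"] iota_hom(2) by (cases "a = 0") auto
qed (simp add: iota_hom)

lemma iota_inj: "\<iota> a = \<iota> b \<longleftrightarrow> a = b"
  using iota_eq_0[of "a - b"] by (simp add: iota_diff)

lemma iota_power: "\<iota> (a ^ k) = \<iota> a ^ k"
  by (induction k) (auto simp: iota_hom)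

lemma iota_inverse: "\<iota> (inverse a) = inverse (\<iota> a)"
proof (cases "a = 0")
  case False
  then show ?thesis using iota_hom(4)[of a "inverse a"] iota_hom(2) iota_eq_0[of a]
    by (simp add: field_simps)
qed (simp add: iota_hom)

lemma iota_divide: "\<iota> (a / b) = \<iota> a / \<iota> b"
  by (simp add: divide_inverse iota_hom iota_inverse)

lemma iota_sum: "\<iota> (sum g A) = (\<Sum>i\<in>A. \<iota> (g i))"
  by (induction A rule: infinite_finite_induct) (auto simp: iota_hom)

lemma iota_of_nat: "\<iota> (of_nat k) = of_nat k"
  by (induction k) (auto simp: iota_hom)

lemma of_nat_n: "of_nat n \<noteq> (0::'a)" "of_nat n \<noteq> (0::'k)"
proof -
  show 1: "of_nat n \<noteq> (0::'a)" using of_nat_dvd_card_minus_1_ne_0[OF n_dvd] .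
  show "of_nat n \<noteq> (0::'k)" using 1 iota_of_nat[of n] iota_eq_0 by metis
qed

definition ev :: "'a poly \<Rightarrow> 'k" where
  "ev p = eval1 \<iota> p x"

lemma ev_altdef: "ev p = (\<Sum>i\<le>degree p. \<iota> (coeff p i) * x ^ i)"
proof -
  have "degree (map_poly \<iota> p) = degree p"
    by (rule degree_map_poly) (simp add: iota_eq_0)
  then show ?thesis
    by (simp add: ev_def eval1_def poly_altdef coeff_map_poly iota_hom)
qed

lemma ev_add: "ev (p + q) = ev p + ev q"
proof -
  have "map_poly \<iota> (p + q) = map_poly \<iota> p + map_poly \<iota> q"
    by (rule poly_eqI) (simp add: coeff_map_poly iota_hom)
  then show ?thesis by (simp add: ev_def eval1_def)
qed

lemma ev_mult: "ev (p * q) = ev p * ev q"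
proof -
  have "map_poly \<iota> (p * q) = map_poly \<iota> p * map_poly \<iota> q"
    by (rule poly_eqI) (simp add: coeff_map_poly coeff_mult iota_hom iota_sum)
  then show ?thesis by (simp add: ev_def eval1_def)
qed

lemma ev_const: "ev [:a:] = \<iota> a"
  by (simp add: ev_def eval1_def map_poly_pCons iota_hom)

lemma ev_0: "ev 0 = 0" and ev_1: "ev 1 = 1" and ev_X: "ev [:0, 1:] = x"
  by (simp_all add: ev_def eval1_def map_poly_pCons iota_hom)

lemma ev_linear: "ev [:- a, 1:] = x - \<iota> a"
  by (simp add: ev_def eval1_def map_poly_pCons iota_hom iota_uminus)

lemma ev_uminus: "ev (- p) = - ev p"
  using ev_add[of p "- p"] ev_0 by (simp add: eq_neg_iff_add_eq_0 add.commute)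

lemma ev_diff: "ev (p - q) = ev p - ev q"
  using ev_add[of p "- q"] by (simp add: ev_uminus)

lemma ev_smult: "ev (smult a p) = \<iota> a * ev p"
  using ev_mult[of "[:a:]" p] by (simp add: ev_const)

lemma ev_power: "ev (p ^ k) = ev p ^ k"
  by (induction k) (auto simp: ev_1 ev_mult)

lemma ev_prod: "ev (prod g A) = (\<Prod>i\<in>A. ev (g i))"
  by (induction A rule: infinite_finite_induct) (auto simp: ev_1 ev_mult)

lemma ev_eq_0: "ev p = 0 \<longleftrightarrow> p = 0"
  using transcendental[of p] ev_0 by (auto simp: ev_def)

lemma ev_inj: "ev p = ev q \<longleftrightarrow> p = q"
  using ev_eq_0[of "p - q"] by (simp add: ev_diff)

lemma x_ne_0: "x \<noteq> 0"
  using ev_eq_0[of "[:0, 1:]"] by (simp add: ev_X)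

lemma f_ne_0: "f \<noteq> 0"
  using degree_f d_ge_3 by auto

lemma y_power: "y ^ n = ev f"
  using y_power_n by (simp add: ev_def)

lemma y_ne_0: "y \<noteq> 0"
  using y_power ev_eq_0[of f] f_ne_0 n_ge_2 by (auto simp: zero_power)

text \<open>The value of a fraction at \<open>x\<close>, which does not depend on the representation because \<open>x\<close> is
  transcendental.\<close>

definition rf :: "'a poly fract \<Rightarrow> 'k" where
  "rf r = (THE z. \<exists>p q. q \<noteq> 0 \<and> r = Fract p q \<and> z = ev p / ev q)"

lemma rf_Fract: "q \<noteq> 0 \<Longrightarrow> rf (Fract p q) = ev p / ev q"
  unfolding rf_def
proof (rule the_equality)
  assume q: "q \<noteq> 0"
  fix z assume "\<exists>p' q'. q' \<noteq> 0 \<and> Fract p q = Fract p' q' \<and> z = ev p' / ev q'"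
  then obtain p' q' where z: "q' \<noteq> 0" "Fract p q = Fract p' q'" "z = ev p' / ev q'" by blast
  then have "p * q' = p' * q" using q by (simp add: eq_fract)
  then have "ev p * ev q' = ev p' * ev q" by (metis ev_mult)
  then show "z = ev p / ev q" using z q by (simp add: ev_eq_0 frac_eq_eq)
qed auto

lemma rf_hom: "rf (r + s) = rf r + rf s" "rf (r * s) = rf r * rf s" "rf 0 = 0" "rf 1 = 1"
proof -
  obtain p q where r: "r = Fract p q" "q \<noteq> 0" by (cases r) blast
  obtain p' q' where s: "s = Fract p' q'" "q' \<noteq> 0" by (cases s) blast
  show "rf (r + s) = rf r + rf s"
    using r s by (simp add: rf_Fract ev_add ev_mult ev_eq_0 add_frac_eq)
  show "rf (r * s) = rf r * rf s"
    using r s by (simp add: rf_Fract ev_mult)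
  show "rf 0 = 0" "rf 1 = 1" by (simp_all add: Zero_fract_def One_fract_def rf_Fract ev_0 ev_1)
qed

lemma rf_poly: "rf (Fract p 1) = ev p"
  by (simp add: rf_Fract ev_1)

lemma rf_cases: obtains p q where "rf r = ev p / ev q" "q \<noteq> 0" "r = Fract p q"
  using rf_Fract by (cases r) auto

lemma rf_eq_0: "rf r = 0 \<longleftrightarrow> r = 0"
proof
  assume z: "rf r = 0"
  show "r = 0"
  proof (rule ccontr)
    assume "r \<noteq> 0"
    then have "rf r * rf (inverse r) = 1" by (simp flip: rf_hom(2) add: rf_hom(4))
    then show False using z by simp
  qed
qed (simp add: rf_hom)

lemma rf_uminus: "rf (- r) = - rf r"
  using rf_hom(1)[of r "- r"] rf_hom(3) by (simp add: eq_neg_iff_add_eq_0 add.commute)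

lemma rf_diff: "rf (r - s) = rf r - rf s"
  using rf_hom(1)[of r "- s"] by (simp add: rf_uminus)

lemma rf_inverse: "rf (inverse r) = inverse (rf r)"
proof (cases "r = 0")
  case False
  then have "rf r * rf (inverse r) = 1" by (simp flip: rf_hom(2) add: rf_hom(4))
  then show ?thesis by (rule inverse_unique[symmetric])
qed (simp add: rf_hom)

lemma rf_vector_space: "vector_space (\<lambda>r z. rf r * z)"
  by unfold_locales (auto simp: rf_hom algebra_simps)

subsection \<open>Coordinates with respect to the powers of \<open>y\<close>\<close>

definition comb :: "(nat \<Rightarrow> 'a poly fract) \<Rightarrow> 'k" where
  "comb a = (\<Sum>j<n. rf (a j) * y ^ j)"

lemma comb_add: "comb a + comb b = comb (\<lambda>j. a j + b j)"
  by (simp add: comb_def rf_hom algebra_simps sum.distrib)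

lemma comb_scale: "rf r * comb a = comb (\<lambda>j. r * a j)"
  by (simp add: comb_def rf_hom sum_distrib_left mult.assoc)

lemma comb_zero: "comb (\<lambda>_. 0) = 0"
  by (simp add: comb_def rf_hom)

lemma comb_sum: "(\<And>i. i \<in> A \<Longrightarrow> g i \<in> range comb) \<Longrightarrow> sum g A \<in> range comb"
proof (induction A rule: infinite_finite_induct)
  case (insert a A)
  then obtain u w where "g a = comb u" "sum g A = comb w" by force
  then show ?case using insert.hyps comb_add[of u w] by simp
qed (metis comb_zero rangeI sum.infinite, metis comb_zero rangeI sum.empty)

lemma comb_single: "j < n \<Longrightarrow> rf r * y ^ j \<in> range comb"
proof -
  assume "j < n"
  have "comb (\<lambda>i. if i = j then r else 0) = (\<Sum>i<n. if i = j then rf r * y ^ i else 0)"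
    unfolding comb_def by (intro sum.cong) (auto simp: rf_hom)
  also have "\<dots> = rf r * y ^ j" using \<open>j < n\<close> by simp
  finally show ?thesis by (metis rangeI)
qed

lemma y_power_reduce: "y ^ m = ev f ^ (m div n) * y ^ (m mod n)"
proof -
  have "y ^ m = y ^ (n * (m div n) + m mod n)" by simp
  then show ?thesis by (simp only: power_add power_mult y_power)
qed

lemma comb_monomial: "rf r * y ^ m \<in> range comb"
proof -
  have "rf r * y ^ m = rf (r * Fract (f ^ (m div n)) 1) * y ^ (m mod n)"
    by (subst y_power_reduce) (simp add: rf_hom rf_poly ev_power)
  then show ?thesis using comb_single n_ge_2 by simp
qed

lemma comb_mult: "z \<in> range comb \<Longrightarrow> w \<in> range comb \<Longrightarrow> z * w \<in> range comb"
proof -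
  assume "z \<in> range comb" "w \<in> range comb"
  then obtain a b where ab: "z = comb a" "w = comb b" by blast
  have "z * w = (\<Sum>i<n. \<Sum>j<n. rf (a i * b j) * y ^ (i + j))"
    unfolding ab comb_def sum_product
    by (intro sum.cong refl) (simp add: rf_hom power_add)
  also have "\<dots> \<in> range comb" by (intro comb_sum comb_monomial)
  finally show ?thesis .
qed

lemma comb_one: "1 \<in> range comb"
  using comb_monomial[of 1 0] by (simp add: rf_hom)

lemma comb_power: "z \<in> range comb \<Longrightarrow> z ^ k \<in> range comb"
  by (induction k) (auto simp: comb_one intro: comb_mult)

text \<open>The combinations form a space of dimension at most \<open>n\<close> over the rational functions, which
  contains the \<open>n + 1\<close> powers \<open>1, z, \<dots>, z\<^sup>n\<close>.\<close>

lemma comb_algebraic: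
  assumes z: "z \<in> range comb"
  shows "\<exists>c. (\<exists>i\<le>n. c i \<noteq> 0) \<and> (\<Sum>i\<le>n. rf (c i) * z ^ i) = 0"
proof -
  interpret V: vector_space "\<lambda>r z. rf r * z" by (rule rf_vector_space)
  let ?T = "(\<lambda>j. y ^ j) ` {..<n}" and ?S = "(\<lambda>i. z ^ i) ` {..n}"
  have range: "range comb \<subseteq> V.span ?T"
  proof
    fix w assume "w \<in> range comb"
    then obtain a where w: "w = (\<Sum>j<n. rf (a j) * y ^ j)" by (auto simp: comb_def)
    have "rf (a j) * y ^ j \<in> V.span ?T" if "j \<in> {..<n}" for j
      by (rule V.span_scale[OF V.span_base]) (rule imageI[OF that])
    then show "w \<in> V.span ?T" unfolding w by (rule V.span_sum)
  qed
  show ?thesis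
  proof (cases "inj_on (\<lambda>i. z ^ i) {..n}")
    case True
    have "\<not> V.independent ?S"
    proof
      assume "V.independent ?S"
      moreover have "?S \<subseteq> V.span ?T" using range comb_power[OF z] by blast
      ultimately have "card ?S \<le> card ?T" using V.independent_span_bound[of ?T ?S] by simp
      moreover have "card ?S = Suc n" using True by (simp add: card_image)
      moreover have "card ?T \<le> n" using card_image_le[of "{..<n}" "\<lambda>j. y ^ j"] by simp
      ultimately show False by simp
    qed
    then obtain u where u: "\<exists>v\<in>?S. u v \<noteq> 0" "(\<Sum>v\<in>?S. rf (u v) * v) = 0"
      using V.dependent_finite[of ?S] by auto
    have "(\<Sum>i\<le>n. rf (u (z ^ i)) * z ^ i) = 0"
      using u(2) True by (simp add: sum.reindex)
    then show ?thesis using u(1) by (intro exI[of _ "\<lambda>i. u (z ^ i)"]) auto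
  next
    case False
    then obtain i j where ij: "i \<le> n" "j \<le> n" "i \<noteq> j" "z ^ i = z ^ j" by (auto simp: inj_on_def)
    let ?c = "\<lambda>k. (if k = i then 1 else 0) - (if k = j then 1 else 0) :: 'a poly fract"
    have "(\<Sum>k\<le>n. rf (?c k) * z ^ k) = (\<Sum>k\<le>n. (if k = i then z ^ k else 0) - (if k = j then z ^ k else 0))"
      by (intro sum.cong) (auto simp: rf_diff rf_hom)
    also have "\<dots> = z ^ i - z ^ j" using ij by (simp add: sum_subtractf)
    finally have "(\<Sum>k\<le>n. rf (?c k) * z ^ k) = 0" using ij by simp
    moreover have "\<exists>k\<le>n. ?c k \<noteq> 0" using ij by (intro exI[of _ i]) simp
    ultimately show ?thesis by (intro exI[of _ ?c] conjI)
  qed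
qed

text \<open>An algebraic equation for \<open>z\<close>, divided by its lowest power of \<open>z\<close>, expresses the inverse of
  \<open>z\<close> as a polynomial in \<open>z\<close>.\<close>

lemma comb_inverse:
  assumes z: "z \<in> range comb" "z \<noteq> 0"
  shows "inverse z \<in> range comb"
proof -
  obtain c where c: "\<exists>i\<le>n. c i \<noteq> 0" "(\<Sum>i\<le>n. rf (c i) * z ^ i) = 0"
    using comb_algebraic[OF z(1)] by blast
  define i0 where "i0 = (LEAST i. c i \<noteq> 0)"
  have c0: "c i0 \<noteq> 0" using c(1) unfolding i0_def by (metis (mono_tags) LeastI)
  have less: "c i = 0" if "i < i0" for i using that not_less_Least unfolding i0_def by blast
  have i0: "i0 \<le> n" using c(1) less by (meson leI le_trans)
  let ?s = "\<Sum>i\<in>{i0<..n}. rf (c i) * z ^ (i - Suc i0)"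
  have "(\<Sum>i\<le>n. rf (c i) * z ^ i) = (\<Sum>i\<in>{i0..n}. rf (c i) * z ^ i)"
    by (rule sum.mono_neutral_right) (auto simp: less rf_hom)
  also have "\<dots> = rf (c i0) * z ^ i0 + (\<Sum>i\<in>{i0<..n}. rf (c i) * z ^ i)"
    using i0 by (subst sum.head) auto
  also have "(\<Sum>i\<in>{i0<..n}. rf (c i) * z ^ i) = (\<Sum>i\<in>{i0<..n}. z ^ i0 * z * (rf (c i) * z ^ (i - Suc i0)))"
  proof (rule sum.cong[OF refl])
    fix i assume "i \<in> {i0<..n}"
    then have "Suc i0 + (i - Suc i0) = i" by auto
    then have "z ^ i = z ^ Suc i0 * z ^ (i - Suc i0)" by (metis power_add)
    then show "rf (c i) * z ^ i = z ^ i0 * z * (rf (c i) * z ^ (i - Suc i0))" by (simp add: mult_ac)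
  qed
  also have "\<dots> = z ^ i0 * z * ?s" by (simp only: sum_distrib_left)
  finally have "z ^ i0 * (rf (c i0) + z * ?s) = 0" using c(2) by (simp add: algebra_simps)
  then have "rf (c i0) + z * ?s = 0" using z(2) by simp
  then have "z * ?s = - rf (c i0)" by (simp add: eq_neg_iff_add_eq_0 add.commute)
  moreover have "z * (- inverse (rf (c i0)) * ?s) = - inverse (rf (c i0)) * (z * ?s)"
    by (simp only: mult_ac)
  ultimately have "z * (- inverse (rf (c i0)) * ?s) = 1" using c0 by (simp add: rf_eq_0)
  then have inv: "inverse z = rf (- inverse (c i0)) * ?s"
    by (simp add: inverse_unique rf_uminus rf_inverse)
  have "?s \<in> range comb"
  proof (rule comb_sum)
    fix i
    have "rf (c i) \<in> range comb" using comb_monomial[of "c i" 0] by simp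
    then show "rf (c i) * z ^ (i - Suc i0) \<in> range comb" by (rule comb_mult[OF _ comb_power[OF z(1)]])
  qed
  then show ?thesis using comb_monomial[of "- inverse (c i0)" 0] comb_mult unfolding inv by simp
qed

text \<open>By the preceding lemmas, the combinations form a field; it contains \<open>x\<close> and \<open>y\<close>.\<close>

lemma comb_surj: "z \<in> range comb"
proof -
  have e2: "eval2 \<iota> P x y \<in> range comb" for P
  proof -
    have "(\<lambda>p. eval1 \<iota> p x) = ev" by (simp add: ev_def fun_eq_iff)
    then have "eval2 \<iota> P x y = (\<Sum>i\<le>degree (map_poly ev P). rf (Fract (coeff P i) 1) * y ^ i)"
      by (simp add: eval2_def poly_altdef coeff_map_poly[of ev, OF ev_0] rf_poly)
    then show ?thesis by (simp only:) (intro comb_sum comb_monomial)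
  qed
  obtain P Q where PQ: "eval2 \<iota> Q x y \<noteq> 0" "z = eval2 \<iota> P x y / eval2 \<iota> Q x y" using generated by blast
  then show ?thesis using comb_mult[OF e2 comb_inverse[OF e2]] by (simp add: divide_inverse)
qed

lemma algebraic: "\<exists>c. (\<exists>i\<le>n. c i \<noteq> 0) \<and> (\<Sum>i\<le>n. rf (c i) * z ^ i) = 0"
  by (rule comb_algebraic[OF comb_surj])

subsection \<open>Places over the places of the rational function field\<close>

lemma algebraic_range: "\<exists>c. (\<forall>i\<le>n. c i \<in> range rf) \<and> (\<exists>i\<le>n. c i \<noteq> 0) \<and> (\<Sum>i\<le>n. c i * z ^ i) = 0"
proof -
  obtain c where c: "\<exists>i\<le>n. c i \<noteq> 0" "(\<Sum>i\<le>n. rf (c i) * z ^ i) = 0" using algebraic by blast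
  then show ?thesis by (intro exI[of _ "\<lambda>i. rf (c i)"]) (simp add: rf_eq_0)
qed

text \<open>A place that dominates the local ring of the polynomials at \<open>p\<close> exists by
  \<open>place_extension\<close>.\<close>

lemma ex_place_over_prime:
  assumes p: "prime_elem p"
  shows "\<exists>v\<in>places \<iota>. 0 < v (ev p) \<and> 0 \<le> v x"
proof -
  let ?A = "{ev a / ev b | a b. \<not> p dvd b}"
  have p1: "\<not> p dvd 1" using p by (simp add: prime_elem_def)
  have pm: "\<not> p dvd b * b'" if "\<not> p dvd b" "\<not> p dvd b'" for b b'
    using that p by (simp add: prime_elem_dvd_mult_iff)
  have AI: "ev a / ev b \<in> ?A" if "\<not> p dvd b" for a b using that by blast
  have AI1: "ev a \<in> ?A" for a using AI[OF p1, of a] by (simp add: ev_1)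
  have "ring_set ?A"
    unfolding ring_set_def subgrp_def
  proof (intro conjI ballI)
    show "1 \<in> ?A" "0 \<in> ?A" using AI1[of 1] AI1[of 0] by (simp_all add: ev_1 ev_0)
    fix s t assume "s \<in> ?A" "t \<in> ?A"
    then obtain a b a' b' where st: "s = ev a / ev b" "\<not> p dvd b" "t = ev a' / ev b'" "\<not> p dvd b'" by blast
    then have ne: "b \<noteq> 0" "b' \<noteq> 0" by auto
    have "s - t = ev (a * b' - a' * b) / ev (b * b')"
      using ne by (simp add: st ev_diff ev_mult diff_frac_eq ev_eq_0)
    also have "\<dots> \<in> ?A" by (rule AI[OF pm[OF st(2,4)]])
    finally show "s - t \<in> ?A" .
    have "s * t = ev (a * a') / ev (b * b')" by (simp add: st ev_mult)
    also have "\<dots> \<in> ?A" by (rule AI[OF pm[OF st(2,4)]])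
    finally show "s * t \<in> ?A" .
  qed
  moreover have "range \<iota> \<subseteq> ?A"
  proof (rule image_subsetI)
    fix a show "\<iota> a \<in> ?A" using AI1[of "[:a:]"] unfolding ev_const .
  qed
  moreover have "ev p \<noteq> 0" using p by (auto simp: ev_eq_0 prime_elem_def)
  moreover have "inverse (ev p) \<notin> ?A"
  proof
    assume "inverse (ev p) \<in> ?A"
    then obtain a b where ab: "inverse (ev p) = ev a / ev b" "\<not> p dvd b" by blast
    then have "ev b \<noteq> 0" by (auto simp: ev_eq_0)
    then have "ev b = ev (p * a)" using ab(1) \<open>ev p \<noteq> 0\<close> by (simp add: ev_mult field_simps)
    then show False using ab(2) by (simp add: ev_inj)
  qed
  moreover have "\<exists>m. c * ev p powi m \<in> ?A \<and> inverse (c * ev p powi m) \<in> ?A"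
    if c: "c \<in> range rf" "c \<noteq> 0" for c
  proof -
    obtain r where "c = rf r" using c(1) by blast
    then obtain a b where ab: "c = ev a / ev b" "b \<noteq> 0" by (metis rf_cases)
    then have "a \<noteq> 0" using c(2) by (auto simp: ev_0)
    obtain i a' where a: "a = p ^ i * a'" "\<not> p dvd a'" using prime_power_decomposition[OF p \<open>a \<noteq> 0\<close>] by blast
    obtain j b' where b: "b = p ^ j * b'" "\<not> p dvd b'" using prime_power_decomposition[OF p ab(2)] by blast
    have ne: "a' \<noteq> 0" "b' \<noteq> 0" using a b by auto
    have "c * ev p powi (int j - int i) = ev a' / ev b'"
      using \<open>ev p \<noteq> 0\<close> ne by (simp add: ab(1) a(1) b(1) ev_mult ev_power power_int_diff ev_eq_0 field_simps)
    then show ?thesis using AI a(2) b(2) by (intro exI[of _ "int j - int i"]) auto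
  qed
  ultimately have "\<exists>v\<in>places \<iota>. 0 < v (ev p) \<and> (\<forall>a\<in>?A. 0 \<le> v a)"
    using AI1 algebraic_range by (intro place_extension[OF emb, where R = "range rf" and n = n]) auto
  then show ?thesis using AI1[of "[:0, 1:]"] unfolding ev_X by blast
qed

text \<open>The same argument with the local ring at infinity, where \<open>1/x\<close> is the prime element.\<close>

lemma ex_place_at_infinity: "\<exists>v\<in>places \<iota>. v x < 0"
proof -
  let ?A = "{ev a / ev b | a b. b \<noteq> 0 \<and> degree a \<le> degree b}"
  have AI: "ev a / ev b \<in> ?A" if "b \<noteq> 0" "degree a \<le> degree b" for a b using that by blast
  have "ring_set ?A"
    unfolding ring_set_def subgrp_def
  proof (intro conjI ballI)
    show "1 \<in> ?A" "0 \<in> ?A" using AI[of 1 1] AI[of 1 0] by (simp_all add: ev_1 ev_0)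
    fix s t assume "s \<in> ?A" "t \<in> ?A"
    then obtain a b a' b' where st: "s = ev a / ev b" "b \<noteq> 0" "degree a \<le> degree b"
      "t = ev a' / ev b'" "b' \<noteq> 0" "degree a' \<le> degree b'" by blast
    have bb: "b * b' \<noteq> 0" "degree (b * b') = degree b + degree b'"
      using st by (auto simp: degree_mult_eq)
    have le: "degree (a * b') \<le> degree b + degree b'" "degree (a' * b) \<le> degree b + degree b'"
      "degree (a * a') \<le> degree b + degree b'"
      using st degree_mult_le[of a b'] degree_mult_le[of a' b] degree_mult_le[of a a'] by linarith+
    have "s - t = ev (a * b' - a' * b) / ev (b * b')"
      using st by (simp add: st ev_diff ev_mult diff_frac_eq ev_eq_0)
    also have "\<dots> \<in> ?A"
    proof (rule AI[OF bb(1)])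
      show "degree (a * b' - a' * b) \<le> degree (b * b')" unfolding bb(2) using le by (intro degree_diff_le)
    qed
    finally show "s - t \<in> ?A" .
    have "s * t = ev (a * a') / ev (b * b')" by (simp add: st ev_mult)
    also have "\<dots> \<in> ?A" using le(3) bb(2) by (intro AI[OF bb(1)]) simp
    finally show "s * t \<in> ?A" .
  qed
  moreover have "range \<iota> \<subseteq> ?A"
  proof
    fix c assume "c \<in> range \<iota>"
    then obtain a where "c = ev [:a:] / ev 1" by (auto simp: ev_const ev_1)
    then show "c \<in> ?A" using AI[of 1 "[:a:]"] by simp
  qed
  moreover have "inverse x \<in> ?A" using AI[of "[:0, 1:]" 1] by (simp add: ev_1 ev_X inverse_eq_divide)
  moreover have "inverse (inverse x) \<notin> ?A"
  proof
    assume "inverse (inverse x) \<in> ?A"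
    then obtain a b where ab: "x = ev a / ev b" "b \<noteq> 0" "degree a \<le> degree b" by auto
    then have "x * ev b = ev a" using nonzero_eq_divide_eq[of "ev b" x "ev a"] by (simp add: ev_eq_0)
    then have "ev a = ev ([:0, 1:] * b)" by (simp only: ev_mult ev_X)
    then have "a = [:0, 1:] * b" by (simp only: ev_inj)
    then have "degree a = Suc (degree b)" using ab(2) by (simp add: degree_mult_eq)
    then show False using ab(3) by simp
  qed
  moreover have "\<exists>m. c * inverse x powi m \<in> ?A \<and> inverse (c * inverse x powi m) \<in> ?A"
    if c: "c \<in> range rf" "c \<noteq> 0" for c
  proof -
    obtain r where "c = rf r" using c(1) by blast
    then obtain a b where ab: "c = ev a / ev b" "b \<noteq> 0" by (metis rf_cases)
    then have "a \<noteq> 0" using c(2) by (auto simp: ev_0)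
    let ?a = "a * [:0, 1:] ^ degree b" and ?b = "b * [:0, 1:] ^ degree a"
    have ne: "?a \<noteq> 0" "?b \<noteq> 0" using ab(2) \<open>a \<noteq> 0\<close> by auto
    have deg: "degree ?a = degree ?b"
      using ab(2) \<open>a \<noteq> 0\<close> by (simp add: degree_mult_eq degree_power_eq)
    have "c * inverse x powi (int (degree a) - int (degree b)) = ev ?a / ev ?b"
      using x_ne_0 ab(2)
      by (simp add: ab(1) ev_mult ev_power ev_X power_int_diff ev_eq_0 power_inverse field_simps)
    then show ?thesis using AI[OF ne(2), of ?a] AI[OF ne(1), of ?b] deg
      by (intro exI[of _ "int (degree a) - int (degree b)"]) simp
  qed
  ultimately have "\<exists>v\<in>places \<iota>. 0 < v (inverse x) \<and> (\<forall>a\<in>?A. 0 \<le> v a)"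
    using x_ne_0 algebraic_range by (intro place_extension[OF emb, where R = "range rf" and n = n]) auto
  then obtain v where "v \<in> places \<iota>" "0 < v (inverse x)" by blast
  then show ?thesis using place_inverse[of v \<iota> x] by (intro bexI[of _ v]) simp_all
qed

lemma ev_pw:
  assumes v: "v \<in> places \<iota>" and x: "0 \<le> v x"
  shows "ev h \<in> pw v 0"
proof -
  have "x ^ i \<in> pw v 0" for i using x by (simp add: pw_def place_power[OF v])
  then have "\<iota> (coeff h i) * x ^ i \<in> pw v 0" for i
    using pw_mult[OF v pw_const[OF v emb], of "x ^ i" 0] by simp
  then show ?thesis unfolding ev_altdef by (rule pw_sum[OF v])
qed

lemma ev_nonneg: "v \<in> places \<iota> \<Longrightarrow> 0 \<le> v x \<Longrightarrow> 0 \<le> v (ev h)"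
  using ev_pw[of v h] by (auto simp: pw_def place_zero)

text \<open>If all rational functions had value \<open>0\<close>, the terms of an algebraic equation for a
  uniformiser would have different values.\<close>

lemma place_nontrivial_on_polys:
  assumes v: "v \<in> places \<iota>"
  shows "\<exists>h. h \<noteq> 0 \<and> v (ev h) \<noteq> 0"
proof (rule ccontr)
  assume "\<not> ?thesis"
  then have triv: "v (ev h) = 0" for h by (cases "h = 0") (auto simp: ev_0 place_zero[OF v])
  have rf0: "v (rf r) = 0" for r
  proof (cases "r = 0")
    case True then show ?thesis by (simp add: rf_hom place_zero[OF v])
  next
    case False
    then have r0: "rf r \<noteq> 0" by (simp add: rf_eq_0)
    obtain p q where "rf r = ev p / ev q" by (rule rf_cases[of r]) blast
    moreover then have "ev p \<noteq> 0" "ev q \<noteq> 0" using r0 by auto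
    ultimately show ?thesis by (simp add: place_divide[OF v] triv)
  qed
  obtain z where z: "v z = 1" "z \<noteq> 0" by (rule uniformizer[OF v])
  obtain c where c: "\<exists>i\<le>n. c i \<noteq> 0" "(\<Sum>i\<le>n. rf (c i) * z ^ i) = 0" using algebraic by blast
  have val: "v (rf (c i) * z ^ i) = int i" if "rf (c i) * z ^ i \<noteq> 0" for i
    using that z by (simp add: place_mult[OF v] place_power[OF v] rf0)
  have "\<exists>i\<in>{..n}. rf (c i) * z ^ i \<noteq> 0" using c(1) z(2) by (auto simp: rf_eq_0)
  then show False
    using place_sum_distinct[OF v, of "{..n}" "\<lambda>i. rf (c i) * z ^ i"] c(2) val by fastforce
qed

text \<open>The polynomials with positive value form a prime ideal, generated by an element of smallest
  degree.\<close>

lemma place_prime_exists: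
  assumes v: "v \<in> places \<iota>" and x: "0 \<le> v x"
  shows "\<exists>p. prime_elem p \<and> 0 < v (ev p) \<and> (\<forall>h. h \<noteq> 0 \<longrightarrow> (0 < v (ev h) \<longleftrightarrow> p dvd h))"
proof -
  let ?P = "\<lambda>h. h \<noteq> 0 \<and> 0 < v (ev h)"
  obtain h0 where "h0 \<noteq> 0" "v (ev h0) \<noteq> 0" using place_nontrivial_on_polys[OF v] by blast
  then have "?P h0" using ev_nonneg[OF v x, of h0] by simp
  then obtain p where p: "?P p" and min: "\<And>h. ?P h \<Longrightarrow> degree p \<le> degree h"
    using ex_has_least_nat[of ?P h0 degree] by blast
  have iff: "0 < v (ev h) \<longleftrightarrow> p dvd h" if h: "h \<noteq> 0" for h
  proof
    assume "p dvd h"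
    then obtain g where g: "h = p * g" by blast
    then have "g \<noteq> 0" using h by auto
    then show "0 < v (ev h)"
      using p ev_nonneg[OF v x, of g] by (simp add: g ev_mult place_mult[OF v] ev_eq_0)
  next
    assume pos: "0 < v (ev h)"
    show "p dvd h"
    proof (rule ccontr)
      assume "\<not> p dvd h"
      then have r: "h mod p \<noteq> 0" by (simp add: dvd_eq_mod_eq_0)
      have "degree (h mod p) < degree p" using degree_mod_less[of p h] p r by auto
      then have "\<not> ?P (h mod p)" using min by fastforce
      then have "\<not> 0 < v (ev (h mod p))" using r by blast
      moreover have "ev (h mod p) \<in> pw v 1"
      proof -
        have "ev (h mod p) = ev h - ev p * ev (h div p)"
          using ev_diff[of h "p * (h div p)"] by (simp add: ev_mult minus_mult_div_eq_mod)
        moreover have "ev h \<in> pw v 1" "ev p \<in> pw v 1" using pos p by (auto simp: pw_def)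
        moreover have "ev p * ev (h div p) \<in> pw v 1"
          using pw_mult[OF v \<open>ev p \<in> pw v 1\<close> ev_pw[OF v x, of "h div p"]] by simp
        ultimately show ?thesis using pw_diff[OF v] by simp
      qed
      ultimately show False using r by (simp add: pw_def ev_eq_0)
    qed
  qed
  have "prime_elem p"
  proof (rule prime_elemI)
    show "p \<noteq> 0" using p by blast
    show "\<not> p dvd 1" using iff[of 1] by (simp add: ev_1 place_one[OF v])
    fix a b assume ab: "p dvd a * b"
    show "p dvd a \<or> p dvd b"
    proof (cases "a = 0 \<or> b = 0")
      case False
      then have "0 < v (ev a) + v (ev b)"
        using ab iff[of "a * b"] by (simp add: ev_mult place_mult[OF v] ev_eq_0)
      then have "0 < v (ev a) \<or> 0 < v (ev b)" by linarith
      then show ?thesis using iff[of a] iff[of b] False by blast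
    qed auto
  qed
  then show ?thesis using p iff by blast
qed

lemma place_prime_value:
  assumes v: "v \<in> places \<iota>" and x: "0 \<le> v x" and p: "prime_elem p" "0 < v (ev p)"
  shows "h \<noteq> 0 \<Longrightarrow> 0 < v (ev h) \<longleftrightarrow> p dvd h" and "\<not> p dvd h \<Longrightarrow> v (ev (p ^ k * h)) = int k * v (ev p)"
proof -
  obtain p' where p': "prime_elem p'" "0 < v (ev p')" "\<And>h. h \<noteq> 0 \<Longrightarrow> 0 < v (ev h) \<longleftrightarrow> p' dvd h"
    using place_prime_exists[OF v x] by blast
  have "p \<noteq> 0" using p(1) by (simp add: prime_elem_def)
  then have "p' dvd p" using p'(3) p(2) by blast
  then obtain u where u: "p = p' * u" by blast
  have "p dvd p'"
  proof -
    have "p dvd p' \<or> p dvd u" using p(1) u by (metis dvd_refl prime_elem_dvd_mult_iff)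
    moreover have "\<not> p dvd u"
    proof
      assume "p dvd u"
      then obtain w where "u = p * w" by blast
      then have "p * (p' * w) = p * 1" using u by (simp add: mult_ac)
      then have "p' * w = 1" using \<open>p \<noteq> 0\<close> by (simp only: mult_cancel_left) simp
      then show False using p'(1) by (metis dvd_triv_left prime_elem_def)
    qed
    ultimately show ?thesis by blast
  qed
  then show iff: "0 < v (ev h) \<longleftrightarrow> p dvd h" if "h \<noteq> 0" for h
    using p'(3)[OF that] \<open>p' dvd p\<close> dvd_trans by blast
  show val: "v (ev (p ^ k * h)) = int k * v (ev p)" if "\<not> p dvd h" for k h
  proof -
    have "h \<noteq> 0" using that by auto
    then have "v (ev h) = 0" using iff[of h] that ev_nonneg[OF v x, of h] by simp
    then show ?thesis using \<open>h \<noteq> 0\<close> \<open>p \<noteq> 0\<close>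
      by (simp add: ev_mult ev_power place_mult[OF v] place_power[OF v] ev_eq_0)
  qed
qed

text \<open>The factor \<open>m\<close> is the exponent of \<open>p\<close> in the rational function, the same for all places over
  \<open>p\<close>.\<close>

lemma place_rf_value:
  assumes p: "prime_elem p"
  shows "\<exists>m. \<forall>v\<in>places \<iota>. 0 \<le> v x \<longrightarrow> 0 < v (ev p) \<longrightarrow> v (rf r) = m * v (ev p)"
proof -
  obtain a b where ab: "rf r = ev a / ev b" "b \<noteq> 0" by (rule rf_cases[of r]) blast
  show ?thesis
  proof (cases "a = 0")
    case True then show ?thesis using ab by (intro exI[of _ 0]) (simp add: ev_0 place_zero)
  next
    case False
    obtain i a' where a: "a = p ^ i * a'" "\<not> p dvd a'" using prime_power_decomposition[OF p False] by blast
    obtain j b' where b: "b = p ^ j * b'" "\<not> p dvd b'" using prime_power_decomposition[OF p ab(2)] by blast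
    have "v (rf r) = (int i - int j) * v (ev p)" if v: "v \<in> places \<iota>" "0 \<le> v x" "0 < v (ev p)" for v
    proof -
      have "v (rf r) = v (ev a) - v (ev b)" using ab False by (simp add: place_divide[OF v(1)] ev_eq_0)
      also have "v (ev a) = int i * v (ev p)" unfolding a(1) by (rule place_prime_value(2)[OF v(1,2) p v(3) a(2)])
      also have "v (ev b) = int j * v (ev p)" unfolding b(1) by (rule place_prime_value(2)[OF v(1,2) p v(3) b(2)])
      finally show ?thesis by (simp add: left_diff_distrib)
    qed
    then show ?thesis by blast
  qed
qed

text \<open>The leading term dominates.\<close>

lemma place_inf_value:
  assumes v: "v \<in> places \<iota>" and x: "v x < 0" and h: "h \<noteq> 0"
  shows "v (ev h) = int (degree h) * v x"
proof -
  let ?g = "\<lambda>i. \<iota> (coeff h i) * x ^ i"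
  have val: "v (?g i) = int i * v x" if "coeff h i \<noteq> 0" for i
    using that x_ne_0 by (simp add: place_mult[OF v] place_power[OF v] place_const[OF v] iota_eq_0)
  have lc: "coeff h (degree h) \<noteq> 0" using h by simp
  have "(\<Sum>i<degree h. ?g i) \<in> pw v (v (?g (degree h)) + 1)"
  proof (rule pw_sum[OF v])
    fix i assume i: "i \<in> {..<degree h}"
    show "?g i \<in> pw v (v (?g (degree h)) + 1)"
    proof (cases "coeff h i = 0")
      case False
      have "int (degree h) * v x < int i * v x" using i x by (intro mult_strict_right_mono_neg) auto
      then show ?thesis using val[OF False] val[OF lc] by (simp add: pw_def)
    qed (simp add: pw_def iota_hom)
  qed
  then have "v (?g (degree h) + (\<Sum>i<degree h. ?g i)) = v (?g (degree h))"
    using lc x_ne_0 by (intro place_add_dominant(2)[OF v]) (auto simp: iota_eq_0)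
  moreover have "ev h = ?g (degree h) + (\<Sum>i<degree h. ?g i)"
    unfolding ev_altdef by (simp add: lessThan_Suc_atMost[symmetric] add.commute)
  ultimately show ?thesis using val[OF lc] by simp
qed

lemma prime_square_not_dvd_f:
  assumes p: "prime_elem p" and g: "f = p * g"
  shows "\<not> p dvd g"
proof
  assume "p dvd g"
  then obtain h where h: "g = p * h" by blast
  have "pderiv f = p * (p * pderiv h + 2 * h * pderiv p)"
    unfolding g h by (simp add: pderiv_mult algebra_simps)
  then have "p dvd pderiv f" by simp
  moreover have "p dvd f" using g by simp
  ultimately have "is_unit p" using coprime_f by (metis coprime_common_divisor)
  then show False using p by (simp add: prime_elem_def)
qed

lemma place_f_value:
  assumes v: "v \<in> places \<iota>" and x: "0 \<le> v x" and p: "prime_elem p" "0 < v (ev p)"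
  shows "v (ev f) = (if p dvd f then v (ev p) else 0)"
proof (cases "p dvd f")
  case True
  then obtain g where g: "f = p * g" by blast
  then show ?thesis
    using place_prime_value(2)[OF assms prime_square_not_dvd_f[OF p(1) g], of 1] True by simp
next
  case False
  then show ?thesis using place_prime_value(2)[OF assms False, of 0] by simp
qed

lemma place_y_value: "v \<in> places \<iota> \<Longrightarrow> int n * v y = v (ev f)"
  using place_power[of v \<iota> y n] y_power by simp

text \<open>At a place over a root of \<open>f\<close> the powers of \<open>y\<close> below the \<open>n\<close>-th have values in different
  classes, so they are linearly independent over the rational functions.\<close>

lemma comb_eq_0:
  assumes "comb a = 0" "j < n"
  shows "a j = 0"
proof (rule ccontr)
  assume aj: "a j \<noteq> 0"
  obtain p where p: "prime_elem p" "p dvd f"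
    using ex_prime_divisor_poly[of f] degree_f d_ge_3 by auto
  obtain v where v: "v \<in> places \<iota>" "0 < v (ev p)" "0 \<le> v x" using ex_place_over_prime[OF p(1)] by blast
  let ?g = "\<lambda>i. rf (a i) * y ^ i"
  have ny: "int n * v y = v (ev p)"
    using place_f_value[OF v(1,3) p(1) v(2)] p(2) place_y_value[OF v(1)] by simp
  then have vy: "0 < v y" using v(2) n_ge_2 by (metis mult_nonneg_nonpos not_le of_nat_0_le_iff)
  have val: "\<exists>m. v (?g i) = (int n * m + int i) * v y" if nz: "?g i \<noteq> 0" for i
  proof -
    obtain m where "v (rf (a i)) = m * v (ev p)" using place_rf_value[OF p(1), of "a i"] v by blast
    then have "v (?g i) = m * (int n * v y) + int i * v y"
      using nz by (simp add: place_mult[OF v(1)] place_power[OF v(1)] ny)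
    then show ?thesis by (intro exI[of _ m]) (simp add: algebra_simps)
  qed
  have dist: "v (?g i) \<noteq> v (?g k)" if ik: "i \<in> {..<n}" "k \<in> {..<n}" "i \<noteq> k" "?g i \<noteq> 0" "?g k \<noteq> 0" for i k
  proof
    assume eq: "v (?g i) = v (?g k)"
    obtain m m' where mm: "v (?g i) = (int n * m + int i) * v y" "v (?g k) = (int n * m' + int k) * v y"
      using val[OF ik(4)] val[OF ik(5)] by blast
    then have "int n * m + int i = int n * m' + int k" using eq vy by simp
    then have "(int i + int n * m) mod int n = (int k + int n * m') mod int n" by (simp add: add.commute)
    then show False using ik(1-3) by simp
  qed
  have ex: "\<exists>i\<in>{..<n}. ?g i \<noteq> 0"
    using aj y_ne_0 assms(2) by (intro bexI[of _ j]) (simp_all add: rf_eq_0)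
  have "(\<Sum>i<n. ?g i) \<noteq> 0"
    using place_sum_distinct[OF v(1) finite_lessThan dist ex] by blast
  then show False using assms(1) by (simp add: comb_def)
qed

text \<open>The coordinates of an element with respect to \<open>1, y, \<dots>, y\<^sup>n\<^sup>-\<^sup>1\<close>. Only the values at \<open>j < n\<close>
  are determined by the element.\<close>

definition coord :: "'k \<Rightarrow> nat \<Rightarrow> 'a poly fract" where
  "coord z = (SOME a. comb a = z)"

lemma comb_coord: "comb (coord z) = z"
  unfolding coord_def using comb_surj[of z] by (metis (mono_tags) rangeE someI)

lemma comb_inj: "comb a = comb b \<Longrightarrow> j < n \<Longrightarrow> a j = b j"
proof -
  assume "comb a = comb b" "j < n"
  have "comb (\<lambda>j. a j + (- b j)) = comb a + comb (\<lambda>j. - 1 * b j)" by (simp add: comb_add)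
  also have "comb (\<lambda>j. - 1 * b j) = - comb b" by (simp only: comb_scale[symmetric] rf_uminus rf_hom) simp
  finally have "comb (\<lambda>j. a j + (- b j)) = 0" using \<open>comb a = comb b\<close> by simp
  then show ?thesis using comb_eq_0[of "\<lambda>j. a j + (- b j)" j] \<open>j < n\<close> by simp
qed

lemma coord_comb: "j < n \<Longrightarrow> coord (comb a) j = a j"
  using comb_inj[OF comb_coord] .

subsection \<open>The automorphisms \<open>y \<mapsto> \<zeta> y\<close>\<close>

text \<open>For \<open>\<zeta>\<^sup>n = 1\<close> this is the automorphism that fixes \<open>x\<close> and the constants and maps \<open>y\<close> to
  \<open>\<zeta> y\<close>.\<close>

definition twist :: "'a \<Rightarrow> 'k \<Rightarrow> 'k" where
  "twist \<zeta> z = (\<Sum>j<n. rf (coord z j) * (\<iota> \<zeta> * y) ^ j)"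

lemma twist_comb: "twist \<zeta> (comb a) = (\<Sum>j<n. rf (a j) * (\<iota> \<zeta> * y) ^ j)"
  unfolding twist_def by (intro sum.cong) (auto simp: coord_comb)

lemma twist_add: "twist \<zeta> (z + w) = twist \<zeta> z + twist \<zeta> w"
proof -
  have "z + w = comb (\<lambda>j. coord z j + coord w j)" by (simp flip: comb_add add: comb_coord)
  then have "twist \<zeta> (z + w) = (\<Sum>j<n. rf (coord z j + coord w j) * (\<iota> \<zeta> * y) ^ j)" by (simp add: twist_comb)
  then show ?thesis by (simp add: twist_def rf_hom sum.distrib algebra_simps)
qed

lemma twist_scale: "twist \<zeta> (rf r * z) = rf r * twist \<zeta> z"
proof -
  have "rf r * z = comb (\<lambda>j. r * coord z j)" by (simp flip: comb_scale add: comb_coord)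
  then have "twist \<zeta> (rf r * z) = (\<Sum>j<n. rf (r * coord z j) * (\<iota> \<zeta> * y) ^ j)" by (simp add: twist_comb)
  then show ?thesis by (simp add: twist_def rf_hom sum_distrib_left mult.assoc)
qed

lemma twist_sum: "twist \<zeta> (sum g A) = (\<Sum>i\<in>A. twist \<zeta> (g i))"
proof (induction A rule: infinite_finite_induct)
  case (insert a A) then show ?case by (simp add: twist_add)
qed (use twist_scale[of \<zeta> 0 0] in \<open>simp_all add: rf_hom\<close>)

lemma twist_y_power:
  assumes "\<zeta> ^ n = 1"
  shows "twist \<zeta> (y ^ m) = (\<iota> \<zeta> * y) ^ m"
proof -
  have small: "twist \<zeta> (y ^ j) = (\<iota> \<zeta> * y) ^ j" if "j < n" for j
  proof -
    have e: "(\<Sum>i<n. rf (if i = j then 1 else 0) * w ^ i) = w ^ j" for w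
    proof -
      have "(\<Sum>i<n. rf (if i = j then 1 else 0) * w ^ i) = (\<Sum>i<n. if i = j then w ^ i else 0)"
        by (intro sum.cong) (auto simp: rf_hom)
      then show ?thesis using that by simp
    qed
    have "y ^ j = comb (\<lambda>i. if i = j then 1 else 0)" by (simp only: comb_def e)
    then show ?thesis by (simp only: twist_comb e)
  qed
  have "(\<iota> \<zeta> * y) ^ n = ev f"
    using assms by (simp add: power_mult_distrib y_power flip: iota_power) (simp add: iota_hom)
  then have red: "(\<iota> \<zeta> * y) ^ m = ev f ^ (m div n) * (\<iota> \<zeta> * y) ^ (m mod n)"
    using power_add[of "\<iota> \<zeta> * y" "n * (m div n)" "m mod n"] by (simp add: power_mult)
  have "twist \<zeta> (y ^ m) = twist \<zeta> (rf (Fract (f ^ (m div n)) 1) * y ^ (m mod n))"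
    by (subst y_power_reduce) (simp add: rf_poly ev_power)
  also have "\<dots> = ev f ^ (m div n) * (\<iota> \<zeta> * y) ^ (m mod n)"
    using n_ge_2 by (simp only: twist_scale) (simp add: small rf_poly ev_power)
  finally show ?thesis using red by simp
qed

lemma twist_one: "\<zeta> ^ n = 1 \<Longrightarrow> twist \<zeta> 1 = 1"
  using twist_y_power[of \<zeta> 0] by simp

lemma twist_rf: "\<zeta> ^ n = 1 \<Longrightarrow> twist \<zeta> (rf r) = rf r"
  using twist_scale[of \<zeta> r 1] by (simp add: twist_one)

lemma twist_ev: "\<zeta> ^ n = 1 \<Longrightarrow> twist \<zeta> (ev h) = ev h"
  using twist_rf[of \<zeta> "Fract h 1"] by (simp add: rf_poly)

lemma twist_mult:
  assumes "\<zeta> ^ n = 1"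
  shows "twist \<zeta> (z * w) = twist \<zeta> z * twist \<zeta> w"
proof -
  have "z * w = comb (coord z) * comb (coord w)" by (simp add: comb_coord)
  also have "\<dots> = (\<Sum>i<n. \<Sum>j<n. rf (coord z i * coord w j) * y ^ (i + j))"
    unfolding comb_def sum_product by (intro sum.cong refl) (simp add: rf_hom power_add)
  finally have "twist \<zeta> (z * w) = (\<Sum>i<n. \<Sum>j<n. rf (coord z i * coord w j) * (\<iota> \<zeta> * y) ^ (i + j))"
    by (simp add: twist_sum twist_scale twist_y_power[OF assms])
  also have "\<dots> = twist \<zeta> z * twist \<zeta> w"
    unfolding twist_def sum_product by (intro sum.cong refl) (simp add: rf_hom power_add)
  finally show ?thesis .
qed

lemma twist_twist:
  assumes "\<zeta> ^ n = 1" "\<xi> ^ n = 1"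
  shows "twist \<zeta> (twist \<xi> z) = twist (\<zeta> * \<xi>) z"
proof -
  have "twist \<xi> z = (\<Sum>j<n. rf (coord z j * Fract [:\<xi> ^ j:] 1) * y ^ j)"
    unfolding twist_def
    by (intro sum.cong refl) (simp add: rf_hom rf_poly ev_const power_mult_distrib iota_power)
  then have "twist \<zeta> (twist \<xi> z) = (\<Sum>j<n. rf (coord z j * Fract [:\<xi> ^ j:] 1) * (\<iota> \<zeta> * y) ^ j)"
    by (simp add: twist_sum twist_scale twist_y_power[OF assms(1)])
  then show ?thesis unfolding twist_def
    by (simp add: rf_hom rf_poly ev_const power_mult_distrib iota_power iota_hom mult_ac)
qed

lemma twist_1: "twist 1 z = z"
  unfolding twist_def by (simp add: iota_hom flip: comb_def) (rule comb_coord)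

lemma twist_inverse:
  assumes "\<zeta> ^ n = 1"
  shows "twist \<zeta> (twist (inverse \<zeta>) z) = z" "twist (inverse \<zeta>) (twist \<zeta> z) = z"
proof -
  have "\<zeta> \<noteq> 0" using assms n_ge_2 by (auto simp: zero_power)
  then show "twist \<zeta> (twist (inverse \<zeta>) z) = z" "twist (inverse \<zeta>) (twist \<zeta> z) = z"
    using assms by (simp_all add: twist_twist power_inverse twist_1)
qed

lemma twist_zero: "twist \<zeta> 0 = 0"
  using twist_scale[of \<zeta> 0 0] by (simp add: rf_hom)

lemma twist_eq_0: "\<zeta> ^ n = 1 \<Longrightarrow> twist \<zeta> z = 0 \<longleftrightarrow> z = 0"
  using twist_inverse(2)[of \<zeta> z] twist_zero by metis

lemma twist_const: "\<zeta> ^ n = 1 \<Longrightarrow> twist \<zeta> (\<iota> a) = \<iota> a"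
  using twist_ev[of \<zeta> "[:a:]"] by (simp add: ev_const)

lemma twist_place:
  assumes v: "v \<in> places \<iota>" and z: "\<zeta> ^ n = 1"
  shows "(\<lambda>z. v (twist \<zeta> z)) \<in> places \<iota>"
proof -
  obtain t where t: "v t = 1" by (rule uniformizer[OF v]) blast
  have "v (twist \<zeta> (twist (inverse \<zeta>) t)) = 1" using twist_inverse(1)[OF z] t by simp
  then have ex: "\<exists>t. v (twist \<zeta> t) = 1" by blast
  show ?thesis
    unfolding places_def
  proof (intro CollectI conjI allI impI)
    show "v (twist \<zeta> 0) = 0" by (simp add: twist_zero place_zero[OF v])
    show "v (twist \<zeta> (a * b)) = v (twist \<zeta> a) + v (twist \<zeta> b)" if "a \<noteq> 0" "b \<noteq> 0" for a b
      using that by (simp add: twist_mult[OF z] place_mult[OF v] twist_eq_0[OF z])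
    show "min (v (twist \<zeta> a)) (v (twist \<zeta> b)) \<le> v (twist \<zeta> (a + b))"
      if "a \<noteq> 0" "b \<noteq> 0" "a + b \<noteq> 0" for a b
    proof -
      have "twist \<zeta> a + twist \<zeta> b \<noteq> 0" using that(3) twist_eq_0[OF z, of "a + b"] by (simp add: twist_add)
      then show ?thesis unfolding twist_add using that twist_eq_0[OF z] by (intro place_add[OF v]) auto
    qed
    show "v (twist \<zeta> (\<iota> a)) = 0" if "a \<noteq> 0" for a
      using that by (simp add: twist_const[OF z] place_const[OF v])
    show "\<exists>t. v (twist \<zeta> t) = 1" by (rule ex)
  qed
qed

lemma twist_x: "\<zeta> ^ n = 1 \<Longrightarrow> twist \<zeta> x = x"
  using twist_ev[of \<zeta> "[:0, 1:]"] by (simp add: ev_X)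

text \<open>The components of an element are averages of its conjugates. The factor at \<open>\<zeta>\<close> is the
  inverse of \<open>\<zeta>\<^sup>j\<close>.\<close>

lemma component_eq:
  assumes j: "j < n"
  shows "(\<Sum>\<zeta>\<in>{\<zeta>. \<zeta> ^ n = 1}. \<iota> (\<zeta> ^ (n - j)) * twist \<zeta> z) = of_nat n * (rf (coord z j) * y ^ j)"
proof -
  let ?U = "{\<zeta>::'a. \<zeta> ^ n = 1}"
  have s: "(\<Sum>\<zeta>\<in>?U. \<zeta> ^ (n - j) * \<zeta> ^ i) = (if i = j then of_nat n else 0)" if i: "i < n" for i
  proof (cases "i = j")
    case True
    have "(\<Sum>\<zeta>\<in>?U. \<zeta> ^ (n - j) * \<zeta> ^ i) = (\<Sum>\<zeta>\<in>?U. 1)"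
      using True j by (intro sum.cong) (auto simp flip: power_add)
    then show ?thesis using True card_roots_of_unity[OF n_dvd] by simp
  next
    case False
    have "\<not> n dvd n - j + i"
    proof
      assume "n dvd n - j + i"
      then obtain k where k: "n - j + i = n * k" by blast
      have "n * k < n * 2" "0 < n * k" using i j unfolding k[symmetric] by auto
      then have "k = 1" by (simp only: nat_mult_less_cancel_disj) auto
      then have "n - j + i = n" using k by simp
      then show False using False j by simp
    qed
    then show ?thesis using sum_roots_of_unity_powers[OF n_dvd, of "n - j + i"] False
      by (simp add: power_add)
  qed
  have "(\<Sum>\<zeta>\<in>?U. \<iota> (\<zeta> ^ (n - j)) * twist \<zeta> z)
      = (\<Sum>\<zeta>\<in>?U. \<Sum>i<n. rf (coord z i) * y ^ i * \<iota> (\<zeta> ^ (n - j) * \<zeta> ^ i))"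
    unfolding twist_def sum_distrib_left
    by (intro sum.cong refl) (simp add: power_mult_distrib iota_hom iota_power mult_ac)
  also have "\<dots> = (\<Sum>i<n. rf (coord z i) * y ^ i * \<iota> (\<Sum>\<zeta>\<in>?U. \<zeta> ^ (n - j) * \<zeta> ^ i))"
    by (subst sum.swap) (simp add: iota_sum sum_distrib_left)
  also have "\<dots> = (\<Sum>i<n. if i = j then of_nat n * (rf (coord z i) * y ^ i) else 0)"
    by (intro sum.cong refl) (simp add: s iota_hom iota_of_nat)
  finally show ?thesis using j by simp
qed

lemma component_pw:
  assumes v: "v \<in> places \<iota>" and z: "\<And>\<zeta>. \<zeta> ^ n = 1 \<Longrightarrow> twist \<zeta> z \<in> pw v m" and j: "j < n"
  shows "rf (coord z j) * y ^ j \<in> pw v m"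
proof -
  have "(\<Sum>\<zeta>\<in>{\<zeta>. \<zeta> ^ n = 1}. \<iota> (\<zeta> ^ (n - j)) * twist \<zeta> z) \<in> pw v m"
    using pw_mult[OF v pw_const[OF v emb] z] by (intro pw_sum[OF v]) simp
  then have "of_nat n * (rf (coord z j) * y ^ j) \<in> pw v m" by (simp add: component_eq[OF j])
  then have "\<iota> (inverse (of_nat n)) * (of_nat n * (rf (coord z j) * y ^ j)) \<in> pw v (0 + m)"
    by (rule pw_mult[OF v pw_const[OF v emb]])
  then show ?thesis using of_nat_n by (simp add: iota_inverse iota_of_nat mult.assoc[symmetric])
qed

section \<open>The places over a place of the rational function field\<close>

lemma coord_diff_one: "j < n \<Longrightarrow> coord (z - 1) j = coord z j - (if j = 0 then 1 else 0)"
proof -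
  assume j: "j < n"
  have one: "(\<Sum>i<n. (if i = 0 then rf 1 * y ^ i else 0)) = 1"
    using n_ge_2 by (simp add: rf_hom)
  have "comb (\<lambda>i. coord z i - (if i = 0 then 1 else 0)) = (\<Sum>i<n. rf (coord z i) * y ^ i - (if i = 0 then rf 1 * y ^ i else 0))"
    unfolding comb_def by (intro sum.cong) (auto simp: rf_diff rf_hom algebra_simps)
  also have "\<dots> = z - 1" unfolding sum_subtractf one by (simp flip: comb_def add: comb_coord)
  finally show ?thesis using coord_comb[OF j, of "\<lambda>i. coord z i - (if i = 0 then 1 else 0)"] by simp
qed

definition orbit :: "'k place \<Rightarrow> 'k place set" where
  "orbit v = (\<lambda>\<zeta>. (\<lambda>z. v (twist \<zeta> z))) ` {\<zeta>. \<zeta> ^ n = 1}"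

lemma finite_orbit: "finite (orbit v)"
  by (simp add: orbit_def)

lemma orbit_places: "v \<in> places \<iota> \<Longrightarrow> orbit v \<subseteq> places \<iota>"
  by (auto simp: orbit_def intro: twist_place)

text \<open>Two places with the same restriction to the rational functions are conjugate: otherwise
  there is an element that is small at the conjugates of one and close to \<open>1\<close> at those of the
  other, and its trace contradicts the assumption.\<close>

lemma same_restriction_conjugate:
  assumes v: "v \<in> places \<iota>" and w: "w \<in> places \<iota>"
    and same: "\<And>r. 0 < v (rf r) \<Longrightarrow> 0 < w (rf r)"
  shows "w \<in> orbit v"
proof (rule ccontr)
  assume nw: "w \<notin> orbit v"
  have disj: "orbit v \<inter> orbit w = {}"
  proof (rule ccontr)
    assume "orbit v \<inter> orbit w \<noteq> {}"
    then obtain \<zeta> \<xi> where z: "\<zeta> ^ n = 1" "\<xi> ^ n = 1" "(\<lambda>z. v (twist \<zeta> z)) = (\<lambda>z. w (twist \<xi> z))"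
      by (auto simp: orbit_def)
    have "w z = v (twist (\<zeta> * inverse \<xi>) z)" for z
    proof -
      have "w z = w (twist \<xi> (twist (inverse \<xi>) z))" using twist_inverse[OF z(2)] by simp
      also have "\<dots> = v (twist \<zeta> (twist (inverse \<xi>) z))" using fun_cong[OF z(3)] by simp
      also have "\<dots> = v (twist (\<zeta> * inverse \<xi>) z)" using z by (simp add: twist_twist power_inverse)
      finally show ?thesis .
    qed
    then have "w = (\<lambda>z. v (twist (\<zeta> * inverse \<xi>) z))" by (simp add: fun_eq_iff)
    moreover have "(\<zeta> * inverse \<xi>) ^ n = 1" using z by (simp add: power_mult_distrib power_inverse)
    ultimately show False using nw by (auto simp: orbit_def)
  qed
  have S: "finite (orbit v \<union> orbit w)" "orbit v \<union> orbit w \<subseteq> places \<iota>"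
    using finite_orbit orbit_places v w by auto
  obtain z where z: "\<forall>u\<in>orbit v \<union> orbit w. z - (if u \<in> orbit v then 0 else 1) \<in> pw u 1"
    using weak_approximation[OF S, of "\<lambda>u. if u \<in> orbit v then 0 else 1" "\<lambda>_. 1"] by blast
  have n0: "0 < n" using n_ge_2 by simp
  have "rf (coord z 0) * y ^ 0 \<in> pw v 1"
  proof (rule component_pw[OF v _ n0])
    fix \<zeta> :: 'a assume \<zeta>: "\<zeta> ^ n = 1"
    then have u: "(\<lambda>z. v (twist \<zeta> z)) \<in> orbit v" by (auto simp: orbit_def)
    then have "z - 0 \<in> pw (\<lambda>z. v (twist \<zeta> z)) 1" using bspec[OF z UnI1[OF u]] by (simp only: if_True)
    then show "twist \<zeta> z \<in> pw v 1" using \<zeta> by (simp add: pw_def twist_eq_0)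
  qed
  then have v1: "rf (coord z 0) \<in> pw v 1" by simp
  have "rf (coord (z - 1) 0) * y ^ 0 \<in> pw w 1"
  proof (rule component_pw[OF w _ n0])
    fix \<zeta> :: 'a assume \<zeta>: "\<zeta> ^ n = 1"
    then have u: "(\<lambda>z. w (twist \<zeta> z)) \<in> orbit w" by (auto simp: orbit_def)
    then have "(\<lambda>z. w (twist \<zeta> z)) \<notin> orbit v" using disj by blast
    then have "z - 1 \<in> pw (\<lambda>z. w (twist \<zeta> z)) 1" using bspec[OF z UnI2[OF u]] by (simp only: if_False)
    then show "twist \<zeta> (z - 1) \<in> pw w 1" using \<zeta> by (simp only: pw_def mem_Collect_eq twist_eq_0)
  qed
  then have w1: "rf (coord z 0) - 1 \<in> pw w 1" using n0 by (simp add: coord_diff_one rf_diff rf_hom)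
  have "1 + (rf (coord z 0) - 1) \<noteq> 0" "w (1 + (rf (coord z 0) - 1)) = w 1"
    using place_add_dominant[OF w, of 1 "rf (coord z 0) - 1"] w1 by (simp_all add: place_one[OF w])
  then have "rf (coord z 0) \<noteq> 0" "w (rf (coord z 0)) = 0" by (simp_all add: place_one[OF w])
  then show False using v1 same[of "coord z 0"] by (simp add: pw_def)
qed

text \<open>Weak approximation gives an element with value \<open>1\<close> at all conjugates of \<open>v\<close>. Its components
  have value at least \<open>1\<close>, and one of them has value exactly \<open>1\<close>. As the values of components are
  easily written down, this determines the ramification.\<close>

lemma component_value_one:
  assumes v: "v \<in> places \<iota>"
  shows "\<exists>r j. j < n \<and> rf r * y ^ j \<noteq> 0 \<and> v (rf r * y ^ j) = 1"
proof -
  have "\<forall>u\<in>orbit v. \<exists>t. u t = 1" using orbit_places[OF v] by (auto simp: places_def)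
  then obtain t where t: "\<forall>u\<in>orbit v. u (t u) = 1" by (rule bchoice[THEN exE])
  \<comment> \<open>An error of value at least \<open>2\<close> does not change the value \<open>1\<close>.\<close>
  obtain z where z: "\<forall>u\<in>orbit v. z - t u \<in> pw u 2"
    using weak_approximation[OF finite_orbit orbit_places[OF v], of t "\<lambda>_. 2"] by blast
  have uz: "u z = 1" "z \<noteq> 0" if u: "u \<in> orbit v" for u
  proof -
    have up: "u \<in> places \<iota>" using u orbit_places[OF v] by blast
    have tu: "u (t u) = 1" "z - t u \<in> pw u 2" using t z u by auto
    then have "t u \<noteq> 0" using place_zero[OF up] by auto
    then have "t u + (z - t u) \<noteq> 0" "u (t u + (z - t u)) = 1"
      using place_add_dominant[OF up, of "t u" "z - t u"] tu by simp_all
    then show "u z = 1" "z \<noteq> 0" by simp_all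
  qed
  have comp: "rf (coord z j) * y ^ j \<in> pw v 1" if "j < n" for j
  proof (rule component_pw[OF v _ that])
    fix \<zeta> :: 'a assume \<zeta>: "\<zeta> ^ n = 1"
    then have "(\<lambda>z. v (twist \<zeta> z)) \<in> orbit v" by (auto simp: orbit_def)
    then have "v (twist \<zeta> z) = 1" using uz(1) by blast
    then show "twist \<zeta> z \<in> pw v 1" by (simp add: pw_def)
  qed
  have "v \<in> orbit v" unfolding orbit_def by (rule image_eqI[of _ _ 1]) (simp_all add: twist_1)
  then have vz: "v z = 1" "z \<noteq> 0" using uz by auto
  have "\<exists>j<n. rf (coord z j) * y ^ j \<notin> pw v 2"
  proof (rule ccontr)
    assume "\<not> ?thesis"
    then have "(\<Sum>j<n. rf (coord z j) * y ^ j) \<in> pw v 2" by (intro pw_sum[OF v]) auto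
    then have "z \<in> pw v 2" by (simp flip: comb_def add: comb_coord)
    then show False using vz by (simp add: pw_def)
  qed
  then obtain j where j: "j < n" "rf (coord z j) * y ^ j \<notin> pw v 2" by blast
  then have "rf (coord z j) * y ^ j \<noteq> 0" "v (rf (coord z j) * y ^ j) = 1"
    using comp[OF j(1)] by (auto simp: pw_def)
  then show ?thesis using j(1) by blast
qed

definition cc :: nat where "cc = gcd n d"
definition nn :: nat where "nn = n div cc"
definition dd :: nat where "dd = d div cc"

lemma cc_pos: "0 < cc" and n_eq: "n = cc * nn" and d_eq: "d = cc * dd" and nn_pos: "0 < nn"
  and coprime_nn_dd: "coprime nn dd"
proof -
  show c: "0 < cc" using n_ge_2 by (simp add: cc_def)
  show n: "n = cc * nn" and d: "d = cc * dd" by (simp_all add: cc_def nn_def dd_def)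
  show "0 < nn" using n n_ge_2 by (cases nn) auto
  show "coprime nn dd" unfolding nn_def dd_def cc_def
    using n_ge_2 by (intro div_gcd_coprime) simp
qed

lemma inf_rf_value:
  assumes v: "v \<in> places \<iota>" and x: "v x < 0"
  shows "rf r = ev a / ev b \<Longrightarrow> a \<noteq> 0 \<Longrightarrow> b \<noteq> 0 \<Longrightarrow> v (rf r) = (int (degree a) - int (degree b)) * v x"
  using place_inf_value[OF assms] by (simp add: place_divide[OF v] ev_eq_0 left_diff_distrib)

text \<open>Since \<open>n v(y) = d v(x)\<close>, there is an integer \<open>e\<close> with \<open>v(x) = e nn\<close> and \<open>v(y) = e dd\<close>. It
  divides the values of all components, one of which is \<open>1\<close>.\<close>

lemma inf_values:
  assumes v: "v \<in> places \<iota>" and x: "v x < 0"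
  shows "v x = - int nn" "v y = - int dd"
proof -
  have "int n * v y = int d * v x"
    using place_y_value[OF v] place_inf_value[OF v x f_ne_0] degree_f by simp
  then have "int cc * (int nn * v y) = int cc * (int dd * v x)"
    using n_eq d_eq by (metis mult.assoc of_nat_mult)
  then have eq: "int nn * v y = int dd * v x" using cc_pos by simp
  have "coprime (int nn) (int dd)" using coprime_nn_dd by simp
  moreover have "int nn dvd int dd * v x" using eq by (metis dvd_triv_left)
  ultimately have "int nn dvd v x" by (simp add: coprime_dvd_mult_right_iff)
  then obtain e where e: "v x = int nn * e" by blast
  then have "int nn * v y = int nn * (int dd * e)" using eq by (simp add: mult_ac)
  then have ey: "v y = int dd * e" using nn_pos by simp
  have "e < 0" using e x by (simp add: mult_less_0_iff)
  obtain r j where rj: "rf r * y ^ j \<noteq> 0" "v (rf r * y ^ j) = 1"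
    using component_value_one[OF v] by blast
  obtain a b where ab: "rf r = ev a / ev b" "b \<noteq> 0" by (rule rf_cases[of r]) blast
  then have "a \<noteq> 0" using rj by (auto simp: ev_0)
  have "1 = v (rf r) + int j * v y"
    using rj by (simp add: place_mult[OF v] place_power[OF v])
  also have "\<dots> = e * ((int (degree a) - int (degree b)) * int nn + int j * int dd)"
    using inf_rf_value[OF v x ab(1) \<open>a \<noteq> 0\<close> ab(2)] by (simp add: e ey algebra_simps)
  finally have "e dvd 1" by (metis dvd_triv_left)
  then have "e = - 1" using \<open>e < 0\<close> by (simp add: zdvd1_eq)
  then show "v x = - int nn" "v y = - int dd" using e ey by simp_all
qed

text \<open>As at infinity, a component with value \<open>1\<close> shows that the values of \<open>p(x)\<close> and \<open>y\<close> have no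
  common divisor beyond what \<open>y\<^sup>n = f(x)\<close> enforces.\<close>

lemma fin_values:
  assumes v: "v \<in> places \<iota>" and x: "0 \<le> v x" and p: "prime_elem p" "0 < v (ev p)"
  shows "p dvd f \<Longrightarrow> v y = 1" "\<not> p dvd f \<Longrightarrow> v y = 0" "\<not> p dvd f \<Longrightarrow> v (ev p) = 1"
proof -
  obtain r j where rj: "rf r * y ^ j \<noteq> 0" "v (rf r * y ^ j) = 1"
    using component_value_one[OF v] by blast
  obtain m where m: "v (rf r) = m * v (ev p)" using place_rf_value[OF p(1), of r] v x p by blast
  have one: "1 = m * v (ev p) + int j * v y"
    using rj m by (simp add: place_mult[OF v] place_power[OF v])
  have ny: "int n * v y = (if p dvd f then v (ev p) else 0)"
    using place_y_value[OF v] place_f_value[OF v x p] by simp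
  show "v y = 1" if "p dvd f"
  proof -
    have e: "v (ev p) = int n * v y" using ny that by simp
    then have vy: "0 < v y" using p(2) by (simp add: zero_less_mult_iff)
    have "1 = v y * (m * int n + int j)" using one unfolding e by (simp add: algebra_simps)
    then have "v y dvd 1" by (metis dvd_triv_left)
    then show ?thesis using vy by (simp add: zdvd1_eq)
  qed
  show vy: "v y = 0" if "\<not> p dvd f" using ny that n_ge_2 by simp
  show "v (ev p) = 1" if "\<not> p dvd f"
  proof -
    have "1 = v (ev p) * m" using one vy[OF that] by (simp add: mult.commute)
    then have "v (ev p) dvd 1" by (metis dvd_triv_left)
    then show ?thesis using p(2) by (simp add: zdvd1_eq)
  qed
qed

definition Pf :: "'k place set" where "Pf = {v \<in> places \<iota>. 0 \<le> v x}"
definition Pinf :: "'k place set" where "Pinf = {v \<in> places \<iota>. v x < 0}"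

lemma PfD: "v \<in> Pf \<Longrightarrow> v \<in> places \<iota>" "v \<in> Pf \<Longrightarrow> 0 \<le> v x"
  and PinfD: "v \<in> Pinf \<Longrightarrow> v \<in> places \<iota>" "v \<in> Pinf \<Longrightarrow> v x < 0"
  and places_Un: "places \<iota> = Pf \<union> Pinf" and Pf_Pinf: "Pf \<inter> Pinf = {}"
  by (auto simp: Pf_def Pinf_def)

lemma Pf_prime: "v \<in> Pf \<Longrightarrow> \<exists>p. prime_elem p \<and> 0 < v (ev p)"
  using place_prime_exists[of v] by (auto simp: Pf_def)

lemma Pf_y:
  assumes v: "v \<in> Pf"
  shows "v y = (if 0 < v (ev f) then 1 else 0)"
proof -
  obtain p where p: "prime_elem p" "0 < v (ev p)" using Pf_prime[OF v] by blast
  show ?thesis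
    using fin_values(1,2)[OF PfD[OF v] p] place_prime_value(1)[OF PfD[OF v] p f_ne_0] by simp
qed

lemma Pf_twist: "v \<in> Pf \<Longrightarrow> \<zeta> ^ n = 1 \<Longrightarrow> (\<lambda>z. v (twist \<zeta> z)) \<in> Pf"
  and Pinf_twist: "v \<in> Pinf \<Longrightarrow> \<zeta> ^ n = 1 \<Longrightarrow> (\<lambda>z. v (twist \<zeta> z)) \<in> Pinf"
  by (auto simp: Pf_def Pinf_def twist_x twist_place)

text \<open>All places at infinity are conjugate, because on rational functions they are proportional to
  the degree.\<close>

lemma finite_Pinf: "finite Pinf"
proof -
  obtain v where v: "v \<in> Pinf" using ex_place_at_infinity by (auto simp: Pinf_def)
  have "Pinf \<subseteq> orbit v"
  proof
    fix w assume w: "w \<in> Pinf"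
    show "w \<in> orbit v"
    proof (rule same_restriction_conjugate[OF PinfD(1)[OF v] PinfD(1)[OF w]])
      fix r assume pos: "0 < v (rf r)"
      obtain a b where ab: "rf r = ev a / ev b" "b \<noteq> 0" by (rule rf_cases[of r]) blast
      have "a \<noteq> 0" using pos ab place_zero[OF PinfD(1)[OF v]] by (auto simp: ev_0)
      then show "0 < w (rf r)"
        using pos inf_rf_value[OF PinfD[OF v] ab(1) _ ab(2)] inf_rf_value[OF PinfD[OF w] ab(1) _ ab(2)]
          PinfD(2)[OF v] PinfD(2)[OF w] by (simp add: zero_less_mult_iff)
    qed
  qed
  then show ?thesis using finite_orbit finite_subset by blast
qed

text \<open>All places over \<open>p\<close> are conjugate.\<close>

lemma finite_Pf_prime:
  assumes p: "prime_elem p"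
  shows "finite {v\<in>Pf. 0 < v (ev p)}"
proof (cases "{v\<in>Pf. 0 < v (ev p)} = {}")
  case True then show ?thesis by (simp only: finite.emptyI)
next
  case False
  then obtain v where v: "v \<in> Pf" "0 < v (ev p)" by blast
  have "{v\<in>Pf. 0 < v (ev p)} \<subseteq> orbit v"
  proof
    fix w assume "w \<in> {v\<in>Pf. 0 < v (ev p)}"
    then have w: "w \<in> Pf" "0 < w (ev p)" by auto
    show "w \<in> orbit v"
    proof (rule same_restriction_conjugate[OF PfD(1)[OF v(1)] PfD(1)[OF w(1)]])
      fix r assume pos: "0 < v (rf r)"
      obtain m where m: "\<forall>v\<in>places \<iota>. 0 \<le> v x \<longrightarrow> 0 < v (ev p) \<longrightarrow> v (rf r) = m * v (ev p)"
        using place_rf_value[OF p, of r] by blast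
      then have "v (rf r) = m * v (ev p)" "w (rf r) = m * w (ev p)" using v w by (auto simp: Pf_def)
      then show "0 < w (rf r)" using pos v(2) w(2) by (simp add: zero_less_mult_iff)
    qed
  qed
  then show ?thesis using finite_orbit finite_subset by blast
qed

lemma finite_Pf_zeros:
  assumes h: "h \<noteq> 0"
  shows "finite {v\<in>Pf. 0 < v (ev h)}"
proof -
  let ?D = "{p. p dvd h}"
  have "?D \<subseteq> {p. \<forall>i\<ge>Suc (degree h). coeff p i = 0}"
  proof
    fix p assume "p \<in> ?D"
    then have "degree p \<le> degree h" using dvd_imp_degree_le[OF _ h] by simp
    then show "p \<in> {p. \<forall>i\<ge>Suc (degree h). coeff p i = 0}" by (auto intro: coeff_eq_0)
  qed
  then have "finite ?D" using finite_polys_degree_less finite_subset by blast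
  then have "finite (\<Union>p\<in>{p\<in>?D. prime_elem p}. {v\<in>Pf. 0 < v (ev p)})"
    using finite_Pf_prime by auto
  moreover have "{v\<in>Pf. 0 < v (ev h)} \<subseteq> (\<Union>p\<in>{p\<in>?D. prime_elem p}. {v\<in>Pf. 0 < v (ev p)})"
  proof
    fix v assume "v \<in> {v\<in>Pf. 0 < v (ev h)}"
    then have v: "v \<in> Pf" "0 < v (ev h)" by auto
    obtain p where p: "prime_elem p" "0 < v (ev p)" using Pf_prime[OF v(1)] by blast
    then have "p dvd h" using place_prime_value(1)[OF PfD[OF v(1)] p h] v(2) by blast
    then show "v \<in> (\<Union>p\<in>{p\<in>?D. prime_elem p}. {v\<in>Pf. 0 < v (ev p)})" using p v by blast
  qed
  ultimately show ?thesis using finite_subset by blast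
qed

section \<open>Integral elements\<close>

definition pcomb :: "(nat \<Rightarrow> 'a poly) \<Rightarrow> 'k" where
  "pcomb p = (\<Sum>j<n. ev (p j) * y ^ j)"

lemma pcomb_comb: "pcomb p = comb (\<lambda>j. Fract (p j) 1)"
  by (simp add: pcomb_def comb_def rf_poly)

lemma pcomb_inj: "pcomb p = pcomb q \<Longrightarrow> j < n \<Longrightarrow> p j = q j"
  using comb_inj[of "\<lambda>j. Fract (p j) 1" "\<lambda>j. Fract (q j) 1" j] by (simp add: pcomb_comb eq_fract)

lemma Pf_y_pw: "v \<in> Pf \<Longrightarrow> y ^ j \<in> pw v 0"
  using Pf_y[of v] by (simp add: pw_def place_power[OF PfD(1)])

lemma Pf_ev_pw: "v \<in> Pf \<Longrightarrow> ev h \<in> pw v 0"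
  using ev_pw PfD by blast

lemma Pf_ev_nonneg: "v \<in> Pf \<Longrightarrow> 0 \<le> v (ev h)"
  using ev_nonneg PfD by blast

lemma pcomb_pw: "v \<in> Pf \<Longrightarrow> pcomb p \<in> pw v 0"
  unfolding pcomb_def
  using pw_mult[OF PfD(1) Pf_ev_pw Pf_y_pw] by (intro pw_sum[OF PfD(1)]) auto

text \<open>A prime \<open>\<pi>\<close> in the denominator would have to be compensated by \<open>y\<^sup>j\<close>, but \<open>n v(y) \<le> v(\<pi>(x))\<close>
  and \<open>j < n\<close>.\<close>

lemma integral_component:
  assumes int: "\<And>v. v \<in> Pf \<Longrightarrow> rf r * y ^ j \<in> pw v 0" and j: "j < n"
  shows "\<exists>p. rf r = ev p"
proof -
  let ?P = "\<lambda>q. q \<noteq> 0 \<and> (\<exists>p. rf r = ev p / ev q)"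
  obtain p0 q0 where "rf r = ev p0 / ev q0" "q0 \<noteq> 0" by (rule rf_cases[of r]) blast
  then have "?P q0" by blast
  then obtain q where Pq: "?P q" and min: "\<And>q'. ?P q' \<Longrightarrow> degree q \<le> degree q'"
    using ex_has_least_nat[of ?P q0 degree] by blast
  then obtain p where q: "q \<noteq> 0" "rf r = ev p / ev q" by blast
  have "degree q = 0"
  proof (rule ccontr)
    assume "degree q \<noteq> 0"
    then obtain \<pi> where \<pi>: "prime_elem \<pi>" "\<pi> dvd q" using ex_prime_divisor_poly[of q] by auto
    then obtain q' where q': "q = \<pi> * q'" by blast
    have ne: "\<pi> \<noteq> 0" "q' \<noteq> 0" using q q' by auto
    have np: "\<not> \<pi> dvd p"
    proof
      assume "\<pi> dvd p"
      then obtain p' where "p = \<pi> * p'" by blast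
      then have "rf r = ev p' / ev q'" using q q' ne by (simp add: ev_mult ev_eq_0)
      then have "degree q \<le> degree q'" using min ne(2) by blast
      then show False using ne prime_elem_degree[OF \<pi>(1)] q' by (simp add: degree_mult_eq)
    qed
    then have p0: "p \<noteq> 0" by auto
    obtain v where v0: "v \<in> places \<iota>" "0 < v (ev \<pi>)" "0 \<le> v x"
      using ex_place_over_prime[OF \<pi>(1)] by blast
    then have v: "v \<in> Pf" by (simp add: Pf_def)
    note val = place_prime_value[OF v0(1,3) \<pi>(1) v0(2)]
    have vp: "v (ev p) = 0" using val(1)[OF p0] np Pf_ev_nonneg[OF v, of p] by simp
    have vq: "v (ev \<pi>) \<le> v (ev q)"
      using Pf_ev_nonneg[OF v, of q'] ne by (simp add: q' ev_mult place_mult[OF v0(1)] ev_eq_0)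
    have nz: "rf r * y ^ j \<noteq> 0" using q p0 y_ne_0 by (simp add: ev_eq_0)
    have "0 \<le> v (rf r * y ^ j)" using int[OF v] pw_iff[OF v0(1) nz] by blast
    then have "0 \<le> int j * v y - v (ev q)"
      using q p0 y_ne_0 vp by (simp add: place_mult[OF v0(1)] place_divide[OF v0(1)] place_power[OF v0(1)] ev_eq_0)
    then have "v (ev \<pi>) \<le> int j * v y" using vq by simp
    then have "int n * v (ev \<pi>) \<le> int j * (int n * v y)"
      using mult_left_mono[of "v (ev \<pi>)" "int j * v y" "int n"] by (simp add: mult_ac)
    also have "int n * v y \<le> v (ev \<pi>)"
      unfolding place_y_value[OF v0(1)] place_f_value[OF v0(1,3) \<pi>(1) v0(2)] using v0(2) by simp
    then have "int j * (int n * v y) \<le> int j * v (ev \<pi>)" by (intro mult_left_mono) auto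
    also have "int j * v (ev \<pi>) < int n * v (ev \<pi>)" using j v0(2) by simp
    finally show False by simp
  qed
  then obtain a where a: "q = [:a:]" by (rule degree_eq_zeroE)
  then have "rf r = ev (smult (inverse a) p)"
    using q by (simp add: ev_const ev_smult iota_inverse divide_inverse)
  then show ?thesis ..
qed

text \<open>The components of a function without finite poles are averages of conjugates, which have no
  finite poles either.\<close>

lemma integral_iff: "(\<forall>v\<in>Pf. z \<in> pw v 0) \<longleftrightarrow> z \<in> range pcomb"
proof
  assume int: "\<forall>v\<in>Pf. z \<in> pw v 0"
  have "\<exists>p. rf (coord z j) = ev p" if j: "j < n" for j
  proof (rule integral_component[OF _ j])
    fix v assume v: "v \<in> Pf"
    show "rf (coord z j) * y ^ j \<in> pw v 0"
    proof (rule component_pw[OF PfD(1)[OF v] _ j])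
      fix \<zeta> :: 'a assume \<zeta>: "\<zeta> ^ n = 1"
      have "z \<in> pw (\<lambda>z. v (twist \<zeta> z)) 0" using int Pf_twist[OF v \<zeta>] by blast
      then show "twist \<zeta> z \<in> pw v 0" using \<zeta> by (auto simp: pw_def twist_eq_0)
    qed
  qed
  then obtain p where p: "\<And>j. j < n \<Longrightarrow> rf (coord z j) = ev (p j)" by metis
  have "z = (\<Sum>j<n. rf (coord z j) * y ^ j)" by (simp flip: comb_def add: comb_coord)
  also have "\<dots> = pcomb p" unfolding pcomb_def by (intro sum.cong) (auto simp: p)
  finally show "z \<in> range pcomb" by blast
qed (auto simp: pcomb_pw)

lemma coord_pcomb: "j < n \<Longrightarrow> rf (coord (pcomb p) j) = ev (p j)"
  by (simp add: pcomb_comb coord_comb rf_poly)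

subsection \<open>Functions with poles at infinity\<close>

text \<open>The functions whose poles at the places of \<open>T\<close> are bounded by \<open>G\<close>. If \<open>T\<close> is the set of all
  places, this is a Riemann-Roch space; if it is the set of finite places, strong approximation
  applies.\<close>

definition Lsp :: "'k place set \<Rightarrow> 'k divisor \<Rightarrow> 'k set" where
  "Lsp T G = {z. \<forall>v\<in>T. z \<in> pw v (- G v)}"

abbreviation (input) L :: "'k divisor \<Rightarrow> 'k set" where
  "L \<equiv> Lsp (places \<iota>)"

text \<open>The divisor \<open>m D\<^sub>\<infinity>\<close>.\<close>

definition mD :: "int \<Rightarrow> 'k divisor" where
  "mD m = (\<lambda>v. m * of_bool (v \<in> Pinf))"

text \<open>The number of exponents \<open>k\<close> for which \<open>x\<^sup>k y\<^sup>j\<close> has poles of order at most \<open>m\<close> at infinity.\<close>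

definition bound :: "int \<Rightarrow> nat \<Rightarrow> nat" where
  "bound m j = nat ((m - int dd * int j) div int nn + 1)"

lemma bound_iff: "int nn * int k + int dd * int j \<le> m \<longleftrightarrow> k < bound m j"
proof -
  have "int nn * int k + int dd * int j \<le> m \<longleftrightarrow> int k * int nn \<le> m - int dd * int j"
    by (simp add: algebra_simps)
  also have "\<dots> \<longleftrightarrow> int k \<le> (m - int dd * int j) div int nn"
  proof
    assume "int k * int nn \<le> m - int dd * int j"
    then have "int k * int nn div int nn \<le> (m - int dd * int j) div int nn"
      using nn_pos by (intro zdiv_mono1) auto
    then show "int k \<le> (m - int dd * int j) div int nn" using nn_pos by simp
  next
    assume "int k \<le> (m - int dd * int j) div int nn"
    then have "int k * int nn \<le> (m - int dd * int j) div int nn * int nn" by (intro mult_right_mono) auto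
    also have "\<dots> \<le> m - int dd * int j"
      using nn_pos pos_mod_sign[of "int nn" "m - int dd * int j"]
        div_mult_mod_eq[of "m - int dd * int j" "int nn"] by linarith
    finally show "int k * int nn \<le> m - int dd * int j" .
  qed
  also have "\<dots> \<longleftrightarrow> k < bound m j" unfolding bound_def zless_nat_eq_int_zless by linarith
  finally show ?thesis .
qed

definition polys_below :: "(nat \<Rightarrow> nat) \<Rightarrow> (nat \<Rightarrow> 'a poly) set" where
  "polys_below k = {p. \<forall>j<n. \<forall>i\<ge>k j. coeff (p j) i = 0}"

lemma coeff_zero_iff_degree: "(\<forall>i\<ge>k. coeff p i = 0) \<longleftrightarrow> p = 0 \<or> degree p < k"
  by (metis coeff_0 coeff_eq_0 leading_coeff_0_iff le_less_trans not_le order.strict_trans2)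

text \<open>The components of a function in the space are averages of conjugates, so they lie in the
  space themselves. At infinity the monomials in a component have different pole orders, so each
  of them lies in the space.\<close>

lemma Lsp_mD: "L (mD m) = pcomb ` polys_below (bound m)"
proof (intro equalityI subsetI)
  fix z assume z: "z \<in> L (mD m)"
  have "\<forall>v\<in>Pf. z \<in> pw v 0"
  proof
    fix v assume v: "v \<in> Pf"
    then have "v \<notin> Pinf" using Pf_Pinf by blast
    then show "z \<in> pw v 0" using z v places_Un unfolding Lsp_def mD_def by force
  qed
  then obtain p where p: "z = pcomb p" using integral_iff by blast
  obtain v where v: "v \<in> Pinf" using ex_place_at_infinity by (auto simp: Pinf_def)
  have inf: "z \<in> pw w (- m)" if "w \<in> Pinf" for w
    using z that places_Un unfolding Lsp_def mD_def by force
  have "p j = 0 \<or> degree (p j) < bound m j" if j: "j < n" for j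
  proof (cases "p j = 0")
    case False
    note pj = this
    have "rf (coord z j) * y ^ j \<in> pw v (- m)"
    proof (rule component_pw[OF PinfD(1)[OF v] _ j])
      fix \<zeta> :: 'a assume \<zeta>: "\<zeta> ^ n = 1"
      have "z \<in> pw (\<lambda>z. v (twist \<zeta> z)) (- m)" using inf Pinf_twist[OF v \<zeta>] by blast
      then show "twist \<zeta> z \<in> pw v (- m)" using \<zeta> by (auto simp: pw_def twist_eq_0)
    qed
    then have "- m \<le> v (ev (p j) * y ^ j)"
      using pj y_ne_0 unfolding p coord_pcomb[OF j] by (simp add: pw_def ev_eq_0)
    then have "- m \<le> int (degree (p j)) * - int nn + int j * - int dd"
      using pj y_ne_0 place_inf_value[OF PinfD[OF v] pj] inf_values[OF PinfD[OF v]]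
      by (simp add: place_mult[OF PinfD(1)[OF v]] place_power[OF PinfD(1)[OF v]] ev_eq_0)
    then have "int nn * int (degree (p j)) + int dd * int j \<le> m" by (simp add: algebra_simps)
    then have "degree (p j) < bound m j" by (simp only: bound_iff)
    then show ?thesis ..
  qed simp
  then have "p \<in> polys_below (bound m)" unfolding polys_below_def coeff_zero_iff_degree by blast
  then show "z \<in> pcomb ` polys_below (bound m)" using p by blast
next
  fix z assume "z \<in> pcomb ` polys_below (bound m)"
  then obtain p where p: "z = pcomb p" "\<And>j. j < n \<Longrightarrow> p j = 0 \<or> degree (p j) < bound m j"
    unfolding polys_below_def coeff_zero_iff_degree by blast
  show "z \<in> L (mD m)"
    unfolding Lsp_def
  proof (rule CollectI, rule ballI)
    fix v assume v: "v \<in> places \<iota>"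
    show "z \<in> pw v (- mD m v)"
    proof (cases "v \<in> Pinf")
      case False
      then have "v \<in> Pf" using v places_Un by blast
      then show ?thesis using pcomb_pw False p(1) by (simp add: mD_def)
    next
      case True
      have "ev (p j) * y ^ j \<in> pw v (- m)" if j: "j < n" for j
      proof (cases "p j = 0")
        case True then show ?thesis by (simp add: ev_0 pw_def)
      next
        case False
        then have "int nn * int (degree (p j)) + int dd * int j \<le> m" using p(2)[OF j] by (simp only: bound_iff) simp
        moreover have "v (ev (p j) * y ^ j) = int (degree (p j)) * - int nn + int j * - int dd"
          using False y_ne_0 place_inf_value[OF PinfD[OF True] False] inf_values[OF PinfD[OF True]]
          by (simp add: place_mult[OF v] place_power[OF v] ev_eq_0)
        ultimately show ?thesis by (simp add: pw_def algebra_simps)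
      qed
      then have "z \<in> pw v (- m)" unfolding p(1) pcomb_def by (intro pw_sum[OF v]) auto
      then show ?thesis using True by (simp add: mD_def)
    qed
  qed
qed

lemma card_pcomb_polys_below:
  shows "card (pcomb ` polys_below k) = CARD('a) ^ (\<Sum>j<n. k j)" "finite (pcomb ` polys_below k)"
proof -
  let ?S = "\<lambda>j. {p :: 'a poly. \<forall>i\<ge>k j. coeff p i = 0}"
  have eq: "pcomb ` polys_below k = pcomb ` (\<Pi>\<^sub>E j\<in>{..<n}. ?S j)"
  proof (intro equalityI subsetI)
    fix z assume "z \<in> pcomb ` polys_below k"
    then obtain p where p: "z = pcomb p" "p \<in> polys_below k" by blast
    have "z = pcomb (restrict p {..<n})" unfolding p(1) pcomb_def by (intro sum.cong) auto
    moreover have "restrict p {..<n} \<in> (\<Pi>\<^sub>E j\<in>{..<n}. ?S j)" using p(2) by (auto simp: polys_below_def)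
    ultimately show "z \<in> pcomb ` (\<Pi>\<^sub>E j\<in>{..<n}. ?S j)" by blast
  next
    fix z assume "z \<in> pcomb ` (\<Pi>\<^sub>E j\<in>{..<n}. ?S j)"
    then obtain p where p: "z = pcomb p" "p \<in> (\<Pi>\<^sub>E j\<in>{..<n}. ?S j)" by blast
    have "p j \<in> ?S j" if "j < n" for j using PiE_mem[OF p(2), of j] that by simp
    then show "z \<in> pcomb ` polys_below k" using p(1) by (auto simp: polys_below_def)
  qed
  have inj: "inj_on pcomb (\<Pi>\<^sub>E j\<in>{..<n}. ?S j)"
  proof (rule inj_onI)
    fix p q assume p: "p \<in> (\<Pi>\<^sub>E j\<in>{..<n}. ?S j)" and q: "q \<in> (\<Pi>\<^sub>E j\<in>{..<n}. ?S j)" and "pcomb p = pcomb q"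
    then have "p j = q j" if "j \<in> {..<n}" for j using pcomb_inj that by blast
    then show "p = q" by (rule PiE_ext[OF p q])
  qed
  have "card (pcomb ` polys_below k) = card (\<Pi>\<^sub>E j\<in>{..<n}. ?S j)" unfolding eq by (rule card_image[OF inj])
  also have "\<dots> = (\<Prod>j<n. CARD('a) ^ k j)" by (simp add: card_PiE card_polys_degree_less)
  finally show "card (pcomb ` polys_below k) = CARD('a) ^ (\<Sum>j<n. k j)" by (simp add: power_sum)
  show "finite (pcomb ` polys_below k)" unfolding eq using finite_polys_degree_less by (intro finite_imageI finite_PiE) auto
qed

lemma Phi_eq: "Phi n d m = (\<Sum>j<n. int (bound m j))"
  unfolding Phi_def
proof (rule sum.cong[OF refl])
  fix j
  have "int (gcd n d) * m - int d * int j = int cc * (m - int dd * int j)"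
    unfolding cc_def[symmetric] by (subst d_eq) (simp add: algebra_simps)
  then have e: "(int (gcd n d) * m - int d * int j) div int n = (m - int dd * int j) div int nn"
    using cc_pos by (subst n_eq) simp
  have fl: "\<lfloor>of_int (int (gcd n d) * m - int d * int j) / (of_nat n :: rat)\<rfloor> = (m - int dd * int j) div int nn"
    using floor_divide_of_int_eq[where 'a = rat, of "int (gcd n d) * m - int d * int j" "int n"] e
    by (simp only: of_int_of_nat_eq)
  show "max 0 (\<lfloor>of_int (int (gcd n d) * m - int d * int j) / (of_nat n :: rat)\<rfloor> + 1) = int (bound m j)"
    unfolding fl bound_def by simp
qed

lemma card_Lsp_mD: "card (L (mD m)) = CARD('a) ^ nat (Phi n d m)" "finite (L (mD m))"
  unfolding Lsp_mD using card_pcomb_polys_below by (simp_all add: Phi_eq flip: of_nat_sum)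

end

section \<open>Strong approximation\<close>

lemma bezout_poly:
  fixes a b :: "'a::field poly"
  assumes "coprime a b"
  shows "\<exists>r s. r * a + s * b = 1"
proof -
  let ?P = "\<lambda>g. g \<noteq> 0 \<and> (\<exists>r s. g = r * a + s * b)"
  have "a \<noteq> 0 \<or> b \<noteq> 0" using assms by auto
  moreover have "a = 1 * a + 0 * b" "b = 0 * a + 1 * b" by simp_all
  ultimately obtain g0 where "?P g0" by blast
  then obtain g where g: "?P g" and min: "\<And>g'. ?P g' \<Longrightarrow> degree g \<le> degree g'"
    using ex_has_least_nat[of ?P g0 degree] by blast
  obtain r s where rs: "g = r * a + s * b" using g by blast
  have dvd: "g dvd u * a + w * b" for u w
  proof (rule ccontr)
    let ?t = "u * a + w * b"
    assume "\<not> g dvd ?t"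
    then have nz: "?t mod g \<noteq> 0" by (simp add: dvd_eq_mod_eq_0)
    define Q where "Q = ?t div g"
    have "?t mod g = ?t - Q * g" by (simp add: minus_div_mult_eq_mod Q_def)
    also have "\<dots> = (u - Q * r) * a + (w - Q * s) * b"
      unfolding rs by (simp add: algebra_simps)
    finally have "?P (?t mod g)" using nz by blast
    then have "degree g \<le> degree (?t mod g)" by (rule min)
    then show False using degree_mod_less[of g ?t] g nz by auto
  qed
  have "is_unit g" using dvd[of 1 0] dvd[of 0 1] assms by (auto intro: coprime_common_divisor)
  then obtain w where "1 = g * w" by (rule dvdE)
  then have "(w * r) * a + (w * s) * b = 1" unfolding rs by (simp add: algebra_simps)
  then show ?thesis by blast
qed

text \<open>The factor \<open>D1\<close> collects the prime factors of \<open>D\<close> that divide \<open>h\<close>.\<close>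

lemma coprime_part_poly:
  fixes D h :: "'a::field poly"
  assumes "D \<noteq> 0"
  shows "\<exists>D1 D2. D = D1 * D2 \<and> coprime D2 h \<and> (\<forall>p. prime_elem p \<longrightarrow> p dvd D1 \<longrightarrow> p dvd h)"
  using assms
proof (induction "degree D" arbitrary: D rule: less_induct)
  case less
  show ?case
  proof (cases "coprime D h")
    case True
    then show ?thesis by (intro exI[of _ 1] exI[of _ D]) (auto simp: prime_elem_def)
  next
    case False
    then obtain c where c: "c dvd D" "c dvd h" "\<not> is_unit c" by (rule not_coprimeE)
    then have "c \<noteq> 0" using less.prems by auto
    then have "0 < degree c" using c(3) is_unit_iff_degree[of c] by simp
    then obtain p where p: "prime_elem p" "p dvd c" using ex_prime_divisor_poly by blast
    then obtain D' where D': "D = p * D'" using c(1) by (meson dvdE dvd_trans)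
    then have ne: "p \<noteq> 0" "D' \<noteq> 0" using less.prems by auto
    then have lt: "degree D' < degree D" using prime_elem_degree[OF p(1)] D' by (simp add: degree_mult_eq)
    obtain D1 D2 where IH: "D' = D1 * D2" "coprime D2 h" "\<forall>p. prime_elem p \<longrightarrow> p dvd D1 \<longrightarrow> p dvd h"
      using less.hyps[OF lt ne(2)] by (elim exE conjE) (rule that)
    have "q dvd h" if "prime_elem q" "q dvd p * D1" for q
    proof -
      have "q dvd p \<or> q dvd D1" using that by (simp add: prime_elem_dvd_mult_iff)
      then show ?thesis using IH(3) that(1) p(2) c(2) by (meson dvd_trans)
    qed
    then show ?thesis using D' IH(1,2) by (intro exI[of _ "p * D1"] exI[of _ D2]) (auto simp: mult.assoc)
  qed
qed

context superelliptic
begin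

lemma common_denominator: "\<exists>D p. D \<noteq> 0 \<and> ev D * z = pcomb p"
proof -
  have "\<forall>j. \<exists>u w. rf (coord z j) = ev u / ev w \<and> w \<noteq> 0"
  proof
    fix j
    obtain u w where "rf (coord z j) = ev u / ev w" "w \<noteq> 0" by (rule rf_cases[of "coord z j"]) blast
    then show "\<exists>u w. rf (coord z j) = ev u / ev w \<and> w \<noteq> 0" by blast
  qed
  then obtain u w where uw: "\<And>j. rf (coord z j) = ev (u j) / ev (w j)" "\<And>j. w j \<noteq> 0" by metis
  define D where "D = prod w {..<n}"
  define p where "p j = u j * prod w ({..<n} - {j})" for j
  have "ev D * (rf (coord z j) * y ^ j) = ev (p j) * y ^ j" if j: "j < n" for j
  proof -
    have "D = w j * prod w ({..<n} - {j})" unfolding D_def using j by (intro prod.remove) auto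
    then show ?thesis using uw(2)[of j] by (simp add: uw(1) p_def ev_mult ev_eq_0)
  qed
  then have "(\<Sum>j<n. ev D * (rf (coord z j) * y ^ j)) = pcomb p"
    unfolding pcomb_def by (intro sum.cong refl) blast
  moreover have "ev D * z = ev D * (\<Sum>j<n. rf (coord z j) * y ^ j)" by (simp flip: comb_def add: comb_coord)
  ultimately have "ev D * z = pcomb p" by (simp only: sum_distrib_left)
  moreover have "D \<noteq> 0" using uw(2) by (simp add: D_def)
  ultimately show ?thesis by blast
qed

text \<open>Let \<open>h\<close> be a polynomial with zeros at all places of \<open>S\<close>. A weak approximation \<open>z0\<close> at all
  zeros of \<open>h\<close> may have poles at other finite places, which are zeros of the factor \<open>D2\<close> of a
  denominator \<open>D\<close> of \<open>z0\<close>. They are cancelled by a multiple of \<open>D2\<close> that is close to \<open>1\<close> at the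
  zeros of \<open>h\<close>; it exists since \<open>D2\<close> and \<open>h\<close> are coprime.\<close>

lemma strong_approximation:
  fixes c :: "'k place \<Rightarrow> 'k" and N :: "'k place \<Rightarrow> int"
  assumes S: "finite S" "S \<subseteq> Pf"
  shows "\<exists>z. (\<forall>v\<in>S. z - c v \<in> pw v (N v)) \<and> (\<forall>v\<in>Pf - S. z \<in> pw v 0)"
proof -
  have "\<forall>v\<in>S. \<exists>p. prime_elem p \<and> 0 < v (ev p)" using Pf_prime S(2) by blast
  then obtain p where p: "\<forall>v\<in>S. prime_elem (p v) \<and> 0 < v (ev (p v))" by (rule bchoice[THEN exE])
  define h where "h = prod p S"
  have h0: "h \<noteq> 0" using p S(1) by (auto simp: h_def prime_elem_def)
  define Z where "Z = {v\<in>Pf. 0 < v (ev h)}"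
  have finZ: "finite Z" unfolding Z_def by (rule finite_Pf_zeros[OF h0])
  have ZP: "Z \<subseteq> Pf" "Z \<subseteq> places \<iota>" by (auto simp: Z_def Pf_def)
  have SZ: "S \<subseteq> Z"
  proof
    fix v assume v: "v \<in> S"
    then have vP: "v \<in> Pf" using S by blast
    have "h = p v * prod p (S - {v})" unfolding h_def using S v by (intro prod.remove) auto
    then have "v (ev h) = v (ev (p v)) + v (ev (prod p (S - {v})))"
      using h0 by (simp add: ev_mult place_mult[OF PfD(1)[OF vP]] ev_eq_0)
    moreover have "0 < v (ev (p v))" using p v by blast
    ultimately show "v \<in> Z" using Pf_ev_nonneg[OF vP, of "prod p (S - {v})"] vP by (simp add: Z_def)
  qed
  obtain z0 where z0: "\<forall>v\<in>Z. z0 - (if v \<in> S then c v else 0) \<in> pw v (if v \<in> S then N v else 0)"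
    using weak_approximation[OF finZ ZP(2), of "\<lambda>v. if v \<in> S then c v else 0" "\<lambda>v. if v \<in> S then N v else 0"]
    by blast
  obtain D P where D: "D \<noteq> 0" "ev D * z0 = pcomb P" using common_denominator by blast
  obtain D1 D2 where D12: "D = D1 * D2" "coprime D2 h" "\<forall>p. prime_elem p \<longrightarrow> p dvd D1 \<longrightarrow> p dvd h"
    using coprime_part_poly[OF D(1), of h] by blast
  have ne: "D1 \<noteq> 0" "D2 \<noteq> 0" using D(1) D12(1) by auto
  obtain r s where rs: "r * D2 + s * h = 1" using bezout_poly[OF D12(2)] by blast
  define M where "M = nat (\<Sum>v\<in>Z. \<bar>v z0\<bar> + \<bar>N v\<bar>)"
  have M: "\<bar>v z0\<bar> + \<bar>N v\<bar> \<le> int M" if "v \<in> Z" for v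
    unfolding M_def using member_le_sum[of v Z "\<lambda>v. \<bar>v z0\<bar> + \<bar>N v\<bar>"] that finZ by auto
  \<comment> \<open>The multiplier is divisible by \<open>D2\<close> and congruent to \<open>1\<close> modulo a high power of \<open>h\<close>.\<close>
  define g where "g = 1 - (s * h) ^ M"
  have "1 - s * h = r * D2" using rs by (simp add: algebra_simps)
  then have "g = r * D2 * (\<Sum>i<M. (s * h) ^ i)" unfolding g_def by (simp only: one_diff_power_eq)
  then have "D2 dvd g" by (simp add: mult_ac)
  then obtain g' where g': "g = D2 * g'" by blast
  let ?z = "z0 * ev g"
  have close: "?z - z0 \<in> pw v (N v)" "?z - z0 \<in> pw v 0" if v: "v \<in> Z" for v
  proof -
    have vP: "v \<in> Pf" "v \<in> places \<iota>" using v ZP by auto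
    have "ev h \<in> pw v 1" using v by (simp add: Z_def pw_def)
    then have "ev (s * h) \<in> pw v 1"
      using pw_mult[OF vP(2) Pf_ev_pw[OF vP(1), of s], of "ev h" 1] by (simp add: ev_mult)
    then have sh: "ev (s * h) = 0 \<or> 1 \<le> v (ev (s * h))" by (auto simp: pw_def)
    have "ev (s * h) ^ M \<in> pw v (int M)"
    proof (cases "ev (s * h) = 0")
      case True then show ?thesis by (cases M) (auto simp: pw_def place_one[OF vP(2)])
    next
      case False
      then have "int M * 1 \<le> int M * v (ev (s * h))" using sh by (intro mult_left_mono) auto
      then show ?thesis by (simp add: pw_def place_power[OF vP(2)])
    qed
    moreover have "?z - z0 = - (z0 * ev (s * h) ^ M)"
    proof -
      have "ev g = 1 - ev (s * h) ^ M" by (simp only: g_def ev_diff ev_1 ev_power)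
      then show ?thesis by (simp only: right_diff_distrib) simp
    qed
    moreover have "z0 \<in> pw v (v z0)" by (simp add: pw_def)
    ultimately have zz: "?z - z0 \<in> pw v (v z0 + int M)"
      using pw_mult[OF vP(2)] pw_uminus[OF vP(2)] by metis
    then show "?z - z0 \<in> pw v (N v)" using M[OF v] by (intro pw_mono[OF vP(2) zz]) linarith
    show "?z - z0 \<in> pw v 0" using M[OF v] by (intro pw_mono[OF vP(2) zz]) linarith
  qed
  have "?z - c v \<in> pw v (N v)" if v: "v \<in> S" for v
  proof -
    have vZ: "v \<in> Z" and vp: "v \<in> places \<iota>" using v SZ ZP by auto
    have "z0 - c v \<in> pw v (N v)" using bspec[OF z0 vZ] v by simp
    then have "(?z - z0) + (z0 - c v) \<in> pw v (N v)" by (rule pw_add[OF vp close(1)[OF vZ]])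
    then show ?thesis by simp
  qed
  moreover have "?z \<in> pw v 0" if v: "v \<in> Pf - S" for v
  proof (cases "v \<in> Z")
    case True
    then have "z0 - 0 \<in> pw v 0" using bspec[OF z0 True] v by simp
    then have "(?z - z0) + z0 \<in> pw v 0" using close(2)[OF True] v PfD(1) by (intro pw_add) auto
    then show ?thesis by simp
  next
    case False
    have vP: "v \<in> Pf" "v \<in> places \<iota>" using v PfD by auto
    obtain \<pi> where \<pi>: "prime_elem \<pi>" "0 < v (ev \<pi>)" using Pf_prime[OF vP(1)] by blast
    note iff = place_prime_value(1)[OF PfD[OF vP(1)] \<pi>]
    have "\<not> \<pi> dvd h" using iff[OF h0] False vP(1) by (simp add: Z_def)
    then have "\<not> \<pi> dvd D1" using D12(3) \<pi>(1) by blast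
    then have v1: "v (ev D1) = 0" using iff[OF ne(1)] Pf_ev_nonneg[OF vP(1), of D1] by simp
    have "ev D1 * ?z = ev D * z0 * ev g'" by (simp add: D12(1) g' ev_mult)
    also have "\<dots> \<in> pw v 0"
      using pw_mult[OF vP(2) pcomb_pw[OF vP(1), of P] Pf_ev_pw[OF vP(1), of g']] by (simp add: D(2))
    finally have "inverse (ev D1) * (ev D1 * ?z) \<in> pw v (0 + 0)"
      using v1 by (intro pw_mult[OF vP(2)]) (simp_all add: pw_def place_inverse[OF vP(2)])
    then show ?thesis using ne(1) by (simp add: ev_eq_0 mult.assoc[symmetric])
  qed
  ultimately show ?thesis by blast
qed

text \<open>A weak approximation is replaced by the polynomial parts of its coordinates. The error in a
  coordinate has a zero at infinity, and multiplied by \<open>y\<^sup>j\<close> it has a pole of order at most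
  \<open>dd * n\<close>.\<close>

lemma approximation_at_infinity:
  fixes c :: "'k place \<Rightarrow> 'k" and N :: "'k place \<Rightarrow> int"
  assumes N: "\<And>v. v \<in> Pinf \<Longrightarrow> N v \<le> - int (dd * n)"
  shows "\<exists>p. \<forall>v\<in>Pinf. pcomb p - c v \<in> pw v (N v)"
proof -
  have "Pinf \<subseteq> places \<iota>" by (auto simp: Pinf_def)
  then obtain z where z: "\<forall>v\<in>Pinf. z - c v \<in> pw v (N v)"
    using weak_approximation[OF finite_Pinf, of \<iota> c N] by blast
  have "\<forall>j. \<exists>u w. rf (coord z j) = ev u / ev w \<and> w \<noteq> 0"
  proof
    fix j
    obtain u w where "rf (coord z j) = ev u / ev w" "w \<noteq> 0" by (rule rf_cases[of "coord z j"]) blast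
    then show "\<exists>u w. rf (coord z j) = ev u / ev w \<and> w \<noteq> 0" by blast
  qed
  then obtain u w where uw: "\<And>j. rf (coord z j) = ev (u j) / ev (w j)" "\<And>j. w j \<noteq> 0" by metis
  define p where "p j = u j div w j" for j
  have "pcomb p - c v \<in> pw v (N v)" if v: "v \<in> Pinf" for v
  proof -
    have vp: "v \<in> places \<iota>" using PinfD v by blast
    note val = place_inf_value[OF PinfD[OF v], unfolded inf_values[OF PinfD[OF v]]]
    have t: "(ev (p j) - rf (coord z j)) * y ^ j \<in> pw v (N v)" if j: "j < n" for j
    proof (cases "u j mod w j = 0")
      case True
      then have "u j = w j * p j" by (simp add: p_def mod_eq_0_iff_dvd)
      then have "ev (p j) - rf (coord z j) = 0" using uw(2)[of j] by (simp add: uw(1) ev_mult ev_eq_0)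
      then show ?thesis by (simp add: pw_def)
    next
      case False
      have "ev (u j) = ev (w j) * ev (p j) + ev (u j mod w j)"
        using ev_add[of "w j * p j" "u j mod w j"] by (simp add: p_def ev_mult)
      then have eq: "ev (p j) - rf (coord z j) = - (ev (u j mod w j) / ev (w j))"
        using uw(2)[of j] by (simp add: uw(1) ev_eq_0 field_simps)
      have deg: "degree (u j mod w j) < degree (w j)"
        using degree_mod_less[OF uw(2)[of j], of "u j"] False by auto
      have "v ((ev (p j) - rf (coord z j)) * y ^ j) = v (ev (u j mod w j)) - v (ev (w j)) + int j * v y"
        using False uw(2)[of j] y_ne_0 unfolding eq
        by (simp add: place_mult[OF vp] place_uminus[OF vp] place_divide[OF vp] place_power[OF vp] ev_eq_0)
      also have "\<dots> = (int (degree (w j)) - int (degree (u j mod w j))) * int nn - int j * int dd"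
        using val[OF False] val[OF uw(2)[of j]] inf_values[OF PinfD[OF v]] by (simp add: algebra_simps)
      finally have "v ((ev (p j) - rf (coord z j)) * y ^ j) \<ge> 0 - int j * int dd" using deg by simp
      moreover have "dd * j \<le> dd * n" using j by simp
      then have "int (dd * j) \<le> int (dd * n)" by (simp only: of_nat_le_iff)
      then have "int j * int dd \<le> int (dd * n)" by (simp only: of_nat_mult mult.commute)
      ultimately have "N v \<le> v ((ev (p j) - rf (coord z j)) * y ^ j)" using N[OF v] by linarith
      then show ?thesis by (simp add: pw_def)
    qed
    have "z = (\<Sum>j<n. rf (coord z j) * y ^ j)" by (simp flip: comb_def add: comb_coord)
    then have "pcomb p - z = (\<Sum>j<n. (ev (p j) - rf (coord z j)) * y ^ j)"
      unfolding pcomb_def by (simp add: left_diff_distrib sum_subtractf)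
    also have "\<dots> \<in> pw v (N v)" using t by (intro pw_sum[OF vp]) simp
    finally have "(pcomb p - z) + (z - c v) \<in> pw v (N v)" using z v by (intro pw_add[OF vp]) auto
    then show ?thesis by simp
  qed
  then show ?thesis by blast
qed

section \<open>Degrees\<close>

lemma subspaceI:
  assumes "subgrp V" "\<And>a z. z \<in> V \<Longrightarrow> \<iota> a * z \<in> V"
  shows "module.subspace (const_scale \<iota>) V"
proof -
  interpret vector_space "const_scale \<iota>" by (rule vector_space_const_scale[OF emb])
  show ?thesis using assms by (auto simp: subspace_def subgrp_zero subgrp_add const_scale_def)
qed

lemma subspace_pw: "v \<in> places \<iota> \<Longrightarrow> module.subspace (const_scale \<iota>) (pw v m)"
proof (rule subspaceI)
  assume v: "v \<in> places \<iota>"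
  show "subgrp (pw v m)" by (rule subgrp_pw[OF v])
  show "\<iota> a * z \<in> pw v m" if "z \<in> pw v m" for a z
    using pw_mult[OF v pw_const[OF v emb] that] by simp
qed

lemma finite_cosets_cover:
  assumes W: "subgrp W" and X: "finite X" and cover: "\<And>v. v \<in> V \<Longrightarrow> \<exists>t\<in>X. v - t \<in> W"
  shows "finite (cosets V W)"
proof (rule finite_subset)
  show "cosets V W \<subseteq> (\<lambda>v. {w. w - v \<in> W}) ` X"
  proof
    fix A assume "A \<in> cosets V W"
    then obtain v where v: "v \<in> V" "A = {w. w - v \<in> W}" by (auto simp: cosets_def)
    then obtain t where t: "t \<in> X" "v - t \<in> W" using cover by blast
    then show "A \<in> (\<lambda>v. {w. w - v \<in> W}) ` X" using v(2) coset_eq_iff[OF W, of v t] by blast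
  qed
qed (use X in simp)

text \<open>Multiplication by a power of a uniformiser identifies the two quotients.\<close>

lemma cosets_pw_shift:
  assumes v: "v \<in> places \<iota>"
  shows "idx (pw v m) (pw v (m + 1)) = idx (pw v 0) (pw v 1)"
    "finite (cosets (pw v m) (pw v (m + 1))) \<longleftrightarrow> finite (cosets (pw v 0) (pw v 1))"
proof -
  obtain t where t: "v t = 1" "t \<noteq> 0" by (rule uniformizer[OF v])
  define s where "s = t powi (- m)"
  have s: "s \<noteq> 0" "v s = - m" using t by (simp_all add: s_def place_power_int[OF v])
  have mul: "z * s \<in> pw v k \<longleftrightarrow> z \<in> pw v (m + k)" for z k
    using s by (cases "z = 0") (auto simp: pw_def place_mult[OF v])
  let ?g = "\<lambda>z. {w. w - z * s \<in> pw v 1}"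
  have g: "?g u = ?g w \<longleftrightarrow> u - w \<in> pw v (m + 1)" for u w
    using coset_eq_iff[OF subgrp_pw[OF v, of 1], of "u * s" "w * s"] mul[of "u - w" 1]
    by (simp add: left_diff_distrib)
  have im: "?g ` pw v m = cosets (pw v 0) (pw v 1)"
  proof (intro equalityI subsetI)
    fix A assume "A \<in> ?g ` pw v m"
    then obtain z where "z \<in> pw v m" "A = ?g z" by blast
    then show "A \<in> cosets (pw v 0) (pw v 1)" using mul[of z 0] by (auto simp: cosets_def)
  next
    fix A assume "A \<in> cosets (pw v 0) (pw v 1)"
    then obtain w where w: "w \<in> pw v 0" "A = {u. u - w \<in> pw v 1}" by (auto simp: cosets_def)
    have "w / s \<in> pw v m" using mul[of "w / s" 0] w(1) s(1) by simp
    moreover have "?g (w / s) = A" using w(2) s(1) by simp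
    ultimately show "A \<in> ?g ` pw v m" by blast
  qed
  show "idx (pw v m) (pw v (m + 1)) = idx (pw v 0) (pw v 1)"
    unfolding idx_fibers(1)[OF subgrp_pw[OF v, of "m + 1"], of "pw v m" ?g, OF g] im
    by (simp only: idx_def)
  show "finite (cosets (pw v m) (pw v (m + 1))) \<longleftrightarrow> finite (cosets (pw v 0) (pw v 1))"
    unfolding idx_fibers(2)[OF subgrp_pw[OF v, of "m + 1"], of "pw v m" ?g, OF g] im ..
qed

text \<open>A residue at a finite place is represented by a function without finite poles, whose
  coordinates can be reduced modulo a polynomial with a zero at the place. At infinity, after a
  shift, the residues are represented in a finite space \<open>L(m D\<^sub>\<infinity>)\<close>.\<close>

lemma finite_residue_field:
  assumes v: "v \<in> places \<iota>"
  shows "finite (cosets (pw v 0) (pw v 1))"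
proof (cases "v \<in> Pf")
  case True
  obtain h where h: "prime_elem h" "0 < v (ev h)" using Pf_prime[OF True] by blast
  have h0: "h \<noteq> 0" using h(1) by (simp add: prime_elem_def)
  show ?thesis
  proof (rule finite_cosets_cover[OF subgrp_pw[OF v] card_pcomb_polys_below(2)])
    fix c assume c: "c \<in> pw v 0"
    obtain z where z: "\<forall>v\<in>{v}. z - c \<in> pw v 1" "\<forall>w\<in>Pf - {v}. z \<in> pw w 0"
      using strong_approximation[of "{v}" "\<lambda>_. c" "\<lambda>_. 1"] True by auto
    have zc: "z - c \<in> pw v 1" using z(1) by simp
    then have "(z - c) + c \<in> pw v 0" using c by (intro pw_add[OF v] pw_mono[OF v zc]) auto
    then have "\<forall>w\<in>Pf. z \<in> pw w 0" using z(2) by auto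
    then obtain p where p: "z = pcomb p" using integral_iff by blast
    let ?r = "\<lambda>j. p j mod h"
    have "?r j = 0 \<or> degree (?r j) < degree h" for j using degree_mod_less[OF h0, of "p j"] by auto
    then have "?r \<in> polys_below (\<lambda>_. degree h)" unfolding polys_below_def coeff_zero_iff_degree by blast
    moreover have "c - pcomb ?r \<in> pw v 1"
    proof -
      have "ev (p j) = ev h * ev (p j div h) + ev (?r j)" for j
        using ev_add[of "h * (p j div h)" "p j mod h"] by (simp add: ev_mult)
      then have "pcomb p = ev h * pcomb (\<lambda>j. p j div h) + pcomb ?r"
        unfolding pcomb_def by (simp add: algebra_simps sum.distrib sum_distrib_left)
      then have eq: "c - pcomb ?r = ev h * pcomb (\<lambda>j. p j div h) - (z - c)" using p by simp
      have "ev h \<in> pw v 1" using h(2) by (simp add: pw_def)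
      then have "ev h * pcomb (\<lambda>j. p j div h) \<in> pw v 1"
        using pw_mult[OF v _ pcomb_pw[OF True], of "ev h" 1] by simp
      then show ?thesis unfolding eq using zc by (rule pw_diff[OF v])
    qed
    ultimately show "\<exists>t\<in>pcomb ` polys_below (\<lambda>_. degree h). c - t \<in> pw v 1" by blast
  qed
next
  case False
  then have vi: "v \<in> Pinf" using v places_Un by blast
  \<comment> \<open>The approximation at infinity is available below \<open>- ?m\<close>, where the quotient is moved by
    \<open>cosets_pw_shift\<close>.\<close>
  let ?m = "int (dd * n)"
  have "finite (cosets (pw v (- ?m - 1)) (pw v (- ?m - 1 + 1)))"
  proof (rule finite_cosets_cover[OF subgrp_pw[OF v] card_Lsp_mD(2)])
    fix c assume c: "c \<in> pw v (- ?m - 1)"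
    obtain p where p: "\<forall>w\<in>Pinf. pcomb p - (if w = v then c else 0) \<in> pw w (- ?m)"
      using approximation_at_infinity[of "\<lambda>_. - ?m" "\<lambda>w. if w = v then c else 0"] by auto
    have pc: "pcomb p - c \<in> pw v (- ?m)" using bspec[OF p vi] by simp
    have "pcomb p \<in> L (mD (?m + 1))"
      unfolding Lsp_def
    proof (rule CollectI, rule ballI)
      fix w assume w: "w \<in> places \<iota>"
      consider "w = v" | "w \<in> Pinf" "w \<noteq> v" | "w \<in> Pf" using w places_Un by blast
      then show "pcomb p \<in> pw w (- mD (?m + 1) w)"
      proof cases
        case 1
        have "(pcomb p - c) + c \<in> pw v (- ?m - 1)" using c by (intro pw_add[OF v] pw_mono[OF v pc]) auto
        then show ?thesis using 1 vi by (simp add: mD_def)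
      next
        case 2
        then have pm: "pcomb p \<in> pw w (- ?m)" using bspec[OF p 2(1)] by simp
        have "- mD (?m + 1) w \<le> - ?m" using 2 by (simp add: mD_def)
        then show ?thesis by (rule pw_mono[OF w pm])
      next
        case 3
        then have "w \<notin> Pinf" using Pf_Pinf by blast
        then show ?thesis using pcomb_pw[OF 3] by (simp add: mD_def)
      qed
    qed
    moreover have "c - pcomb p \<in> pw v (- ?m - 1 + 1)" using pw_uminus[OF v pc] by simp
    ultimately show "\<exists>t\<in>L (mD (?m + 1)). c - t \<in> pw v (- ?m - 1 + 1)" by blast
  qed
  then show ?thesis using cosets_pw_shift(2)[OF v, of "- ?m - 1"] by simp
qed

lemma card_power_place_degree:
  assumes v: "v \<in> places \<iota>"
  shows "CARD('a) ^ place_degree \<iota> v = idx (pw v 0) (pw v 1)"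
  unfolding place_degree_def valuation_ring_eq maximal_ideal_eq
  by (rule card_power_quotient_dim[OF vector_space_const_scale[OF emb] subspace_pw[OF v] subspace_pw[OF v]
        finite_residue_field[OF v]])

lemma card_power_inject: "CARD('a) ^ i = CARD('a) ^ j \<longleftrightarrow> i = j"
  using card_field_ge_2[where 'a = 'a] by (simp add: power_inject_exp)

lemma card_power_le: "CARD('a) ^ i \<le> CARD('a) ^ j \<longleftrightarrow> i \<le> j"
  using card_field_ge_2[where 'a = 'a] by simp

definition single :: "'k place \<Rightarrow> 'k divisor" where
  "single v = (\<lambda>w. of_bool (w = v))"

lemma subgrp_Lsp: "T \<subseteq> places \<iota> \<Longrightarrow> subgrp (Lsp T G)"
  unfolding subgrp_def Lsp_def using pw_diff pw_zero by blast

lemma Lsp_mono: "T \<subseteq> places \<iota> \<Longrightarrow> (\<And>v. v \<in> T \<Longrightarrow> G v \<le> G' v) \<Longrightarrow> Lsp T G \<subseteq> Lsp T G'"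
  unfolding Lsp_def using pw_mono by (smt (verit, best) Collect_mono subsetD)

text \<open>The quotient embeds into that of two consecutive fractional ideals at \<open>v\<close>, which has
  \<open>q ^ place_degree \<iota> v\<close> elements. The embedding is surjective if every principal part occurs.\<close>

lemma Lsp_step:
  assumes T: "T \<subseteq> places \<iota>" and v: "v \<in> T"
  shows "idx (Lsp T (G + single v)) (Lsp T G) \<le> CARD('a) ^ place_degree \<iota> v"
    and "finite (cosets (Lsp T (G + single v)) (Lsp T G))"
    and "(\<And>c. c \<in> pw v (- G v - 1) \<Longrightarrow> \<exists>z\<in>Lsp T (G + single v). z - c \<in> pw v (- G v)) \<Longrightarrow>
      idx (Lsp T (G + single v)) (Lsp T G) = CARD('a) ^ place_degree \<iota> v"
proof -
  have vp: "v \<in> places \<iota>" using T v by blast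
  let ?V = "Lsp T (G + single v)" and ?k = "- G v - 1"
  let ?g = "\<lambda>z. {w. w - z \<in> pw v (- G v)}"
  have Vpw: "z \<in> pw v ?k" if "z \<in> ?V" for z
    using that v by (auto simp: Lsp_def single_def)
  have mem: "z \<in> Lsp T G \<longleftrightarrow> z \<in> pw v (- G v)" if z: "z \<in> ?V" for z
  proof
    assume "z \<in> Lsp T G" then show "z \<in> pw v (- G v)" using v by (auto simp: Lsp_def)
  next
    assume zv: "z \<in> pw v (- G v)"
    have "z \<in> pw w (- G w)" if "w \<in> T" for w
      using z that zv by (cases "w = v") (auto simp: Lsp_def single_def)
    then show "z \<in> Lsp T G" by (simp add: Lsp_def)
  qed
  have g: "?g u = ?g w \<longleftrightarrow> u - w \<in> Lsp T G" if "u \<in> ?V" "w \<in> ?V" for u w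
    using coset_eq_iff[OF subgrp_pw[OF vp, of "- G v"], of u w] mem[OF subgrp_diff[OF subgrp_Lsp[OF T] that]]
    by simp
  have fib: "idx ?V (Lsp T G) = card (?g ` ?V)" "finite (cosets ?V (Lsp T G)) \<longleftrightarrow> finite (?g ` ?V)"
    by (rule idx_fibers[OF subgrp_Lsp[OF T]], rule g, assumption, assumption)+
  let ?C = "cosets (pw v ?k) (pw v (?k + 1))"
  have C: "card ?C = CARD('a) ^ place_degree \<iota> v" "finite ?C"
    using cosets_pw_shift[OF vp, of ?k] card_power_place_degree[OF vp] finite_residue_field[OF vp]
    by (simp_all add: idx_def)
  have sub: "?g ` ?V \<subseteq> ?C" using Vpw by (auto simp: cosets_def)
  show "idx ?V (Lsp T G) \<le> CARD('a) ^ place_degree \<iota> v"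
    unfolding fib(1) C(1)[symmetric] by (rule card_mono[OF C(2) sub])
  show "finite (cosets ?V (Lsp T G))" unfolding fib(2) by (rule finite_subset[OF sub C(2)])
  assume surj: "\<And>c. c \<in> pw v ?k \<Longrightarrow> \<exists>z\<in>?V. z - c \<in> pw v (- G v)"
  have "?C \<subseteq> ?g ` ?V"
  proof
    fix A assume "A \<in> ?C"
    then obtain c where c: "c \<in> pw v ?k" "A = ?g c" by (auto simp: cosets_def)
    then obtain z where z: "z \<in> ?V" "z - c \<in> pw v (- G v)" using surj by blast
    then have "?g z = ?g c" using coset_eq_iff[OF subgrp_pw[OF vp, of "- G v"]] by blast
    then show "A \<in> ?g ` ?V" using z(1) c(2) by blast
  qed
  then have "?g ` ?V = ?C" by (rule subset_antisym[OF sub])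
  then show "idx ?V (Lsp T G) = CARD('a) ^ place_degree \<iota> v"
    unfolding fib(1) C(1)[symmetric] by (simp only:)
qed

definition effective_on :: "'k place set \<Rightarrow> 'k divisor \<Rightarrow> bool" where
  "effective_on U B \<longleftrightarrow> finite {v. B v \<noteq> 0} \<and> {v. B v \<noteq> 0} \<subseteq> U \<and> (\<forall>v. 0 \<le> B v)"

lemma effective_induct [consumes 1, case_names zero add]:
  assumes "effective_on U B" and zero: "P 0"
    and add: "\<And>B v. effective_on U B \<Longrightarrow> v \<in> U \<Longrightarrow> P B \<Longrightarrow> P (B + single v)"
  shows "P B"
proof -
  define S where "S = {v. B v \<noteq> 0}"
  have S: "finite S" "S \<subseteq> U" using assms(1) by (auto simp: S_def effective_on_def)
  have "P B'" if "\<forall>v. 0 \<le> B' v" "{v. B' v \<noteq> 0} \<subseteq> S" "(\<Sum>v\<in>S. B' v) = int k" for B' k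
    using that
  proof (induction k arbitrary: B')
    case 0
    have "\<forall>v\<in>S. B' v = 0" using 0 S(1) by (simp add: sum_nonneg_eq_0_iff)
    then have "B' = 0" using 0 by (auto simp: fun_eq_iff)
    then show ?case using zero by (simp only:)
  next
    case (Suc k)
    have "\<exists>v\<in>S. B' v \<noteq> 0"
    proof (rule ccontr)
      assume "\<not> ?thesis"
      then have "(\<Sum>v\<in>S. B' v) = 0" by (intro sum.neutral) auto
      then show False using Suc.prems(3) by simp
    qed
    then obtain v where v: "v \<in> S" "B' v \<noteq> 0" by blast
    then have pos: "1 \<le> B' v" using Suc.prems(1) by (simp add: order_less_le int_one_le_iff_zero_less)
    let ?B = "B' - single v"
    have nonneg: "\<forall>w. 0 \<le> ?B w" using Suc.prems(1) pos by (simp add: single_def)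
    have supp: "{w. ?B w \<noteq> 0} \<subseteq> S" using Suc.prems(2) v(1) by (auto simp: single_def)
    have "(\<Sum>w\<in>S. single v w) = 1" using v(1) S(1) by (simp add: single_def of_bool_def)
    then have "(\<Sum>w\<in>S. ?B w) = int k" using Suc.prems(3) by (simp add: sum_subtractf)
    then have "P ?B" by (rule Suc.IH[OF nonneg supp])
    moreover have "effective_on U ?B"
      unfolding effective_on_def using nonneg supp S finite_subset by blast
    ultimately have "P (?B + single v)" using add v(1) S(2) by blast
    moreover have "?B + single v = B'" by simp
    ultimately show ?case by (simp only:)
  qed
  moreover have "(\<Sum>v\<in>S. B v) = int (nat (\<Sum>v\<in>S. B v))"
    using assms(1) by (simp add: effective_on_def sum_nonneg)
  ultimately show ?thesis using assms(1) unfolding effective_on_def S_def by blast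
qed

lemma divisor_degree_sum:
  assumes "finite S" "{v. G v \<noteq> 0} \<subseteq> S"
  shows "divisor_degree \<iota> G = (\<Sum>v\<in>S. G v * int (place_degree \<iota> v))"
  unfolding divisor_degree_def by (rule sum.mono_neutral_left) (use assms in auto)

lemma divisor_degree_add:
  assumes "finite {v. G v \<noteq> 0}" "finite {v. H v \<noteq> 0}"
  shows "divisor_degree \<iota> (G + H) = divisor_degree \<iota> G + divisor_degree \<iota> H"
proof -
  let ?S = "{v. G v \<noteq> 0} \<union> {v. H v \<noteq> 0}"
  have "finite ?S" using assms by simp
  moreover have "{v. (G + H) v \<noteq> 0} \<subseteq> ?S" by auto
  ultimately show ?thesis
    using divisor_degree_sum[of ?S G] divisor_degree_sum[of ?S H] divisor_degree_sum[of ?S "G + H"]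
    by (simp add: distrib_right sum.distrib)
qed

lemma divisor_degree_single: "divisor_degree \<iota> (single v) = int (place_degree \<iota> v)"
  using divisor_degree_sum[of "{v}" "single v"] by (auto simp: single_def)

lemma finite_support_single: "finite {w. single v w \<noteq> 0}"
  by (rule finite_subset[of _ "{v}"]) (auto simp: single_def)

lemma divisor_degree_zero: "divisor_degree \<iota> 0 = 0"
  by (simp add: divisor_degree_def)

lemma divisor_degree_nonneg: "(\<And>v. 0 \<le> G v) \<Longrightarrow> 0 \<le> divisor_degree \<iota> G"
  unfolding divisor_degree_def by (intro sum_nonneg) auto

lemma divisor_degree_add_single:
  "effective_on U B \<Longrightarrow> nat (divisor_degree \<iota> (B + single v)) = nat (divisor_degree \<iota> B) + place_degree \<iota> v"
  using divisor_degree_nonneg[of B]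
  by (simp add: effective_on_def divisor_degree_add finite_support_single divisor_degree_single nat_add_distrib)

lemma idx_self: "subgrp V \<Longrightarrow> idx V V = 1" "subgrp V \<Longrightarrow> finite (cosets V V)"
proof -
  assume V: "subgrp V"
  have "transversal V V {0}" using V by (auto simp: transversal_def subgrp_zero)
  then show "idx V V = 1" "finite (cosets V V)" using idx_transversal[OF V] by simp_all
qed

lemma Lsp_subset_add: "T \<subseteq> places \<iota> \<Longrightarrow> (\<And>v. 0 \<le> B v) \<Longrightarrow> Lsp T G \<subseteq> Lsp T (G + B)"
  by (rule Lsp_mono) simp_all

lemma Lsp_chain_le:
  assumes T: "T \<subseteq> places \<iota>" and B: "effective_on T B"
  shows "finite (cosets (Lsp T (G + B)) (Lsp T G)) \<and>
    idx (Lsp T (G + B)) (Lsp T G) \<le> CARD('a) ^ nat (divisor_degree \<iota> B)"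
  using B
proof (induction rule: effective_induct)
  case zero
  show ?case unfolding add.right_neutral divisor_degree_zero
    using idx_self[OF subgrp_Lsp[OF T, of G]] by simp
next
  case (add B v)
  have sub: "Lsp T G \<subseteq> Lsp T (G + B)" "Lsp T (G + B) \<subseteq> Lsp T (G + B + single v)"
    by (rule Lsp_subset_add[OF T], use add.hyps(1) in \<open>simp add: effective_on_def\<close>)
       (rule Lsp_subset_add[OF T], simp add: single_def)
  note step = Lsp_step[OF T \<open>v \<in> T\<close>, of "G + B"]
  have m: "idx (Lsp T (G + B + single v)) (Lsp T G)
      = idx (Lsp T (G + B + single v)) (Lsp T (G + B)) * idx (Lsp T (G + B)) (Lsp T G)"
    "finite (cosets (Lsp T (G + B + single v)) (Lsp T G))"
    using idx_mult[OF subgrp_Lsp[OF T] subgrp_Lsp[OF T] sub subgrp_Lsp[OF T] step(2)] add.IH by blast+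
  have "idx (Lsp T (G + B + single v)) (Lsp T G) \<le> CARD('a) ^ place_degree \<iota> v * CARD('a) ^ nat (divisor_degree \<iota> B)"
    unfolding m(1) by (rule mult_mono[OF step(1) conjunct2[OF add.IH]]) simp_all
  also have "\<dots> = CARD('a) ^ nat (divisor_degree \<iota> (B + single v))"
    unfolding divisor_degree_add_single[OF add.hyps(1)] power_add by (rule mult.commute)
  finally show ?case unfolding add.assoc[symmetric] using m(2) by blast
qed

lemma Lsp_chain_eq:
  assumes T: "T \<subseteq> places \<iota>" and U: "U \<subseteq> T" and B: "effective_on U B"
    and surj: "\<And>B v c. effective_on U B \<Longrightarrow> v \<in> U \<Longrightarrow> c \<in> pw v (- (G + B) v - 1) \<Longrightarrow>
      \<exists>z\<in>Lsp T (G + B + single v). z - c \<in> pw v (- (G + B) v)"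
  shows "finite (cosets (Lsp T (G + B)) (Lsp T G)) \<and>
    idx (Lsp T (G + B)) (Lsp T G) = CARD('a) ^ nat (divisor_degree \<iota> B)"
  using B
proof (induction rule: effective_induct)
  case zero
  show ?case unfolding add.right_neutral divisor_degree_zero
    using idx_self[OF subgrp_Lsp[OF T, of G]] by simp
next
  case (add B v)
  have vT: "v \<in> T" using add.hyps U by blast
  have sub: "Lsp T G \<subseteq> Lsp T (G + B)" "Lsp T (G + B) \<subseteq> Lsp T (G + B + single v)"
    by (rule Lsp_subset_add[OF T], use add.hyps(1) in \<open>simp add: effective_on_def\<close>)
       (rule Lsp_subset_add[OF T], simp add: single_def)
  note step = Lsp_step[OF T vT, of "G + B"]
  have m: "idx (Lsp T (G + B + single v)) (Lsp T G)
      = idx (Lsp T (G + B + single v)) (Lsp T (G + B)) * idx (Lsp T (G + B)) (Lsp T G)"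
    "finite (cosets (Lsp T (G + B + single v)) (Lsp T G))"
    using idx_mult[OF subgrp_Lsp[OF T] subgrp_Lsp[OF T] sub subgrp_Lsp[OF T] step(2)] add.IH by blast+
  have "idx (Lsp T (G + B + single v)) (Lsp T (G + B)) = CARD('a) ^ place_degree \<iota> v"
    using surj[OF add.hyps] by (rule step(3))
  then have "idx (Lsp T (G + B + single v)) (Lsp T G) = CARD('a) ^ nat (divisor_degree \<iota> (B + single v))"
    unfolding m(1) conjunct2[OF add.IH] divisor_degree_add_single[OF add.hyps(1)] power_add
    by (simp only: mult.commute)
  then show ?case unfolding add.assoc[symmetric] using m(2) by blast
qed

definition zero_part :: "'a poly \<Rightarrow> 'k divisor" where
  "zero_part h = (\<lambda>v. if v \<in> Pf then v (ev h) else 0)"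

lemma zero_part_effective: "h \<noteq> 0 \<Longrightarrow> effective_on Pf (zero_part h)"
proof -
  assume h: "h \<noteq> 0"
  have sub: "{v. zero_part h v \<noteq> 0} \<subseteq> {v\<in>Pf. 0 < v (ev h)}"
  proof
    fix v assume "v \<in> {v. zero_part h v \<noteq> 0}"
    then have "v \<in> Pf" "v (ev h) \<noteq> 0" by (auto simp: zero_part_def split: if_splits)
    then show "v \<in> {v\<in>Pf. 0 < v (ev h)}" using Pf_ev_nonneg[of v h] by simp
  qed
  show ?thesis
    unfolding effective_on_def
  proof (intro conjI allI)
    show "finite {v. zero_part h v \<noteq> 0}" by (rule finite_subset[OF sub finite_Pf_zeros[OF h]])
    show "{v. zero_part h v \<noteq> 0} \<subseteq> Pf" using sub by blast
    show "0 \<le> zero_part h v" for v using Pf_ev_nonneg[of v h] by (simp add: zero_part_def)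
  qed
qed

text \<open>By strong approximation all principal parts occur, so the degree of the zeros of \<open>h(x)\<close> is
  the dimension of the functions \<open>z/h(x)\<close> with \<open>z\<close> integral modulo the integral functions.
  Representatives are given by the \<open>z\<close> whose \<open>n\<close> coordinates are polynomials of smaller degree
  than \<open>h\<close>.\<close>

lemma degree_zero_part:
  assumes h: "h \<noteq> 0"
  shows "divisor_degree \<iota> (zero_part h) = int (n * degree h)"
proof -
  have T: "Pf \<subseteq> places \<iota>" by (auto simp: Pf_def)
  have eh: "ev h \<noteq> 0" using h by (simp add: ev_eq_0)
  have chain: "idx (Lsp Pf (0 + zero_part h)) (Lsp Pf 0) = CARD('a) ^ nat (divisor_degree \<iota> (zero_part h))"
  proof (rule conjunct2[OF Lsp_chain_eq[OF T subset_refl zero_part_effective[OF h]]])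
    fix B :: "'k divisor" and v c
    assume B: "effective_on Pf B" and v: "v \<in> Pf" and c: "c \<in> pw v (- (0 + B) v - 1)"
    let ?S = "insert v {w. B w \<noteq> 0}"
    have S: "finite ?S" "?S \<subseteq> Pf" using B v by (auto simp: effective_on_def)
    obtain z where z: "\<forall>w\<in>?S. z - (if w = v then c else 0) \<in> pw w (- B w)" "\<forall>w\<in>Pf - ?S. z \<in> pw w 0"
      using strong_approximation[OF S, of "\<lambda>w. if w = v then c else 0" "\<lambda>w. - B w"] by blast
    have zv: "z - c \<in> pw v (- B v)" using z(1) by simp
    have "z \<in> pw w (- (0 + B + single v) w)" if w: "w \<in> Pf" for w
    proof -
      have wp: "w \<in> places \<iota>" using w PfD by blast
      consider "w = v" | "w \<noteq> v" "w \<in> ?S" | "w \<notin> ?S" by blast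
      then show ?thesis
      proof cases
        case 1
        have vp: "v \<in> places \<iota>" using v PfD by blast
        have "c \<in> pw v (- B v - 1)" using c by simp
        then have "(z - c) + c \<in> pw v (- B v - 1)" by (intro pw_add[OF vp] pw_mono[OF vp zv]) auto
        then show ?thesis using 1 by (simp add: single_def)
      next
        case 2
        then have "z - 0 \<in> pw w (- B w)" using bspec[OF z(1) 2(2)] by simp
        then show ?thesis using 2 by (simp add: single_def)
      next
        case 3
        then have "z \<in> pw w 0" using z(2) w by blast
        then show ?thesis using 3 by (simp add: single_def)
      qed
    qed
    then show "\<exists>z\<in>Lsp Pf (0 + B + single v). z - c \<in> pw v (- (0 + B) v)"
      using zv unfolding Lsp_def by (intro bexI[of _ z] CollectI ballI) simp_all
  qed
  let ?R = "pcomb ` polys_below (\<lambda>_. degree h)"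
  have O: "Lsp Pf 0 = range pcomb" using integral_iff by (auto simp: Lsp_def)
  have mem: "z \<in> Lsp Pf (0 + zero_part h) \<longleftrightarrow> ev h * z \<in> range pcomb" for z
  proof -
    have "z \<in> pw v (- zero_part h v) \<longleftrightarrow> ev h * z \<in> pw v 0" if v: "v \<in> Pf" for v
      using eh v by (cases "z = 0") (auto simp: pw_def zero_part_def place_mult[OF PfD(1)[OF v]])
    then show ?thesis unfolding integral_iff[symmetric] Lsp_def by simp
  qed
  have "transversal (Lsp Pf (0 + zero_part h)) (Lsp Pf 0) ((\<lambda>z. z / ev h) ` ?R)"
    unfolding transversal_def
  proof (intro conjI ballI impI)
    show "(\<lambda>z. z / ev h) ` ?R \<subseteq> Lsp Pf (0 + zero_part h)"
    proof (rule image_subsetI)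
      fix z assume "z \<in> ?R"
      then show "z / ev h \<in> Lsp Pf (0 + zero_part h)" unfolding mem using eh by auto
    qed
  next
    fix z assume "z \<in> Lsp Pf (0 + zero_part h)"
    then obtain p where p: "ev h * z = pcomb p" unfolding mem by blast
    let ?r = "\<lambda>j. p j mod h"
    have "?r j = 0 \<or> degree (?r j) < degree h" for j using degree_mod_less[OF h, of "p j"] by auto
    then have r: "?r \<in> polys_below (\<lambda>_. degree h)" unfolding polys_below_def coeff_zero_iff_degree by blast
    have "ev (p j) = ev h * ev (p j div h) + ev (?r j)" for j
      using ev_add[of "h * (p j div h)" "p j mod h"] by (simp add: ev_mult)
    then have "pcomb p = ev h * pcomb (\<lambda>j. p j div h) + pcomb ?r"
      unfolding pcomb_def by (simp add: algebra_simps sum.distrib sum_distrib_left)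
    then have "z - pcomb ?r / ev h = pcomb (\<lambda>j. p j div h)" using p eh by (simp add: field_simps)
    then show "\<exists>t\<in>(\<lambda>z. z / ev h) ` ?R. z - t \<in> Lsp Pf 0" using r unfolding O by blast
  next
    fix t t' assume "t \<in> (\<lambda>z. z / ev h) ` ?R" "t' \<in> (\<lambda>z. z / ev h) ` ?R" "t - t' \<in> Lsp Pf 0"
    then obtain r r' q where r: "t = pcomb r / ev h" "r \<in> polys_below (\<lambda>_. degree h)"
      "t' = pcomb r' / ev h" "r' \<in> polys_below (\<lambda>_. degree h)" "t - t' = pcomb q" unfolding O by blast
    have "pcomb r - pcomb r' = ev h * pcomb q"
      using r(5) eh unfolding r(1,3) by (simp add: field_simps)
    then have "pcomb r = pcomb (\<lambda>j. r' j + h * q j)"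
      unfolding pcomb_def by (simp add: algebra_simps sum.distrib sum_distrib_left ev_add ev_mult)
    then have eq: "r j = r' j + h * q j" if "j < n" for j using pcomb_inj that by blast
    have "r j = r' j" if j: "j < n" for j
    proof (rule ccontr)
      assume "r j \<noteq> r' j"
      then have q: "q j \<noteq> 0" "r j - r' j = h * q j" "r j - r' j \<noteq> 0" using eq[OF j] by auto
      have "\<forall>i\<ge>degree h. coeff (r j - r' j) i = 0" using r(2,4) j by (simp add: polys_below_def)
      then have "degree (r j - r' j) < degree h" using q(3) coeff_zero_iff_degree by blast
      then show False unfolding q(2) using h q(1) by (simp add: degree_mult_eq)
    qed
    then have "pcomb r = pcomb r'" unfolding pcomb_def by (intro sum.cong) auto
    then show "t = t'" by (simp add: r)
  qed
  then have "idx (Lsp Pf (0 + zero_part h)) (Lsp Pf 0) = card ((\<lambda>z. z / ev h) ` ?R)"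
    by (rule idx_transversal[OF subgrp_Lsp[OF T]])
  also have "\<dots> = card ?R" using eh by (intro card_image) (auto simp: inj_on_def)
  also have "\<dots> = CARD('a) ^ (n * degree h)" by (simp add: card_pcomb_polys_below)
  finally have "nat (divisor_degree \<iota> (zero_part h)) = n * degree h"
    using chain card_power_inject by simp
  moreover have "0 \<le> divisor_degree \<iota> (zero_part h)"
    using zero_part_effective[OF h] by (intro divisor_degree_nonneg) (simp add: effective_on_def)
  ultimately show ?thesis by (metis int_nat_eq)
qed

end

section \<open>Counting monomials\<close>

lemma div_reflect:
  fixes a b :: int
  assumes "0 < b"
  shows "(- 1 - a) div b = - 1 - a div b"
proof (rule int_div_pos_eq[where r = "b - 1 - a mod b"])
  show "- 1 - a = b * (- 1 - a div b) + (b - 1 - a mod b)"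
    using mult_div_mod_eq[of b a] by (simp add: algebra_simps)
  show "0 \<le> b - 1 - a mod b" "b - 1 - a mod b < b"
    using pos_mod_bound[OF assms, of a] pos_mod_sign[OF assms, of a] by linarith+
qed

text \<open>Because \<open>k\<close> and \<open>e\<close> are coprime, the residues run through \<open>0, \<dots>, k - 1\<close>.\<close>

lemma sum_residues:
  fixes m :: int and k e :: nat
  assumes k: "0 < k" and cop: "coprime k e"
  shows "2 * (\<Sum>j<k. (m - int e * int j) mod int k) = int k * (int k - 1)"
proof -
  let ?r = "\<lambda>j. nat ((m - int e * int j) mod int k)"
  have r: "int (?r j) = (m - int e * int j) mod int k" for j using k by simp
  have inj: "inj_on ?r {..<k}"
  proof (rule inj_onI)
    fix i j assume ij: "i \<in> {..<k}" "j \<in> {..<k}" "?r i = ?r j"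
    then have "(m - int e * int i) mod int k = (m - int e * int j) mod int k" using r by metis
    then have "int k dvd (m - int e * int i) - (m - int e * int j)" by (simp only: mod_eq_dvd_iff)
    then have "int k dvd int e * (int j - int i)" by (simp add: algebra_simps)
    moreover have "coprime (int k) (int e)" using cop by simp
    ultimately have d: "int k dvd int j - int i" by (simp add: coprime_dvd_mult_right_iff)
    have "int j - int i = 0"
    proof (rule ccontr)
      assume ne: "int j - int i \<noteq> 0"
      then have "int k \<le> \<bar>int j - int i\<bar>" using dvd_imp_le_int[OF ne d] by simp
      then show False using ij(1,2) by auto
    qed
    then show "i = j" by simp
  qed
  have "?r ` {..<k} \<subseteq> {..<k}"
  proof (rule image_subsetI)
    fix j show "?r j \<in> {..<k}" using pos_mod_bound[of "int k" "m - int e * int j"] k by (simp add: nat_less_iff)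
  qed
  then have im: "?r ` {..<k} = {..<k}" using inj by (simp add: endo_inj_surj)
  have "(\<Sum>j<k. (m - int e * int j) mod int k) = (\<Sum>j<k. int (?r j))" by (simp only: r)
  also have "\<dots> = (\<Sum>i\<in>?r ` {..<k}. int i)" using sum.reindex[OF inj, of int] by (simp only: o_def)
  also have "\<dots> = (\<Sum>i<k. int i)" by (simp only: im)
  finally have "(\<Sum>j<k. (m - int e * int j) mod int k) = (\<Sum>i<k. int i)" .
  moreover have "2 * (\<Sum>i<k. int i) = int k * (int k - 1)"
    by (induction k) (simp_all add: algebra_simps)
  ultimately show ?thesis by simp
qed

context superelliptic
begin

text \<open>The canonical divisor \<open>K\<close> is equivalent to \<open>kappa D\<^sub>\<infinity>\<close>, as will be shown in \<open>K_div_eq\<close>.\<close>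

definition kappa :: int where
  "kappa = int dd * (int n - 1) - int nn - 1"

text \<open>The genus, by \<open>genus_eq\<close>; the division is exact by \<open>two_genus_num\<close>.\<close>

definition genus_num :: int where
  "genus_num = int cc * kappa div 2 + 1"

text \<open>The floors are expressed by residues modulo \<open>nn\<close>, which form \<open>cc\<close> complete systems of
  residues.\<close>

lemma sum_floor: "2 * (\<Sum>j<n. (m - int dd * int j) div int nn + 1) = 2 * int cc * m - int cc * kappa"
proof -
  let ?A = "\<lambda>j. m - int dd * int j"
  have "2 * (\<Sum>j<n. ?A j mod int nn) = int cc * (int nn * (int nn - 1))"
  proof -
    have "(\<Sum>j<n. ?A j mod int nn) = (\<Sum>i<cc. \<Sum>j\<in>{i * nn..<i * nn + nn}. ?A j mod int nn)"
      unfolding sum.nat_group n_eq[symmetric] ..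
    also have "\<dots> = (\<Sum>i<cc. \<Sum>j<nn. ?A j mod int nn)"
    proof (rule sum.cong[OF refl])
      fix i
      have "(\<Sum>j\<in>{i * nn..<i * nn + nn}. ?A j mod int nn) = (\<Sum>j<nn. ?A (j + i * nn) mod int nn)"
        using sum.shift_bounds_nat_ivl[of "\<lambda>j. ?A j mod int nn" 0 "i * nn" nn]
        by (simp add: add.commute atLeast0LessThan)
      also have "\<dots> = (\<Sum>j<nn. ?A j mod int nn)"
      proof (rule sum.cong[OF refl])
        fix j
        have "?A (j + i * nn) = ?A j + (- int dd * int i) * int nn" by (simp add: algebra_simps)
        then show "?A (j + i * nn) mod int nn = ?A j mod int nn" by (simp only: mod_mult_self1)
      qed
      finally show "(\<Sum>j\<in>{i * nn..<i * nn + nn}. ?A j mod int nn) = (\<Sum>j<nn. ?A j mod int nn)" .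
    qed
    finally show ?thesis using sum_residues[OF nn_pos coprime_nn_dd, of m] by simp
  qed
  moreover have "2 * (\<Sum>j<n. ?A j) = 2 * int n * m - int dd * (int n * (int n - 1))"
  proof -
    have "2 * (\<Sum>i<k. int i) = int k * (int k - 1)" for k by (induction k) (simp_all add: algebra_simps)
    then have "2 * (int dd * (\<Sum>i<n. int i)) = int dd * (int n * (int n - 1))" by (metis mult.left_commute)
    moreover have "(\<Sum>j<n. ?A j) = int n * m - int dd * (\<Sum>i<n. int i)"
      by (simp add: sum_subtractf sum_distrib_left)
    ultimately show ?thesis by (simp only: right_diff_distrib mult.assoc)
  qed
  moreover have "int nn * (\<Sum>j<n. ?A j div int nn) = (\<Sum>j<n. ?A j) - (\<Sum>j<n. ?A j mod int nn)"
  proof -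
    have "int nn * (?A j div int nn) = ?A j - ?A j mod int nn" for j
      using mult_div_mod_eq[of "int nn" "?A j"] by linarith
    then show ?thesis by (simp only: sum_distrib_left sum_subtractf)
  qed
  ultimately have "int nn * (2 * (\<Sum>j<n. ?A j div int nn))
      = 2 * int n * m - int dd * (int n * (int n - 1)) - int cc * (int nn * (int nn - 1))" by linarith
  also have "\<dots> = int nn * (2 * int cc * m - int cc * int dd * (int n - 1) - int cc * (int nn - 1))"
    by (subst (1 2) n_eq) (simp add: algebra_simps)
  finally have "2 * (\<Sum>j<n. ?A j div int nn) = 2 * int cc * m - int cc * int dd * (int n - 1) - int cc * (int nn - 1)"
    using nn_pos by simp
  moreover have "(\<Sum>j<n. ?A j div int nn + 1) = (\<Sum>j<n. ?A j div int nn) + int n" by (simp add: sum.distrib)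
  moreover have "int n = int cc * int nn" using n_eq by (metis of_nat_mult)
  moreover have "int cc * kappa = int cc * int dd * (int n - 1) - int cc * int nn - int cc"
    by (simp add: kappa_def algebra_simps)
  ultimately show ?thesis by (simp add: algebra_simps)
qed

text \<open>The product is even because \<open>sum_floor\<close> expresses it as twice an integer.\<close>

lemma two_genus_num: "2 * genus_num - 2 = int cc * kappa"
proof -
  define S where "S = (\<Sum>j<n. (0 - int dd * int j) div int nn + 1)"
  have "2 * S = 2 * int cc * 0 - int cc * kappa" unfolding S_def by (rule sum_floor)
  then have "int cc * kappa = 2 * (- S)" by simp
  then have "even (int cc * kappa)" by simp
  then show ?thesis by (simp add: genus_num_def)
qed

text \<open>Serre duality for monomials: \<open>j \<mapsto> n - 1 - j\<close> turns the floor that belongs to \<open>kappa - m\<close>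
  into the negative of the one that belongs to \<open>m\<close>. The difference of the two sums is thus the sum
  of the floors without truncation.\<close>

lemma Phi_duality: "Phi n d m - Phi n d (kappa - m) = int cc * m + 1 - genus_num"
proof -
  let ?a = "\<lambda>j. (m - int dd * int j) div int nn + 1"
  have b: "int (bound m' j) = max 0 ((m' - int dd * int j) div int nn + 1)" for m' j
    by (simp add: bound_def max_def)
  have reflect: "(kappa - m - int dd * int (n - Suc j)) div int nn + 1 = - ?a j" if "j < n" for j
  proof -
    have "kappa - m - int dd * int (n - Suc j) = (- 1 - (m - int dd * int j)) + (- 1) * int nn"
      using that by (simp add: kappa_def of_nat_diff algebra_simps)
    then have "(kappa - m - int dd * int (n - Suc j)) div int nn = ((- 1 - (m - int dd * int j)) + (- 1) * int nn) div int nn"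
      by (simp only:)
    also have "\<dots> = - 1 + (- 1 - (m - int dd * int j)) div int nn"
      by (rule div_mult_self1) (use nn_pos in simp)
    finally show ?thesis using div_reflect[of "int nn" "m - int dd * int j"] nn_pos by simp
  qed
  have "Phi n d (kappa - m) = (\<Sum>j<n. int (bound (kappa - m) (n - Suc j)))"
    unfolding Phi_eq by (rule sum.nat_diff_reindex[symmetric])
  also have "\<dots> = (\<Sum>j<n. max 0 (- ?a j))"
  proof (rule sum.cong[OF refl])
    fix j assume "j \<in> {..<n}"
    then have j: "j < n" by simp
    show "int (bound (kappa - m) (n - Suc j)) = max 0 (- ?a j)" unfolding b reflect[OF j] ..
  qed
  finally have k: "Phi n d (kappa - m) = (\<Sum>j<n. max 0 (- ?a j))" .
  have "Phi n d m - Phi n d (kappa - m) = (\<Sum>j<n. max 0 (?a j) - max 0 (- ?a j))"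
    unfolding k unfolding Phi_eq b by (simp only: sum_subtractf)
  also have "\<dots> = (\<Sum>j<n. ?a j)" by (intro sum.cong) auto
  finally have "2 * (Phi n d m - Phi n d (kappa - m)) = 2 * int cc * m - int cc * kappa" using sum_floor by simp
  moreover have "A = Y + 1 - g" if "2 * A = X - K" "2 * g - 2 = K" "X = 2 * Y" for A X K Y g :: int
    using that by linarith
  ultimately show ?thesis using two_genus_num by (simp only: mult.assoc)
qed

lemma Phi_nonneg: "0 \<le> Phi n d m"
  unfolding Phi_eq by (simp add: sum_nonneg)

lemma Phi_neg: "m < 0 \<Longrightarrow> Phi n d m = 0"
proof -
  assume m: "m < 0"
  have "bound m j = 0" for j
  proof -
    have "0 \<le> int dd * int j" by simp
    then have "m - int dd * int j < 0" using m by linarith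
    then have "(m - int dd * int j) div int nn < 0"
      using pos_imp_zdiv_neg_iff[of "int nn" "m - int dd * int j"] nn_pos by linarith
    then show ?thesis by (simp add: bound_def)
  qed
  then show ?thesis by (simp add: Phi_eq)
qed

lemma Phi_pos: "0 \<le> m \<Longrightarrow> 0 < Phi n d m"
proof -
  assume m: "0 \<le> m"
  have "0 \<le> m div int nn" using m nn_pos by (simp add: pos_imp_zdiv_nonneg_iff)
  then have "0 < int (bound m 0)" by (simp add: bound_def)
  also have "\<dots> \<le> Phi n d m"
    unfolding Phi_eq using n_ge_2 by (intro member_le_sum) auto
  finally show ?thesis .
qed

text \<open>The term \<open>Phi n d (kappa - m)\<close> of the duality vanishes only for a negative argument.\<close>

lemma Phi_eq_iff: "Phi n d m = int cc * m + 1 - genus_num \<longleftrightarrow> 2 * genus_num - 2 < int cc * m"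
proof -
  have "Phi n d m = int cc * m + 1 - genus_num \<longleftrightarrow> Phi n d (kappa - m) = 0" using Phi_duality[of m] by auto
  also have "\<dots> \<longleftrightarrow> kappa - m < 0" using Phi_neg[of "kappa - m"] Phi_pos[of "kappa - m"] by (cases "kappa - m < 0") auto
  also have "\<dots> \<longleftrightarrow> int cc * kappa < int cc * m" using cc_pos by simp
  finally show ?thesis by (simp only: two_genus_num)
qed

lemma Phi_ge: "int cc * m + 1 - genus_num \<le> Phi n d m"
  using Phi_duality[of m] Phi_nonneg[of "kappa - m"] by linarith

section \<open>The degree of the divisor at infinity and the genus\<close>

lemma D_inf_eq: "D_inf \<iota> x = mD 1"
  by (auto simp: D_inf_def mD_def Pinf_def fun_eq_iff)

lemma G_div_eq: "G_div \<iota> x s = mD s"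
  by (auto simp: G_div_def D_inf_eq mD_def fun_eq_iff)

lemma finite_support_mD: "finite {v. mD m v \<noteq> 0}"
  by (rule finite_subset[OF _ finite_Pinf]) (auto simp: mD_def)

lemma mD_add: "mD m + mD k = mD (m + k)"
  by (auto simp: mD_def fun_eq_iff)

text \<open>For large \<open>m\<close> all principal parts at infinity occur when the pole order is raised from \<open>m\<close>
  to \<open>m + 1\<close>, so the degree is the number of new monomials.\<close>

lemma degree_mD_1: "divisor_degree \<iota> (mD 1) = int cc"
proof -
  \<comment> \<open>From \<open>kappa + 1\<close> on, the number of monomials is linear; the second bound is the one required
    by the approximation at infinity.\<close>
  define m where "m = max (kappa + 1) (int (dd * n))"
  have T: "Pinf \<subseteq> places \<iota>" by (auto simp: Pinf_def)
  have eff: "effective_on Pinf (mD 1)"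
    using finite_support_mD[of 1] by (auto simp: effective_on_def mD_def)
  have "finite (cosets (L (mD m + mD 1)) (L (mD m))) \<and>
    idx (L (mD m + mD 1)) (L (mD m)) = CARD('a) ^ nat (divisor_degree \<iota> (mD 1))"
  proof (rule Lsp_chain_eq[OF subset_refl T eff])
    fix B :: "'k divisor" and v c
    assume B: "effective_on Pinf B" and v: "v \<in> Pinf" and c: "c \<in> pw v (- (mD m + B) v - 1)"
    let ?N = "\<lambda>w. - (mD m + B) w"
    have N: "?N w \<le> - int (dd * n)" if "w \<in> Pinf" for w
    proof -
      have "0 \<le> B w" "mD m w = m" using B that by (simp_all add: effective_on_def mD_def)
      then show ?thesis unfolding m_def by simp
    qed
    obtain p where p: "\<forall>w\<in>Pinf. pcomb p - (if w = v then c else 0) \<in> pw w (?N w)"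
      using approximation_at_infinity[of ?N "\<lambda>w. if w = v then c else 0", OF N] by blast
    have pc: "pcomb p - c \<in> pw v (?N v)" using bspec[OF p v] by simp
    have all: "pcomb p \<in> pw w (- (mD m + B + single v) w)" if w: "w \<in> places \<iota>" for w
    proof -
      consider "w = v" | "w \<in> Pinf" "w \<noteq> v" | "w \<in> Pf" using w places_Un by blast
      then show ?thesis
      proof cases
        case 1
        have vp: "v \<in> places \<iota>" using v PinfD by blast
        have "(pcomb p - c) + c \<in> pw v (?N v - 1)" using c by (intro pw_add[OF vp] pw_mono[OF vp pc]) auto
        then show ?thesis using 1 by (simp add: single_def)
      next
        case 2
        then show ?thesis using bspec[OF p 2(1)] by (simp add: single_def)
      next
        case 3
        then have "w \<notin> Pinf" using Pf_Pinf by blast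
        moreover then have "B w = 0" using B by (auto simp: effective_on_def)
        moreover have "w \<noteq> v" using \<open>w \<notin> Pinf\<close> v by blast
        ultimately show ?thesis using pcomb_pw[OF 3] by (simp add: mD_def single_def)
      qed
    qed
    have "pcomb p \<in> L (mD m + B + single v)"
      unfolding Lsp_def by (rule CollectI, rule ballI, rule all)
    with pc show "\<exists>z\<in>L (mD m + B + single v). z - c \<in> pw v (- (mD m + B) v)"
      by (rule bexI)
  qed
  then have i: "idx (L (mD (m + 1))) (L (mD m)) = CARD('a) ^ nat (divisor_degree \<iota> (mD 1))"
    by (simp only: mD_add)
  have "L (mD m) \<subseteq> L (mD (m + 1))"
    by (rule Lsp_mono) (auto simp: mD_def)
  from card_eq_idx_mult[OF subgrp_Lsp[OF subset_refl] subgrp_Lsp[OF subset_refl] this card_Lsp_mD(2)]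
  have "CARD('a) ^ nat (Phi n d (m + 1)) = CARD('a) ^ nat (divisor_degree \<iota> (mD 1)) * CARD('a) ^ nat (Phi n d m)"
    unfolding i card_Lsp_mD(1) .
  then have eq: "nat (Phi n d (m + 1)) = nat (divisor_degree \<iota> (mD 1)) + nat (Phi n d m)"
    by (simp only: power_add[symmetric] card_power_inject)
  have "kappa - m < 0" "kappa - (m + 1) < 0" by (simp_all add: m_def)
  then have "Phi n d m = int cc * m + 1 - genus_num" "Phi n d (m + 1) = int cc * (m + 1) + 1 - genus_num"
    using Phi_duality[of m] Phi_duality[of "m + 1"] Phi_neg[of "kappa - m"] Phi_neg[of "kappa - (m + 1)"] by simp_all
  then have "Phi n d (m + 1) = Phi n d m + int cc" by (simp add: algebra_simps)
  then have "nat (divisor_degree \<iota> (mD 1)) = cc"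
    using eq Phi_nonneg[of m] by (simp add: nat_add_distrib)
  moreover have "0 \<le> divisor_degree \<iota> (mD 1)" by (intro divisor_degree_nonneg) (simp add: mD_def)
  ultimately show ?thesis by linarith
qed

lemma degree_mD: "divisor_degree \<iota> (mD m) = int cc * m"
proof -
  have sup: "{v. mD k v \<noteq> 0} \<subseteq> Pinf" for k by (auto simp: mD_def)
  have "divisor_degree \<iota> (mD m) = (\<Sum>v\<in>Pinf. m * (mD 1 v * int (place_degree \<iota> v)))"
    unfolding divisor_degree_sum[OF finite_Pinf sup] by (intro sum.cong) (simp_all add: mD_def)
  also have "\<dots> = m * divisor_degree \<iota> (mD 1)"
    unfolding divisor_degree_sum[OF finite_Pinf sup] by (simp only: sum_distrib_left)
  finally show ?thesis by (simp add: degree_mD_1)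
qed

definition pdiv :: "'k \<Rightarrow> 'k divisor" where "pdiv = principal_divisor \<iota>"

lemma pdiv_apply: "pdiv h v = (if v \<in> places \<iota> then v h else 0)"
  by (simp add: pdiv_def principal_divisor_def)

lemma pdiv_ev: "h \<noteq> 0 \<Longrightarrow> pdiv (ev h) = zero_part h + mD (- (int nn * int (degree h)))"
proof
  fix v assume h: "h \<noteq> 0"
  show "pdiv (ev h) v = (zero_part h + mD (- (int nn * int (degree h)))) v"
  proof (cases "v \<in> Pinf")
    case True
    then have "v \<notin> Pf" using Pf_Pinf by blast
    then show ?thesis
      using True place_inf_value[OF PinfD[OF True] h] inf_values[OF PinfD[OF True]] PinfD(1)[OF True]
      by (simp add: pdiv_apply zero_part_def mD_def)
  next
    case False
    then show ?thesis using places_Un by (auto simp: pdiv_apply zero_part_def mD_def)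
  qed
qed

lemma finite_support_zero_part: "h \<noteq> 0 \<Longrightarrow> finite {v. zero_part h v \<noteq> 0}"
  using zero_part_effective by (simp add: effective_on_def)

lemma finite_support_add:
  "finite {v. G v \<noteq> 0} \<Longrightarrow> finite {v. H v \<noteq> 0} \<Longrightarrow> finite {v. (G + H) v \<noteq> (0::int)}"
  by (rule finite_subset[of _ "{v. G v \<noteq> 0} \<union> {v. H v \<noteq> 0}"]) auto

lemma finite_support_pdiv_ev: "h \<noteq> 0 \<Longrightarrow> finite {v. pdiv (ev h) v \<noteq> 0}"
  unfolding pdiv_ev by (intro finite_support_add finite_support_zero_part finite_support_mD)

lemma degree_pdiv_ev: "h \<noteq> 0 \<Longrightarrow> divisor_degree \<iota> (pdiv (ev h)) = 0"
proof -
  assume h: "h \<noteq> 0"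
  have "int n = int cc * int nn" using n_eq by (metis of_nat_mult)
  then show ?thesis
    unfolding pdiv_ev[OF h] divisor_degree_add[OF finite_support_zero_part[OF h] finite_support_mD]
      degree_zero_part[OF h] degree_mD by simp
qed

lemma RR_space_eq: "{v. G v \<noteq> 0} \<subseteq> places \<iota> \<Longrightarrow> RR_space \<iota> G = L G"
proof -
  assume G: "{v. G v \<noteq> 0} \<subseteq> places \<iota>"
  have "h \<in> RR_space \<iota> G \<longleftrightarrow> h \<in> L G" for h
  proof (cases "h = 0")
    case True then show ?thesis by (simp add: RR_space_def Lsp_def pw_def)
  next
    case False
    have "h \<in> RR_space \<iota> G \<longleftrightarrow> (\<forall>v. 0 \<le> (if v \<in> places \<iota> then v h else 0) + G v)"
      using False by (simp add: RR_space_def le_fun_def principal_divisor_def)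
    also have "\<dots> \<longleftrightarrow> (\<forall>v\<in>places \<iota>. - G v \<le> v h)"
    proof
      assume a: "\<forall>v. 0 \<le> (if v \<in> places \<iota> then v h else 0) + G v"
      show "\<forall>v\<in>places \<iota>. - G v \<le> v h"
      proof
        fix v assume "v \<in> places \<iota>" then show "- G v \<le> v h" using spec[OF a, of v] by simp
      qed
    next
      assume a: "\<forall>v\<in>places \<iota>. - G v \<le> v h"
      show "\<forall>v. 0 \<le> (if v \<in> places \<iota> then v h else 0) + G v"
      proof
        fix v show "0 \<le> (if v \<in> places \<iota> then v h else 0) + G v"
        proof (cases "v \<in> places \<iota>")
          case True then show ?thesis using bspec[OF a True] by simp
        next
          case False
          then have "G v = 0" using G by blast
          then show ?thesis using False by simp
        qed
      qed
    qed
    also have "\<dots> \<longleftrightarrow> h \<in> L G" using False by (simp add: Lsp_def pw_def)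
    finally show ?thesis .
  qed
  then show ?thesis by blast
qed

lemma subspace_Lsp: "T \<subseteq> places \<iota> \<Longrightarrow> module.subspace (const_scale \<iota>) (Lsp T G)"
proof (rule subspaceI)
  assume T: "T \<subseteq> places \<iota>"
  show "subgrp (Lsp T G)" by (rule subgrp_Lsp[OF T])
  show "\<iota> a * z \<in> Lsp T G" if z: "z \<in> Lsp T G" for a z
    unfolding Lsp_def
  proof (rule CollectI, rule ballI)
    fix v assume v: "v \<in> T"
    then have vp: "v \<in> places \<iota>" and "z \<in> pw v (- G v)" using T z by (auto simp: Lsp_def)
    then show "\<iota> a * z \<in> pw v (- G v)" using pw_mult[OF vp pw_const[OF vp emb, of a]] by fastforce
  qed
qed

lemma card_power_RR_dim:
  "{v. G v \<noteq> 0} \<subseteq> places \<iota> \<Longrightarrow> finite (L G) \<Longrightarrow> CARD('a) ^ RR_dim \<iota> G = card (L G)"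
  unfolding RR_dim_def
  by (simp add: RR_space_eq card_power_dim[OF vector_space_const_scale[OF emb] subspace_Lsp])

text \<open>Multiplication by \<open>h\<close> identifies the spaces of functions of the two equivalent divisors.\<close>

lemma Lsp_shift:
  assumes h: "h \<noteq> 0"
  shows "z \<in> L (mD m + pdiv h) \<longleftrightarrow> z * h \<in> L (mD m)"
    and "card (L (mD m + pdiv h)) = CARD('a) ^ nat (Phi n d m)"
    and "finite (L (mD m + pdiv h))"
proof -
  have iff: "z \<in> L (mD m + pdiv h) \<longleftrightarrow> z * h \<in> L (mD m)" for z
  proof -
    have "z \<in> pw v (- (mD m + pdiv h) v) \<longleftrightarrow> z * h \<in> pw v (- mD m v)" if v: "v \<in> places \<iota>" for v
      using h v by (cases "z = 0") (auto simp: pw_def pdiv_apply place_mult[OF v])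
    then show ?thesis unfolding Lsp_def by simp
  qed
  show "z \<in> L (mD m + pdiv h) \<longleftrightarrow> z * h \<in> L (mD m)" by (rule iff)
  have b: "bij_betw (\<lambda>z. z * h) (L (mD m + pdiv h)) (L (mD m))"
  proof (rule bij_betwI[where g = "\<lambda>z. z / h"])
    show "(\<lambda>z. z * h) \<in> L (mD m + pdiv h) \<rightarrow> L (mD m)" by (simp add: iff)
    show "(\<lambda>z. z / h) \<in> L (mD m) \<rightarrow> L (mD m + pdiv h)" using h by (simp add: iff)
  qed (use h in simp_all)
  show "card (L (mD m + pdiv h)) = CARD('a) ^ nat (Phi n d m)"
    unfolding bij_betw_same_card[OF b] by (rule card_Lsp_mD(1))
  show "finite (L (mD m + pdiv h))" unfolding bij_betw_finite[OF b] by (rule card_Lsp_mD(2))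
qed

text \<open>A product of powers of polynomials covers the coefficients at the finite places, after which
  \<open>m\<close> is chosen for those at infinity.\<close>

lemma divisor_below:
  assumes G: "is_divisor \<iota> G"
  shows "\<exists>m h. h \<noteq> 0 \<and> (\<forall>v. G v \<le> (mD m + pdiv (ev h)) v)"
proof -
  let ?S = "{v. G v \<noteq> 0} \<inter> Pf"
  have S: "finite ?S" using G by (simp add: is_divisor_def)
  have "\<forall>v\<in>?S. \<exists>p. prime_elem p \<and> 0 < v (ev p)" using Pf_prime by blast
  then obtain p where p: "\<forall>v\<in>?S. prime_elem (p v) \<and> 0 < v (ev (p v))" by (rule bchoice[THEN exE])
  define h where "h = (\<Prod>v\<in>?S. p v ^ nat \<bar>G v\<bar>)"
  have h0: "h \<noteq> 0" using p S by (auto simp: h_def prime_elem_def)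
  have fin: "G v \<le> v (ev h)" if v: "v \<in> Pf" for v
  proof (cases "v \<in> ?S")
    case True
    let ?g = "\<Prod>v\<in>?S - {v}. p v ^ nat \<bar>G v\<bar>"
    have eq: "h = p v ^ nat \<bar>G v\<bar> * ?g" unfolding h_def using S True by (intro prod.remove) auto
    have pv: "0 < v (ev (p v))" using p True by blast
    have "p v ^ nat \<bar>G v\<bar> \<noteq> 0" "?g \<noteq> 0" using h0 eq by auto
    then have "v (ev h) = int (nat \<bar>G v\<bar>) * v (ev (p v)) + v (ev ?g)"
      unfolding eq by (simp add: ev_mult ev_power place_mult[OF PfD(1)[OF v]] place_power[OF PfD(1)[OF v]] ev_eq_0)
    moreover have "\<bar>G v\<bar> * 1 \<le> \<bar>G v\<bar> * v (ev (p v))" using pv by (intro mult_left_mono) auto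
    ultimately show ?thesis using Pf_ev_nonneg[OF v, of ?g] by simp
  next
    case False
    then show ?thesis using v Pf_ev_nonneg[OF v, of h] by simp
  qed
  define m where "m = (\<Sum>v\<in>Pinf. \<bar>G v\<bar>) + int nn * int (degree h)"
  have inf: "G v \<le> m - int nn * int (degree h)" if v: "v \<in> Pinf" for v
    using member_le_sum[OF v, of "\<lambda>v. \<bar>G v\<bar>"] finite_Pinf by (simp add: m_def)
  have "G v \<le> (mD m + pdiv (ev h)) v" for v
  proof -
    consider "v \<in> Pf" | "v \<in> Pinf" | "v \<notin> places \<iota>" using places_Un by blast
    then show ?thesis
    proof cases
      case 1
      then have "v \<notin> Pinf" using Pf_Pinf by blast
      then show ?thesis using fin[OF 1] PfD(1)[OF 1] by (simp add: mD_def pdiv_apply)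
    next
      case 2
      then have "v \<notin> Pf" using Pf_Pinf by blast
      then show ?thesis using inf[OF 2] 2 unfolding pdiv_ev[OF h0] by (simp add: mD_def zero_part_def)
    next
      case 3
      then have "v \<notin> Pinf" "G v = 0" using G PinfD(1) by (auto simp: is_divisor_def)
      then show ?thesis using 3 by (simp add: mD_def pdiv_apply)
    qed
  qed
  then show ?thesis using h0 by blast
qed

text \<open>Enlarging a divisor adds at most as much to the dimension as to the degree, so the
  difference of the two does not decrease. It is known for the larger divisor of \<open>divisor_below\<close>.\<close>

lemma divisor_degree_defect_le:
  assumes G: "is_divisor \<iota> G"
  shows "divisor_degree \<iota> G - int (RR_dim \<iota> G) + 1 \<le> genus_num"
proof -
  obtain m h where h: "h \<noteq> 0" and le: "\<forall>v. G v \<le> (mD m + pdiv (ev h)) v"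
    using divisor_below[OF G] by blast
  define H where "H = mD m + pdiv (ev h)"
  define B where "B = H - G"
  have eh: "ev h \<noteq> 0" using h by (simp add: ev_eq_0)
  have finG: "finite {v. G v \<noteq> 0}" and supG: "{v. G v \<noteq> 0} \<subseteq> places \<iota>" using G by (auto simp: is_divisor_def)
  have finH: "finite {v. H v \<noteq> 0}"
    unfolding H_def by (intro finite_support_add finite_support_mD finite_support_pdiv_ev[OF h])
  have supH: "{v. H v \<noteq> 0} \<subseteq> places \<iota>" by (auto simp: H_def mD_def pdiv_apply Pinf_def split: if_splits)
  have supB: "{v. B v \<noteq> 0} \<subseteq> {v. H v \<noteq> 0} \<union> {v. G v \<noteq> 0}" by (auto simp: B_def)
  have finB: "finite {v. B v \<noteq> 0}" using supB finG finH by (meson finite_UnI finite_subset)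
  have eff: "effective_on (places \<iota>) B"
    unfolding effective_on_def using finB supB supG supH le by (auto simp: B_def H_def)
  have HB: "H = G + B" by (simp add: B_def)
  have sub: "L G \<subseteq> L H"
    by (rule Lsp_mono) (use le in \<open>simp_all only: H_def subset_refl\<close>)
  have finL: "finite (L H)" unfolding H_def by (rule Lsp_shift(3)[OF eh])
  have finLG: "finite (L G)" by (rule finite_subset[OF sub finL])
  have "CARD('a) ^ nat (Phi n d m) = card (L H)" unfolding H_def by (rule Lsp_shift(2)[OF eh, symmetric])
  also have "\<dots> = idx (L H) (L G) * card (L G)"
    by (rule card_eq_idx_mult[OF subgrp_Lsp subgrp_Lsp sub finL]) simp_all
  also have "\<dots> \<le> CARD('a) ^ nat (divisor_degree \<iota> B) * CARD('a) ^ RR_dim \<iota> G"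
    using Lsp_chain_le[OF subset_refl eff, of G] unfolding HB[symmetric] card_power_RR_dim[OF supG finLG]
    by (intro mult_right_mono) simp_all
  finally have "nat (Phi n d m) \<le> nat (divisor_degree \<iota> B) + RR_dim \<iota> G"
    by (simp only: power_add[symmetric] card_power_le)
  moreover have "0 \<le> divisor_degree \<iota> B" using eff by (intro divisor_degree_nonneg) (simp add: effective_on_def)
  moreover have "divisor_degree \<iota> H = divisor_degree \<iota> G + divisor_degree \<iota> B"
    unfolding HB by (rule divisor_degree_add[OF finG finB])
  moreover have "divisor_degree \<iota> H = int cc * m"
    unfolding H_def divisor_degree_add[OF finite_support_mD finite_support_pdiv_ev[OF h]]
    by (simp add: degree_mD degree_pdiv_ev[OF h])
  ultimately have "divisor_degree \<iota> G \<le> int cc * m - Phi n d m + int (RR_dim \<iota> G)"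
    using Phi_nonneg[of m] by linarith
  then show ?thesis using Phi_ge[of m] by linarith
qed

lemma is_divisor_mD: "is_divisor \<iota> (mD m)"
  using finite_support_mD by (auto simp: is_divisor_def mD_def Pinf_def)

text \<open>The bound is attained by the multiple of \<open>D\<^sub>\<infinity>\<close> of coefficient \<open>kappa + 1\<close>.\<close>

lemma genus_eq: "genus \<iota> = genus_num"
  unfolding genus_def
proof (rule Greatest_equality)
  \<comment> \<open>The smallest coefficient for which the dual term \<open>Phi n d (kappa - m)\<close> is certain to vanish.\<close>
  define m where "m = kappa + 1"
  have "int cc * m + 1 - genus_num = Phi n d m"
    using Phi_duality[of m] Phi_neg[of "kappa - m"] by (simp add: m_def)
  moreover have "CARD('a) ^ RR_dim \<iota> (mD m) = CARD('a) ^ nat (Phi n d m)"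
    using card_power_RR_dim[of "mD m"] card_Lsp_mD is_divisor_mD by (simp add: is_divisor_def)
  then have "int (RR_dim \<iota> (mD m)) = Phi n d m" using Phi_nonneg[of m] by (simp add: card_power_inject)
  ultimately have "genus_num = divisor_degree \<iota> (mD m) - int (RR_dim \<iota> (mD m)) + 1" by (simp add: degree_mD)
  then show "\<exists>G. is_divisor \<iota> G \<and> genus_num = divisor_degree \<iota> G - int (RR_dim \<iota> G) + 1"
    using is_divisor_mD by blast
next
  fix g assume "\<exists>G. is_divisor \<iota> G \<and> g = divisor_degree \<iota> G - int (RR_dim \<iota> G) + 1"
  then show "g \<le> genus_num" using divisor_degree_defect_le by blast
qed

section \<open>Derivations and the canonical divisor\<close>

definition pp :: nat where "pp = CHAR('k)"

lemma pp_prime: "prime pp"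
proof -
  have "of_nat CARD('a) = (0::'k)" using of_nat_card_eq_0 iota_of_nat iota_hom(1) by metis
  then have "0 < CHAR('k)" using CHAR_pos_iff by (metis zero_less_card_finite)
  then show ?thesis unfolding pp_def by (rule prime_CHAR_semidom)
qed

lemma pp_ge_2: "2 \<le> pp"
  using pp_prime by (rule prime_ge_2_nat)

lemma of_nat_eq_0_pp: "of_nat k = (0::'k) \<longleftrightarrow> pp dvd k"
  unfolding pp_def by (rule of_nat_eq_0_iff_char_dvd)

lemma frob_add: "(a + b) ^ pp = a ^ pp + (b ^ pp :: 'k)"
  by (rule freshmans_dream[OF pp_prime[unfolded pp_def] pp_def])

lemma frob_uminus: "(- a) ^ pp = - (a ^ pp :: 'k)"
  using frob_add[of a "- a"] pp_ge_2 by (simp add: zero_power eq_neg_iff_add_eq_0 add.commute)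

lemma frob_diff: "(a - b) ^ pp = a ^ pp - (b ^ pp :: 'k)"
  using frob_add[of a "- b"] by (simp add: frob_uminus)

lemma iota_frob: "\<exists>b. \<iota> a = \<iota> b ^ pp"
proof -
  have "inj (\<lambda>b::'a. b ^ pp)"
  proof (rule injI)
    fix a b :: 'a assume "a ^ pp = b ^ pp"
    then have "(\<iota> a - \<iota> b) ^ pp = 0" by (simp add: frob_diff flip: iota_power)
    then show "a = b" using iota_inj by simp
  qed
  then have "surj (\<lambda>b::'a. b ^ pp)" by (simp add: finite_UNIV_inj_surj)
  then obtain b where "a = b ^ pp" by (metis surjD)
  then show ?thesis using iota_power by blast
qed

lemma frob_vector_space: "vector_space (\<lambda>a z. a ^ pp * z :: 'k)"
  by unfold_locales (auto simp: frob_add power_mult_distrib algebra_simps)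

text \<open>The combinations of \<open>1, t, \<dots>, t ^ (pp - 1)\<close> over the subfield of the \<open>pp\<close>-th powers. The
  coefficients are given by their roots.\<close>

definition fcomb :: "'k \<Rightarrow> (nat \<Rightarrow> 'k) \<Rightarrow> 'k" where
  "fcomb t a = (\<Sum>i<pp. a i ^ pp * t ^ i)"

lemma fcomb_scale: "c ^ pp * fcomb t a = fcomb t (\<lambda>i. c * a i)"
  by (simp add: fcomb_def sum_distrib_left power_mult_distrib mult.assoc)

lemma fcomb_diff: "fcomb t a - fcomb t b = fcomb t (\<lambda>i. a i - b i)"
  by (simp add: fcomb_def frob_diff sum_subtractf algebra_simps)

lemma fcomb_add: "fcomb t a + fcomb t b = fcomb t (\<lambda>i. a i + b i)"
  by (simp add: fcomb_def frob_add sum.distrib algebra_simps)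

lemma fcomb_delta: "j < pp \<Longrightarrow> fcomb t (\<lambda>i. if i = j then 1 else 0) = t ^ j"
proof -
  assume j: "j < pp"
  have "fcomb t (\<lambda>i. if i = j then 1 else 0) = (\<Sum>i<pp. if i = j then t ^ i else 0)"
    unfolding fcomb_def using pp_ge_2 by (intro sum.cong) (auto simp: zero_power)
  then show ?thesis using j by simp
qed

lemma power_reduce: "t ^ m = (t ^ (m div pp)) ^ pp * t ^ (m mod pp)" for t :: 'k
proof -
  have "t ^ m = t ^ (m div pp * pp + m mod pp)" by simp
  then show ?thesis by (simp only: power_add power_mult)
qed

lemma fcomb_power: "t ^ m \<in> range (fcomb t)"
proof -
  have "m mod pp < pp" using pp_ge_2 by simp
  then have "t ^ m = (t ^ (m div pp)) ^ pp * fcomb t (\<lambda>i. if i = m mod pp then 1 else 0)"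
    by (subst power_reduce) (simp only: fcomb_delta)
  then show ?thesis unfolding fcomb_scale by blast
qed

text \<open>The field is generated by \<open>x\<close> over its \<open>p\<close>-th powers, because \<open>y\<close> is a \<open>p\<close>-th power times a
  power of \<open>f(x)\<close>.\<close>

lemma fcomb_x_surj: "z \<in> range (fcomb x)"
proof -
  let ?X = "range (fcomb x)"
  have scale: "c ^ pp * w \<in> ?X" if "w \<in> ?X" for c w
    using that fcomb_scale by blast
  have diff: "u - w \<in> ?X" if "u \<in> ?X" "w \<in> ?X" for u w
    using that fcomb_diff by blast
  have add: "u + w \<in> ?X" if "u \<in> ?X" "w \<in> ?X" for u w
    using that fcomb_add by blast
  have zero: "0 \<in> ?X" using diff[OF fcomb_power[of x 0] fcomb_power[of x 0]] by simp
  have sum: "sum g I \<in> ?X" if "\<And>i. i \<in> I \<Longrightarrow> g i \<in> ?X" for g :: "'i \<Rightarrow> 'k" and I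
    using that by (induction I rule: infinite_finite_induct) (simp_all add: zero add)
  have mult: "u * w \<in> ?X" if uw: "u \<in> ?X" "w \<in> ?X" for u w
  proof -
    obtain a b where ab: "u = fcomb x a" "w = fcomb x b" using uw by blast
    have "u * w = (\<Sum>i<pp. \<Sum>j<pp. (a i * b j) ^ pp * x ^ (i + j))"
      unfolding ab fcomb_def sum_product
      by (intro sum.cong refl) (simp add: power_add power_mult_distrib)
    also have "\<dots> \<in> ?X" by (intro sum scale fcomb_power)
    finally show ?thesis .
  qed
  have ring: "ring_set ?X"
    unfolding ring_set_def subgrp_def using fcomb_power[of x 0] zero diff mult by simp
  have inv: "inverse w \<in> ?X" if w: "w \<in> ?X" for w
  proof (cases "w = 0")
    case False
    have "inverse w = inverse w ^ pp * w ^ (pp - 1)"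
    proof -
      have "w ^ pp = w * w ^ (pp - 1)" using pp_ge_2 by (metis Suc_diff_1 pos2 order.strict_trans2 power_Suc)
      then show ?thesis using False by (simp add: power_inverse)
    qed
    then show ?thesis using scale[OF ring_power[OF ring w]] by metis
  qed (simp add: zero)
  have const: "\<iota> a \<in> ?X" for a
  proof -
    obtain b where "\<iota> a = \<iota> b ^ pp" using iota_frob by blast
    then show ?thesis using scale[OF fcomb_power[of x 0], of "\<iota> b"] by simp
  qed
  have evX: "ev h \<in> ?X" for h
    unfolding ev_altdef by (intro sum mult const fcomb_power)
  have yX: "y \<in> ?X"
  proof -
    have "\<not> pp dvd n" using of_nat_n(2) of_nat_eq_0_pp by blast
    then have "coprime pp n" by (rule prime_imp_coprime[OF pp_prime])
    then have "coprime n pp" by (simp only: coprime_commute)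
    moreover have "pp \<noteq> 1" using pp_ge_2 by simp
    ultimately obtain \<alpha> \<beta> where ab: "n * \<alpha> = pp * \<beta> + 1" using coprime_bezout_strong by blast
    have "(y ^ \<beta>) ^ pp * y = y ^ (pp * \<beta> + 1)" by (simp add: power_mult[symmetric] mult.commute)
    also have "\<dots> = ev f ^ \<alpha>" unfolding ab[symmetric] power_mult y_power ..
    finally have "y = inverse (y ^ \<beta>) ^ pp * ev f ^ \<alpha>"
      using y_ne_0 by (simp add: power_inverse field_simps)
    then show ?thesis using scale[OF ring_power[OF ring evX], of "inverse (y ^ \<beta>)" f \<alpha>] by simp
  qed
  have rfX: "rf r \<in> ?X" for r
  proof -
    obtain a b where "rf r = ev a / ev b" by (rule rf_cases[of r]) blast
    then show ?thesis using mult[OF evX inv[OF evX]] by (simp add: divide_inverse)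
  qed
  have "z = (\<Sum>j<n. rf (coord z j) * y ^ j)" by (simp flip: comb_def add: comb_coord)
  also have "\<dots> \<in> ?X" by (intro sum mult rfX ring_power[OF ring yX])
  finally show ?thesis .
qed

lemma fcomb_distinct:
  assumes v: "v \<in> places \<iota>" and t: "v t = 1" "t \<noteq> 0"
    and ij: "i < pp" "j < pp" "i \<noteq> j" "a i ^ pp * t ^ i \<noteq> 0" "a j ^ pp * t ^ j \<noteq> 0"
  shows "v (a i ^ pp * t ^ i) \<noteq> v (a j ^ pp * t ^ j)"
proof
  assume "v (a i ^ pp * t ^ i) = v (a j ^ pp * t ^ j)"
  then have "int i + v (a i) * int pp = int j + v (a j) * int pp"
    using ij t by (simp add: place_mult[OF v] place_power[OF v] mult.commute add.commute)
  then have "(int i + v (a i) * int pp) mod int pp = (int j + v (a j) * int pp) mod int pp" by (simp only:)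
  then show False using ij by (simp only: mod_mult_self1) simp
qed

lemma fcomb_values:
  assumes v: "v \<in> places \<iota>" and t: "v t = 1" "t \<noteq> 0" and ex: "\<exists>i<pp. a i \<noteq> 0"
  shows "fcomb t a \<noteq> 0" and "i < pp \<Longrightarrow> a i ^ pp * t ^ i \<in> pw v (v (fcomb t a))"
proof -
  let ?g = "\<lambda>i. a i ^ pp * t ^ i"
  have dist: "v (?g i) \<noteq> v (?g j)" if "i \<in> {..<pp}" "j \<in> {..<pp}" "i \<noteq> j" "?g i \<noteq> 0" "?g j \<noteq> 0" for i j
    using that by (intro fcomb_distinct[OF v t]) auto
  have "\<exists>i\<in>{..<pp}. ?g i \<noteq> 0" using ex t by auto
  from place_sum_distinct[OF v finite_lessThan dist this]
  obtain m where m: "?g m \<noteq> 0" "sum ?g {..<pp} \<noteq> 0" "v (sum ?g {..<pp}) = v (?g m)"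
    "\<forall>j\<in>{..<pp}. ?g j \<in> pw v (v (?g m))" by blast
  show "fcomb t a \<noteq> 0" unfolding fcomb_def by (rule m(2))
  show "i < pp \<Longrightarrow> ?g i \<in> pw v (v (fcomb t a))" using m(3,4) by (simp only: fcomb_def lessThan_iff Ball_def)
qed

lemma fcomb_inj:
  assumes v: "v \<in> places \<iota>" and t: "v t = 1" "t \<noteq> 0" and eq: "fcomb t a = fcomb t b" and i: "i < pp"
  shows "a i = b i"
proof (rule ccontr)
  assume "a i \<noteq> b i"
  then have "\<exists>i<pp. a i - b i \<noteq> 0" using i by auto
  then have "fcomb t (\<lambda>i. a i - b i) \<noteq> 0" by (rule fcomb_values(1)[OF v t])
  then show False using eq by (simp flip: fcomb_diff)
qed

text \<open>The powers of a uniformiser below the \<open>p\<close>-th have distinct values modulo \<open>p\<close>. They are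
  therefore independent over the \<open>p\<close>-th powers, and there are as many as powers of \<open>x\<close>.\<close>

lemma fcomb_uniformizer_surj:
  assumes v: "v \<in> places \<iota>" and t: "v t = 1" "t \<noteq> 0"
  shows "z \<in> range (fcomb t)"
proof -
  interpret V: vector_space "\<lambda>a z. a ^ pp * z :: 'k" by (rule frob_vector_space)
  let ?S = "(\<lambda>i. t ^ i) ` {..<pp}" and ?T = "(\<lambda>i. x ^ i) ` {..<pp}"
  have inj: "inj_on (\<lambda>i. t ^ i) {..<pp}"
  proof (rule inj_onI)
    fix i j assume "t ^ i = t ^ j"
    then have "v (t ^ i) = v (t ^ j)" by simp
    then show "i = j" using t by (simp add: place_power[OF v])
  qed
  have sumS: "(\<Sum>w\<in>?S. u w ^ pp * w) = fcomb t (\<lambda>i. u (t ^ i))" for u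
    unfolding fcomb_def using inj by (simp add: sum.reindex)
  have ind: "V.independent ?S"
  proof
    assume "V.dependent ?S"
    then obtain u where u: "\<exists>w\<in>?S. u w \<noteq> 0" "(\<Sum>w\<in>?S. u w ^ pp * w) = 0"
      using V.dependent_finite[of ?S] by auto
    have "\<exists>i<pp. u (t ^ i) \<noteq> 0" using u(1) by auto
    then have "fcomb t (\<lambda>i. u (t ^ i)) \<noteq> 0" by (rule fcomb_values(1)[OF v t])
    then show False using u(2) sumS by simp
  qed
  have spanT: "w \<in> V.span ?T" for w
  proof -
    obtain a where w: "w = fcomb x a" using fcomb_x_surj by blast
    have "a i ^ pp * x ^ i \<in> V.span ?T" if "i \<in> {..<pp}" for i
      by (rule V.span_scale[OF V.span_base]) (rule imageI[OF that])
    then show ?thesis unfolding w fcomb_def by (rule V.span_sum)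
  qed
  have "z \<in> V.span ?S"
  proof (rule ccontr)
    assume nz: "z \<notin> V.span ?S"
    then have zS: "z \<notin> ?S" using V.span_base[of z ?S] by blast
    have "V.independent (insert z ?S)" using V.independent_insertI[OF nz ind] .
    moreover have "insert z ?S \<subseteq> V.span ?T" using spanT by blast
    ultimately have "card (insert z ?S) \<le> card ?T" using V.independent_span_bound[of ?T "insert z ?S"] by simp
    moreover have "card (insert z ?S) = Suc pp" using zS inj by (simp add: card_image)
    moreover have "card ?T \<le> pp" using card_image_le[of "{..<pp}" "\<lambda>i. x ^ i"] by simp
    ultimately show False by simp
  qed
  then obtain u where "z = (\<Sum>w\<in>?S. u w ^ pp * w)" using V.span_finite[of ?S] by auto
  then show ?thesis using sumS by simp
qed

lemma derivation_power:
  assumes "\<delta> \<in> derivations \<iota>"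
  shows "\<delta> (z ^ m) = of_nat m * z ^ (m - 1) * \<delta> z"
proof (induction m)
  case 0
  have "\<delta> (1 * 1) = 1 * \<delta> 1 + 1 * \<delta> 1" using assms unfolding derivations_def by blast
  then have "\<delta> 1 = \<delta> 1 + \<delta> 1" by (simp only: mult_1_left)
  then have "\<delta> 1 = 0" by (simp only: add_cancel_right_right)
  then show ?case by simp
next
  case (Suc m)
  have "\<delta> (z * z ^ m) = z * \<delta> (z ^ m) + z ^ m * \<delta> z" using assms unfolding derivations_def by blast
  then show ?case using Suc by (cases m) (simp_all add: algebra_simps)
qed

lemma derivationD:
  assumes "\<delta> \<in> derivations \<iota>"
  shows "\<delta> (z + w) = \<delta> z + \<delta> w" "\<delta> (z * w) = z * \<delta> w + w * \<delta> z" "\<delta> (\<iota> a) = 0" "\<delta> 0 = 0"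
    "\<delta> (sum g A) = (\<Sum>i\<in>A. \<delta> (g i))"
proof -
  show add: "\<delta> (z + w) = \<delta> z + \<delta> w" for z w using assms unfolding derivations_def by blast
  show "\<delta> (z * w) = z * \<delta> w + w * \<delta> z" "\<delta> (\<iota> a) = 0" using assms unfolding derivations_def by blast+
  have "\<delta> 0 = \<delta> 0 + \<delta> 0" using add[of 0 0] by (simp only: add_0_left)
  then show zero: "\<delta> 0 = 0" by (simp only: add_cancel_right_right)
  show "\<delta> (sum g A) = (\<Sum>i\<in>A. \<delta> (g i))"
    by (induction A rule: infinite_finite_induct) (simp_all add: zero add)
qed

lemma derivation_ev:
  assumes "\<delta> \<in> derivations \<iota>"
  shows "\<delta> (ev h) = ev (pderiv h) * \<delta> x"
proof (induction h)
  case 0 then show ?case by (simp add: ev_0 derivationD(4)[OF assms])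
next
  case (pCons a p)
  have e: "ev (pCons a p) = \<iota> a + x * ev p" for a p
    by (simp add: ev_def eval1_def map_poly_pCons iota_hom)
  show ?case
    unfolding pderiv_pCons ev_add e
    by (simp add: derivationD[OF assms] pCons.IH iota_hom algebra_simps)
qed

text \<open>\<open>D\<close> differentiates the combinations of powers of \<open>t\<close> with respect to \<open>t\<close>. A derivation
  vanishes on \<open>p\<close>-th powers, so it is determined by its value at \<open>t\<close>. The nonzero terms of a
  combination have different values, so each of them is integral if the sum is. The values of the
  terms that are not annihilated are prime to \<open>p\<close>, hence positive, so that differentiation does
  not create poles.\<close>

lemma ex_local_derivation:
  assumes v: "v \<in> places \<iota>" and t: "v t = 1"
  shows "\<exists>D\<in>derivations \<iota>. D t = 1 \<and> (\<forall>\<delta>\<in>derivations \<iota>. \<forall>z. \<delta> z = D z * \<delta> t) \<and>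
    (\<forall>z\<in>pw v 0. D z \<in> pw v 0)"
proof -
  have t0: "t \<noteq> 0" using t place_zero[OF v] by auto
  note inj = fcomb_inj[OF v t t0]
  have "\<forall>z. \<exists>a. z = fcomb t a" using fcomb_uniformizer_surj[OF v t t0] by blast
  then obtain c where c: "\<And>z. z = fcomb t (c z)" by metis
  define D where "D z = (\<Sum>i<pp. c z i ^ pp * (of_nat i * t ^ (i - 1)))" for z
  have Dcomb: "D (fcomb t a) = (\<Sum>i<pp. a i ^ pp * (of_nat i * t ^ (i - 1)))" for a
  proof -
    have "c (fcomb t a) i = a i" if "i < pp" for i using inj[OF c[symmetric] that] .
    then show ?thesis unfolding D_def by (intro sum.cong) auto
  qed
  have Dadd: "D (z + w) = D z + D w" for z w
  proof -
    have "z + w = fcomb t (\<lambda>i. c z i + c w i)" using c[of z] c[of w] fcomb_add by metis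
    then have "D (z + w) = (\<Sum>i<pp. (c z i + c w i) ^ pp * (of_nat i * t ^ (i - 1)))" by (simp only: Dcomb)
    then show ?thesis by (simp add: D_def frob_add sum.distrib distrib_right)
  qed
  have Dscale: "D (a ^ pp * z) = a ^ pp * D z" for a z
  proof -
    have "a ^ pp * z = fcomb t (\<lambda>i. a * c z i)" using c[of z] fcomb_scale by metis
    then have "D (a ^ pp * z) = (\<Sum>i<pp. (a * c z i) ^ pp * (of_nat i * t ^ (i - 1)))" by (simp only: Dcomb)
    then show ?thesis by (simp add: D_def sum_distrib_left power_mult_distrib mult.assoc)
  qed
  have "D 0 = D 0 + D 0" using Dadd[of 0 0] by (simp only: add_0_left)
  then have D0: "D 0 = 0" by (simp only: add_cancel_right_right)
  have Dsum: "D (sum g A) = (\<Sum>i\<in>A. D (g i))" for g :: "nat \<Rightarrow> 'k" and A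
    by (induction A rule: infinite_finite_induct) (simp_all add: D0 Dadd)
  have Dt: "D (t ^ m) = of_nat m * t ^ (m - 1)" for m
  proof -
    have r: "m mod pp < pp" using pp_ge_2 by simp
    have "D (t ^ (m mod pp)) = of_nat (m mod pp) * t ^ (m mod pp - 1)"
    proof -
      have "D (t ^ (m mod pp)) = (\<Sum>i<pp. (if i = m mod pp then 1 else 0) ^ pp * (of_nat i * t ^ (i - 1)))"
        by (simp only: fcomb_delta[OF r, symmetric] Dcomb)
      also have "\<dots> = (\<Sum>i<pp. if i = m mod pp then of_nat i * t ^ (i - 1) else 0)"
        using pp_ge_2 by (intro sum.cong) (auto simp: zero_power)
      finally show ?thesis using r by simp
    qed
    then have eq: "D (t ^ m) = (t ^ (m div pp)) ^ pp * (of_nat (m mod pp) * t ^ (m mod pp - 1))"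
      by (subst power_reduce) (simp only: Dscale)
    have m: "m = m div pp * pp + m mod pp" by simp
    have "of_nat (m div pp * pp) = (0::'k)" using of_nat_eq_0_pp by (simp only: dvd_triv_right)
    then have om: "of_nat m = (of_nat (m mod pp) :: 'k)" by (subst m) (simp only: of_nat_add add_0_left)
    show ?thesis
    proof (cases "m mod pp = 0")
      case True then show ?thesis using eq om by simp
    next
      case False
      then have "m - 1 = m div pp * pp + (m mod pp - 1)" using m by linarith
      then have "t ^ (m - 1) = (t ^ (m div pp)) ^ pp * t ^ (m mod pp - 1)" by (simp only: power_add power_mult)
      then show ?thesis using eq om by (simp only: mult.left_commute)
    qed
  qed
  have leib: "of_nat (i + j) * t ^ (i + j - 1) = t ^ i * (of_nat j * t ^ (j - 1)) + t ^ j * (of_nat i * t ^ (i - 1))"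
    for i j :: nat
    by (cases i; cases j) (simp_all add: power_add algebra_simps)
  have Dmult: "D (z * w) = z * D w + w * D z" for z w
  proof -
    let ?a = "c z" and ?b = "c w"
    have "z * w = fcomb t ?a * fcomb t ?b" using c by metis
    also have "\<dots> = (\<Sum>i<pp. \<Sum>j<pp. (?a i * ?b j) ^ pp * t ^ (i + j))"
      unfolding fcomb_def sum_product
      by (intro sum.cong refl) (simp add: power_add power_mult_distrib)
    finally have "D (z * w) = (\<Sum>i<pp. \<Sum>j<pp. (?a i * ?b j) ^ pp * (of_nat (i + j) * t ^ (i + j - 1)))"
      by (simp only: Dsum Dscale Dt)
    also have "\<dots> = (\<Sum>i<pp. \<Sum>j<pp. (?a i ^ pp * t ^ i) * (?b j ^ pp * (of_nat j * t ^ (j - 1)))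
        + (?a i ^ pp * (of_nat i * t ^ (i - 1))) * (?b j ^ pp * t ^ j))"
      unfolding leib by (intro sum.cong refl) (simp add: power_mult_distrib algebra_simps)
    also have "\<dots> = fcomb t ?a * D w + D z * fcomb t ?b"
      unfolding fcomb_def D_def sum_product by (simp only: sum.distrib)
    also have "\<dots> = z * D w + D z * w" using c by metis
    finally show ?thesis by (simp only: mult.commute)
  qed
  have Dconst: "D (\<iota> a) = 0" for a
  proof -
    obtain b where "\<iota> a = \<iota> b ^ pp" using iota_frob by blast
    then have "\<iota> a = \<iota> b ^ pp * t ^ 0" by simp
    then have "D (\<iota> a) = \<iota> b ^ pp * D (t ^ 0)" by (simp only: Dscale)
    also have "D (t ^ 0) = 0" unfolding Dt by simp
    finally show ?thesis by simp
  qed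
  have "D \<in> derivations \<iota>" unfolding derivations_def using Dadd Dmult Dconst by blast
  moreover have "D t = 1" using Dt[of 1] by simp
  moreover have "\<delta> z = D z * \<delta> t" if \<delta>: "\<delta> \<in> derivations \<iota>" for \<delta> z
  proof -
    have "\<delta> (a ^ pp) = 0" for a
      using derivation_power[OF \<delta>, of a pp] of_nat_eq_0_pp[of pp] by simp
    then have "\<delta> (a ^ pp * t ^ i) = a ^ pp * (of_nat i * t ^ (i - 1)) * \<delta> t" for a i
      by (simp add: derivationD(2)[OF \<delta>] derivation_power[OF \<delta>, of t i])
    then have "\<delta> (fcomb t (c z)) = D z * \<delta> t"
      unfolding fcomb_def D_def derivationD(5)[OF \<delta>] by (simp add: sum_distrib_right)
    then show ?thesis using c[of z] by simp
  qed
  moreover have "D z \<in> pw v 0" if z: "z \<in> pw v 0" for z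
  proof (cases "\<exists>i<pp. c z i \<noteq> 0")
    case False
    then have "D z = 0" unfolding D_def using pp_ge_2 by (intro sum.neutral) (auto simp: zero_power)
    then show ?thesis by (simp add: pw_def)
  next
    case True
    have z0: "z \<noteq> 0" using fcomb_values(1)[OF v t t0 True] c[of z] by simp
    then have vz: "0 \<le> v z" using z by (simp add: pw_def)
    have "c z i ^ pp * (of_nat i * t ^ (i - 1)) \<in> pw v 0" if i: "i < pp" for i
    proof (cases "c z i = 0")
      case True then show ?thesis using pp_ge_2 by (simp add: zero_power pw_def)
    next
      case False
      have "c z i ^ pp * t ^ i \<in> pw v (v z)" using fcomb_values(2)[OF v t t0 True i] c[of z] by simp
      then have "0 \<le> v (c z i ^ pp * t ^ i)" using False t0 vz by (simp add: pw_def)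
      then have "0 \<le> int pp * v (c z i) + int i"
        using False t0 t by (simp add: place_mult[OF v] place_power[OF v])
      then have "0 \<le> v (c z i)"
      proof (rule contrapos_pp)
        assume "\<not> 0 \<le> v (c z i)"
        then have "int pp * v (c z i) \<le> int pp * (- 1)" by (intro mult_left_mono) auto
        then show "\<not> 0 \<le> int pp * v (c z i) + int i" using i by linarith
      qed
      then have "c z i ^ pp \<in> pw v 0" by (simp add: pw_def place_power[OF v])
      moreover have "of_nat i * t ^ (i - 1) \<in> pw v 0"
      proof -
        have "\<iota> (of_nat i) \<in> pw v 0" by (rule pw_const[OF v emb])
        moreover have "t ^ (i - 1) \<in> pw v 0" using t by (simp add: pw_def place_power[OF v])
        ultimately show ?thesis using pw_mult[OF v, of "\<iota> (of_nat i)" 0 "t ^ (i - 1)" 0] by (simp add: iota_of_nat)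
      qed
      ultimately show ?thesis using pw_mult[OF v, of "c z i ^ pp" 0] by fastforce
    qed
    then show ?thesis unfolding D_def by (intro pw_sum[OF v]) simp
  qed
  ultimately show ?thesis by blast
qed

text \<open>The order does not depend on the local parameter: if \<open>D\<close> and \<open>D'\<close> belong to \<open>t\<close> and \<open>t'\<close>,
  then \<open>D t'\<close> and \<open>D' t\<close> are integral with product \<open>1\<close>.\<close>

lemma diff_order_eq:
  assumes v: "v \<in> places \<iota>" and t: "v t = 1" and h: "h \<noteq> 0" and Dx: "D x \<noteq> 0"
    and D: "D \<in> derivations \<iota>" "D t = 1" "\<forall>\<delta>\<in>derivations \<iota>. \<forall>z. \<delta> z = D z * \<delta> t" "\<forall>z\<in>pw v 0. D z \<in> pw v 0"
  shows "diff_order \<iota> v (mult_diff h (exact_diff x)) = v h + v (D x)"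
  unfolding diff_order_def
proof (rule the_equality)
  have "\<forall>\<delta>\<in>derivations \<iota>. mult_diff h (exact_diff x) \<delta> = mult_diff (h * D x) (exact_diff t) \<delta>"
  proof
    fix \<delta> assume "\<delta> \<in> derivations \<iota>"
    then have "\<delta> x = D x * \<delta> t" using D(3) by blast
    then show "mult_diff h (exact_diff x) \<delta> = mult_diff (h * D x) (exact_diff t) \<delta>"
      by (simp add: mult_diff_def exact_diff_def)
  qed
  then show "\<exists>t g. v t = 1 \<and> (\<forall>\<delta>\<in>derivations \<iota>. mult_diff h (exact_diff x) \<delta> = mult_diff g (exact_diff t) \<delta>) \<and>
      v g = v h + v (D x)"
    using t h Dx by (intro exI[of _ t] exI[of _ "h * D x"]) (simp add: place_mult[OF v])
next
  fix m assume "\<exists>t g. v t = 1 \<and> (\<forall>\<delta>\<in>derivations \<iota>. mult_diff h (exact_diff x) \<delta> = mult_diff g (exact_diff t) \<delta>) \<and> v g = m"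
  then obtain t' g where t': "v t' = 1" and g: "\<forall>\<delta>\<in>derivations \<iota>. mult_diff h (exact_diff x) \<delta> = mult_diff g (exact_diff t') \<delta>"
    and m: "v g = m" by blast
  have eq: "h * D x = g * D t'" using bspec[OF g D(1)] by (simp add: mult_diff_def exact_diff_def)
  obtain D' where D': "D' \<in> derivations \<iota>" "D' t' = 1" "\<forall>z\<in>pw v 0. D' z \<in> pw v 0"
    using ex_local_derivation[OF v t'] by blast
  have one: "1 = D t' * D' t" using D(3) D'(1,2) by metis
  have "D t' \<in> pw v 0" "D' t \<in> pw v 0" using D(4) D'(3) t t' by (simp_all add: pw_def)
  then have "D t' \<noteq> 0" "D' t \<noteq> 0" "0 \<le> v (D t')" "0 \<le> v (D' t)" using one by (auto simp: pw_def)
  moreover then have "v (D t') + v (D' t) = 0" using place_mult[OF v, of "D t'" "D' t"] one place_one[OF v] by simp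
  ultimately have "v (D t') = 0" "D t' \<noteq> 0" by auto
  moreover have "g \<noteq> 0" using eq h Dx by auto
  ultimately have "v (h * D x) = v g" unfolding eq by (simp add: place_mult[OF v])
  then show "m = v h + v (D x)" using h Dx m by (simp add: place_mult[OF v])
qed

lemma place_of_nat_n: "v \<in> places \<iota> \<Longrightarrow> k dvd n \<Longrightarrow> of_nat k \<noteq> (0::'k) \<and> v (of_nat k) = 0"
proof -
  assume v: "v \<in> places \<iota>" and k: "k dvd n"
  have "of_nat k \<noteq> (0::'a)" using k of_nat_n(1) by (auto elim!: dvdE)
  then show ?thesis using place_const[OF v, of "of_nat k"] iota_eq_0[of "of_nat k"] by (simp add: iota_of_nat)
qed

text \<open>At a zero of \<open>y\<close>, differentiating \<open>y\<^sup>n = f(x)\<close> shows that \<open>dx\<close> has the order of \<open>y\<^sup>n\<^sup>-\<^sup>1\<close>.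
  At the other finite places a polynomial in \<open>x\<close> is a local parameter, so \<open>dx\<close> has order \<open>0\<close>. At
  infinity \<open>x\<close> has a pole whose order \<open>nn\<close> is prime to the characteristic.\<close>

lemma order_dx:
  assumes v: "v \<in> places \<iota>" and h: "h \<noteq> 0"
  shows "diff_order \<iota> v (mult_diff h (exact_diff x)) = v h + v (y ^ (n - 1)) + mD kappa v"
proof (cases "v \<in> Pinf")
  case True
  obtain t where t: "v t = 1" "t \<noteq> 0" by (rule uniformizer[OF v])
  obtain D where D: "D \<in> derivations \<iota>" "D t = 1" "\<forall>\<delta>\<in>derivations \<iota>. \<forall>z. \<delta> z = D z * \<delta> t" "\<forall>z\<in>pw v 0. D z \<in> pw v 0"
    using ex_local_derivation[OF v t(1)] by blast
  note vals = inf_values[OF PinfD[OF True]]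
  have nnd: "of_nat nn \<noteq> (0::'k)" "v (of_nat nn) = 0"
    using place_of_nat_n[OF v dvdI[of n nn cc]] n_eq by (simp_all add: mult.commute)
  let ?w = "x * (of_nat nn * t ^ (nn - 1))"
  have w0: "?w \<noteq> 0" using x_ne_0 nnd t by simp
  have vw: "v ?w = - 1"
    using x_ne_0 nnd t vals nn_pos by (simp add: place_mult[OF v] place_power[OF v])
  have "v (x * t ^ nn) = 0" using x_ne_0 t vals by (simp add: place_mult[OF v] place_power[OF v])
  then have Du: "D (x * t ^ nn) \<in> pw v 0" using D(4) by (simp add: pw_def)
  have "D (x * t ^ nn) = ?w + t ^ nn * D x"
    using derivationD(2)[OF D(1), of x "t ^ nn"] derivation_power[OF D(1), of t nn] D(2) by simp
  then have e: "t ^ nn * D x = - ?w + D (x * t ^ nn)" by simp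
  have "D (x * t ^ nn) \<in> pw v (v (- ?w) + 1)" using Du by (simp only: place_uminus[OF v] vw) simp
  then have "t ^ nn * D x \<noteq> 0" "v (t ^ nn * D x) = - 1"
    using place_add_dominant[OF v, of "- ?w" "D (x * t ^ nn)"] w0 unfolding e by (simp_all only: place_uminus[OF v] vw neg_equal_0_iff_equal not_False_eq_True)
  then have Dx: "D x \<noteq> 0" "v (D x) = - 1 - int nn"
    using t by (auto simp: place_mult[OF v] place_power[OF v])
  have "v (y ^ (n - 1)) = - (int dd * (int n - 1))"
    using vals n_ge_2 by (simp add: place_power[OF v] of_nat_diff)
  then show ?thesis
    using diff_order_eq[OF v t(1) h Dx(1) D] Dx(2) True by (simp add: mD_def kappa_def)
next
  case False
  then have vf: "v \<in> Pf" using v places_Un by blast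
  have xv: "x \<in> pw v 0" using PfD(2)[OF vf] by (simp add: pw_def)
  have "\<exists>t D. v t = 1 \<and> D \<in> derivations \<iota> \<and> D t = 1 \<and> (\<forall>\<delta>\<in>derivations \<iota>. \<forall>z. \<delta> z = D z * \<delta> t) \<and>
    (\<forall>z\<in>pw v 0. D z \<in> pw v 0) \<and> D x \<noteq> 0 \<and> v (D x) = v (y ^ (n - 1))"
  proof (cases "0 < v (ev f)")
    case True
    then have vy: "v y = 1" using Pf_y[OF vf] by simp
    obtain D where D: "D \<in> derivations \<iota>" "D y = 1" "\<forall>\<delta>\<in>derivations \<iota>. \<forall>z. \<delta> z = D z * \<delta> y" "\<forall>z\<in>pw v 0. D z \<in> pw v 0"
      using ex_local_derivation[OF v vy] by blast
    have e: "of_nat n * y ^ (n - 1) = ev (pderiv f) * D x"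
      using derivation_power[OF D(1), of y n] derivation_ev[OF D(1), of f] D(2) by (simp add: y_power)
    have nz: "of_nat n * y ^ (n - 1) \<noteq> 0" using of_nat_n y_ne_0 by simp
    then have ne: "ev (pderiv f) \<noteq> 0" "D x \<noteq> 0" using e by auto
    obtain r s where rs: "r * f + s * pderiv f = 1" using bezout_poly[OF coprime_f] by blast
    have "v (ev (pderiv f)) = 0"
    proof (rule ccontr)
      assume "v (ev (pderiv f)) \<noteq> 0"
      then have "ev (pderiv f) \<in> pw v 1" "ev f \<in> pw v 1"
        using Pf_ev_nonneg[OF vf, of "pderiv f"] True by (simp_all add: pw_def)
      then have "ev r * ev f + ev s * ev (pderiv f) \<in> pw v 1"
        using pw_mult[OF v Pf_ev_pw[OF vf, of r], of "ev f" 1] pw_mult[OF v Pf_ev_pw[OF vf, of s], of "ev (pderiv f)" 1]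
        by (intro pw_add[OF v]) simp_all
      then have "1 \<in> pw v 1" using arg_cong[OF rs, of ev] by (simp add: ev_add ev_mult ev_1)
      then show False by (simp add: pw_def place_one[OF v])
    qed
    moreover have "v (of_nat n * y ^ (n - 1)) = v (y ^ (n - 1))"
      using place_of_nat_n[OF v, of n] y_ne_0 by (simp add: place_mult[OF v])
    ultimately have "v (D x) = v (y ^ (n - 1))" using ne unfolding e by (simp add: place_mult[OF v])
    then show ?thesis using vy D ne(2) by blast
  next
    case False
    obtain p where p: "prime_elem p" "0 < v (ev p)" using Pf_prime[OF vf] by blast
    have np: "\<not> p dvd f" using place_prime_value(1)[OF PfD[OF vf] p f_ne_0] False by blast
    have t: "v (ev p) = 1" by (rule fin_values(3)[OF PfD[OF vf] p np])
    obtain D where D: "D \<in> derivations \<iota>" "D (ev p) = 1" "\<forall>\<delta>\<in>derivations \<iota>. \<forall>z. \<delta> z = D z * \<delta> (ev p)" "\<forall>z\<in>pw v 0. D z \<in> pw v 0"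
      using ex_local_derivation[OF v t] by blast
    have e: "1 = ev (pderiv p) * D x" using derivation_ev[OF D(1), of p] D(2) by simp
    then have ne: "ev (pderiv p) \<noteq> 0" "D x \<noteq> 0" by auto
    have "D x \<in> pw v 0" using D(4) xv by blast
    then have "0 \<le> v (D x)" using ne by (simp add: pw_def)
    moreover have "0 \<le> v (ev (pderiv p))" by (rule Pf_ev_nonneg[OF vf])
    moreover have "v (ev (pderiv p)) + v (D x) = 0"
      using place_mult[OF v ne] by (simp add: e[symmetric] place_one[OF v])
    ultimately have "v (D x) = 0" by linarith
    moreover have "v (y ^ (n - 1)) = 0" using fin_values(2)[OF PfD[OF vf] p np] by (simp add: place_power[OF v])
    ultimately show ?thesis using t D ne(2) by metis
  qed
  then obtain t D where t: "v t = 1" and D: "D \<in> derivations \<iota>" "D t = 1" "\<forall>\<delta>\<in>derivations \<iota>. \<forall>z. \<delta> z = D z * \<delta> t"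
    "\<forall>z\<in>pw v 0. D z \<in> pw v 0" and Dx: "D x \<noteq> 0" "v (D x) = v (y ^ (n - 1))" by blast
  show ?thesis using diff_order_eq[OF v t h Dx(1) D] Dx(2) False by (simp add: mD_def)
qed

definition lin :: "'a set \<Rightarrow> 'a poly" where
  "lin S = (\<Prod>a\<in>S. [:- a, 1:])"

lemma lin_ne_0: "lin S \<noteq> 0"
  by (simp add: lin_def)

lemma degree_lin: "degree (lin S) = card S"
  unfolding lin_def by (subst degree_prod_sum_eq) simp_all

text \<open>Every element of the field is a root of \<open>X\<^sup>q - X\<close>.\<close>

lemma lin_UNIV: "lin UNIV = monom 1 CARD('a) - [:0, 1:]"
proof -
  let ?q = "CARD('a)" and ?h = "monom 1 CARD('a) - [:0, 1:] :: 'a poly"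
  have lt: "degree (- [:0, 1:] :: 'a poly) < degree (monom 1 ?q :: 'a poly)"
    using card_field_ge_2[where 'a = 'a] by (simp add: degree_monom_eq)
  have deg: "degree ?h = ?q"
    unfolding diff_conv_add_uminus degree_add_eq_left[OF lt] by (simp add: degree_monom_eq)
  have lc: "lead_coeff ?h = 1" unfolding deg using card_field_ge_2[where 'a = 'a]
    by (auto simp: coeff_pCons split: nat.split)
  have root: "poly ?h a = 0" for a
  proof (cases "a = 0")
    case True then show ?thesis using card_field_ge_2[where 'a = 'a] by (simp add: poly_monom zero_power)
  next
    case False
    have "a ^ ?q = a * a ^ (?q - 1)" using card_field_ge_2[where 'a = 'a] by (metis Suc_diff_1 pos2 order.strict_trans2 power_Suc)
    then show ?thesis using finite_field_power_card[OF False] by (simp add: poly_monom)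
  qed
  show ?thesis unfolding lin_def by (rule monic_eq_prod_roots[symmetric]) (use deg lc root in simp_all)
qed

lemma pdiv_divide: "g \<noteq> 0 \<Longrightarrow> h \<noteq> 0 \<Longrightarrow> pdiv (g / h) = pdiv g - pdiv h"
  by (auto simp: pdiv_apply fun_eq_iff place_divide)

lemma K_div_eq: "K_div \<iota> x = mD kappa + pdiv (y ^ (n - 1) / ev (lin UNIV))"
proof
  fix v
  have x: "x ^ CARD('a) - x = ev (lin UNIV)"
  proof -
    have "monom 1 CARD('a) = ([:0, 1:] :: 'a poly) ^ CARD('a)" by (simp add: monom_altdef)
    then show ?thesis unfolding lin_UNIV ev_diff ev_X by (simp only: ev_power ev_X)
  qed
  have ne: "ev (lin UNIV) \<noteq> 0" by (simp add: ev_eq_0 lin_ne_0)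
  show "K_div \<iota> x v = (mD kappa + pdiv (y ^ (n - 1) / ev (lin UNIV))) v"
  proof (cases "v \<in> places \<iota>")
    case True
    have "diff_order \<iota> v (eta \<iota> x) = v (- 1 / ev (lin UNIV)) + v (y ^ (n - 1)) + mD kappa v"
      unfolding eta_def x using ne by (intro order_dx[OF True]) simp
    then show ?thesis using True ne y_ne_0
      by (simp add: K_div_def diff_divisor_def pdiv_apply place_divide[OF True] place_uminus[OF True] place_one[OF True])
  next
    case False
    then have "v \<notin> Pinf" using PinfD(1) by blast
    then show ?thesis using False by (simp add: K_div_def diff_divisor_def pdiv_apply mD_def)
  qed
qed

end

section \<open>Rational points and residues\<close>

context superelliptic
begin

definition has_residue :: "'k place \<Rightarrow> 'k \<Rightarrow> 'a \<Rightarrow> bool" where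
  "has_residue v z b \<longleftrightarrow> z - \<iota> b \<in> pw v 1"

lemma residue_unique:
  assumes v: "v \<in> places \<iota>" and "has_residue v z b" "has_residue v z c"
  shows "b = c"
proof (rule ccontr)
  assume ne: "b \<noteq> c"
  have "(z - \<iota> c) - (z - \<iota> b) \<in> pw v 1"
    using assms(2,3) unfolding has_residue_def by (rule pw_diff[OF v, rotated])
  then have "\<iota> (b - c) \<in> pw v 1" by (simp add: iota_diff)
  then show False using ne place_const[OF v, of "b - c"] by (simp add: pw_def iota_eq_0)
qed

lemma place_value_eq:
  assumes v: "v \<in> places \<iota>" and "has_residue v z b"
  shows "place_value \<iota> v z = b"
  unfolding place_value_def maximal_ideal_eq
proof (rule the_equality)
  show "z - \<iota> b \<in> pw v 1" using assms(2) by (simp only: has_residue_def)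
  fix c assume "z - \<iota> c \<in> pw v 1"
  then show "c = b" using residue_unique[OF v assms(2), of c] by (simp add: has_residue_def)
qed

lemma residue_pw: "v \<in> places \<iota> \<Longrightarrow> has_residue v z b \<Longrightarrow> z \<in> pw v 0"
proof -
  assume v: "v \<in> places \<iota>" and z: "has_residue v z b"
  have "z - \<iota> b \<in> pw v 0" using z by (auto simp: has_residue_def pw_def)
  then have "(z - \<iota> b) + \<iota> b \<in> pw v 0" by (intro pw_add[OF v] pw_const[OF v emb])
  then show ?thesis by simp
qed

lemma residue_const: "v \<in> places \<iota> \<Longrightarrow> has_residue v (\<iota> a) a"
  by (simp add: has_residue_def pw_zero)

lemma residue_add:
  assumes v: "v \<in> places \<iota>" and "has_residue v z b" "has_residue v w c"
  shows "has_residue v (z + w) (b + c)"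
proof -
  have "(z - \<iota> b) + (w - \<iota> c) \<in> pw v 1"
    using assms(2,3) unfolding has_residue_def by (intro pw_add[OF v])
  then show ?thesis by (simp add: has_residue_def iota_hom algebra_simps)
qed

lemma residue_uminus: "v \<in> places \<iota> \<Longrightarrow> has_residue v z b \<Longrightarrow> has_residue v (- z) (- b)"
proof -
  assume v: "v \<in> places \<iota>" and "has_residue v z b"
  then have "- (z - \<iota> b) \<in> pw v 1" unfolding has_residue_def by (intro pw_uminus[OF v])
  then show ?thesis by (simp add: has_residue_def iota_uminus)
qed

lemma residue_diff:
  assumes v: "v \<in> places \<iota>" and "has_residue v z b" "has_residue v w c"
  shows "has_residue v (z - w) (b - c)"
  using residue_add[OF v assms(2) residue_uminus[OF v assms(3)]] by simp

lemma residue_mult: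
  assumes v: "v \<in> places \<iota>" and z: "has_residue v z b" and w: "has_residue v w c"
  shows "has_residue v (z * w) (b * c)"
proof -
  have "(z - \<iota> b) * w \<in> pw v (1 + 0)"
    using z unfolding has_residue_def by (intro pw_mult[OF v] residue_pw[OF v w])
  moreover have "\<iota> b * (w - \<iota> c) \<in> pw v (0 + 1)"
    using w unfolding has_residue_def by (intro pw_mult[OF v] pw_const[OF v emb])
  ultimately have "(z - \<iota> b) * w + \<iota> b * (w - \<iota> c) \<in> pw v 1" by (intro pw_add[OF v]) simp_all
  then show ?thesis by (simp add: has_residue_def iota_hom algebra_simps)
qed

lemma residue_power:
  assumes v: "v \<in> places \<iota>" and z: "has_residue v z b"
  shows "has_residue v (z ^ k) (b ^ k)"
proof (induction k)
  case 0 then show ?case using residue_const[OF v, of 1] by (simp add: iota_hom)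
next
  case (Suc k) then show ?case using residue_mult[OF v z] by simp
qed

lemma residue_sum:
  assumes v: "v \<in> places \<iota>" and "finite A" and z: "\<And>i. i \<in> A \<Longrightarrow> has_residue v (g i) (b i)"
  shows "has_residue v (sum g A) (sum b A)"
  using assms(2) z
proof (induction A)
  case empty then show ?case using residue_const[OF v, of 0] by (simp add: iota_hom)
next
  case (insert a A)
  then show ?case using residue_add[OF v, of "g a" "b a" "sum g A" "sum b A"] by simp
qed

lemma residue_divide:
  assumes v: "v \<in> places \<iota>" and z: "has_residue v z b" and w: "has_residue v w c" and c: "c \<noteq> 0"
  shows "has_residue v (z / w) (b / c)"
proof -
  have ic: "\<iota> c \<noteq> 0" "v (\<iota> c) = 0" using c place_const[OF v c] by (simp_all add: iota_eq_0)
  have "w = \<iota> c + (w - \<iota> c)" by simp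
  moreover have "w - \<iota> c \<in> pw v (v (\<iota> c) + 1)" using w by (simp add: ic has_residue_def)
  ultimately have w0: "w \<noteq> 0" "v w = 0" using place_add_dominant[OF v ic(1)] ic(2) by metis+
  have "has_residue v (z * \<iota> c - \<iota> b * w) (b * c - b * c)"
    by (intro residue_diff[OF v] residue_mult[OF v] residue_const[OF v] z w)
  then have n: "z * \<iota> c - \<iota> b * w \<in> pw v 1" by (simp add: has_residue_def iota_hom)
  have "inverse (w * \<iota> c) \<in> pw v 0"
    using w0 ic by (simp add: pw_def place_inverse[OF v] place_mult[OF v])
  then have "(z * \<iota> c - \<iota> b * w) * inverse (w * \<iota> c) \<in> pw v (1 + 0)" by (rule pw_mult[OF v n])
  moreover have "(z * \<iota> c - \<iota> b * w) * inverse (w * \<iota> c) = z / w - \<iota> (b / c)"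
    using w0 ic by (simp add: field_simps iota_divide)
  ultimately show ?thesis by (simp add: has_residue_def)
qed

lemma constants_cosets:
  assumes v: "v \<in> places \<iota>"
  defines "R \<equiv> (\<lambda>b. {w. w - \<iota> b \<in> pw v 1}) ` UNIV"
  shows "R \<subseteq> cosets (pw v 0) (pw v 1)" "card R = CARD('a)"
proof -
  show "R \<subseteq> cosets (pw v 0) (pw v 1)"
    unfolding R_def cosets_def using pw_const[OF v emb] by blast
  have "inj (\<lambda>b. {w. w - \<iota> b \<in> pw v 1})"
  proof (rule injI)
    fix b c assume "{w. w - \<iota> b \<in> pw v 1} = {w. w - \<iota> c \<in> pw v 1}"
    then have "\<iota> b - \<iota> c \<in> pw v 1" by (simp only: coset_eq_iff[OF subgrp_pw[OF v]])
    then show "b = c" using residue_unique[OF v _ residue_const[OF v], of b c] by (simp add: has_residue_def)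
  qed
  then show "card R = CARD('a)" unfolding R_def by (rule card_image)
qed

lemma place_degree_pos: "v \<in> places \<iota> \<Longrightarrow> 1 \<le> place_degree \<iota> v"
proof -
  assume v: "v \<in> places \<iota>"
  have "CARD('a) \<le> idx (pw v 0) (pw v 1)"
    unfolding idx_def using card_mono[OF finite_residue_field[OF v] constants_cosets(1)[OF v]]
    by (simp only: constants_cosets(2)[OF v])
  then have "CARD('a) ^ 1 \<le> CARD('a) ^ place_degree \<iota> v" by (simp add: card_power_place_degree[OF v])
  then show ?thesis by (simp only: card_power_le)
qed

text \<open>The constants represent \<open>q\<close> different residues, and there are no others if the degree is
  one.\<close>

lemma degree_one_residue:
  assumes v: "v \<in> places \<iota>" and deg: "place_degree \<iota> v = 1" and z: "z \<in> pw v 0"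
  shows "\<exists>b. has_residue v z b"
proof -
  have "card (cosets (pw v 0) (pw v 1)) = CARD('a)"
    using card_power_place_degree[OF v] by (simp add: deg idx_def)
  then have "(\<lambda>b. {w. w - \<iota> b \<in> pw v 1}) ` UNIV = cosets (pw v 0) (pw v 1)"
    using constants_cosets[OF v] by (intro card_subset_eq[OF finite_residue_field[OF v]]) simp_all
  then have "{w. w - z \<in> pw v 1} \<in> (\<lambda>b. {w. w - \<iota> b \<in> pw v 1}) ` UNIV"
    using z by (simp add: cosets_def)
  then obtain b where "{w. w - z \<in> pw v 1} = {w. w - \<iota> b \<in> pw v 1}" by blast
  then have "z - \<iota> b \<in> pw v 1" by (simp only: coset_eq_iff[OF subgrp_pw[OF v]])
  then show ?thesis unfolding has_residue_def by (rule exI)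
qed

section \<open>The points over the affine line\<close>

definition Over :: "'a \<Rightarrow> 'k place set" where
  "Over a = {v \<in> Pf. 0 < v (x - \<iota> a)}"

definition Delta :: "'a set" where
  "Delta = {a. \<not> (\<exists>b. b \<noteq> 0 \<and> poly f a = b ^ n)}"

lemma num_nonpowers_eq: "num_nonpowers n f = card Delta"
  by (simp add: num_nonpowers_def Delta_def)

lemma OverD: "v \<in> Over a \<Longrightarrow> v \<in> Pf" "v \<in> Over a \<Longrightarrow> v \<in> places \<iota>"
  by (simp_all add: Over_def Pf_def)

lemma prime_linear: "prime_elem [:- a, 1 :: 'a:]"
  by (rule prime_elem_linear_field_poly) simp

lemma Over_ev: "v \<in> Over a \<Longrightarrow> h \<noteq> 0 \<Longrightarrow> 0 < v (ev h) \<longleftrightarrow> poly h a = 0"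
proof -
  assume v: "v \<in> Over a" and h: "h \<noteq> 0"
  have "0 < v (ev [:- a, 1:])" using v by (simp only: ev_linear Over_def mem_Collect_eq)
  from place_prime_value(1)[OF PfD[OF OverD(1)[OF v]] prime_linear this h]
  show ?thesis by (simp only: poly_eq_0_iff_dvd)
qed

text \<open>The polynomial \<open>X - a\<close> does not divide \<open>f\<close>, so its place is unramified.\<close>

lemma Over_value: "v \<in> Over a \<Longrightarrow> v (x - \<iota> a) = 1"
proof -
  assume v: "v \<in> Over a"
  have "0 < v (ev [:- a, 1:])" using v by (simp only: ev_linear Over_def mem_Collect_eq)
  moreover have "\<not> [:- a, 1:] dvd f" using f_no_root[of a] by (simp only: poly_eq_0_iff_dvd not_False_eq_True)
  ultimately have "v (ev [:- a, 1:]) = 1" by (rule fin_values(3)[OF PfD[OF OverD(1)[OF v]] prime_linear])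
  then show ?thesis by (simp only: ev_linear)
qed

lemma Over_residue_ev: "v \<in> Over a \<Longrightarrow> has_residue v (ev h) (poly h a)"
proof -
  assume v: "v \<in> Over a"
  let ?g = "h - [:poly h a:]"
  have e: "ev h - \<iota> (poly h a) = ev ?g" by (simp only: ev_diff ev_const)
  have r: "poly ?g a = 0" by simp
  show ?thesis
  proof (cases "?g = 0")
    case True
    show ?thesis unfolding has_residue_def e True ev_0 by (rule pw_zero[OF OverD(2)[OF v]])
  next
    case False
    have "0 < v (ev ?g)" using Over_ev[OF v False] r by (simp only:)
    then show ?thesis unfolding has_residue_def e by (simp add: pw_def)
  qed
qed

lemma Over_disjoint: "v \<in> Over a \<Longrightarrow> v \<in> Over b \<Longrightarrow> a = b"
proof -
  assume a: "v \<in> Over a" and b: "v \<in> Over b"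
  show ?thesis
    using residue_unique[OF OverD(2)[OF a] Over_residue_ev[OF a, of "[:0, 1:]"], of b]
      Over_residue_ev[OF b, of "[:0, 1:]"] by simp
qed

lemma finite_Over: "finite (Over a)"
  using finite_Pf_zeros[of "[:- a, 1:]"] by (simp add: Over_def ev_linear)

lemma value_lin: "v \<in> Pf \<Longrightarrow> v (ev (lin S)) = of_bool (\<exists>a\<in>S. v \<in> Over a)"
proof -
  assume v: "v \<in> Pf"
  have s: "v (x - \<iota> a) = of_bool (v \<in> Over a)" for a
  proof (cases "v \<in> Over a")
    case False
    then have "\<not> 0 < v (x - \<iota> a)" using v by (simp add: Over_def)
    moreover have "0 \<le> v (x - \<iota> a)" using Pf_ev_nonneg[OF v, of "[:- a, 1:]"] by (simp only: ev_linear)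
    ultimately show ?thesis using False by simp
  qed (simp add: Over_value)
  have "ev (lin S) = (\<Prod>a\<in>S. x - \<iota> a)" unfolding lin_def ev_prod ev_linear ..
  moreover have "x - \<iota> a \<noteq> 0" for a using ev_eq_0[of "[:- a, 1:]"] by (simp add: ev_linear)
  ultimately have "v (ev (lin S)) = (\<Sum>a\<in>S. of_bool (v \<in> Over a))"
    using place_prod[OF PfD(1)[OF v], of S "\<lambda>a. x - \<iota> a"] by (simp add: s)
  also have "\<dots> = of_bool (\<exists>a\<in>S. v \<in> Over a)"
  proof (cases "\<exists>a\<in>S. v \<in> Over a")
    case True
    then obtain a where a: "a \<in> S" "v \<in> Over a" by blast
    have "v \<in> Over b \<longleftrightarrow> b = a" for b using Over_disjoint[OF a(2)] a(2) by blast
    then have "(\<Sum>b\<in>S. of_bool (v \<in> Over b)) = (\<Sum>b\<in>S. if b = a then 1 else (0::int))" by (intro sum.cong) simp_all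
    then show ?thesis using a by (auto simp: True)
  qed (auto intro: sum.neutral)
  finally show ?thesis .
qed

lemma sum_degree_Over: "(\<Sum>v\<in>Over a. place_degree \<iota> v) = n"
proof -
  have z: "zero_part [:- a, 1:] v = of_bool (v \<in> Over a)" for v
  proof (cases "v \<in> Pf")
    case True
    then show ?thesis using value_lin[OF True, of "{a}"] by (simp add: zero_part_def lin_def)
  next
    case False
    then have "v \<notin> Over a" using OverD(1) by blast
    then show ?thesis using False by (simp add: zero_part_def)
  qed
  have "{v. zero_part [:- a, 1:] v \<noteq> 0} \<subseteq> Over a" by (auto simp: z)
  from divisor_degree_sum[OF finite_Over this]
  also have "(\<Sum>v\<in>Over a. zero_part [:- a, 1:] v * int (place_degree \<iota> v)) = (\<Sum>v\<in>Over a. int (place_degree \<iota> v))"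
    by (intro sum.cong) (simp_all add: z)
  finally have "int (\<Sum>v\<in>Over a. place_degree \<iota> v) = int (n * degree [:- a, 1:])"
    using degree_zero_part[of "[:- a, 1:]"] unfolding of_nat_sum by simp
  then show ?thesis by (simp only: of_nat_eq_iff) simp
qed

lemma card_nth_roots_power:
  assumes a: "a \<notin> Delta"
  shows "card {b. b ^ n = poly f a} = n"
proof -
  obtain e where e: "e \<noteq> 0" "poly f a = e ^ n" using a by (auto simp: Delta_def)
  have "{b. b ^ n = poly f a} = (\<lambda>z. e * z) ` {z. z ^ n = 1}"
  proof (intro equalityI subsetI)
    fix b assume "b \<in> {b. b ^ n = poly f a}"
    then have "(b / e) ^ n = 1" using e by (simp add: power_divide)
    then show "b \<in> (\<lambda>z. e * z) ` {z. z ^ n = 1}" using e by (intro image_eqI[of _ _ "b / e"]) simp_all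
  qed (auto simp: e power_mult_distrib)
  then show ?thesis using card_roots_of_unity[OF n_dvd] e(1) by (simp add: card_image inj_on_def)
qed

lemma residue_y_root:
  assumes v: "v \<in> Over a" and "has_residue v y b"
  shows "b ^ n = poly f a"
proof -
  have "has_residue v (ev f) (b ^ n)" using residue_power[OF OverD(2)[OF v] assms(2), of n] by (simp only: y_power)
  then show ?thesis by (rule residue_unique[OF OverD(2)[OF v] _ Over_residue_ev[OF v]])
qed

text \<open>If \<open>f(a)\<close> is an \<open>n\<close>-th power, then \<open>y\<^sup>n - f(a)\<close> is a product of linear factors \<open>y - b\<close>. It
  lies in the maximal ideal, hence so does one of the factors.\<close>

lemma ex_residue_y:
  assumes v: "v \<in> Over a" and a: "a \<notin> Delta"
  shows "\<exists>b. has_residue v y b"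
proof (rule ccontr)
  assume no: "\<nexists>b. has_residue v y b"
  note vp = OverD(2)[OF v]
  let ?R = "{b. b ^ n = poly f a}"
  have c: "card ?R = n" using card_nth_roots_power[OF a] .
  have "monom 1 n - [:\<iota> (poly f a):] = (\<Prod>b\<in>\<iota> ` ?R. [:- b, 1:])"
  proof (rule monic_eq_prod_roots)
    have lt: "degree (- [:\<iota> (poly f a):]) < degree (monom (1::'k) n)" using n_ge_2 by (simp add: degree_monom_eq)
    have "degree (monom 1 n - [:\<iota> (poly f a):]) = n"
      unfolding diff_conv_add_uminus degree_add_eq_left[OF lt] by (simp add: degree_monom_eq)
    moreover have "card (\<iota> ` ?R) = n" using c by (subst card_image) (auto simp: inj_on_def iota_inj)
    ultimately show "degree (monom 1 n - [:\<iota> (poly f a):]) = card (\<iota> ` ?R)" by (simp only:)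
    have "coeff (monom 1 n - [:\<iota> (poly f a):]) n = 1" using n_ge_2 by (simp add: coeff_pCons split: nat.split)
    then show "lead_coeff (monom 1 n - [:\<iota> (poly f a):]) = 1"
      using \<open>degree (monom 1 n - [:\<iota> (poly f a):]) = n\<close> by (simp only:)
    fix b assume "b \<in> \<iota> ` ?R"
    then obtain e where e: "e ^ n = poly f a" "b = \<iota> e" by auto
    have "b ^ n = \<iota> (poly f a)" unfolding e(2) e(1)[symmetric] by (rule iota_power[symmetric])
    then show "poly (monom 1 n - [:\<iota> (poly f a):]) b = 0" by (simp add: poly_monom)
  qed simp
  then have "poly (monom 1 n - [:\<iota> (poly f a):]) y = poly (\<Prod>b\<in>\<iota> ` ?R. [:- b, 1:]) y" by (rule arg_cong)
  then have "ev f - \<iota> (poly f a) = (\<Prod>b\<in>\<iota> ` ?R. y - b)" by (simp add: poly_monom poly_prod y_power)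
  also have "\<dots> = (\<Prod>b\<in>?R. y - \<iota> b)" by (subst prod.reindex) (auto simp: inj_on_def iota_inj)
  finally have p: "(\<Prod>b\<in>?R. y - \<iota> b) \<in> pw v 1" using Over_residue_ev[OF v, of f] by (simp only: has_residue_def)
  have nr: "y - \<iota> b \<notin> pw v 1" for b using no by (simp add: has_residue_def)
  then have ne: "y - \<iota> b \<noteq> 0" for b using pw_zero[OF vp, of 1] by metis
  have "y - \<iota> b \<in> pw v 0" for b
    using Pf_y_pw[OF OverD(1)[OF v], of 1] by (intro pw_diff[OF vp] pw_const[OF vp emb]) simp
  then have "v (y - \<iota> b) = 0" for b using nr[of b] ne[of b] by (force simp: pw_def)
  then have "v (\<Prod>b\<in>?R. y - \<iota> b) = 0" using place_prod[OF vp, of ?R "\<lambda>b. y - \<iota> b"] ne by simp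
  moreover have "(\<Prod>b\<in>?R. y - \<iota> b) \<noteq> 0" using ne by simp
  ultimately show False using p by (simp add: pw_def)
qed

text \<open>The automorphisms \<open>y \<mapsto> \<zeta> y\<close> permute the places over \<open>a\<close> and multiply the residue of \<open>y\<close> by
  \<open>\<zeta>\<close>, up to inversion. Hence all \<open>n\<close> roots of \<open>b\<^sup>n = f(a)\<close> are residues. As the degrees of the
  places over \<open>a\<close> add up to \<open>n\<close>, there are \<open>n\<close> of them, of degree one.\<close>

lemma residues_y:
  assumes a: "a \<notin> Delta"
  shows "bij_betw (\<lambda>v. place_value \<iota> v y) (Over a) {b. b ^ n = poly f a}"
    and "v \<in> Over a \<Longrightarrow> place_degree \<iota> v = 1" and "card (Over a) = n"
proof -
  let ?R = "{b. b ^ n = poly f a}" and ?g = "\<lambda>v. place_value \<iota> v y"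
  have sub: "?g ` Over a \<subseteq> ?R"
  proof (rule image_subsetI)
    fix v assume v: "v \<in> Over a"
    obtain b where b: "has_residue v y b" using ex_residue_y[OF v a] by blast
    then show "?g v \<in> ?R" using residue_y_root[OF v b] by (simp add: place_value_eq[OF OverD(2)[OF v] b])
  qed
  have sup: "?R \<subseteq> ?g ` Over a"
  proof
    fix b assume "b \<in> ?R"
    then have b: "b ^ n = poly f a" by simp
    have "Over a \<noteq> {}" using sum_degree_Over[of a] n_ge_2 by auto
    then obtain v where v: "v \<in> Over a" by blast
    note vp = OverD(2)[OF v]
    obtain b1 where b1: "has_residue v y b1" using ex_residue_y[OF v a] by blast
    have e1: "b1 ^ n = poly f a" by (rule residue_y_root[OF v b1])
    then have "b1 \<noteq> 0" using f_no_root[of a] n_ge_2 by (auto simp: zero_power)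
    \<comment> \<open>This automorphism moves a place with residue \<open>b1\<close> of \<open>y\<close> to one with residue \<open>b\<close>.\<close>
    define \<zeta> where "\<zeta> = b / b1"
    have z: "\<zeta> ^ n = 1" using b e1 f_no_root[of a] by (simp add: \<zeta>_def power_divide)
    let ?w = "\<lambda>z. v (twist \<zeta> z)"
    have "twist \<zeta> (x - \<iota> a) = x - \<iota> a" using twist_ev[OF z, of "[:- a, 1:]"] by (simp only: ev_linear)
    then have w: "?w \<in> Over a" using v Pf_twist[OF OverD(1)[OF v] z] by (simp add: Over_def)
    have "twist \<zeta> (y - \<iota> b) = twist \<zeta> (y ^ 1) + twist \<zeta> (\<iota> (- b))"
      unfolding twist_add[symmetric] by (simp add: iota_uminus)
    also have "\<dots> = \<iota> \<zeta> * y - \<iota> b" by (simp only: twist_y_power[OF z] twist_const[OF z]) (simp add: iota_uminus)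
    finally have s: "twist \<zeta> (y - \<iota> b) = \<iota> \<zeta> * y - \<iota> b" .
    have "has_residue v (\<iota> \<zeta> * y) (\<zeta> * b1)" by (rule residue_mult[OF vp residue_const[OF vp] b1])
    moreover have "\<zeta> * b1 = b" using \<open>b1 \<noteq> 0\<close> by (simp add: \<zeta>_def)
    ultimately have "\<iota> \<zeta> * y - \<iota> b \<in> pw v 1" by (simp only: has_residue_def)
    then have "has_residue ?w y b"
      using twist_eq_0[OF z, of "y - \<iota> b"] by (auto simp: has_residue_def pw_def s)
    from place_value_eq[OF OverD(2)[OF w] this] show "b \<in> ?g ` Over a" using w by (intro image_eqI[of _ _ ?w]) simp_all
  qed
  have im: "?g ` Over a = ?R" using sub sup by (rule equalityI)
  have "n \<le> card (Over a)"
    using card_image_le[OF finite_Over, of ?g a] by (simp only: im card_nth_roots_power[OF a])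
  moreover have "card (Over a) \<le> n"
    using sum_mono[of "Over a" "\<lambda>_. 1" "place_degree \<iota>"] place_degree_pos OverD(2) by (simp add: sum_degree_Over)
  ultimately show c: "card (Over a) = n" by simp
  show "bij_betw ?g (Over a) ?R"
    unfolding bij_betw_def using im finite_Over c card_nth_roots_power[OF a] by (simp add: eq_card_imp_inj_on)
  show "place_degree \<iota> v = 1" if "v \<in> Over a"
  proof (rule ccontr)
    assume "place_degree \<iota> v \<noteq> 1"
    then have "1 < place_degree \<iota> v" using place_degree_pos[OF OverD(2)[OF that]] by simp
    then have "(\<Sum>v\<in>Over a. 1) < (\<Sum>v\<in>Over a. place_degree \<iota> v)"
      using that place_degree_pos OverD(2) by (intro sum_strict_mono_ex1 finite_Over) auto
    then show False by (simp add: sum_degree_Over c)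
  qed
qed

text \<open>The residue of \<open>y\<close> is an \<open>n\<close>-th root of \<open>f(a)\<close>.\<close>

lemma degree_one_not_Delta:
  assumes v: "v \<in> Over a" and deg: "place_degree \<iota> v = 1"
  shows "a \<notin> Delta"
proof -
  obtain b where b: "has_residue v y b"
    using degree_one_residue[OF OverD(2)[OF v] deg] Pf_y_pw[OF OverD(1)[OF v], of 1] by auto
  have "b ^ n = poly f a" by (rule residue_y_root[OF v b])
  moreover have "b \<noteq> 0" using calculation f_no_root[of a] n_ge_2 by (auto simp: zero_power)
  ultimately show ?thesis unfolding Delta_def by auto
qed

lemma D_aff_eq: "D_aff \<iota> x = zero_part (lin (- Delta))"
proof
  fix v
  have mem: "v \<in> Pf" if "v \<in> places \<iota>" "0 < v (x - \<iota> a)" for a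
  proof -
    have "x - \<iota> a \<in> pw v 0" using that(2) by (simp add: pw_def)
    then have "(x - \<iota> a) + \<iota> a \<in> pw v 0" by (intro pw_add[OF that(1)] pw_const[OF that(1) emb])
    then show ?thesis using that(1) x_ne_0 by (simp add: Pf_def pw_def)
  qed
  have "v \<in> places \<iota> \<and> place_degree \<iota> v = 1 \<and> (\<exists>a. 0 < v (x - \<iota> a)) \<longleftrightarrow> (\<exists>a\<in>- Delta. v \<in> Over a)"
  proof
    assume *: "v \<in> places \<iota> \<and> place_degree \<iota> v = 1 \<and> (\<exists>a. 0 < v (x - \<iota> a))"
    then obtain a where "0 < v (x - \<iota> a)" by blast
    then have "v \<in> Over a" using mem[of a] * by (simp add: Over_def)
    then show "\<exists>a\<in>- Delta. v \<in> Over a" using degree_one_not_Delta * by blast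
  next
    assume "\<exists>a\<in>- Delta. v \<in> Over a"
    then obtain a where a: "a \<notin> Delta" "v \<in> Over a" by blast
    then show "v \<in> places \<iota> \<and> place_degree \<iota> v = 1 \<and> (\<exists>a. 0 < v (x - \<iota> a))"
      using residues_y(2)[OF a] OverD(2)[OF a(2)] by (auto simp: Over_def)
  qed
  then have D: "D_aff \<iota> x v = of_bool (\<exists>a\<in>- Delta. v \<in> Over a)" unfolding D_aff_def by (simp only:)
  show "D_aff \<iota> x v = zero_part (lin (- Delta)) v"
  proof (cases "v \<in> Pf")
    case True then show ?thesis unfolding D by (simp add: zero_part_def value_lin)
  next
    case False
    then have "v \<notin> Over a" for a using OverD(1) by blast
    then show ?thesis unfolding D using False by (simp add: zero_part_def)
  qed
qed

lemma support_D_aff: "{v. D_aff \<iota> x v \<noteq> 0} = (\<Union>a\<in>- Delta. Over a)"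
proof -
  have "D_aff \<iota> x v \<noteq> 0 \<longleftrightarrow> (\<exists>a\<in>- Delta. v \<in> Over a)" for v
  proof (cases "v \<in> Pf")
    case True then show ?thesis unfolding D_aff_eq by (simp add: zero_part_def value_lin)
  next
    case False
    then have "v \<notin> Over a" for a using OverD(1) by blast
    then show ?thesis unfolding D_aff_eq using False by (simp add: zero_part_def)
  qed
  then show ?thesis by blast
qed

lemma D_aff_values: "D_aff \<iota> x v \<noteq> 0 \<Longrightarrow> D_aff \<iota> x v = 1 \<and> v \<in> Pf \<and> place_degree \<iota> v = 1"
proof -
  assume ne: "D_aff \<iota> x v \<noteq> 0"
  then have "v \<in> {v. D_aff \<iota> x v \<noteq> 0}" by simp
  then have "v \<in> Pf" unfolding support_D_aff using OverD(1) by blast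
  then show ?thesis using ne unfolding D_aff_def by (cases "v \<in> places \<iota> \<and> place_degree \<iota> v = 1 \<and> (\<exists>a. 0 < v (x - \<iota> a))") simp_all
qed

lemma finite_support_D_aff: "finite {v. D_aff \<iota> x v \<noteq> 0}"
  unfolding support_D_aff by (simp add: finite_Over)

lemma sum_support_D_aff:
  fixes g :: "'k place \<Rightarrow> 'b::comm_monoid_add"
  shows "(\<Sum>v | D_aff \<iota> x v \<noteq> 0. g v) = (\<Sum>a\<in>- Delta. \<Sum>v\<in>Over a. g v)"
  unfolding support_D_aff by (intro sum.UNION_disjoint) (auto simp: finite_Over dest: Over_disjoint)

lemma card_support_D_aff: "card {v. D_aff \<iota> x v \<noteq> 0} = n * card (- Delta)"
proof -
  have "card {v. D_aff \<iota> x v \<noteq> 0} = (\<Sum>v | D_aff \<iota> x v \<noteq> 0. 1)" by simp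
  also have "\<dots> = (\<Sum>a\<in>- Delta. card (Over a))" unfolding sum_support_D_aff by simp
  also have "\<dots> = (\<Sum>a\<in>- Delta. n)" by (intro sum.cong) (simp_all add: residues_y(3))
  finally show ?thesis by simp
qed

lemma degree_D_aff: "divisor_degree \<iota> (D_aff \<iota> x) = int (n * card (- Delta))"
  unfolding D_aff_eq degree_zero_part[OF lin_ne_0] degree_lin ..

section \<open>Orthogonality\<close>

lemma sum_poly_eq_0:
  assumes "\<And>i. CARD('a) - 1 \<le> i \<Longrightarrow> coeff h i = 0"
  shows "(\<Sum>a\<in>UNIV. poly h (a :: 'a)) = 0"
proof -
  have "(\<Sum>a\<in>UNIV. poly h a) = (\<Sum>i\<le>degree h. coeff h i * (\<Sum>a\<in>UNIV. a ^ i))"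
    unfolding poly_altdef sum_distrib_left by (rule sum.swap)
  also have "\<dots> = 0"
  proof (rule sum.neutral, rule ballI)
    fix i
    show "coeff h i * (\<Sum>a\<in>UNIV. a ^ i) = 0"
      using assms[of i] sum_powers_eq_0[of i, where 'a = 'a] by (cases "i < CARD('a) - 1") simp_all
  qed
  finally show ?thesis .
qed

lemma sum_nth_roots_powers:
  assumes a: "a \<notin> Delta" and j: "j < n"
  shows "(\<Sum>b\<in>{b. b ^ n = poly f a}. b ^ Suc j) = (if Suc j = n then of_nat n * poly f a else 0)"
proof (cases "Suc j = n")
  case True
  have "(\<Sum>b\<in>{b. b ^ n = poly f a}. b ^ Suc j) = (\<Sum>b\<in>{b. b ^ n = poly f a}. poly f a)"
    unfolding True by (intro sum.cong) simp_all
  then show ?thesis using True by (simp add: card_nth_roots_power[OF a])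
next
  case False
  obtain e where e: "e \<noteq> 0" "poly f a = e ^ n" using a by (auto simp: Delta_def)
  have "bij_betw (\<lambda>z. e * z) {z. z ^ n = 1} {b. b ^ n = poly f a}"
    by (rule bij_betwI[where g = "\<lambda>b. b / e"]) (use e in \<open>auto simp: power_mult_distrib power_divide\<close>)
  from sum.reindex_bij_betw[OF this, of "\<lambda>b. b ^ Suc j"]
  have "(\<Sum>b\<in>{b. b ^ n = poly f a}. b ^ Suc j) = (\<Sum>z\<in>{z. z ^ n = 1}. (e * z) ^ Suc j)" by (simp only:)
  also have "\<dots> = e ^ Suc j * (\<Sum>z\<in>{z. z ^ n = 1}. z ^ Suc j)"
    unfolding power_mult_distrib by (simp only: sum_distrib_left)
  also have "\<not> n dvd Suc j" using j False by (auto dest: dvd_imp_le)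
  then have "(\<Sum>z\<in>{z::'a. z ^ n = 1}. z ^ Suc j) = 0" by (rule sum_roots_of_unity_powers[OF n_dvd])
  finally show ?thesis using False by simp
qed

text \<open>Such a function has the form \<open>z = y g(x) p / f(x)\<close>, where \<open>g\<close> has the zeros \<open>\<Delta>\<close> and \<open>p\<close> is a
  combination of monomials. In the sum over the \<open>n\<close> points above \<open>a\<close> the terms of \<open>p\<close> with \<open>y\<^sup>j\<close>
  cancel, except for \<open>j = n - 1\<close>, where \<open>y\<^sup>j\<^sup>+\<^sup>1 = f(a)\<close>. What remains are \<open>n\<close> times the values of
  a polynomial in \<open>x\<close>. Its degree is less than \<open>q - 1\<close> by the bound on the poles at infinity, so
  the sum of its values is zero.\<close>

lemma residue_sum_zero:
  assumes z: "z \<in> L (mD (int nn * int (card (- Delta)) + kappa) + pdiv (y ^ (n - 1) / ev (lin Delta)))"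
  shows "(\<Sum>v | D_aff \<iota> x v \<noteq> 0. place_value \<iota> v z) = 0"
proof -
  define m where "m = int nn * int (card (- Delta)) + kappa"
  let ?h = "y ^ (n - 1) / ev (lin Delta)"
  have ne: "ev (lin Delta) \<noteq> 0" "ev f \<noteq> 0" by (simp_all add: ev_eq_0 lin_ne_0 f_ne_0)
  have h: "?h \<noteq> 0" using ne y_ne_0 by simp
  have "z * ?h \<in> L (mD m)" using z unfolding Lsp_shift(1)[OF h] m_def .
  then obtain p where p: "p \<in> polys_below (bound m)" "z * ?h = pcomb p" unfolding Lsp_mD by blast
  have yn: "y ^ (n - 1) * y = ev f"
    using n_ge_2 power_Suc2[of y "n - 1"] by (simp add: y_power)
  have "z * ev f = (z * ?h) * (y * ev (lin Delta))" using ne y_ne_0 by (simp add: yn[symmetric] field_simps)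
  then have ze: "z = (pcomb p * (y * ev (lin Delta))) / ev f" unfolding p(2) using ne by (simp add: field_simps)
  have val: "place_value \<iota> v z = (\<Sum>j<n. poly (p j * lin Delta) a / poly f a * place_value \<iota> v y ^ Suc j)"
    if v: "v \<in> Over a" and a: "a \<notin> Delta" for v a
  proof -
    note vp = OverD(2)[OF v]
    obtain b where b: "has_residue v y b" using ex_residue_y[OF v a] by blast
    have "has_residue v (pcomb p) (\<Sum>j<n. poly (p j) a * b ^ j)" unfolding pcomb_def
      by (intro residue_sum[OF vp] residue_mult[OF vp] residue_power[OF vp] Over_residue_ev[OF v] b) simp
    then have "has_residue v z ((\<Sum>j<n. poly (p j) a * b ^ j) * (b * poly (lin Delta) a) / poly f a)"
      unfolding ze
      by (intro residue_divide[OF vp] residue_mult[OF vp] Over_residue_ev[OF v] b f_no_root)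
    then have "place_value \<iota> v z = (\<Sum>j<n. poly (p j) a * b ^ j) * (b * poly (lin Delta) a) / poly f a"
      by (rule place_value_eq[OF vp])
    also have "\<dots> = (\<Sum>j<n. poly (p j * lin Delta) a / poly f a * b ^ Suc j)"
      unfolding sum_distrib_right sum_divide_distrib by (intro sum.cong) (simp_all add: mult_ac)
    finally show ?thesis by (simp only: place_value_eq[OF vp b])
  qed
  let ?g = "p (n - 1) * lin Delta"
  have over: "(\<Sum>v\<in>Over a. place_value \<iota> v z) = of_nat n * poly ?g a" if a: "a \<notin> Delta" for a
  proof -
    let ?c = "\<lambda>j. poly (p j * lin Delta) a / poly f a"
    have "(\<Sum>v\<in>Over a. place_value \<iota> v z) = (\<Sum>v\<in>Over a. \<Sum>j<n. ?c j * place_value \<iota> v y ^ Suc j)"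
      by (intro sum.cong refl val a)
    also have "\<dots> = (\<Sum>b\<in>{b. b ^ n = poly f a}. \<Sum>j<n. ?c j * b ^ Suc j)"
      by (rule sum.reindex_bij_betw[OF residues_y(1)[OF a]])
    also have "\<dots> = (\<Sum>j<n. ?c j * (\<Sum>b\<in>{b. b ^ n = poly f a}. b ^ Suc j))"
      unfolding sum_distrib_left by (rule sum.swap)
    also have "\<dots> = (\<Sum>j<n. if j = n - 1 then ?c j * (of_nat n * poly f a) else 0)"
    proof (rule sum.cong[OF refl])
      fix j assume "j \<in> {..<n}"
      then have j: "j < n" by simp
      have "Suc j = n \<longleftrightarrow> j = n - 1" using n_ge_2 by auto
      then show "?c j * (\<Sum>b\<in>{b. b ^ n = poly f a}. b ^ Suc j) = (if j = n - 1 then ?c j * (of_nat n * poly f a) else 0)"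
        unfolding sum_nth_roots_powers[OF a j] by simp
    qed
    also have "\<dots> = ?c (n - 1) * (of_nat n * poly f a)" using n_ge_2 by simp
    also have "\<dots> = of_nat n * poly ?g a" using f_no_root[of a] by simp
    finally show ?thesis .
  qed
  have "(\<Sum>v | D_aff \<iota> x v \<noteq> 0. place_value \<iota> v z) = (\<Sum>a\<in>- Delta. of_nat n * poly ?g a)"
    unfolding sum_support_D_aff by (intro sum.cong over) simp_all
  also have "\<dots> = (\<Sum>a\<in>UNIV. of_nat n * poly ?g a)"
  proof (rule sum.mono_neutral_left)
    have "poly (lin Delta) a = 0" if "a \<in> Delta" for a
      unfolding lin_def poly_prod using that by (intro prod_zero) (auto intro!: bexI[of _ a])
    then show "\<forall>a\<in>UNIV - - Delta. of_nat n * poly ?g a = 0" by simp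
  qed simp_all
  also have "\<dots> = of_nat n * (\<Sum>a\<in>UNIV. poly ?g a)" by (simp only: sum_distrib_left)
  also have "(\<Sum>a\<in>UNIV. poly ?g a) = 0"
  proof (rule sum_poly_eq_0)
    fix i assume i: "CARD('a) - 1 \<le> i"
    have c0: "\<forall>i\<ge>bound m (n - 1). coeff (p (n - 1)) i = 0"
      using p(1) n_ge_2 by (simp add: polys_below_def)
    show "coeff ?g i = 0"
    proof (cases "p (n - 1) = 0")
      case False
      let ?k = "degree (p (n - 1))"
      have "?k < bound m (n - 1)" using c0 False unfolding coeff_zero_iff_degree by simp
      then have "int nn * int ?k + int dd * int (n - 1) \<le> m" by (simp only: bound_iff)
      then have "int nn * int ?k < int nn * (int (card (- Delta)) - 1)"
        using n_ge_2 by (simp add: m_def kappa_def of_nat_diff algebra_simps)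
      then have "int ?k < int (card (- Delta)) - 1" using nn_pos by simp
      moreover have "degree ?g \<le> ?k + card Delta" using degree_mult_le[of "p (n - 1)" "lin Delta"] by (simp add: degree_lin)
      moreover have "card Delta + card (- Delta) = CARD('a)" 
        by (subst card_Un_disjoint[symmetric]) simp_all
      ultimately have "degree ?g < i" using i by linarith
      then show ?thesis by (rule coeff_eq_0)
    qed simp
  qed
  finally show ?thesis by simp
qed

end

section \<open>Counting pairs in a fibre product\<close>

lemma subgrp_difference_pairs:
  assumes "subgrp U" "subgrp V" "subgrp S"
  shows "subgrp {p \<in> U \<times> V. fst p - snd p \<in> S}"
  unfolding subgrp_def
proof (intro conjI ballI)
  show "0 \<in> {p \<in> U \<times> V. fst p - snd p \<in> S}"
    using assms by (simp add: zero_prod_def subgrp_zero)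
  fix p r assume p: "p \<in> {p \<in> U \<times> V. fst p - snd p \<in> S}" and r: "r \<in> {p \<in> U \<times> V. fst p - snd p \<in> S}"
  have e: "fst p - fst r - (snd p - snd r) = (fst p - snd p) - (fst r - snd r)" by simp
  have "fst p - fst r - (snd p - snd r) \<in> S" unfolding e by (rule subgrp_diff[OF assms(3)]) (use p r in auto)
  moreover have "fst p - fst r \<in> U" "snd p - snd r \<in> V"
    using subgrp_diff[OF assms(1)] subgrp_diff[OF assms(2)] p r by (simp_all add: mem_Times_iff)
  ultimately show "p - r \<in> {p \<in> U \<times> V. fst p - snd p \<in> S}" by (simp add: mem_Times_iff)
qed

text \<open>The difference maps these pairs onto \<open>(U + V) \<inter> S\<close>, and its fibres are cosets of the
  diagonal of \<open>U \<inter> V\<close>.\<close>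

lemma card_difference_pairs:
  fixes U V S :: "'b::ab_group_add set"
  assumes U: "subgrp U" "finite U" and V: "subgrp V" "finite V" and S: "subgrp S"
  shows "card {p \<in> U \<times> V. fst p - snd p \<in> S} = card (sum_space U V \<inter> S) * card (U \<inter> V)"
proof -
  define T where "T = {p \<in> U \<times> V. fst p - snd p \<in> S}"
  define W where "W = (\<lambda>u. (u, u)) ` (U \<inter> V)"
  have T: "subgrp T" "finite T" unfolding T_def
    using subgrp_difference_pairs[OF U(1) V(1) S] U(2) V(2) by simp_all
  have memT: "p \<in> T \<longleftrightarrow> fst p \<in> U \<and> snd p \<in> V \<and> fst p - snd p \<in> S" for p
    by (simp add: T_def mem_Times_iff)
  have memW: "p \<in> W \<longleftrightarrow> fst p = snd p \<and> fst p \<in> U \<and> fst p \<in> V" for p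
    by (cases p) (auto simp: W_def)
  have W: "subgrp W" unfolding subgrp_def
    using subgrp_zero[OF U(1)] subgrp_zero[OF V(1)] subgrp_diff[OF U(1)] subgrp_diff[OF V(1)]
    by (auto simp: memW)
  have "W \<subseteq> T" using subgrp_zero[OF S] by (auto simp: memW memT)
  from card_eq_idx_mult[OF T(1) W this T(2)] have "card T = idx T W * card W" .
  moreover have "card W = card (U \<inter> V)" unfolding W_def by (simp add: card_image inj_on_def)
  moreover have "idx T W = card ((\<lambda>p. fst p - snd p) ` T)"
  proof (rule idx_fibers(1)[OF W])
    fix p r assume p: "p \<in> T" and r: "r \<in> T"
    have "fst p - fst r \<in> U" "snd p - snd r \<in> V"
      using subgrp_diff[OF U(1)] subgrp_diff[OF V(1)] p r by (simp_all add: memT)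
    moreover have "fst p - snd p = fst r - snd r \<longleftrightarrow> fst p - fst r = snd p - snd r" by (auto simp: algebra_simps)
    ultimately show "fst p - snd p = fst r - snd r \<longleftrightarrow> p - r \<in> W" by (auto simp: memW)
  qed
  moreover have "(\<lambda>p. fst p - snd p) ` T = sum_space U V \<inter> S"
  proof (intro equalityI subsetI)
    fix z assume "z \<in> (\<lambda>p. fst p - snd p) ` T"
    then obtain p where p: "p \<in> T" "z = fst p - snd p" by blast
    have "z = fst p + - snd p" "fst p \<in> U" "- snd p \<in> V" "z \<in> S"
      using p subgrp_uminus[OF V(1)] by (simp_all add: memT)
    then show "z \<in> sum_space U V \<inter> S" unfolding sum_space_def by blast
  next
    fix z assume "z \<in> sum_space U V \<inter> S"
    then obtain u v where uv: "z = u + v" "u \<in> U" "v \<in> V" "z \<in> S" by (auto simp: sum_space_def)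
    then have "(u, - v) \<in> T" using subgrp_uminus[OF V(1)] by (simp add: memT)
    then show "z \<in> (\<lambda>p. fst p - snd p) ` T" by (rule rev_image_eqI) (simp add: uv)
  qed
  ultimately show ?thesis unfolding T_def by simp
qed

text \<open>Here the same pairs are sorted by their common value under \<open>g\<close>, the fibres being cosets of
  \<open>WU \<times> WV\<close>.\<close>

lemma card_fibre_product:
  fixes U V S :: "'b::ab_group_add set"
  assumes U: "subgrp U" "finite U" and V: "subgrp V" "finite V" and S: "subgrp S"
    and WU: "subgrp WU" "WU \<subseteq> U" and WV: "subgrp WV" "WV \<subseteq> V"
    and gS: "\<And>u v. u \<in> U \<Longrightarrow> v \<in> V \<Longrightarrow> g u = g v \<longleftrightarrow> u - v \<in> S"
    and gU: "\<And>u v. u \<in> U \<Longrightarrow> v \<in> U \<Longrightarrow> g u = g v \<longleftrightarrow> u - v \<in> WU"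
    and gV: "\<And>u v. u \<in> V \<Longrightarrow> v \<in> V \<Longrightarrow> g u = g v \<longleftrightarrow> u - v \<in> WV"
  shows "card {p \<in> U \<times> V. fst p - snd p \<in> S} = card (g ` U \<inter> g ` V) * (card WU * card WV)"
proof -
  define T where "T = {p \<in> U \<times> V. fst p - snd p \<in> S}"
  have T: "subgrp T" "finite T" unfolding T_def
    using subgrp_difference_pairs[OF U(1) V(1) S] U(2) V(2) by simp_all
  have memT: "p \<in> T \<longleftrightarrow> fst p \<in> U \<and> snd p \<in> V \<and> g (fst p) = g (snd p)" for p
    using gS by (auto simp: T_def mem_Times_iff)
  have W: "subgrp (WU \<times> WV)" unfolding subgrp_def
    using subgrp_zero[OF WU(1)] subgrp_zero[OF WV(1)] subgrp_diff[OF WU(1)] subgrp_diff[OF WV(1)]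
    by (simp add: zero_prod_def mem_Times_iff)
  have "WU \<times> WV \<subseteq> T"
  proof
    fix p assume "p \<in> WU \<times> WV"
    then have p: "fst p \<in> WU" "snd p \<in> WV" by (simp_all add: mem_Times_iff)
    have "g (fst p) = g 0" using gU[of "fst p" 0] p WU(2) subgrp_zero[OF U(1)] by auto
    moreover have "g (snd p) = g 0" using gV[of "snd p" 0] p WV(2) subgrp_zero[OF V(1)] by auto
    ultimately show "p \<in> T" using p WU(2) WV(2) by (auto simp: memT)
  qed
  from card_eq_idx_mult[OF T(1) W this T(2)] have "card T = idx T (WU \<times> WV) * card (WU \<times> WV)" .
  moreover have "idx T (WU \<times> WV) = card ((\<lambda>p. g (fst p)) ` T)"
  proof (rule idx_fibers(1)[OF W])
    fix p r assume p: "p \<in> T" and r: "r \<in> T"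
    have "g (fst p) = g (fst r) \<longleftrightarrow> fst p - fst r \<in> WU" "g (snd p) = g (snd r) \<longleftrightarrow> snd p - snd r \<in> WV"
      using p r gU[of "fst p" "fst r"] gV[of "snd p" "snd r"] unfolding memT by blast+
    then show "g (fst p) = g (fst r) \<longleftrightarrow> p - r \<in> WU \<times> WV" using p r by (simp add: memT mem_Times_iff)
  qed
  moreover have "(\<lambda>p. g (fst p)) ` T = g ` U \<inter> g ` V"
  proof (intro equalityI subsetI)
    fix c assume "c \<in> (\<lambda>p. g (fst p)) ` T"
    then obtain p where "p \<in> T" "c = g (fst p)" by blast
    then have "c = g (fst p)" "c = g (snd p)" "fst p \<in> U" "snd p \<in> V" by (simp_all add: memT)
    then show "c \<in> g ` U \<inter> g ` V" by blast
  next
    fix c assume "c \<in> g ` U \<inter> g ` V"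
    then obtain u v where "u \<in> U" "c = g u" "v \<in> V" "c = g v" by blast
    then have "(u, v) \<in> T" "c = g (fst (u, v))" by (simp_all add: memT)
    then show "c \<in> (\<lambda>p. g (fst p)) ` T" by (rule rev_image_eqI)
  qed
  ultimately show ?thesis unfolding T_def by (simp add: card_cartesian_product)
qed

text \<open>The pairs are now those of \<open>U \<times> V\<close>, with \<open>S\<close> the whole group.\<close>

lemma card_sum_space:
  assumes "subgrp U" "finite U" "subgrp V" "finite V"
  shows "card (sum_space U V) * card (U \<inter> V) = card U * card V"
proof -
  have "subgrp (UNIV :: 'a set)" by (simp add: subgrp_def)
  from card_difference_pairs[OF assms this] show ?thesis
    by (simp add: card_cartesian_product Collect_mem_eq)
qed

section \<open>Evaluation at the rational points\<close>

context superelliptic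
begin

text \<open>The word of values at the points of \<open>D\<close>; evaluation is meaningful for the functions without
  poles there.\<close>

definition evaluate :: "'k \<Rightarrow> 'k place \<Rightarrow> 'a" where
  "evaluate h = (\<lambda>v. if D_aff \<iota> x v \<noteq> 0 then place_value \<iota> v h else 0)"

definition avoids_D :: "'k divisor \<Rightarrow> bool" where
  "avoids_D H \<longleftrightarrow> (\<forall>v. D_aff \<iota> x v \<noteq> 0 \<longrightarrow> H v = 0) \<and> {v. H v \<noteq> 0} \<subseteq> places \<iota>"

lemma subgrp_L: "subgrp (L H)"
  by (rule subgrp_Lsp) simp

lemma avoids_residue:
  assumes H: "avoids_D H" and z: "z \<in> L H" and v: "D_aff \<iota> x v \<noteq> 0"
  shows "has_residue v z (place_value \<iota> v z)"
proof -
  have vp: "v \<in> places \<iota>" and deg: "place_degree \<iota> v = 1" using D_aff_values[OF v] PfD(1) by auto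
  have "z \<in> pw v (- H v)" using z vp unfolding Lsp_def by blast
  then have "z \<in> pw v 0" using H v by (simp add: avoids_D_def)
  then obtain b where b: "has_residue v z b" using degree_one_residue[OF vp deg] by blast
  then show ?thesis by (simp add: place_value_eq[OF vp b])
qed

text \<open>At a point of \<open>D\<close> both coefficients vanish, and membership means that \<open>z - w\<close> has a zero.
  Elsewhere membership holds for all differences.\<close>

lemma evaluate_eq_iff:
  assumes H: "avoids_D H" and z: "z \<in> L H" and H': "avoids_D H'" and w: "w \<in> L H'"
  shows "evaluate z = evaluate w \<longleftrightarrow> z - w \<in> L (sup H H' - D_aff \<iota> x)"
proof -
  have "z - w \<in> pw v (- (sup H H' - D_aff \<iota> x) v)" if "D_aff \<iota> x v = 0" "v \<in> places \<iota>" for v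
  proof -
    have "z \<in> pw v (- H v)" "w \<in> pw v (- H' v)" using z w that(2) unfolding Lsp_def by blast+
    then have "z \<in> pw v (- max (H v) (H' v))" "w \<in> pw v (- max (H v) (H' v))"
      by (auto simp: pw_def)
    then have "z - w \<in> pw v (- max (H v) (H' v))" by (rule pw_diff[OF that(2)])
    then show ?thesis using that(1) by (simp add: sup_int_def)
  qed
  moreover have "z - w \<in> pw v (- (sup H H' - D_aff \<iota> x) v) \<longleftrightarrow> evaluate z v = evaluate w v" if v: "D_aff \<iota> x v \<noteq> 0" for v
  proof -
    have vp: "v \<in> places \<iota>" and D: "D_aff \<iota> x v = 1" using D_aff_values[OF v] PfD(1) by auto
    have "- (sup H H' - D_aff \<iota> x) v = 1" using H H' v D by (simp add: avoids_D_def)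
    moreover have d: "has_residue v (z - w) (place_value \<iota> v z - place_value \<iota> v w)"
      by (intro residue_diff[OF vp] avoids_residue[OF H z v] avoids_residue[OF H' w v])
    have "has_residue v (z - w) 0 \<longleftrightarrow> place_value \<iota> v z - place_value \<iota> v w = 0"
      using d residue_unique[OF vp d, of 0] by auto
    then have "z - w \<in> pw v 1 \<longleftrightarrow> place_value \<iota> v z = place_value \<iota> v w"
      by (simp add: has_residue_def iota_hom)
    ultimately show ?thesis using v by (simp add: evaluate_def)
  qed
  moreover have "evaluate z v = evaluate w v" if "D_aff \<iota> x v = 0" for v using that by (simp add: evaluate_def)
  moreover have "v \<in> places \<iota>" if "D_aff \<iota> x v \<noteq> 0" for v using D_aff_values[OF that] PfD(1) by simp
  ultimately have "(\<forall>v. evaluate z v = evaluate w v) \<longleftrightarrow> (\<forall>v\<in>places \<iota>. z - w \<in> pw v (- (sup H H' - D_aff \<iota> x) v))"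
    by metis
  then show ?thesis unfolding Lsp_def fun_eq_iff mem_Collect_eq .
qed

lemma evaluate_diff:
  assumes H: "avoids_D H" and z: "z \<in> L H" and w: "w \<in> L H"
  shows "evaluate (z - w) = evaluate z - evaluate w"
proof
  fix v show "evaluate (z - w) v = (evaluate z - evaluate w) v"
  proof (cases "D_aff \<iota> x v = 0")
    case False
    have vp: "v \<in> places \<iota>" using D_aff_values[OF False] PfD(1) by simp
    have "has_residue v (z - w) (place_value \<iota> v z - place_value \<iota> v w)"
      by (intro residue_diff[OF vp] avoids_residue[OF H _ False] z w)
    from place_value_eq[OF vp this] show ?thesis using False by (simp add: evaluate_def)
  qed (simp add: evaluate_def)
qed

lemma evaluate_scale:
  assumes H: "avoids_D H" and z: "z \<in> L H"
  shows "evaluate (\<iota> a * z) = (\<lambda>v. a * evaluate z v)"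
proof
  fix v show "evaluate (\<iota> a * z) v = a * evaluate z v"
  proof (cases "D_aff \<iota> x v = 0")
    case False
    have vp: "v \<in> places \<iota>" using D_aff_values[OF False] PfD(1) by simp
    have "has_residue v (\<iota> a * z) (a * place_value \<iota> v z)"
      by (intro residue_mult[OF vp] residue_const[OF vp] avoids_residue[OF H z False])
    from place_value_eq[OF vp this] show ?thesis using False by (simp add: evaluate_def)
  qed (simp add: evaluate_def)
qed

lemma L_scale: "z \<in> L H \<Longrightarrow> \<iota> a * z \<in> L H"
  using pw_mult[OF _ pw_const[OF _ emb]] unfolding Lsp_def by fastforce

lemma code_subspace:
  assumes H: "avoids_D H"
  shows "subgrp (evaluate ` L H)" "w \<in> evaluate ` L H \<Longrightarrow> (\<lambda>v. a * w v) \<in> evaluate ` L H" "evaluate ` L H \<subseteq> words (D_aff \<iota> x)"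
proof -
  have "evaluate z - evaluate w \<in> evaluate ` L H" if "z \<in> L H" "w \<in> L H" for z w
    unfolding evaluate_diff[OF H that, symmetric] by (rule imageI) (rule subgrp_diff[OF subgrp_L that])
  moreover have "(0 :: 'k place \<Rightarrow> 'a) = evaluate 0"
    using evaluate_diff[OF H subgrp_zero[OF subgrp_L] subgrp_zero[OF subgrp_L]] by simp
  then have "0 \<in> evaluate ` L H" using subgrp_zero[OF subgrp_L] by (rule image_eqI)
  ultimately show "subgrp (evaluate ` L H)" unfolding subgrp_def by blast
  show "(\<lambda>v. a * w v) \<in> evaluate ` L H" if w: "w \<in> evaluate ` L H"
  proof -
    obtain z where z: "z \<in> L H" "w = evaluate z" using w by blast
    have "(\<lambda>v. a * w v) = evaluate (\<iota> a * z)" unfolding z(2) by (rule evaluate_scale[OF H z(1), symmetric])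
    then show ?thesis using L_scale[OF z(1)] by (simp only: imageI)
  qed
  show "evaluate ` L H \<subseteq> words (D_aff \<iota> x)" by (auto simp: words_def evaluate_def)
qed

lemma AG_code_eq: "avoids_D H \<Longrightarrow> AG_code \<iota> (D_aff \<iota> x) H = evaluate ` L H"
proof -
  assume "avoids_D H"
  then have "RR_space \<iota> H = L H" by (intro RR_space_eq) (simp add: avoids_D_def)
  then show ?thesis unfolding AG_code_def evaluate_def by simp
qed

lemma L_diff_D_subset: "L (H - D_aff \<iota> x) \<subseteq> L H"
  by (rule Lsp_mono) (simp_all add: D_aff_def)

lemma card_code:
  assumes H: "avoids_D H" and fin: "finite (L H)"
  shows "card (evaluate ` L H) * card (L (H - D_aff \<iota> x)) = card (L H)"
proof -
  have "idx (L H) (L (H - D_aff \<iota> x)) = card (evaluate ` L H)"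
  proof (rule idx_fibers(1)[OF subgrp_L])
    fix z w assume "z \<in> L H" "w \<in> L H"
    from evaluate_eq_iff[OF H this(1) H this(2)] show "evaluate z = evaluate w \<longleftrightarrow> z - w \<in> L (H - D_aff \<iota> x)" by (simp only: sup_idem)
  qed
  then show ?thesis using card_eq_idx_mult[OF subgrp_L subgrp_L L_diff_D_subset fin] by simp
qed

lemma L_inf: "L G \<inter> L H = L (inf G H)"
proof -
  have "z \<in> pw v (- G v) \<and> z \<in> pw v (- H v) \<longleftrightarrow> z \<in> pw v (- (inf G H) v)" for z v
    by (auto simp: pw_def inf_int_def)
  then show ?thesis unfolding Lsp_def by blast
qed

section \<open>The divisors of the code and of its dual\<close>

text \<open>The degree of \<open>D\<close> in units of the degree of \<open>D\<^sub>\<infinity>\<close>: the divisor \<open>D\<close> is equivalent to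
  \<open>degD D\<^sub>\<infinity>\<close>.\<close>

definition degD :: int where
  "degD = int nn * int (card (- Delta))"

lemma card_Delta: "card Delta + card (- Delta) = CARD('a)"
  by (subst card_Un_disjoint[symmetric]) simp_all

lemma degree_D: "divisor_degree \<iota> (D_aff \<iota> x) = int cc * degD"
proof -
  have "int n = int cc * int nn" using n_eq by (metis of_nat_mult)
  then show ?thesis by (simp add: degree_D_aff degD_def)
qed

lemma mu_eq: "mu n f s = min s ((int CARD('a) - 1) * int nn - 1 - s)"
proof -
  have "int n = int nn * int cc" using n_eq by (metis of_nat_mult mult.commute)
  then have "(int CARD('a) - 1) * int n div int cc = (int CARD('a) - 1) * int nn"
    using cc_pos by (simp only: mult.assoc[symmetric]) simp
  then show ?thesis by (simp add: mu_def M_const_def degree_f cc_def)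
qed

lemma nu_eq: "nu n f s = mu n f s - int nn * int (card Delta)"
proof -
  have "int n = int cc * int nn" using n_eq by (metis of_nat_mult)
  then have "int (n * card Delta) = int cc * (int nn * int (card Delta))" by (simp only: of_nat_mult mult.assoc)
  moreover have "int cc * (int nn * int (card Delta)) div int cc = int nn * int (card Delta)" using cc_pos by simp
  ultimately have "int (n * card Delta) div int cc = int nn * int (card Delta)" by (simp only:)
  then show ?thesis by (simp add: nu_def num_nonpowers_eq degree_f cc_def)
qed

lemma t_fun_eq: "t_fun \<iota> n f s = int cc * (kappa - nu n f s)"
proof -
  have "int n = int cc * int nn" using n_eq by (metis of_nat_mult)
  moreover have "t_fun \<iota> n f s = int cc * kappa - int cc * mu n f s + int n * int (card Delta)"
    unfolding t_fun_def genus_eq num_nonpowers_eq two_genus_num degree_f cc_def by simp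
  ultimately show ?thesis by (simp add: nu_eq algebra_simps)
qed

lemma value_lin_UNIV: "v \<in> places \<iota> \<Longrightarrow> v (ev (lin UNIV)) = v (ev (lin Delta)) + v (ev (lin (- Delta)))"
proof -
  assume v: "v \<in> places \<iota>"
  have "lin UNIV = lin Delta * lin (- Delta)"
    unfolding lin_def by (subst prod.union_disjoint[symmetric]) simp_all
  then show ?thesis by (simp add: ev_mult place_mult[OF v] ev_eq_0 lin_ne_0)
qed

lemma value_lin_inf: "v \<in> Pinf \<Longrightarrow> v (ev (lin S)) = - (int nn * int (card S))"
proof -
  assume v: "v \<in> Pinf"
  show ?thesis using place_inf_value[OF PinfD[OF v] lin_ne_0, of S] inf_values(1)[OF PinfD[OF v]] by (simp add: degree_lin)
qed

lemma values_quotient: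
  assumes v: "v \<in> places \<iota>"
  shows "v (y ^ k / ev (lin S)) = int k * v y - v (ev (lin S))" "v (1 / ev (lin S)) = - v (ev (lin S))"
  using y_ne_0 by (simp_all add: place_divide[OF v] place_power[OF v] place_one[OF v] ev_eq_0 lin_ne_0)

text \<open>As \<open>f\<close> has no rational root, \<open>y\<close> and \<open>lin S\<close> have no common zeros.\<close>

lemma y_or_lin: "v \<in> Pf \<Longrightarrow> v y = 0 \<and> 0 \<le> v (ev (lin S)) \<or> 0 \<le> v y \<and> v (ev (lin S)) = 0"
proof -
  assume v: "v \<in> Pf"
  have y_zero: "v y = 0" if a: "v \<in> Over a" for a using Over_ev[OF a f_ne_0] f_no_root[of a] Pf_y[OF v] by simp
  show ?thesis
  proof (cases "\<exists>a\<in>S. v \<in> Over a")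
    case True
    then show ?thesis using y_zero value_lin[OF v, of S] by auto
  next
    case False
    then show ?thesis using value_lin[OF v, of S] Pf_y[OF v] by simp
  qed
qed

text \<open>All divisors in question are sums of terms \<open>mD m\<close> and \<open>pdiv h\<close>, whose values at the finite
  places and at infinity are explicit.\<close>

lemma divisor_eqI:
  assumes "\<And>v. v \<in> Pf \<Longrightarrow> G v = H v" "\<And>v. v \<in> Pinf \<Longrightarrow> G v = H v"
    and "\<And>v. v \<notin> places \<iota> \<Longrightarrow> G v = (H v :: int)"
  shows "G = H"
  using assms places_Un by (metis Un_iff ext)

lemma at_finite: "v \<in> Pf \<Longrightarrow> (mD m + pdiv h) v = v h" "v \<in> Pf \<Longrightarrow> mD m v = 0"
  and at_infinity: "v \<in> Pinf \<Longrightarrow> (mD m + pdiv h) v = m + v h" "v \<in> Pinf \<Longrightarrow> mD m v = m"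
  and at_no_place: "v \<notin> places \<iota> \<Longrightarrow> (mD m + pdiv h) v = 0" "v \<notin> places \<iota> \<Longrightarrow> mD m v = 0"
  using Pf_Pinf places_Un by (auto simp: mD_def pdiv_apply)

lemma D_aff_at: "v \<in> Pf \<Longrightarrow> D_aff \<iota> x v = v (ev (lin (- Delta)))" "v \<in> Pinf \<Longrightarrow> D_aff \<iota> x v = 0"
  "v \<notin> places \<iota> \<Longrightarrow> D_aff \<iota> x v = 0"
  unfolding D_aff_eq using Pf_Pinf places_Un by (auto simp: zero_part_def)

lemma dd_n: "int dd * (int n - 1) = kappa + int nn + 1"
  by (simp add: kappa_def)

context
  fixes s :: int
begin

lemma G_minus_D: "mD s - D_aff \<iota> x = mD (s - degD) + pdiv (1 / ev (lin (- Delta)))"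
proof (rule divisor_eqI)
  fix v assume v: "v \<in> Pinf"
  then show "(mD s - D_aff \<iota> x) v = (mD (s - degD) + pdiv (1 / ev (lin (- Delta)))) v"
    unfolding at_infinity(1)[OF v] minus_apply by (simp add: at_infinity D_aff_at values_quotient PinfD value_lin_inf degD_def)
next
  fix v assume v: "v \<in> Pf"
  then show "(mD s - D_aff \<iota> x) v = (mD (s - degD) + pdiv (1 / ev (lin (- Delta)))) v"
    unfolding at_finite(1)[OF v] minus_apply by (simp add: at_finite D_aff_at values_quotient PfD)
next
  fix v assume v: "v \<notin> places \<iota>"
  then show "(mD s - D_aff \<iota> x) v = (mD (s - degD) + pdiv (1 / ev (lin (- Delta)))) v"
    unfolding at_no_place(1)[OF v] minus_apply by (simp add: at_no_place D_aff_at)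
qed

lemma A_eq: "A_div \<iota> x s = mD (kappa - (s - degD)) + pdiv (y ^ (n - 1) / ev (lin Delta))"
proof (rule divisor_eqI)
  fix v assume v: "v \<in> Pinf"
  show "A_div \<iota> x s v = (mD (kappa - (s - degD)) + pdiv (y ^ (n - 1) / ev (lin Delta))) v"
    unfolding A_div_def K_div_eq G_div_eq plus_fun_apply[of _ "mD kappa + _"] minus_apply at_infinity(1)[OF v]
    using v by (simp add: at_infinity D_aff_at values_quotient PinfD value_lin_UNIV) (simp add: value_lin_inf degD_def)
next
  fix v assume v: "v \<in> Pf"
  show "A_div \<iota> x s v = (mD (kappa - (s - degD)) + pdiv (y ^ (n - 1) / ev (lin Delta))) v"
    unfolding A_div_def K_div_eq G_div_eq plus_fun_apply[of _ "mD kappa + _"] minus_apply at_finite(1)[OF v]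
    using v by (simp add: at_finite D_aff_at values_quotient PfD value_lin_UNIV)
next
  fix v assume v: "v \<notin> places \<iota>"
  show "A_div \<iota> x s v = (mD (kappa - (s - degD)) + pdiv (y ^ (n - 1) / ev (lin Delta))) v"
    unfolding A_div_def K_div_eq G_div_eq plus_fun_apply[of _ "mD kappa + _"] minus_apply at_no_place(1)[OF v]
    using v by (simp add: at_no_place D_aff_at)
qed

lemma A_minus_D: "A_div \<iota> x s - D_aff \<iota> x = mD (kappa - s) + pdiv (y ^ (n - 1) / ev (lin UNIV))"
  unfolding A_div_def K_div_eq G_div_eq using mD_add[of "kappa - s" s] by (simp add: algebra_simps)

text \<open>At the finite places the coefficient of \<open>G\<close> is \<open>0\<close>, and that of \<open>A\<close> is positive at the zeros
  of \<open>y\<close> and negative at the zeros of \<open>lin Delta\<close>; only the latter remain in the minimum. At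
  infinity, the minimum of the coefficients is \<open>mu n f s\<close>.\<close>

lemma inf_eq: "inf (mD s) (A_div \<iota> x s) = mD (nu n f s) + pdiv (1 / ev (lin Delta))"
proof (rule divisor_eqI)
  fix v assume v: "v \<in> Pinf"
  have vy: "v y = - int dd" by (rule inf_values(2)[OF PinfD[OF v]])
  have "A_div \<iota> x s v = kappa - (s - degD) - (kappa + int nn + 1) + int nn * int (card Delta)"
    unfolding A_eq at_infinity(1)[OF v] using v n_ge_2 dd_n
    by (simp add: values_quotient PinfD value_lin_inf vy of_nat_diff algebra_simps)
  also have "\<dots> = (int CARD('a) - 1) * int nn - 1 - s"
    unfolding card_Delta[symmetric] degD_def by (simp add: algebra_simps)
  finally have "min s (A_div \<iota> x s v) = mu n f s" by (simp add: mu_eq)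
  then show "inf (mD s) (A_div \<iota> x s) v = (mD (nu n f s) + pdiv (1 / ev (lin Delta))) v"
    unfolding at_infinity(1)[OF v] using v
    by (simp add: at_infinity inf_int_def values_quotient PinfD value_lin_inf nu_eq)
next
  fix v assume v: "v \<in> Pf"
  have "A_div \<iota> x s v = int (n - 1) * v y - v (ev (lin Delta))"
    unfolding A_eq at_finite(1)[OF v] by (simp add: values_quotient PfD[OF v])
  then have "min 0 (A_div \<iota> x s v) = - v (ev (lin Delta))" using y_or_lin[OF v, of Delta] by auto
  then show "inf (mD s) (A_div \<iota> x s) v = (mD (nu n f s) + pdiv (1 / ev (lin Delta))) v"
    unfolding at_finite(1)[OF v] using v by (simp add: at_finite inf_int_def values_quotient PfD)
next
  fix v assume v: "v \<notin> places \<iota>"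
  then show "inf (mD s) (A_div \<iota> x s) v = (mD (nu n f s) + pdiv (1 / ev (lin Delta))) v"
    unfolding A_eq inf_fun_def at_no_place(1)[OF v] by (simp add: at_no_place)
qed

lemma inf_minus_D: "inf (mD s) (A_div \<iota> x s) - D_aff \<iota> x = mD (nu n f s - degD) + pdiv (1 / ev (lin UNIV))"
  unfolding inf_eq
proof (rule divisor_eqI)
  fix v assume v: "v \<in> Pinf"
  show "(mD (nu n f s) + pdiv (1 / ev (lin Delta)) - D_aff \<iota> x) v = (mD (nu n f s - degD) + pdiv (1 / ev (lin UNIV))) v"
    unfolding minus_apply at_infinity(1)[OF v]
    using v by (simp add: D_aff_at values_quotient PinfD value_lin_UNIV) (simp add: value_lin_inf degD_def)
next
  fix v assume v: "v \<in> Pf"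
  show "(mD (nu n f s) + pdiv (1 / ev (lin Delta)) - D_aff \<iota> x) v = (mD (nu n f s - degD) + pdiv (1 / ev (lin UNIV))) v"
    unfolding minus_apply at_finite(1)[OF v]
    using v by (simp add: D_aff_at values_quotient PfD value_lin_UNIV)
next
  fix v assume v: "v \<notin> places \<iota>"
  show "(mD (nu n f s) + pdiv (1 / ev (lin Delta)) - D_aff \<iota> x) v = (mD (nu n f s - degD) + pdiv (1 / ev (lin UNIV))) v"
    unfolding minus_apply at_no_place(1)[OF v] using v by (simp add: D_aff_at)
qed

lemma K_minus_inf: "K_div \<iota> x - inf (mD s) (A_div \<iota> x s) = mD (kappa - nu n f s) + pdiv (y ^ (n - 1) / ev (lin (- Delta)))"
  unfolding inf_eq K_div_eq
proof (rule divisor_eqI)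
  fix v assume v: "v \<in> Pinf"
  show "(mD kappa + pdiv (y ^ (n - 1) / ev (lin UNIV)) - (mD (nu n f s) + pdiv (1 / ev (lin Delta)))) v =
      (mD (kappa - nu n f s) + pdiv (y ^ (n - 1) / ev (lin (- Delta)))) v"
    unfolding minus_apply at_infinity(1)[OF v] using v by (simp add: values_quotient PinfD value_lin_UNIV)
next
  fix v assume v: "v \<in> Pf"
  show "(mD kappa + pdiv (y ^ (n - 1) / ev (lin UNIV)) - (mD (nu n f s) + pdiv (1 / ev (lin Delta)))) v =
      (mD (kappa - nu n f s) + pdiv (y ^ (n - 1) / ev (lin (- Delta)))) v"
    unfolding minus_apply at_finite(1)[OF v] using v by (simp add: values_quotient PfD value_lin_UNIV)
next
  fix v assume v: "v \<notin> places \<iota>"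
  show "(mD kappa + pdiv (y ^ (n - 1) / ev (lin UNIV)) - (mD (nu n f s) + pdiv (1 / ev (lin Delta)))) v =
      (mD (kappa - nu n f s) + pdiv (y ^ (n - 1) / ev (lin (- Delta)))) v"
    unfolding minus_apply at_no_place(1)[OF v] by simp
qed

text \<open>The minimum and the maximum of two divisors have the same sum as the divisors themselves.\<close>

lemma sup_minus_D: "sup (mD s) (A_div \<iota> x s) - D_aff \<iota> x = K_div \<iota> x - inf (mD s) (A_div \<iota> x s)"
proof
  fix v
  have "sup (mD s v) (A_div \<iota> x s v) + inf (mD s v) (A_div \<iota> x s v) = mD s v + A_div \<iota> x s v"
    by (simp add: sup_int_def inf_int_def)
  moreover have "A_div \<iota> x s v = D_aff \<iota> x v - mD s v + K_div \<iota> x v"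
    by (simp add: A_div_def G_div_eq)
  ultimately show "(sup (mD s) (A_div \<iota> x s) - D_aff \<iota> x) v = (K_div \<iota> x - inf (mD s) (A_div \<iota> x s)) v"
    by simp
qed

text \<open>The function in \<open>K_minus_inf\<close> has a power that is rational in \<open>x\<close>, so its divisor has degree
  \<open>0\<close>.\<close>

lemma degree_K_minus_inf: "divisor_degree \<iota> (K_div \<iota> x - inf (mD s) (A_div \<iota> x s)) = t_fun \<iota> n f s"
proof -
  let ?h = "y ^ (n - 1) / ev (lin (- Delta))" and ?a = "f ^ (n - 1)" and ?b = "lin (- Delta) ^ n"
  have ne: "?a \<noteq> 0" "?b \<noteq> 0" "ev ?b \<noteq> 0" "?h \<noteq> 0"
    using f_ne_0 y_ne_0 by (simp_all add: lin_ne_0 ev_eq_0)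
  have "?h ^ n = ev ?a / ev ?b" by (simp add: power_divide ev_power y_power[symmetric] power_mult[symmetric] mult.commute)
  then have hn: "pdiv (?h ^ n) = pdiv (ev ?a) - pdiv (ev ?b)" using ne by (simp add: pdiv_divide ev_eq_0)
  have nh: "pdiv (?h ^ n) v = int n * pdiv ?h v" for v by (simp add: pdiv_apply place_power)
  have hv: "pdiv (?h ^ n) v = pdiv (ev ?a) v - pdiv (ev ?b) v" for v unfolding hn by (rule minus_apply)
  have "{v. pdiv (?h ^ n) v \<noteq> 0} \<subseteq> {v. pdiv (ev ?a) v \<noteq> 0} \<union> {v. pdiv (ev ?b) v \<noteq> 0}"
    unfolding hv by auto
  from finite_subset[OF this finite_UnI[OF finite_support_pdiv_ev[OF ne(1)] finite_support_pdiv_ev[OF ne(2)]]]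
  have finn: "finite {v. pdiv (?h ^ n) v \<noteq> 0}" .
  have supp: "{v. pdiv (?h ^ n) v \<noteq> 0} = {v. pdiv ?h v \<noteq> 0}" using n_ge_2 unfolding nh by simp
  have "divisor_degree \<iota> (pdiv (?h ^ n) + pdiv (ev ?b)) = divisor_degree \<iota> (pdiv (?h ^ n)) + divisor_degree \<iota> (pdiv (ev ?b))"
    by (rule divisor_degree_add[OF finn finite_support_pdiv_ev[OF ne(2)]])
  moreover have "pdiv (?h ^ n) + pdiv (ev ?b) = pdiv (ev ?a)" unfolding hn by (rule diff_add_cancel)
  ultimately have "divisor_degree \<iota> (pdiv (?h ^ n)) = 0" by (simp only: degree_pdiv_ev[OF ne(1)] degree_pdiv_ev[OF ne(2)])
  moreover have "divisor_degree \<iota> (pdiv (?h ^ n)) = int n * divisor_degree \<iota> (pdiv ?h)"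
    unfolding divisor_degree_def supp by (simp only: nh sum_distrib_left mult.assoc)
  ultimately have "divisor_degree \<iota> (pdiv ?h) = 0" using n_ge_2 by simp
  then show ?thesis unfolding K_minus_inf t_fun_eq
    using divisor_degree_add[OF finite_support_mD finn[unfolded supp]] by (simp only: degree_mD add_0_right)
qed

section \<open>The dual code\<close>

lemma support_form: "{v. (mD m + pdiv h) v \<noteq> 0} \<subseteq> places \<iota>"
  using at_no_place(1) by blast

lemma G_avoids: "avoids_D (mD s)"
  unfolding avoids_D_def using at_finite(2) at_no_place(2) D_aff_values by blast

lemma A_avoids: "avoids_D (A_div \<iota> x s)"
  unfolding avoids_D_def
proof (intro conjI allI impI)
  fix v assume ne: "D_aff \<iota> x v \<noteq> 0"
  then have v: "v \<in> Pf" using D_aff_values by blast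
  then have p: "v (ev (lin (- Delta))) \<noteq> 0" using ne D_aff_at(1) by simp
  then obtain a where a: "a \<notin> Delta" "v \<in> Over a" using value_lin[OF v, of "- Delta"] by auto
  have "v \<notin> Over b" if "b \<in> Delta" for b using Over_disjoint[OF a(2)] a(1) that by blast
  then have "v (ev (lin Delta)) = 0" using value_lin[OF v, of Delta] by auto
  moreover have "v y = 0" using y_or_lin[OF v, of "- Delta"] p by simp
  ultimately show "A_div \<iota> x s v = 0" unfolding A_eq at_finite(1)[OF v] by (simp add: values_quotient PfD[OF v])
next
  show "{v. A_div \<iota> x s v \<noteq> 0} \<subseteq> places \<iota>" unfolding A_eq by (rule support_form)
qed

lemma quotient_ne_0: "y ^ k / ev (lin S) \<noteq> 0" "1 / ev (lin S) \<noteq> 0"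
  using y_ne_0 by (simp_all add: ev_eq_0 lin_ne_0)

lemma card_L_values:
  "card (L (mD s)) = CARD('a) ^ nat (Phi n d s)"
  "card (L (mD s - D_aff \<iota> x)) = CARD('a) ^ nat (Phi n d (s - degD))"
  "card (L (A_div \<iota> x s)) = CARD('a) ^ nat (Phi n d (kappa - (s - degD)))"
  "card (L (A_div \<iota> x s - D_aff \<iota> x)) = CARD('a) ^ nat (Phi n d (kappa - s))"
  "card (L (inf (mD s) (A_div \<iota> x s))) = CARD('a) ^ nat (Phi n d (nu n f s))"
  "card (L (inf (mD s) (A_div \<iota> x s) - D_aff \<iota> x)) = CARD('a) ^ nat (Phi n d (nu n f s - degD))"
  "card (L (sup (mD s) (A_div \<iota> x s) - D_aff \<iota> x)) = CARD('a) ^ nat (Phi n d (kappa - nu n f s))"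
  unfolding sup_minus_D K_minus_inf inf_minus_D unfolding inf_eq A_minus_D unfolding A_eq G_minus_D
  by (rule card_Lsp_mD(1) Lsp_shift(2) quotient_ne_0)+

lemma finite_L_values:
  "finite (L (mD s))" "finite (L (A_div \<iota> x s))" "finite (L (sup (mD s) (A_div \<iota> x s) - D_aff \<iota> x))"
  unfolding sup_minus_D K_minus_inf unfolding A_eq
  by (rule card_Lsp_mD(2) Lsp_shift(3) quotient_ne_0)+

lemma L_mult:
  assumes "z \<in> L G" "w \<in> L H"
  shows "z * w \<in> L (G + H)"
proof -
  have "z * w \<in> pw v (- (G + H) v)" if v: "v \<in> places \<iota>" for v
  proof -
    have "z \<in> pw v (- G v)" "w \<in> pw v (- H v)" using assms v unfolding Lsp_def by blast+
    then have "z * w \<in> pw v (- G v + - H v)" by (rule pw_mult[OF v])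
    then show ?thesis by simp
  qed
  then show ?thesis unfolding Lsp_def by blast
qed

text \<open>The product of functions in \<open>L(A)\<close> and \<open>L(G)\<close> lies in \<open>L(A + G)\<close>, to which
  \<open>residue_sum_zero\<close> applies.\<close>

lemma codes_orthogonal: "evaluate ` L (A_div \<iota> x s) \<subseteq> dual_code (D_aff \<iota> x) (evaluate ` L (mD s))"
proof (rule image_subsetI)
  fix w assume w: "w \<in> L (A_div \<iota> x s)"
  have "(\<Sum>v | D_aff \<iota> x v \<noteq> 0. evaluate w v * evaluate u v) = 0" if u: "u \<in> L (mD s)" for u
  proof -
    have GA: "A_div \<iota> x s + mD s = mD (int nn * int (card (- Delta)) + kappa) + pdiv (y ^ (n - 1) / ev (lin Delta))"
      unfolding A_eq using mD_add[of "kappa - (s - degD)" s] by (simp add: degD_def algebra_simps)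
    have "w * u \<in> L (A_div \<iota> x s + mD s)" by (rule L_mult[OF w u])
    then have "(\<Sum>v | D_aff \<iota> x v \<noteq> 0. place_value \<iota> v (w * u)) = 0" unfolding GA by (rule residue_sum_zero)
    moreover have "place_value \<iota> v (w * u) = evaluate w v * evaluate u v" if v: "D_aff \<iota> x v \<noteq> 0" for v
    proof -
      have vp: "v \<in> places \<iota>" using D_aff_values[OF v] PfD(1) by simp
      have "has_residue v (w * u) (place_value \<iota> v w * place_value \<iota> v u)"
        by (intro residue_mult[OF vp] avoids_residue[OF A_avoids w v] avoids_residue[OF G_avoids u v])
      from place_value_eq[OF vp this] show ?thesis using v by (simp add: evaluate_def)
    qed
    ultimately show ?thesis by simp
  qed
  then show "evaluate w \<in> dual_code (D_aff \<iota> x) (evaluate ` L (mD s))"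
    using code_subspace(3)[OF A_avoids] w unfolding dual_code_def by blast
qed

text \<open>One inclusion is orthogonality. Equality holds since the dimensions of the two codes add up
  to the length: by duality the differences \<open>Phi s - Phi (kappa - s)\<close> for the four spaces are
  given by degrees.\<close>

lemma dual_code_eq: "dual_code (D_aff \<iota> x) (evaluate ` L (mD s)) = evaluate ` L (A_div \<iota> x s)"
proof -
  let ?C = "evaluate ` L (mD s)" and ?B = "evaluate ` L (A_div \<iota> x s)" and ?q = "CARD('a)"
  have N: "int n = int cc * int nn" using n_eq by (metis of_nat_mult)
  have combine: "(C * B) * ?q ^ (i + j) = ?q ^ (k + l)" if "C * ?q ^ i = ?q ^ k" "B * ?q ^ j = ?q ^ l" for C B i j k l
    unfolding power_add that[symmetric] by (simp only: mult_ac)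
  have "(card ?C * card ?B) * ?q ^ (nat (Phi n d (s - degD)) + nat (Phi n d (kappa - s)))
      = ?q ^ (nat (Phi n d s) + nat (Phi n d (kappa - (s - degD))))"
  proof (rule combine)
    show "card ?C * ?q ^ nat (Phi n d (s - degD)) = ?q ^ nat (Phi n d s)"
      using card_code[OF G_avoids finite_L_values(1)] by (simp only: card_L_values)
    show "card ?B * ?q ^ nat (Phi n d (kappa - s)) = ?q ^ nat (Phi n d (kappa - (s - degD)))"
      using card_code[OF A_avoids finite_L_values(2)] by (simp only: card_L_values)
  qed
  moreover have "nat (Phi n d s) + nat (Phi n d (kappa - (s - degD))) =
      n * card (- Delta) + (nat (Phi n d (s - degD)) + nat (Phi n d (kappa - s)))"
  proof -
    have "int cc * degD = int (n * card (- Delta))" by (simp add: N degD_def)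
    then have "Phi n d s + Phi n d (kappa - (s - degD)) = int (n * card (- Delta)) + (Phi n d (s - degD) + Phi n d (kappa - s))"
      using Phi_duality[of s] Phi_duality[of "s - degD"] by (simp add: algebra_simps)
    then show ?thesis using Phi_nonneg[of s] Phi_nonneg[of "kappa - (s - degD)"] Phi_nonneg[of "s - degD"] Phi_nonneg[of "kappa - s"]
      by linarith
  qed
  ultimately have CB: "card ?C * card ?B = ?q ^ (n * card (- Delta))"
    by (simp add: power_add)
  have "card ?C * card (dual_code (D_aff \<iota> x) ?C) = ?q ^ (n * card (- Delta))"
    using card_dual_code[OF finite_support_D_aff code_subspace(3)[OF G_avoids] code_subspace(1)[OF G_avoids] code_subspace(2)[OF G_avoids]]
    by (simp only: card_support_D_aff)
  then have "card ?C * card (dual_code (D_aff \<iota> x) ?C) = card ?C * card ?B" "card ?C \<noteq> 0"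
    using CB by (metis, metis mult_is_0 power_not_zero zero_less_card_finite less_irrefl)
  then have eq: "card ?B = card (dual_code (D_aff \<iota> x) ?C)" by simp
  moreover have "card ?B \<noteq> 0" using CB by (metis mult_is_0 power_not_zero zero_less_card_finite less_irrefl)
  ultimately have "finite (dual_code (D_aff \<iota> x) ?C)" by (metis card.infinite)
  from card_subset_eq[OF this codes_orthogonal eq] show ?thesis by simp
qed

section \<open>The hull\<close>

lemma excess_subspaces:
  defines "X \<equiv> sum_space (L (mD s)) (L (A_div \<iota> x s)) \<inter> L (sup (mD s) (A_div \<iota> x s) - D_aff \<iota> x)"
    and "Y \<equiv> sum_space (L (mD s - D_aff \<iota> x)) (L (A_div \<iota> x s - D_aff \<iota> x))"
  shows "subgrp X" "subgrp Y" "Y \<subseteq> X" "finite X"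
    and "CARD('a) ^ excess \<iota> (D_aff \<iota> x) (G_div \<iota> x s) (A_div \<iota> x s) = idx X Y"
proof -
  let ?S = "L (sup (mD s) (A_div \<iota> x s) - D_aff \<iota> x)"
  show X: "subgrp X" "subgrp Y" unfolding X_def Y_def
    by (intro subgrp_inter subgrp_sum_space subgrp_L)+
  show fin: "finite X" unfolding X_def using finite_L_values(3) by simp
  have "L (mD s - D_aff \<iota> x) \<subseteq> ?S" "L (A_div \<iota> x s - D_aff \<iota> x) \<subseteq> ?S"
    by (rule Lsp_mono; simp add: sup_int_def)+
  then have "u + w \<in> ?S" if "u \<in> L (mD s - D_aff \<iota> x)" "w \<in> L (A_div \<iota> x s - D_aff \<iota> x)" for u w
    using that by (intro subgrp_add[OF subgrp_L]) blast+
  then show "Y \<subseteq> X" unfolding X_def Y_def sum_space_def using L_diff_D_subset by blast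
  have sum_scale: "\<iota> a * z \<in> sum_space (L G) (L H)" if z: "z \<in> sum_space (L G) (L H)" for a z G H
  proof -
    obtain u w where uw: "z = u + w" "u \<in> L G" "w \<in> L H" using z by (auto simp: sum_space_def)
    have "\<iota> a * z = \<iota> a * u + \<iota> a * w" by (simp add: uw(1) distrib_left)
    then show ?thesis using L_scale[OF uw(2)] L_scale[OF uw(3)] unfolding sum_space_def by blast
  qed
  have sub: "module.subspace (const_scale \<iota>) X" "module.subspace (const_scale \<iota>) Y"
    by (rule subspaceI[OF X(1)]; simp add: X_def sum_scale L_scale) (rule subspaceI[OF X(2)]; simp add: Y_def sum_scale)
  have RR: "RR_space \<iota> (mD s) = L (mD s)" "RR_space \<iota> (A_div \<iota> x s) = L (A_div \<iota> x s)"
    using RR_space_eq G_avoids A_avoids unfolding avoids_D_def by blast+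
  have RR': "RR_space \<iota> (sup (mD s) (A_div \<iota> x s) - D_aff \<iota> x) = ?S"
    "RR_space \<iota> (mD s - D_aff \<iota> x) = L (mD s - D_aff \<iota> x)"
    "RR_space \<iota> (A_div \<iota> x s - D_aff \<iota> x) = L (A_div \<iota> x s - D_aff \<iota> x)"
    unfolding sup_minus_D K_minus_inf A_minus_D G_minus_D by (intro RR_space_eq support_form)+
  have "excess \<iota> (D_aff \<iota> x) (G_div \<iota> x s) (A_div \<iota> x s) = quotient_dim (const_scale \<iota>) X Y"
    unfolding excess_def G_div_eq RR RR' X_def Y_def ..
  then show "CARD('a) ^ excess \<iota> (D_aff \<iota> x) (G_div \<iota> x s) (A_div \<iota> x s) = idx X Y"
    using card_power_quotient_dim[OF vector_space_const_scale[OF emb] sub finite_cosets[OF fin]] by (simp only:)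
qed

text \<open>By \<open>sup_minus_D\<close>, the excess is the dimension of a subquotient of \<open>L(K - G \<and> A)\<close>.\<close>

lemma excess_le: "excess \<iota> (D_aff \<iota> x) (G_div \<iota> x s) (A_div \<iota> x s) \<le> RR_dim \<iota> (K_div \<iota> x - inf (mD s) (A_div \<iota> x s))"
  and RR_dim_K_minus_inf: "RR_dim \<iota> (K_div \<iota> x - inf (mD s) (A_div \<iota> x s)) = nat (Phi n d (kappa - nu n f s))"
proof -
  let ?S = "L (sup (mD s) (A_div \<iota> x s) - D_aff \<iota> x)"
  have supp: "{v. (K_div \<iota> x - inf (mD s) (A_div \<iota> x s)) v \<noteq> 0} \<subseteq> places \<iota>"
    unfolding K_minus_inf by (rule support_form)
  have RR: "CARD('a) ^ RR_dim \<iota> (K_div \<iota> x - inf (mD s) (A_div \<iota> x s)) = card ?S"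
    using card_power_RR_dim[OF supp] finite_L_values(3) by (simp only: sup_minus_D)
  then show "RR_dim \<iota> (K_div \<iota> x - inf (mD s) (A_div \<iota> x s)) = nat (Phi n d (kappa - nu n f s))"
    by (simp only: card_L_values card_power_inject)
  let ?X = "sum_space (L (mD s)) (L (A_div \<iota> x s)) \<inter> ?S"
  have "idx ?X Y \<le> card ?X" for Y
    unfolding idx_def cosets_def using finite_L_values(3) by (intro card_image_le) simp
  also have "card ?X \<le> card ?S" using finite_L_values(3) by (intro card_mono) simp_all
  finally have "CARD('a) ^ excess \<iota> (D_aff \<iota> x) (G_div \<iota> x s) (A_div \<iota> x s) \<le>
      CARD('a) ^ RR_dim \<iota> (K_div \<iota> x - inf (mD s) (A_div \<iota> x s))"
    unfolding excess_subspaces(5) RR .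
  then show "excess \<iota> (D_aff \<iota> x) (G_div \<iota> x s) (A_div \<iota> x s) \<le> RR_dim \<iota> (K_div \<iota> x - inf (mD s) (A_div \<iota> x s))"
    by (simp only: card_power_le)
qed

text \<open>The pairs of functions in \<open>L(G)\<close> and \<open>L(A)\<close> with the same evaluation are counted in two
  ways. The assumption makes \<open>L(G - D) \<inter> L(A - D) = L(G \<and> A - D)\<close> trivial, so the sum of these
  spaces has as many elements as their product.\<close>

lemma card_hull:
  assumes small: "nu n f s < degD"
  shows "card (evaluate ` L (mD s) \<inter> evaluate ` L (A_div \<iota> x s)) =
    CARD('a) ^ (nat (Phi n d (nu n f s)) + excess \<iota> (D_aff \<iota> x) (G_div \<iota> x s) (A_div \<iota> x s))"
proof -
  let ?U = "L (mD s)" and ?V = "L (A_div \<iota> x s)" and ?S = "L (sup (mD s) (A_div \<iota> x s) - D_aff \<iota> x)"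
  let ?WU = "L (mD s - D_aff \<iota> x)" and ?WV = "L (A_div \<iota> x s - D_aff \<iota> x)"
  let ?X = "sum_space ?U ?V \<inter> ?S" and ?Y = "sum_space ?WU ?WV"
  note U = subgrp_L[of "mD s"] finite_L_values(1) and V = subgrp_L[of "A_div \<iota> x s"] finite_L_values(2)
  have fin: "finite ?WU" "finite ?WV" using finite_subset[OF L_diff_D_subset] U(2) V(2) by blast+
  have "card (evaluate ` ?U \<inter> evaluate ` ?V) * (card ?WU * card ?WV) = card {p \<in> ?U \<times> ?V. fst p - snd p \<in> ?S}"
  proof (rule card_fibre_product[symmetric, OF U V subgrp_L subgrp_L L_diff_D_subset subgrp_L L_diff_D_subset])
    show "evaluate u = evaluate v \<longleftrightarrow> u - v \<in> ?S" if "u \<in> ?U" "v \<in> ?V" for u v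
      by (rule evaluate_eq_iff[OF G_avoids that(1) A_avoids that(2)])
    show "evaluate u = evaluate v \<longleftrightarrow> u - v \<in> ?WU" if "u \<in> ?U" "v \<in> ?U" for u v
      using evaluate_eq_iff[OF G_avoids that(1) G_avoids that(2)] by (simp only: sup_idem)
    show "evaluate u = evaluate v \<longleftrightarrow> u - v \<in> ?WV" if "u \<in> ?V" "v \<in> ?V" for u v
      using evaluate_eq_iff[OF A_avoids that(1) A_avoids that(2)] by (simp only: sup_idem)
  qed
  also have "\<dots> = card ?X * card (?U \<inter> ?V)" by (rule card_difference_pairs[OF U V subgrp_L])
  also have "card ?X = idx ?X ?Y * card ?Y"
    by (rule card_eq_idx_mult[OF excess_subspaces(1-4)])
  finally have e1: "card (evaluate ` ?U \<inter> evaluate ` ?V) * (card ?WU * card ?WV) = idx ?X ?Y * card ?Y * card (?U \<inter> ?V)" .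
  have "?WU \<inter> ?WV = L (inf (mD s) (A_div \<iota> x s) - D_aff \<iota> x)"
    unfolding L_inf by (rule arg_cong[where f = L]) (auto simp: fun_eq_iff inf_int_def)
  then have "card (?WU \<inter> ?WV) = 1" using small by (simp only: card_L_values) (simp add: Phi_neg)
  then have e2: "card ?Y = card ?WU * card ?WV"
    using card_sum_space[OF subgrp_L fin(1) subgrp_L fin(2)] by simp
  have "card ?WU * card ?WV \<noteq> 0" by (simp add: card_L_values)
  then have "card (evaluate ` ?U \<inter> evaluate ` ?V) = idx ?X ?Y * card (?U \<inter> ?V)"
    using e1 unfolding e2 by (simp add: mult_ac)
  also have "\<dots> = CARD('a) ^ excess \<iota> (D_aff \<iota> x) (G_div \<iota> x s) (A_div \<iota> x s) * CARD('a) ^ nat (Phi n d (nu n f s))"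
    unfolding excess_subspaces(5)[symmetric] L_inf card_L_values ..
  finally show ?thesis by (simp add: power_add mult.commute)
qed

lemma dim_hull:
  assumes small: "nu n f s < degD"
  shows "int (code_dim (code_hull (D_aff \<iota> x) (superelliptic_code \<iota> x s))) =
    Phi n d (nu n f s) + int (excess \<iota> (D_aff \<iota> x) (G_div \<iota> x s) (A_div \<iota> x s))"
proof -
  let ?H = "evaluate ` L (mD s) \<inter> evaluate ` L (A_div \<iota> x s)"
  have "superelliptic_code \<iota> x s = evaluate ` L (mD s)"
    unfolding superelliptic_code_def G_div_eq by (rule AG_code_eq[OF G_avoids])
  then have hull: "code_hull (D_aff \<iota> x) (superelliptic_code \<iota> x s) = ?H"
    unfolding code_hull_def by (simp only: dual_code_eq)
  have vs: "vector_space (\<lambda>(a::'a) w (v::'k place). a * w v)"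
    by unfold_locales (auto simp: fun_eq_iff algebra_simps)
  have H: "subgrp ?H" by (intro subgrp_inter code_subspace(1) G_avoids A_avoids)
  have "module.subspace (\<lambda>(a::'a) w (v::'k place). a * w v) ?H"
    unfolding module.subspace_def[OF vs[unfolded module_iff_vector_space[symmetric]]]
  proof (intro conjI ballI allI)
    show "0 \<in> ?H" by (rule subgrp_zero[OF H])
    show "u + w \<in> ?H" if "u \<in> ?H" "w \<in> ?H" for u w by (rule subgrp_add[OF H that])
    show "(\<lambda>v. a * w v) \<in> ?H" if "w \<in> ?H" for a w
      using that code_subspace(2)[OF G_avoids] code_subspace(2)[OF A_avoids] by blast
  qed
  moreover have "finite ?H" using finite_L_values(1) by simp
  ultimately have "CARD('a) ^ code_dim ?H = card ?H" unfolding code_dim_def by (rule card_power_dim[OF vs])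
  then have "code_dim ?H = nat (Phi n d (nu n f s)) + excess \<iota> (D_aff \<iota> x) (G_div \<iota> x s) (A_div \<iota> x s)"
    by (simp only: card_hull[OF small] card_power_inject)
  then show ?thesis using Phi_nonneg[of "nu n f s"] by (simp add: hull)
qed

end

text \<open>Beyond \<open>2 g - 2\<close> the function is given by one linear polynomial for all residue classes, so
  \<open>1\<close> is a quasi-period.\<close>

lemma Phi_quasi_polynomial:
  "quasi_polynomial_on {\<nu>. 2 * genus \<iota> - 2 < int (gcd n d) * \<nu>} (Phi n d) 1 (of_nat (gcd n d)) 1"
  unfolding quasi_polynomial_on_def
proof (intro conjI exI[of _ "\<lambda>_. [:of_int (1 - genus_num), of_nat cc:]"] allI ballI)
  fix \<nu> :: int
  assume "\<nu> \<in> {\<nu>. 2 * genus \<iota> - 2 < int (gcd n d) * \<nu>}"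
  then have "2 * genus_num - 2 < int cc * \<nu>" by (simp only: mem_Collect_eq genus_eq cc_def)
  then have "Phi n d \<nu> = int cc * \<nu> + 1 - genus_num" by (simp only: Phi_eq_iff)
  then show "of_int (Phi n d \<nu>) = poly [:of_int (1 - genus_num), of_nat cc:] (of_int \<nu> :: rat)" by simp
next
  fix \<nu> :: int
  show "degree [:of_int (1 - genus_num), of_nat cc :: rat:] = 1" using cc_pos by simp
  show "lead_coeff [:of_int (1 - genus_num), of_nat cc :: rat:] = of_nat (gcd n d)" using cc_pos by (simp add: cc_def[symmetric])
qed simp_all

end

theorem theorem4p11:
  fixes \<iota> :: "'a::{field,finite} \<Rightarrow> 'k::field"
    and x y :: 'k and n d :: nat and f :: "'a poly" and s :: int
  assumes "superelliptic_curve \<iota> x y n d f"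
    and "1 \<le> s"
    and "int (gcd n d) * nu n f s < divisor_degree \<iota> (D_aff \<iota> x)"
  shows
    "int (code_dim (code_hull (D_aff \<iota> x) (superelliptic_code \<iota> x s))) =
       Phi n d (nu n f s) + int (excess \<iota> (D_aff \<iota> x) (G_div \<iota> x s) (A_div \<iota> x s))
     \<and> (\<exists>m. m dvd n div gcd n d \<and>
          quasi_polynomial_on {\<nu>. 2 * genus \<iota> - 2 < int (gcd n d) * \<nu>}
            (Phi n d) 1 (of_nat (gcd n d)) m)
     \<and> (Phi n d (nu n f s) = int (gcd n d) * nu n f s + 1 - genus \<iota> \<longleftrightarrow> s \<in> window \<iota> n f)
     \<and> (s \<in> window \<iota> n f \<longrightarrow> excess \<iota> (D_aff \<iota> x) (G_div \<iota> x s) (A_div \<iota> x s) = 0)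
     \<and> 0 \<le> excess \<iota> (D_aff \<iota> x) (G_div \<iota> x s) (A_div \<iota> x s)
     \<and> excess \<iota> (D_aff \<iota> x) (G_div \<iota> x s) (A_div \<iota> x s)
         \<le> RR_dim \<iota> (K_div \<iota> x - inf (G_div \<iota> x s) (A_div \<iota> x s))
     \<and> divisor_degree \<iota> (K_div \<iota> x - inf (G_div \<iota> x s) (A_div \<iota> x s)) = t_fun \<iota> n f s"
proof -
  interpret superelliptic \<iota> x y n d f by unfold_locales (fact assms(1))
  have "int cc * nu n f s < int cc * degD" using assms(3) by (simp only: degree_D cc_def)
  then have small: "nu n f s < degD" using cc_pos by simp
  have win: "s \<in> window \<iota> n f \<longleftrightarrow> kappa < nu n f s"
    using assms(2) cc_pos by (simp add: window_def t_fun_eq mult_less_0_iff)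
  have two: "Phi n d (nu n f s) = int (gcd n d) * nu n f s + 1 - genus \<iota> \<longleftrightarrow> s \<in> window \<iota> n f"
    unfolding genus_eq win cc_def[symmetric] Phi_eq_iff two_genus_num using cc_pos by simp
  have zero: "excess \<iota> (D_aff \<iota> x) (G_div \<iota> x s) (A_div \<iota> x s) = 0" if "s \<in> window \<iota> n f"
    using excess_le[of s] that unfolding RR_dim_K_minus_inf win by (simp add: Phi_neg)
  have "\<exists>m. m dvd n div gcd n d \<and>
      quasi_polynomial_on {\<nu>. 2 * genus \<iota> - 2 < int (gcd n d) * \<nu>} (Phi n d) 1 (of_nat (gcd n d)) m"
    using Phi_quasi_polynomial by (intro exI[of _ 1]) simp
  then show ?thesis
    using dim_hull[OF small] two zero excess_le[of s] degree_K_minus_inf[of s] unfolding G_div_eq by simp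
qed

end
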